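(* Let $1/4<H<1$, $T>0$, let $b,\sigma$ satisfy the standing assumption (A) of the context, and let $\bar X$ solve $\bar X_t'=b_t(\bar X_t)$, $\bar X_0=x_0$ on $[0,T]$. Set $x_T:=\bar X_T$. Fix constants $C_1>0$ and $\lambda_V\ge0$ (such constants exist) such that, for every $\eta\in\mathcal H_H^\sigma([0,T];\mathbb R^n)$, $$\int_0^T\left|(K_H^\sigma)^{-1}\left(\eta_\cdot-\int_0^\cdot\nabla b_u(\bar X_u)\eta_u\,du\right)(s)\right|^2ds\ \ge\ C_1\|\eta\|_{\mathcal H_H^\sigma}^2,$$ $$-\int_0^T\eta_s^T\,\nabla^2(\nabla\cdot b_s)(\bar X_s)\,\eta_s\,ds\ \le\ \lambda_V\|\eta\|_{\mathcal H_H^\sigma}^2 .$$ Suppose that $\nabla(\nabla\cdot b_t)(\bar X_t)=0$ for all $t\in[0,T]$, and that $\epsilon>0$ satisfies $$\frac{C_1}{\epsilon}-\frac{d_H}{2}\lambda_V>0 .$$ Then $\bar X$ is a strict local minimizer of $J_\epsilon$ both in the fixed-endpoint path space $\mathcal H^{\sigma,T}_{H;x_0,x_T}$ and in the free-endpoint path space $x_0+\mathcal H_H^\sigma([0,T];\mathbb R^n)$. In particular, it persists as both a locally most probable transition path and a locally most probable evolution path.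
   Context: Standing assumption (A): $b\in C_b^{1,3}([0,T]\times\mathbb R^n;\mathbb R^n)$ (bounded, with bounded continuous derivatives up to order one in $t$ and order three in $x$); $\sigma_t=\operatorname{diag}(\sigma_t^1,\dots,\sigma_t^n)$ with $\sigma^i\in C^1([0,T])$ and $0<m_i\le\sigma_t^i\le M_i$. $\nabla,\nabla\cdot,\nabla^2$ act in the space variable. Kernel, for $0<s<t$: $K_H(t,s)=c_H\left[(t/s)^{H-\frac12}(t-s)^{H-\frac12}-(H-\frac12)s^{\frac12-H}\int_s^tu^{H-\frac32}(u-s)^{H-\frac12}du\right]$, $c_H=\sqrt{\frac{2H\Gamma(3/2-H)}{\Gamma(H+1/2)\Gamma(2-2H)}}$. For $u\in L^2([0,T];\mathbb R^n)$: $(K_Hu)(t)=\int_0^tK_H(t,s)u(s)ds$, $(K_H^\sigma u)(t)=\int_0^t\sigma_s\,d(K_Hu)(s)$ (Young integral). $K_H^\sigma$ is injective; $\mathcal H_H^\sigma:=\mathcal H_H^\sigma([0,T];\mathbb R^n):=K_H^\sigma(L^2)$ with norm $\|h\|_{\mathcal H_H^\sigma}=\|(K_H^\sigma)^{-1}h\|_{L^2(0,T)}$. $d_H=\sqrt{2H\Gamma(H+\frac12)\Gamma(\frac32-H)/\Gamma(2-2H)}$. For $\phi\in x_0+\mathcal H_H^\sigma$, $$J_\epsilon(\phi)=\frac1{2\epsilon}\int_0^T\left|(K_H^\sigma)^{-1}\left(\phi_\cdot-x_0-\int_0^\cdot b_s(\phi_s)ds\right)(t)\right|^2dt+\frac{d_H}2\int_0^T\nabla\cdot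 b_t(\phi_t)\,dt .$$ $\mathcal H^{\sigma,T}_{H;x_0,x_T}=\{\phi\in x_0+\mathcal H_H^\sigma:\phi_T=x_T\}$. Strict local minimizer is meant with respect to $\|\cdot\|_{\mathcal H_H^\sigma}$: there is $\delta>0$ with $J_\epsilon(\bar X)<J_\epsilon(\phi)$ for all $\phi$ in the space with $0<\|\phi-\bar X\|_{\mathcal H_H^\sigma}\le\delta$. A (locally) most probable transition path, resp. evolution path, is a (local) minimizer of $J_\epsilon$ over the fixed-endpoint space, resp. the free-endpoint space. *)

theory Defs
  imports "HOL-Analysis.Analysis"
begin

text \<open>
  A path on \<open>[0, T]\<close> is a total function \<^typ>\<open>real \<Rightarrow> real ^ 'n\<close> of which only the values on
  \<open>{0..T}\<close> matter: every definition below depends on those values only. Likewise, elements of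
  \<open>L\<^sup>2\<close> are represented by functions, which are identified when they agree almost everywhere.
\<close>

subsection \<open>Spatial derivatives and assumptions on the coefficients\<close>

definition partial_deriv ::
  "'n \<Rightarrow> (real ^ 'n::finite \<Rightarrow> 'b::real_normed_vector) \<Rightarrow> real ^ 'n \<Rightarrow> 'b" where
  "partial_deriv i f x = frechet_derivative f (at x) (axis i 1)"

fun iterated_partial ::
  "'n list \<Rightarrow> (real ^ 'n::finite \<Rightarrow> 'b::real_normed_vector) \<Rightarrow> real ^ 'n \<Rightarrow> 'b" where
  "iterated_partial [] f = f"
| "iterated_partial (i # is) f = partial_deriv i (iterated_partial is f)"

definition divg :: "(real ^ 'n::finite \<Rightarrow> real ^ 'n) \<Rightarrow> real ^ 'n \<Rightarrow> real" where
  "divg f x = (\<Sum>i\<in>UNIV. partial_deriv i f x $ i)"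

definition grad :: "(real ^ 'n::finite \<Rightarrow> real) \<Rightarrow> real ^ 'n \<Rightarrow> real ^ 'n" where
  "grad g x = (\<chi> i. partial_deriv i g x)"

definition hessian :: "(real ^ 'n::finite \<Rightarrow> real) \<Rightarrow> real ^ 'n \<Rightarrow> real ^ 'n ^ 'n" where
  "hessian g x = (\<chi> i j. partial_deriv i (partial_deriv j g) x)"

definition bounded_continuous_on :: "'a::topological_space set \<Rightarrow> ('a \<Rightarrow> 'b::metric_space) \<Rightarrow> bool" where
  "bounded_continuous_on S f \<longleftrightarrow> continuous_on S f \<and> bounded (f ` S)"

text \<open>
  The class \<open>C\<^sub>b\<close> with exponents \<open>1,3\<close>: the function, its time derivative, and its spatial
  derivatives of order at most three exist and are jointly continuous and bounded on
  \<open>[0, T] \<times> \<real>\<^sup>n\<close>. No mixed space-time derivatives are required. The time derivative is one-sided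
  at the end points.
\<close>

definition Cb_1_3 :: "real \<Rightarrow> (real \<Rightarrow> real ^ 'n::finite \<Rightarrow> real ^ 'n) \<Rightarrow> bool" where
  "Cb_1_3 T b \<longleftrightarrow>
     (\<exists>b'. (\<forall>t\<in>{0..T}. \<forall>x. ((\<lambda>s. b s x) has_vector_derivative b' t x) (at t within {0..T})) \<and>
           bounded_continuous_on ({0..T} \<times> UNIV) (\<lambda>(t, x). b' t x)) \<and>
     (\<forall>is. length is < 3 \<longrightarrow> (\<forall>t\<in>{0..T}. \<forall>x. iterated_partial is (b t) differentiable (at x))) \<and>
     (\<forall>is. length is \<le> 3 \<longrightarrow>
        bounded_continuous_on ({0..T} \<times> UNIV) (\<lambda>(t, x). iterated_partial is (b t) x))"

definition diag :: "real ^ 'n::finite \<Rightarrow> real ^ 'n ^ 'n" where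
  "diag v = (\<chi> i j. if i = j then v $ i else 0)"

text \<open>The vector \<open>\<sigma> t\<close> holds the diagonal entries of the diffusion matrix.\<close>

definition admissible_diffusion :: "real \<Rightarrow> (real \<Rightarrow> real ^ 'n::finite) \<Rightarrow> bool" where
  "admissible_diffusion T \<sigma> \<longleftrightarrow>
     (\<forall>i. \<exists>\<sigma>'. (\<forall>t\<in>{0..T}. ((\<lambda>s. \<sigma> s $ i) has_real_derivative \<sigma>' t) (at t within {0..T})) \<and>
                continuous_on {0..T} \<sigma>') \<and>
     (\<forall>i. \<exists>m M. 0 < m \<and> (\<forall>t\<in>{0..T}. m \<le> \<sigma> t $ i \<and> \<sigma> t $ i \<le> M))"

subsection \<open>The kernel and the associated Cameron-Martin space\<close>

definition c_H :: "real \<Rightarrow> real" where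
  "c_H H = sqrt (2 * H * Gamma (3/2 - H) / (Gamma (H + 1/2) * Gamma (2 - 2 * H)))"

definition d_H :: "real \<Rightarrow> real" where
  "d_H H = sqrt (2 * H * Gamma (H + 1/2) * Gamma (3/2 - H) / Gamma (2 - 2 * H))"

definition K_kernel :: "real \<Rightarrow> real \<Rightarrow> real \<Rightarrow> real" where
  "K_kernel H t s = c_H H *
     ((t / s) powr (H - 1/2) * (t - s) powr (H - 1/2)
      - (H - 1/2) * s powr (1/2 - H) *
        (LINT u:{s..t}|lebesgue. u powr (H - 3/2) * (u - s) powr (H - 1/2)))"

definition L2 :: "real \<Rightarrow> (real \<Rightarrow> real ^ 'n::finite) set" where
  "L2 T = {u. set_borel_measurable lebesgue {0..T} u \<and>
              set_integrable lebesgue {0..T} (\<lambda>t. (norm (u t))\<^sup>2)}"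

definition L2_sqnorm :: "real \<Rightarrow> (real \<Rightarrow> real ^ 'n::finite) \<Rightarrow> real" where
  "L2_sqnorm T u = (LINT t:{0..T}|lebesgue. (norm (u t))\<^sup>2)"

definition K_op :: "real \<Rightarrow> (real \<Rightarrow> real ^ 'n::finite) \<Rightarrow> real \<Rightarrow> real ^ 'n" where
  "K_op H u t = (LINT s:{0<..<t}|lebesgue. K_kernel H t s *\<^sub>R u s)"

text \<open>
  The Young integral of \<open>A\<close> against \<open>g\<close> is the limit of the Riemann-Stieltjes sums over tagged
  partitions as the mesh tends to zero. A partition interval \<open>K\<close> is \<open>{Inf K..Sup K}\<close>.
\<close>

definition has_young_integral ::
  "(real \<Rightarrow> real ^ 'n::finite ^ 'n) \<Rightarrow> (real \<Rightarrow> real ^ 'n) \<Rightarrow> real \<Rightarrow> real \<Rightarrow> real ^ 'n \<Rightarrow> bool" where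
  "has_young_integral A g a b I \<longleftrightarrow>
     (\<forall>e>0. \<exists>d>0. \<forall>p. p tagged_division_of {a..b} \<and> (\<lambda>x. ball x d) fine p \<longrightarrow>
        norm ((\<Sum>(x, K)\<in>p. A x *v (g (Sup K) - g (Inf K))) - I) < e)"

definition young_integral ::
  "(real \<Rightarrow> real ^ 'n::finite ^ 'n) \<Rightarrow> (real \<Rightarrow> real ^ 'n) \<Rightarrow> real \<Rightarrow> real \<Rightarrow> real ^ 'n" where
  "young_integral A g a b = (THE I. has_young_integral A g a b I)"

definition K_sigma ::
  "real \<Rightarrow> (real \<Rightarrow> real ^ 'n::finite) \<Rightarrow> (real \<Rightarrow> real ^ 'n) \<Rightarrow> real \<Rightarrow> real ^ 'n" where
  "K_sigma H \<sigma> u t = young_integral (\<lambda>s. diag (\<sigma> s)) (K_op H u) 0 t"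

definition CM_space ::
  "real \<Rightarrow> real \<Rightarrow> (real \<Rightarrow> real ^ 'n::finite) \<Rightarrow> (real \<Rightarrow> real ^ 'n) set" where
  "CM_space H T \<sigma> = {h. \<exists>u\<in>L2 T. \<forall>t\<in>{0..T}. h t = K_sigma H \<sigma> u t}"

text \<open>
  A representative of the preimage. It is determined up to a null set, since the operator is
  injective; below it only occurs under integrals over \<open>[0, T]\<close>.
\<close>

definition K_sigma_inv ::
  "real \<Rightarrow> real \<Rightarrow> (real \<Rightarrow> real ^ 'n::finite) \<Rightarrow> (real \<Rightarrow> real ^ 'n) \<Rightarrow> real \<Rightarrow> real ^ 'n" where
  "K_sigma_inv H T \<sigma> h = (SOME u. u \<in> L2 T \<and> (\<forall>t\<in>{0..T}. h t = K_sigma H \<sigma> u t))"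

definition CM_norm ::
  "real \<Rightarrow> real \<Rightarrow> (real \<Rightarrow> real ^ 'n::finite) \<Rightarrow> (real \<Rightarrow> real ^ 'n) \<Rightarrow> real" where
  "CM_norm H T \<sigma> h = sqrt (L2_sqnorm T (K_sigma_inv H T \<sigma> h))"

subsection \<open>The functional, path spaces and minimizers\<close>

definition OM_functional ::
  "real \<Rightarrow> real \<Rightarrow> (real \<Rightarrow> real ^ 'n::finite) \<Rightarrow> (real \<Rightarrow> real ^ 'n \<Rightarrow> real ^ 'n) \<Rightarrow> real ^ 'n \<Rightarrow> real
     \<Rightarrow> (real \<Rightarrow> real ^ 'n) \<Rightarrow> real" where
  "OM_functional H T \<sigma> b x0 \<epsilon> \<phi> =
     1 / (2 * \<epsilon>) *
       L2_sqnorm T (K_sigma_inv H T \<sigma> (\<lambda>t. \<phi> t - x0 - (LINT s:{0..t}|lebesgue. b s (\<phi> s))))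
     + d_H H / 2 * (LINT t:{0..T}|lebesgue. divg (b t) (\<phi> t))"

definition free_paths ::
  "real \<Rightarrow> real \<Rightarrow> (real \<Rightarrow> real ^ 'n::finite) \<Rightarrow> real ^ 'n \<Rightarrow> (real \<Rightarrow> real ^ 'n) set" where
  "free_paths H T \<sigma> x0 = {\<phi>. (\<lambda>t. \<phi> t - x0) \<in> CM_space H T \<sigma>}"

definition fixed_paths ::
  "real \<Rightarrow> real \<Rightarrow> (real \<Rightarrow> real ^ 'n::finite) \<Rightarrow> real ^ 'n \<Rightarrow> real ^ 'n \<Rightarrow> (real \<Rightarrow> real ^ 'n) set" where
  "fixed_paths H T \<sigma> x0 xT = {\<phi> \<in> free_paths H T \<sigma> x0. \<phi> T = xT}"

definition local_minimizer ::
  "real \<Rightarrow> real \<Rightarrow> (real \<Rightarrow> real ^ 'n::finite) \<Rightarrow> (real \<Rightarrow> real ^ 'n) set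
     \<Rightarrow> ((real \<Rightarrow> real ^ 'n) \<Rightarrow> real) \<Rightarrow> (real \<Rightarrow> real ^ 'n) \<Rightarrow> bool" where
  "local_minimizer H T \<sigma> S J X \<longleftrightarrow> X \<in> S \<and>
     (\<exists>\<delta>>0. \<forall>\<phi>\<in>S. CM_norm H T \<sigma> (\<lambda>t. \<phi> t - X t) \<le> \<delta> \<longrightarrow> J X \<le> J \<phi>)"

definition strict_local_minimizer ::
  "real \<Rightarrow> real \<Rightarrow> (real \<Rightarrow> real ^ 'n::finite) \<Rightarrow> (real \<Rightarrow> real ^ 'n) set
     \<Rightarrow> ((real \<Rightarrow> real ^ 'n) \<Rightarrow> real) \<Rightarrow> (real \<Rightarrow> real ^ 'n) \<Rightarrow> bool" where
  "strict_local_minimizer H T \<sigma> S J X \<longleftrightarrow> X \<in> S \<and>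
     (\<exists>\<delta>>0. \<forall>\<phi>\<in>S. 0 < CM_norm H T \<sigma> (\<lambda>t. \<phi> t - X t) \<and> CM_norm H T \<sigma> (\<lambda>t. \<phi> t - X t) \<le> \<delta>
        \<longrightarrow> J X < J \<phi>)"

definition locally_most_probable_transition_path ::
  "real \<Rightarrow> real \<Rightarrow> (real \<Rightarrow> real ^ 'n::finite) \<Rightarrow> (real \<Rightarrow> real ^ 'n \<Rightarrow> real ^ 'n)
     \<Rightarrow> real ^ 'n \<Rightarrow> real ^ 'n \<Rightarrow> real \<Rightarrow> (real \<Rightarrow> real ^ 'n) \<Rightarrow> bool" where
  "locally_most_probable_transition_path H T \<sigma> b x0 xT \<epsilon> X \<longleftrightarrow>
     local_minimizer H T \<sigma> (fixed_paths H T \<sigma> x0 xT) (OM_functional H T \<sigma> b x0 \<epsilon>) X"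

definition locally_most_probable_evolution_path ::
  "real \<Rightarrow> real \<Rightarrow> (real \<Rightarrow> real ^ 'n::finite) \<Rightarrow> (real \<Rightarrow> real ^ 'n \<Rightarrow> real ^ 'n)
     \<Rightarrow> real ^ 'n \<Rightarrow> real \<Rightarrow> (real \<Rightarrow> real ^ 'n) \<Rightarrow> bool" where
  "locally_most_probable_evolution_path H T \<sigma> b x0 \<epsilon> X \<longleftrightarrow>
     local_minimizer H T \<sigma> (free_paths H T \<sigma> x0) (OM_functional H T \<sigma> b x0 \<epsilon>) X"

text \<open>The two inequalities that the constants \<open>C\<^sub>1\<close> and \<open>\<lambda>\<^sub>V\<close> have to satisfy.\<close>

definition linearization_lower_bound ::
  "real \<Rightarrow> real \<Rightarrow> (real \<Rightarrow> real ^ 'n::finite) \<Rightarrow> (real \<Rightarrow> real ^ 'n \<Rightarrow> real ^ 'n)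
     \<Rightarrow> (real \<Rightarrow> real ^ 'n) \<Rightarrow> real \<Rightarrow> bool" where
  "linearization_lower_bound H T \<sigma> b X C \<longleftrightarrow>
     (\<forall>\<eta>\<in>CM_space H T \<sigma>.
        L2_sqnorm T (K_sigma_inv H T \<sigma>
          (\<lambda>t. \<eta> t - (LINT u:{0..t}|lebesgue. jacobian (b u) (at (X u)) *v \<eta> u)))
        \<ge> C * (CM_norm H T \<sigma> \<eta>)\<^sup>2)"

definition divergence_hessian_bound ::
  "real \<Rightarrow> real \<Rightarrow> (real \<Rightarrow> real ^ 'n::finite) \<Rightarrow> (real \<Rightarrow> real ^ 'n \<Rightarrow> real ^ 'n)
     \<Rightarrow> (real \<Rightarrow> real ^ 'n) \<Rightarrow> real \<Rightarrow> bool" where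
  "divergence_hessian_bound H T \<sigma> b X L \<longleftrightarrow>
     (\<forall>\<eta>\<in>CM_space H T \<sigma>.
        - (LINT s:{0..T}|lebesgue. \<eta> s \<bullet> (hessian (divg (b s)) (X s) *v \<eta> s))
        \<le> L * (CM_norm H T \<sigma> \<eta>)\<^sup>2)"

end

theory Submission
  imports Defs
begin

text \<open>
  Write \<open>a = H - 1/2\<close>. On \<open>L\<^sup>2\<close> the kernel operator equals, up to the factor \<open>c_H H\<close>,
  \<open>t powr a * p t\<close> minus \<open>a\<close> times the integral of \<open>r powr (a - 1) * p r\<close> over \<open>[0, t]\<close>, where \<open>p\<close> is
  the Riemann-Liouville integral of order \<open>1 + a\<close> of \<open>s powr - a * u s\<close>. This turns injectivity
  into an elementary differential equation followed by Abel inversion, and shows that every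
  primitive of a continuous (for \<open>H > 1/2\<close>: \<open>H / 2\<close>-Hoelder) function \<open>f\<close> has a preimage \<open>v\<close> with
  \<open>\<bar>v s\<bar> \<le> C * N * s powr - a\<close>, where \<open>N\<close> depends on \<open>f\<close> on \<open>[0, s]\<close> only. Since
  the Young integral of a \<open>C\<^sup>1\<close> function is given by parts, the same holds with the diffusion
  coefficient. The linearized drift is therefore a Volterra perturbation with a weakly singular
  bound, and Gronwall's inequality gives the coercivity constant \<open>C\<^sub>1\<close>.

  For a perturbation of norm \<open>\<rho>\<close> the Taylor remainder of the drift is of size \<open>\<rho>\<^sup>2\<close> and has
  Hoelder-\<open>1/2\<close> constant of order \<open>\<rho>\<close>, so by interpolation its preimage is of order \<open>\<rho> powr (2 - H)\<close>,
  which is \<open>o(\<rho>)\<close>. The first-order term of the divergence integral vanishes by the hypothesis on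
  its gradient; hence the functional grows at least like a positive multiple of \<open>\<rho>\<^sup>2\<close>.
\<close>

subsection \<open>Riemann--Liouville kernels\<close>

text \<open>Nothing is ever computed with the chosen inverse of the operator: each norm is evaluated
  on an explicit preimage, and injectivity makes the choice irrelevant. The sign of
  \<open>H - 1/2\<close> decides how hard such a preimage is to find. For \<open>H < 1/2\<close> it
  comes from a fractional integral of the datum, and a sup bound suffices. For
  \<open>H > 1/2\<close> it comes from a fractional derivative of order \<open>H - 1/2\<close>, so
  the datum needs a Hoelder exponent above that number, while paths of the Cameron-Martin space are
  only shown to be Hoelder-1/2. The exponent \<open>H / 2\<close> satisfies
  \<open>H - 1/2 < H / 2 < 1/2\<close> because \<open>H < 1\<close>: the lower inequality makes the
  derivative converge, the upper one leaves room to interpolate a linear Hoelder-1/2 bound with a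
  quadratic sup bound. All estimates are kept causal, that is, the value at time \<open>s\<close> is
  bounded through data on \<open>[0, s]\<close>. This is what lets Gronwall's inequality handle the
  linearized drift on the whole interval without any smallness of \<open>T\<close>.\<close>

definition rl_kernel :: "real \<Rightarrow> real \<Rightarrow> real" where
  "rl_kernel a x = (if 0 < x then x powr (a - 1) else 0)"

lemma rl_kernel_nonneg [simp]: "0 \<le> rl_kernel a x"
  by (simp add: rl_kernel_def)

lemma rl_kernel_measurable [measurable]: "rl_kernel a \<in> borel_measurable borel"
  unfolding rl_kernel_def by measurable

lemma rl_kernel_mult: "rl_kernel a x * rl_kernel b x = rl_kernel (a + b - 1) x"
  by (simp add: rl_kernel_def powr_add [symmetric] algebra_simps)

lemma rl_kernel_pos: "0 < x \<Longrightarrow> rl_kernel a x = x powr (a - 1)"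
  by (simp add: rl_kernel_def)

lemma rl_kernel_nonpos: "x \<le> 0 \<Longrightarrow> rl_kernel a x = 0"
  by (simp add: rl_kernel_def)

lemma rl_kernel_1: "rl_kernel 1 x = indicator {0<..} x"
  by (simp add: rl_kernel_def)

lemma rl_kernel_2: "0 \<le> x \<Longrightarrow> rl_kernel 2 x = x"
  by (simp add: rl_kernel_def)

lemma has_bochner_integral_Beta_01:
  assumes "0 < a" "0 < b"
  shows "has_bochner_integral lborel (\<lambda>x. rl_kernel a (1 - x) * rl_kernel b x) (Beta a b)"
proof -
  let ?f = "\<lambda>x::real. x powr (b - 1) * (1 - x) powr (a - 1)"
  have hi: "(?f has_integral Beta a b) {0<..<1}"
    using has_integral_Beta_real [of b a] assms
    by (simp add: has_integral_Icc_iff_Ioo Beta_commute)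
  have ai: "?f absolutely_integrable_on {0<..<1}"
    by (rule nonnegative_absolutely_integrable_1) (use hi in auto)
  have eq: "(\<lambda>x. rl_kernel a (1 - x) * rl_kernel b x) = (\<lambda>x. indicator {0<..<1} x *\<^sub>R ?f x)"
    by (auto simp: rl_kernel_def indicator_def fun_eq_iff)
  have m: "(\<lambda>x. rl_kernel a (1 - x) * rl_kernel b x) \<in> borel_measurable lborel"
    by measurable
  have "integrable lborel (\<lambda>x. rl_kernel a (1 - x) * rl_kernel b x)"
    using ai integrable_completion [OF m] unfolding set_integrable_def eq by simp
  moreover have "integral\<^sup>L lborel (\<lambda>x. rl_kernel a (1 - x) * rl_kernel b x) = Beta a b"
    using set_lebesgue_integral_eq_integral(2) [OF ai] integral_completion [OF m]
      integral_unique [OF hi]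
    unfolding set_lebesgue_integral_def eq by simp
  ultimately show ?thesis by (simp add: has_bochner_integral_iff)
qed

text \<open>This is the semigroup law of Riemann-Liouville integration. The kernels omit the factor
  \<open>1 / Gamma a\<close>, so the composition constant is a Beta value; their truncation at 0
  makes both sides vanish for \<open>t \<le> s\<close> and lets every integral run over the whole
  line.\<close>

lemma has_bochner_integral_rl_kernel:
  assumes "0 < a" "0 < b"
  shows "has_bochner_integral lborel (\<lambda>r. rl_kernel a (t - r) * rl_kernel b (r - s))
           (Beta a b * rl_kernel (a + b) (t - s))"
proof (cases "s < t")
  case False
  then have "(\<lambda>r. rl_kernel a (t - r) * rl_kernel b (r - s)) = (\<lambda>r. 0)"
    by (auto simp: rl_kernel_def fun_eq_iff)
  with False show ?thesis by (simp add: rl_kernel_nonpos has_bochner_integral_zero)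
next
  case True
  define c where "c = t - s"
  have c: "0 < c" using True by (simp add: c_def)
  have *: "rl_kernel a (t - (s + c * x)) * rl_kernel b (s + c * x - s)
      = c powr (a + b - 2) * (rl_kernel a (1 - x) * rl_kernel b x)" for x
  proof -
    have 1: "t - (s + c * x) = c * (1 - x)" by (simp add: c_def algebra_simps)
    have "c powr (a - 1) * c powr (b - 1) = c powr (a + b - 2)"
      by (simp add: powr_add [symmetric] algebra_simps)
    moreover have "(c * (1 - x)) powr (a - 1) = c powr (a - 1) * (1 - x) powr (a - 1)" if "x < 1"
      using c that by (simp add: powr_mult)
    ultimately show ?thesis
      using c unfolding 1
      by (auto simp: rl_kernel_def zero_less_mult_iff powr_mult simp del: right_diff_distrib)
  qed
  have "has_bochner_integral lborel
      (\<lambda>x. rl_kernel a (t - (s + c * x)) * rl_kernel b (s + c * x - s))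
      (c powr (a + b - 2) * Beta a b)"
    unfolding * using has_bochner_integral_Beta_01 [OF assms]
    by (rule has_bochner_integral_mult_right)
  also have "c powr (a + b - 2) * Beta a b = (Beta a b * rl_kernel (a + b) (t - s)) /\<^sub>R \<bar>c\<bar>"
  proof -
    have "c powr (a + b - 2) = c powr (a + b - 1) / c"
      using c powr_diff [of c "a + b - 1" 1] by simp
    then show ?thesis using c by (simp add: rl_kernel_def c_def divide_simps)
  qed
  finally show ?thesis
    using c by (subst lborel_has_bochner_integral_real_affine_iff [where c = c and t = s]) auto
qed

lemmas integrable_rl_kernel = has_bochner_integral_rl_kernel [THEN integrable.intros]
lemmas integral_rl_kernel = has_bochner_integral_rl_kernel [THEN has_bochner_integral_integral_eq]

text \<open>The kernel of order one is the indicator of \<open>r < t\<close>, and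
  \<open>Beta 1 a = 1 / a\<close>.\<close>

lemma has_bochner_integral_power_kernel:
  assumes "0 < a" "s \<le> t"
  shows "has_bochner_integral lborel (\<lambda>r. indicator {..<t} r * rl_kernel a (r - s)) ((t - s) powr a / a)"
proof -
  have "Gamma (a + 1) = a * Gamma a"
    by (rule Gamma_plus1) (use assms in \<open>auto elim!: nonpos_Ints_cases\<close>)
  moreover have "Gamma a \<noteq> 0"
    using Gamma_real_pos [of a] assms by linarith
  ultimately have "Beta 1 a * rl_kernel (1 + a) (t - s) = (t - s) powr a / a"
    using assms by (auto simp: Beta_def rl_kernel_def add.commute [of 1 a])
  moreover have "rl_kernel 1 (t - r) = indicator {..<t} r" for r
    by (simp add: rl_kernel_1 indicator_def)
  ultimately show ?thesis
    using has_bochner_integral_rl_kernel [of 1 a t s] assms by simp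
qed

section \<open>Cauchy-Schwarz and Fubini for nonnegative kernels\<close>

lemma integrable_mult_square:
  fixes f g :: "'a \<Rightarrow> real"
  assumes [measurable]: "f \<in> borel_measurable M" "g \<in> borel_measurable M"
    and "integrable M (\<lambda>x. (f x)\<^sup>2)" "integrable M (\<lambda>x. (g x)\<^sup>2)"
  shows "integrable M (\<lambda>x. f x * g x)"
proof (rule Bochner_Integration.integrable_bound)
  show "integrable M (\<lambda>x. (f x)\<^sup>2 + (g x)\<^sup>2)" using assms by simp
  have "\<bar>f x * g x\<bar> \<le> (f x)\<^sup>2 + (g x)\<^sup>2" for x
  proof -
    have "2 * \<bar>f x\<bar> * \<bar>g x\<bar> \<le> \<bar>f x\<bar>\<^sup>2 + \<bar>g x\<bar>\<^sup>2" by (rule sum_squares_bound)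
    moreover have "0 \<le> \<bar>f x\<bar> * \<bar>g x\<bar>" by simp
    ultimately show ?thesis unfolding power2_abs abs_mult by linarith
  qed
  then show "AE x in M. norm (f x * g x) \<le> norm ((f x)\<^sup>2 + (g x)\<^sup>2)" by auto
qed measurable

lemma Cauchy_Schwarz_integral:
  fixes f g :: "'a \<Rightarrow> real"
  assumes [measurable]: "f \<in> borel_measurable M" "g \<in> borel_measurable M"
    and f: "integrable M (\<lambda>x. (f x)\<^sup>2)" and g: "integrable M (\<lambda>x. (g x)\<^sup>2)"
  shows "(\<integral>x. f x * g x \<partial>M)\<^sup>2 \<le> (\<integral>x. (f x)\<^sup>2 \<partial>M) * (\<integral>x. (g x)\<^sup>2 \<partial>M)"
proof -
  note fg = integrable_mult_square [OF assms]
  let ?A = "\<integral>x. (f x)\<^sup>2 \<partial>M" and ?B = "\<integral>x. f x * g x \<partial>M" and ?C = "\<integral>x. (g x)\<^sup>2 \<partial>M"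
  have pos: "0 \<le> ?A + 2 * z * ?B + z\<^sup>2 * ?C" for z
  proof -
    have "0 \<le> (\<integral>x. (f x + z * g x)\<^sup>2 \<partial>M)" by simp
    also have "(\<lambda>x. (f x + z * g x)\<^sup>2) = (\<lambda>x. (f x)\<^sup>2 + 2 * z * (f x * g x) + z\<^sup>2 * (g x)\<^sup>2)"
      by (auto simp: power2_eq_square algebra_simps)
    also have "(\<integral>x. (f x)\<^sup>2 + 2 * z * (f x * g x) + z\<^sup>2 * (g x)\<^sup>2 \<partial>M) = ?A + 2 * z * ?B + z\<^sup>2 * ?C"
      using f g fg by simp
    finally show ?thesis .
  qed
  have C0: "0 \<le> ?C" "0 \<le> ?A" by simp_all
  show ?thesis
  proof (cases "?C = 0")
    case True
    have "?B = 0"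
    proof (rule ccontr)
      assume B: "?B \<noteq> 0"
      \<comment> \<open>With \<open>?C = 0\<close> the quadratic is affine in \<open>z\<close>, and
        this \<open>z\<close> gives it the value -1.\<close>
      from pos [of "- (?A + 1) / (2 * ?B)"] True B show False
        by (simp add: field_simps)
    qed
    then show ?thesis using True by simp
  next
    case False
    then have C: "0 < ?C" using C0 by linarith
    from pos [of "- ?B / ?C"] have "0 \<le> ?A - ?B\<^sup>2 / ?C"
      using C by (simp add: power2_eq_square field_simps)
    then show ?thesis using C by (simp add: field_simps)
  qed
qed

text \<open>As \<open>K\<close> is nonnegative, the absolute value falls on \<open>w\<close> alone,
  so integrability on the product space reduces to that of the iterated integral in
  \<open>int2\<close>. Columns with \<open>w s = 0\<close> contribute nothing, whatever
  \<open>K\<close> does there.\<close>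

lemma Fubini_kernel:
  fixes K :: "real \<Rightarrow> real \<Rightarrow> real" and w :: "real \<Rightarrow> real"
  assumes [measurable]: "case_prod K \<in> borel_measurable (lborel \<Otimes>\<^sub>M lborel)" "w \<in> borel_measurable lborel"
    and nonneg: "\<And>r s. 0 \<le> K r s"
    and int1: "\<And>s. w s \<noteq> 0 \<Longrightarrow> integrable lborel (\<lambda>r. K r s)"
    and int2: "integrable lborel (\<lambda>s. (\<integral>r. K r s \<partial>lborel) * w s)"
  shows "integrable lborel (\<lambda>r. \<integral>s. K r s * w s \<partial>lborel)"
    and "(\<integral>r. (\<integral>s. K r s * w s \<partial>lborel) \<partial>lborel) = (\<integral>s. (\<integral>r. K r s \<partial>lborel) * w s \<partial>lborel)"
proof -
  have [measurable]: "(\<lambda>(s, r). K r s) \<in> borel_measurable (lborel \<Otimes>\<^sub>M lborel)"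
    using measurable_compose [OF measurable_pair_swap' assms(1)] by (simp add: case_prod_beta)
  have m: "(\<lambda>(s, r). K r s * w s) \<in> borel_measurable (lborel \<Otimes>\<^sub>M lborel)"
    by measurable
  have I: "integrable (lborel \<Otimes>\<^sub>M lborel) (\<lambda>(s, r). K r s * w s)"
  proof (rule lborel_pair.Fubini_integrable [OF m])
    have "integrable lborel (\<lambda>s. norm ((\<integral>r. K r s \<partial>lborel) * w s))"
      using int2 by (rule integrable_norm)
    also have "(\<lambda>s. norm ((\<integral>r. K r s \<partial>lborel) * w s))
        = (\<lambda>s. \<integral>r. norm (case (s, r) of (s, r) \<Rightarrow> K r s * w s) \<partial>lborel)"
      using nonneg by (auto simp: abs_mult fun_eq_iff)
    finally show "integrable lborel (\<lambda>s. \<integral>r. norm (case (s, r) of (s, r) \<Rightarrow> K r s * w s) \<partial>lborel)" .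
    show "AE s in lborel. integrable lborel (\<lambda>r. case (s, r) of (s, r) \<Rightarrow> K r s * w s)"
    proof (rule AE_I2)
      fix s show "integrable lborel (\<lambda>r. case (s, r) of (s, r) \<Rightarrow> K r s * w s)"
        using int1 [of s] by (cases "w s = 0") auto
    qed
  qed
  show "integrable lborel (\<lambda>r. \<integral>s. K r s * w s \<partial>lborel)"
    using lborel_pair.integrable_snd [OF I] by simp
  have "(\<integral>r. (\<integral>s. K r s * w s \<partial>lborel) \<partial>lborel) = (\<integral>s. (\<integral>r. K r s * w s \<partial>lborel) \<partial>lborel)"
    using lborel_pair.Fubini_integral [OF I] by simp
  also have "\<dots> = (\<integral>s. (\<integral>r. K r s \<partial>lborel) * w s \<partial>lborel)"
    by simp
  finally show "(\<integral>r. (\<integral>s. K r s * w s \<partial>lborel) \<partial>lborel) = (\<integral>s. (\<integral>r. K r s \<partial>lborel) * w s \<partial>lborel)" .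
qed

subsection \<open>The fractional kernel on square-integrable functions\<close>

text \<open>The running energy is used instead of the full norm because the Volterra estimates must
  see only the past of \<open>u\<close>.\<close>

definition energy :: "(real \<Rightarrow> real) \<Rightarrow> real \<Rightarrow> real" where
  "energy u t = (\<integral>s. indicator {0<..<t} s * (u s)\<^sup>2 \<partial>lborel)"

definition sq_integrable :: "(real \<Rightarrow> real) \<Rightarrow> bool" where
  "sq_integrable u \<longleftrightarrow> u \<in> borel_measurable borel \<and> integrable lborel (\<lambda>s. (u s)\<^sup>2)"

definition weighted_kernel :: "real \<Rightarrow> real \<Rightarrow> real \<Rightarrow> real" where
  "weighted_kernel a t s = rl_kernel (1 + a) (t - s) * rl_kernel (1 - a) s"

definition frac_path :: "real \<Rightarrow> (real \<Rightarrow> real) \<Rightarrow> real \<Rightarrow> real" where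
  "frac_path a u t = (\<integral>s. weighted_kernel a t s * u s \<partial>lborel)"

abbreviation kernel_const :: "real \<Rightarrow> real" where
  "kernel_const a \<equiv> Beta (1 + 2 * a) (1 - 2 * a)"

lemma sq_integrableD [dest]:
  assumes "sq_integrable u"
  shows "u \<in> borel_measurable borel" "integrable lborel (\<lambda>s. (u s)\<^sup>2)"
  using assms by (auto simp: sq_integrable_def)

lemma energy_integrable:
  assumes "sq_integrable u"
  shows "integrable lborel (\<lambda>s. indicator {0<..<t} s * (u s)\<^sup>2)"
  using integrable_real_mult_indicator [of "{0<..<t}" lborel "\<lambda>s. (u s)\<^sup>2"] sq_integrableD [OF assms]
  by (simp add: mult.commute)

lemma energy_nonneg [simp]: "0 \<le> energy u t"
  by (simp add: energy_def)

lemma energy_mono: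
  assumes "sq_integrable u" "s \<le> t"
  shows "energy u s \<le> energy u t"
  unfolding energy_def
  by (intro integral_mono energy_integrable assms) (use assms in \<open>auto simp: indicator_def\<close>)

lemma weighted_kernel_measurable [measurable]: "weighted_kernel a t \<in> borel_measurable borel"
  unfolding weighted_kernel_def by measurable

lemma weighted_kernel_nonneg [simp]: "0 \<le> weighted_kernel a t s"
  by (simp add: weighted_kernel_def)

lemma weighted_kernel_eq_0: "s \<notin> {0<..<t} \<Longrightarrow> weighted_kernel a t s = 0"
  by (auto simp: weighted_kernel_def rl_kernel_def)

lemma weighted_kernel_square:
  "(weighted_kernel a t s)\<^sup>2 = rl_kernel (1 + 2 * a) (t - s) * rl_kernel (1 - 2 * a) s"
proof -
  have "(weighted_kernel a t s)\<^sup>2 =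
      (rl_kernel (1 + a) (t - s) * rl_kernel (1 + a) (t - s)) * (rl_kernel (1 - a) s * rl_kernel (1 - a) s)"
    unfolding weighted_kernel_def power2_eq_square by (simp only: ac_simps)
  also have "\<dots> = rl_kernel (1 + 2 * a) (t - s) * rl_kernel (1 - 2 * a) s"
    unfolding rl_kernel_mult by (simp add: algebra_simps)
  finally show ?thesis .
qed

text \<open>The orders \<open>1 + 2 * a\<close> and \<open>1 - 2 * a\<close> add up to 2, so the
  squared kernel has mass linear in \<open>t\<close>; the condition on \<open>a\<close> is exactly
  positivity of both orders.\<close>

lemma has_bochner_integral_weighted_kernel_square:
  assumes "\<bar>a\<bar> < 1/2" "0 \<le> t"
  shows "has_bochner_integral lborel (\<lambda>s. (weighted_kernel a t s)\<^sup>2) (kernel_const a * t)"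
  using has_bochner_integral_rl_kernel [of "1 + 2 * a" "1 - 2 * a" t 0] assms
  by (auto simp: weighted_kernel_square rl_kernel_2)

lemma integrable_weighted_kernel_square:
  assumes "\<bar>a\<bar> < 1/2"
  shows "integrable lborel (\<lambda>s. (weighted_kernel a t s)\<^sup>2)"
proof (cases "0 \<le> t")
  case True
  then show ?thesis
    using has_bochner_integral_weighted_kernel_square [OF assms] by (blast intro: integrable.intros)
next
  case False
  then have "weighted_kernel a t s = 0" for s by (intro weighted_kernel_eq_0) auto
  then show ?thesis by simp
qed

lemma kernel_const_nonneg: "\<bar>a\<bar> < 1/2 \<Longrightarrow> 0 \<le> kernel_const a"
  by (auto simp: Beta_def intro!: divide_nonneg_nonneg mult_nonneg_nonneg less_imp_le [OF Gamma_real_pos])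

lemma integrable_square_mult:
  assumes "sq_integrable u" "k \<in> borel_measurable borel" "integrable lborel (\<lambda>s. (k s)\<^sup>2)"
  shows "integrable lborel (\<lambda>s. k s * u s)"
  by (rule integrable_mult_square) (use assms sq_integrableD [OF assms(1)] in auto)

text \<open>Cauchy-Schwarz is applied after cutting \<open>u\<close> off to the support of
  \<open>k\<close>, so that only the energy up to \<open>t\<close> enters.\<close>

lemma abs_integral_le_energy:
  assumes u: "sq_integrable u" and k [measurable]: "k \<in> borel_measurable borel"
    and k2: "integrable lborel (\<lambda>s. (k s)\<^sup>2)" and k0: "\<And>s. s \<notin> {0<..<t} \<Longrightarrow> k s = 0"
    and le: "(\<integral>s. (k s)\<^sup>2 \<partial>lborel) \<le> c"
  shows "\<bar>\<integral>s. k s * u s \<partial>lborel\<bar> \<le> sqrt c * sqrt (energy u t)"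
proof -
  have [measurable]: "u \<in> borel_measurable borel" using u by auto
  let ?u = "\<lambda>s. indicator {0<..<t} s * u s"
  have sq: "(\<lambda>s. (?u s)\<^sup>2) = (\<lambda>s. indicator {0<..<t} s * (u s)\<^sup>2)"
    by (auto simp: indicator_def fun_eq_iff)
  have "(\<lambda>s. k s * u s) = (\<lambda>s. k s * ?u s)" using k0 by (auto simp: indicator_def fun_eq_iff)
  then have "(\<integral>s. k s * u s \<partial>lborel)\<^sup>2 = (\<integral>s. k s * ?u s \<partial>lborel)\<^sup>2" by simp
  also have "\<dots> \<le> (\<integral>s. (k s)\<^sup>2 \<partial>lborel) * (\<integral>s. (?u s)\<^sup>2 \<partial>lborel)"
    by (intro Cauchy_Schwarz_integral k2) (use energy_integrable [OF u] in \<open>simp_all add: sq\<close>)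
  also have "\<dots> \<le> c * energy u t"
    unfolding sq energy_def [symmetric] by (intro mult_right_mono le) simp
  finally have "sqrt ((\<integral>s. k s * u s \<partial>lborel)\<^sup>2) \<le> sqrt (c * energy u t)"
    by (rule real_sqrt_le_mono)
  then show ?thesis by (simp add: real_sqrt_mult)
qed

lemma integrable_frac_path:
  assumes "\<bar>a\<bar> < 1/2" "sq_integrable u"
  shows "integrable lborel (\<lambda>s. weighted_kernel a t s * u s)"
  by (intro integrable_square_mult integrable_weighted_kernel_square assms) measurable

lemma frac_path_bound:
  assumes "\<bar>a\<bar> < 1/2" "sq_integrable u" "0 \<le> t"
  shows "\<bar>frac_path a u t\<bar> \<le> sqrt (kernel_const a * t) * sqrt (energy u t)"
  unfolding frac_path_def
  using has_bochner_integral_weighted_kernel_square [OF assms(1,3)]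
  by (intro abs_integral_le_energy assms) (auto simp: has_bochner_integral_iff weighted_kernel_eq_0)

lemma frac_path_0: "t \<le> 0 \<Longrightarrow> frac_path a u t = 0"
  unfolding frac_path_def by (subst weighted_kernel_eq_0) auto

lemma frac_path_diff_le:
  assumes a: "\<bar>a\<bar> < 1/2" and u: "sq_integrable u" and t: "t \<le> t'"
    and le: "(\<integral>s. (weighted_kernel a t' s - weighted_kernel a t s)\<^sup>2 \<partial>lborel) \<le> c"
  shows "\<bar>frac_path a u t' - frac_path a u t\<bar> \<le> sqrt c * sqrt (energy u t')"
proof -
  have I: "integrable lborel (\<lambda>s. (weighted_kernel a t' s - weighted_kernel a t s)\<^sup>2)"
  proof -
    have "integrable lborel (\<lambda>s. (weighted_kernel a t' s)\<^sup>2 - 2 * (weighted_kernel a t' s * weighted_kernel a t s)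
        + (weighted_kernel a t s)\<^sup>2)"
      by (intro Bochner_Integration.integrable_add Bochner_Integration.integrable_diff
          integrable_weighted_kernel_square a integrable_mult_right integrable_mult_square) measurable
    then show ?thesis by (simp add: power2_diff algebra_simps)
  qed
  have "frac_path a u t' - frac_path a u t = (\<integral>s. (weighted_kernel a t' s - weighted_kernel a t s) * u s \<partial>lborel)"
    unfolding frac_path_def left_diff_distrib
    by (rule Bochner_Integration.integral_diff [symmetric]) (intro integrable_frac_path a u)+
  also have "\<bar>\<dots>\<bar> \<le> sqrt c * sqrt (energy u t')"
    by (intro abs_integral_le_energy u le I) (use t in \<open>auto simp: weighted_kernel_eq_0\<close>)
  finally show ?thesis .
qed

text \<open>
  Both increment bounds rest on \<open>(x - y)\<^sup>2 \<le> x\<^sup>2 - y\<^sup>2\<close> for \<open>x \<ge> y \<ge> 0\<close> together with the fact that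
  the squared kernel has total mass proportional to \<open>t\<close>; the kernel increases with \<open>t\<close> when
  \<open>a \<ge> 0\<close>, and decreases (off the new part of its support) when \<open>a < 0\<close>.
\<close>

lemma square_diff_le: "0 \<le> y \<Longrightarrow> y \<le> x \<Longrightarrow> (x - y)\<^sup>2 \<le> x\<^sup>2 - (y::real)\<^sup>2"
  by (simp add: power2_eq_square algebra_simps mult_right_mono)

lemma frac_path_increment_nonneg:
  assumes a: "0 \<le> a" "a < 1/2" and u: "sq_integrable u" and t: "0 \<le> t" "t \<le> t'"
  shows "\<bar>frac_path a u t' - frac_path a u t\<bar> \<le> sqrt (kernel_const a * (t' - t)) * sqrt (energy u t')"
proof (rule frac_path_diff_le)
  have a': "\<bar>a\<bar> < 1/2" using a by simp
  note h = has_bochner_integral_weighted_kernel_square [OF a', unfolded has_bochner_integral_iff]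
  have "weighted_kernel a t s \<le> weighted_kernel a t' s" for s
    unfolding weighted_kernel_def
    by (intro mult_right_mono rl_kernel_nonneg) (use a t in \<open>auto simp: rl_kernel_def intro: powr_mono2\<close>)
  then have *: "(weighted_kernel a t' s - weighted_kernel a t s)\<^sup>2
      \<le> (weighted_kernel a t' s)\<^sup>2 - (weighted_kernel a t s)\<^sup>2" for s
    by (intro square_diff_le) auto
  have "(\<integral>s. (weighted_kernel a t' s - weighted_kernel a t s)\<^sup>2 \<partial>lborel)
      \<le> (\<integral>s. (weighted_kernel a t' s)\<^sup>2 - (weighted_kernel a t s)\<^sup>2 \<partial>lborel)"
    using * order_trans [OF zero_le_power2 *]
    by (intro integral_mono' Bochner_Integration.integrable_diff integrable_weighted_kernel_square a')
  also have "\<dots> = kernel_const a * (t' - t)"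
    using h [of t] h [of t'] t by (simp add: algebra_simps)
  finally show "(\<integral>s. (weighted_kernel a t' s - weighted_kernel a t s)\<^sup>2 \<partial>lborel) \<le> kernel_const a * (t' - t)" .
qed (use a u t in auto)

lemma frac_path_increment_nonpos:
  assumes a: "- 1/2 < a" "a \<le> 0" and u: "sq_integrable u" and t: "0 \<le> t" "t \<le> t'" "t' \<le> T"
  shows "\<bar>frac_path a u t' - frac_path a u t\<bar>
    \<le> sqrt (2 * T powr (- 2 * a) * ((t' - t) powr (1 + 2 * a) / (1 + 2 * a))) * sqrt (energy u t')"
proof (rule frac_path_diff_le)
  have a': "\<bar>a\<bar> < 1/2" using a by simp
  note h = has_bochner_integral_weighted_kernel_square [OF a', unfolded has_bochner_integral_iff]
  \<comment> \<open>This is \<open>(t' - s) powr (2 * a)\<close> on \<open>t < s < t'\<close>,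
    written as the image of the power kernel under the reflection
    \<open>s \<mapsto> t + t' - s\<close>, so that its integral follows by an affine
    substitution.\<close>
  let ?q = "\<lambda>s. indicator {..<t'} (t + t' - s) * rl_kernel (1 + 2 * a) (t + t' - s - t)"
  have q: "has_bochner_integral lborel ?q ((t' - t) powr (1 + 2 * a) / (1 + 2 * a))"
    using has_bochner_integral_power_kernel [of "1 + 2 * a" t t'] a t
      lborel_has_bochner_integral_real_affine_iff [of "-1"
        "\<lambda>r. indicator {..<t'} r * rl_kernel (1 + 2 * a) (r - t)" _ "t + t'"]
    by simp
  \<comment> \<open>On the new part of the support the left side equals the square that is
    subtracted on the right, so twice this square has to be compensated; hence the factor 2. At
    \<open>s = t\<close> the function \<open>?q\<close> is 0 and the inequality may fail.\<close>
  have *: "(weighted_kernel a t' s - weighted_kernel a t s)\<^sup>2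
      \<le> (weighted_kernel a t s)\<^sup>2 - (weighted_kernel a t' s)\<^sup>2 + 2 * T powr (- 2 * a) * ?q s"
    if "s \<noteq> t" for s
  proof (cases "s < t")
    case True
    have "weighted_kernel a t' s \<le> weighted_kernel a t s"
      unfolding weighted_kernel_def
      by (intro mult_right_mono rl_kernel_nonneg)
        (use a t True in \<open>auto simp: rl_kernel_def intro: powr_mono2'\<close>)
    then have "(weighted_kernel a t s - weighted_kernel a t' s)\<^sup>2
      \<le> (weighted_kernel a t s)\<^sup>2 - (weighted_kernel a t' s)\<^sup>2"
      by (intro square_diff_le) auto
    moreover have "0 \<le> 2 * T powr (- 2 * a) * ?q s" by simp
    ultimately show ?thesis
      unfolding power2_commute [of "weighted_kernel a t' s"] by linarith
  next
    case False
    then have s: "t < s" using that by simp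
    have 0: "weighted_kernel a t s = 0" using s by (intro weighted_kernel_eq_0) auto
    have "(weighted_kernel a t' s)\<^sup>2 \<le> T powr (- 2 * a) * ?q s"
    proof (cases "s < t'")
      case True
      have "rl_kernel (1 + 2 * a) (t' - s) * rl_kernel (1 - 2 * a) s
          \<le> rl_kernel (1 + 2 * a) (t' - s) * T powr (- 2 * a)"
        by (intro mult_left_mono rl_kernel_nonneg)
          (use s t a True in \<open>auto simp: rl_kernel_def intro: powr_mono2\<close>)
      then show ?thesis using s by (simp add: weighted_kernel_square mult.commute)
    next
      case False
      then show ?thesis by (subst weighted_kernel_eq_0) auto
    qed
    then show ?thesis by (simp add: 0)
  qed
  have "(\<integral>s. (weighted_kernel a t' s - weighted_kernel a t s)\<^sup>2 \<partial>lborel)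
      \<le> (\<integral>s. (weighted_kernel a t s)\<^sup>2 - (weighted_kernel a t' s)\<^sup>2 + 2 * T powr (- 2 * a) * ?q s \<partial>lborel)"
  proof (rule integral_mono_AE')
    show "AE s in lborel. (weighted_kernel a t' s - weighted_kernel a t s)\<^sup>2
      \<le> (weighted_kernel a t s)\<^sup>2 - (weighted_kernel a t' s)\<^sup>2 + 2 * T powr (- 2 * a) * ?q s"
      using AE_lborel_singleton [of t] * by (auto elim!: eventually_mono)
    show "integrable lborel (\<lambda>s. (weighted_kernel a t s)\<^sup>2 - (weighted_kernel a t' s)\<^sup>2
        + 2 * T powr (- 2 * a) * ?q s)"
      using q by (intro Bochner_Integration.integrable_add Bochner_Integration.integrable_diff
          integrable_weighted_kernel_square a' integrable_mult_right) (auto intro: integrable.intros)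
    show "AE s in lborel. 0 \<le> (weighted_kernel a t s)\<^sup>2 - (weighted_kernel a t' s)\<^sup>2
        + 2 * T powr (- 2 * a) * ?q s"
      using AE_lborel_singleton [of t] order_trans [OF zero_le_power2 *] by (auto elim!: eventually_mono)
  qed
  also have "\<dots> = kernel_const a * t - kernel_const a * t'
      + 2 * T powr (- 2 * a) * ((t' - t) powr (1 + 2 * a) / (1 + 2 * a))"
    using h [of t] h [of t'] t q
    by (simp add: has_bochner_integral_iff Bochner_Integration.integral_add Bochner_Integration.integral_diff)
  also have "\<dots> \<le> 2 * T powr (- 2 * a) * ((t' - t) powr (1 + 2 * a) / (1 + 2 * a))"
    using mult_left_mono [OF t(2) kernel_const_nonneg [OF a']] by simp
  finally show "(\<integral>s. (weighted_kernel a t' s - weighted_kernel a t s)\<^sup>2 \<partial>lborel)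
      \<le> 2 * T powr (- 2 * a) * ((t' - t) powr (1 + 2 * a) / (1 + 2 * a))" .
qed (use a u t in auto)

lemma continuous_on_frac_path:
  assumes a: "\<bar>a\<bar> < 1/2" and u: "sq_integrable u"
  shows "continuous_on {0..T} (frac_path a u)"
proof -
  define \<omega> where "\<omega> h = (if 0 \<le> a then sqrt (kernel_const a * h)
      else sqrt (2 * T powr (- 2 * a) * (h powr (1 + 2 * a) / (1 + 2 * a)))) * sqrt (energy u T)" for h
  have inc: "\<bar>frac_path a u t' - frac_path a u t\<bar> \<le> \<omega> (t' - t)" if "0 \<le> t" "t \<le> t'" "t' \<le> T" for t t'
  proof -
    have "sqrt (energy u t') \<le> sqrt (energy u T)"
      using energy_mono [OF u] that by simp
    moreover have "0 \<le> kernel_const a * (t' - t)"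
      using kernel_const_nonneg [OF a] that by simp
    moreover have "0 \<le> 2 * T powr (- 2 * a) * ((t' - t) powr (1 + 2 * a) / (1 + 2 * a))"
      using a by simp
    ultimately show ?thesis
      using frac_path_increment_nonneg [OF _ _ u that(1,2)] frac_path_increment_nonpos [OF _ _ u that] a
      unfolding \<omega>_def
      by (auto intro!: order_trans [OF _ mult_left_mono [of "sqrt (energy u t')" "sqrt (energy u T)"]])
  qed
  have "((\<lambda>h. \<omega> \<bar>h\<bar>) \<longlongrightarrow> \<omega> 0) (at 0)"
  proof (cases "0 \<le> a")
    case True
    then show ?thesis unfolding \<omega>_def by (auto intro!: tendsto_eq_intros)
  next
    case False
    then have "((\<lambda>h::real. \<bar>h\<bar> powr (1 + 2 * a)) \<longlongrightarrow> 0 powr (1 + 2 * a)) (at 0)"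
      using a by (auto intro!: tendsto_powr2 tendsto_eq_intros simp: eventually_at_filter)
    with False show ?thesis using a unfolding \<omega>_def by (auto intro!: tendsto_eq_intros)
  qed
  then have lim: "((\<lambda>h. \<omega> \<bar>h\<bar>) \<longlongrightarrow> 0) (at 0)" using a by (simp add: \<omega>_def split: if_splits)
  show ?thesis
    unfolding continuous_on_def
  proof
    fix t assume t: "t \<in> {0..T}"
    have "((\<lambda>t'. \<omega> \<bar>t' - t\<bar>) \<longlongrightarrow> 0) (at t within {0..T})"
      by (rule tendsto_within_subset [OF LIM_offset_zero_cancel]) (use lim in simp_all)
    then have "((\<lambda>t'. frac_path a u t' - frac_path a u t) \<longlongrightarrow> 0) (at t within {0..T})"
    proof (rule Lim_null_comparison [rotated])
      show "\<forall>\<^sub>F t' in at t within {0..T}. norm (frac_path a u t' - frac_path a u t) \<le> \<omega> \<bar>t' - t\<bar>"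
        unfolding eventually_at_filter
      proof (intro always_eventually allI impI)
        fix t' assume "t' \<noteq> t" "t' \<in> {0..T}"
        then show "norm (frac_path a u t' - frac_path a u t) \<le> \<omega> \<bar>t' - t\<bar>"
          using inc [of t t'] inc [of t' t] t by (cases "t \<le> t'") (auto simp: abs_minus_commute)
      qed
    qed
    then show "(frac_path a u \<longlongrightarrow> frac_path a u t) (at t within {0..T})"
      by (subst LIM_zero_iff [symmetric])
  qed
qed

lemma Fubini_lborel:
  fixes F :: "real \<Rightarrow> real \<Rightarrow> real"
  assumes m [measurable]: "case_prod F \<in> borel_measurable (lborel \<Otimes>\<^sub>M lborel)"
    and int1: "\<And>r. integrable lborel (\<lambda>s. F r s)"
    and int2: "integrable lborel (\<lambda>r. \<integral>s. \<bar>F r s\<bar> \<partial>lborel)"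
  shows "integrable lborel (\<lambda>s. \<integral>r. F r s \<partial>lborel)"
    and "(\<integral>r. (\<integral>s. F r s \<partial>lborel) \<partial>lborel) = (\<integral>s. (\<integral>r. F r s \<partial>lborel) \<partial>lborel)"
proof -
  have I: "integrable (lborel \<Otimes>\<^sub>M lborel) (case_prod F)"
    by (rule lborel_pair.Fubini_integrable [OF m]) (use int1 int2 in auto)
  show "integrable lborel (\<lambda>s. \<integral>r. F r s \<partial>lborel)"
    using lborel_pair.integrable_snd [OF I] .
  show "(\<integral>r. (\<integral>s. F r s \<partial>lborel) \<partial>lborel) = (\<integral>s. (\<integral>r. F r s \<partial>lborel) \<partial>lborel)"
    using lborel_pair.Fubini_integral [OF I] by simp
qed

lemma frac_path_measurable [measurable]:
  assumes [measurable]: "u \<in> borel_measurable borel"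
  shows "frac_path a u \<in> borel_measurable borel"
  unfolding frac_path_def weighted_kernel_def by measurable

lemma sq_integrable_abs: "sq_integrable u \<Longrightarrow> sq_integrable (\<lambda>s. \<bar>u s\<bar>)"
  by (auto simp: sq_integrable_def)

text \<open>The Cauchy-Schwarz bound of the fractional path gains \<open>sqrt r\<close>, which makes
  its product with \<open>r powr (a - 1)\<close> integrable at 0 even for negative
  \<open>a > - 1/2\<close>.\<close>

lemma rl_kernel_frac_path_bound:
  assumes a: "\<bar>a\<bar> < 1/2" and u: "sq_integrable u" and r: "r \<le> t"
  shows "\<bar>rl_kernel a r * frac_path a u r\<bar>
    \<le> sqrt (kernel_const a) * sqrt (energy u t) * rl_kernel (a + 1/2) r"
proof (cases "0 < r")
  case True
  have "\<bar>frac_path a u r\<bar> \<le> sqrt (kernel_const a * r) * sqrt (energy u r)"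
    by (rule frac_path_bound [OF a u]) (use True in simp)
  also have "\<dots> \<le> sqrt (kernel_const a * r) * sqrt (energy u t)"
    by (intro mult_left_mono real_sqrt_le_mono energy_mono u r)
      (use True kernel_const_nonneg [OF a] in auto)
  finally have "r powr (a - 1) * \<bar>frac_path a u r\<bar>
      \<le> r powr (a - 1) * (sqrt (kernel_const a * r) * sqrt (energy u t))"
    by (rule mult_left_mono) simp
  also have "\<dots> = sqrt (kernel_const a) * sqrt (energy u t) * (r powr (a - 1) * r powr (1/2))"
    using True by (simp add: real_sqrt_mult powr_half_sqrt)
  also have "r powr (a - 1) * r powr (1/2) = r powr (a + 1/2 - 1)"
    by (simp add: powr_add [symmetric] algebra_simps)
  finally show ?thesis using True by (simp add: rl_kernel_def abs_mult)
qed (simp add: rl_kernel_nonpos)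

lemma has_bochner_integral_indicator_rl_kernel:
  assumes "0 < a" "0 \<le> t"
  shows "has_bochner_integral lborel (\<lambda>r. indicator {..<t} r * rl_kernel a r) (t powr a / a)"
  using has_bochner_integral_power_kernel [of a 0 t] assms by simp

lemma integrable_weighted_frac_path:
  assumes a: "\<bar>a\<bar> < 1/2" and u: "sq_integrable u"
  shows "integrable lborel (\<lambda>r. indicator {..<t} r * (rl_kernel a r * frac_path a u r))"
    and "0 \<le> t \<Longrightarrow> \<bar>\<integral>r. indicator {..<t} r * (rl_kernel a r * frac_path a u r) \<partial>lborel\<bar>
      \<le> sqrt (kernel_const a) * sqrt (energy u t) * (t powr (a + 1/2) / (a + 1/2))"
proof -
  have [measurable]: "u \<in> borel_measurable borel" using u by auto
  let ?c = "sqrt (kernel_const a) * sqrt (energy u t)"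
  have le: "\<bar>indicator {..<t} r * (rl_kernel a r * frac_path a u r)\<bar>
      \<le> ?c * (indicator {..<t} r * rl_kernel (a + 1/2) r)" for r
    using rl_kernel_frac_path_bound [OF a u, of r t] by (auto simp: indicator_def)
  have h: "has_bochner_integral lborel (\<lambda>r. ?c * (indicator {..<t} r * rl_kernel (a + 1/2) r))
      (?c * (t powr (a + 1/2) / (a + 1/2)))" if "0 \<le> t"
    using has_bochner_integral_indicator_rl_kernel [of "a + 1/2" t] a that
    by (intro has_bochner_integral_mult_right) auto
  show I: "integrable lborel (\<lambda>r. indicator {..<t} r * (rl_kernel a r * frac_path a u r))"
  proof (cases "0 \<le> t")
    case True
    show ?thesis
      by (rule Bochner_Integration.integrable_bound [OF integrable.intros [OF h [OF True]]])
        (use le in \<open>auto intro!: AE_I2 order_trans [OF le]\<close>)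
  next
    case False
    then have "(\<lambda>r. indicator {..<t} r * (rl_kernel a r * frac_path a u r)) = (\<lambda>r. 0)"
      by (auto simp: indicator_def rl_kernel_nonpos)
    then show ?thesis by simp
  qed
  assume t: "0 \<le> t"
  have "\<bar>\<integral>r. indicator {..<t} r * (rl_kernel a r * frac_path a u r) \<partial>lborel\<bar>
      \<le> (\<integral>r. \<bar>indicator {..<t} r * (rl_kernel a r * frac_path a u r)\<bar> \<partial>lborel)"
    using integral_norm_bound [of lborel "\<lambda>r. indicator {..<t} r * (rl_kernel a r * frac_path a u r)"]
    by simp
  also have "\<dots> \<le> (\<integral>r. ?c * (indicator {..<t} r * rl_kernel (a + 1/2) r) \<partial>lborel)"
    by (rule integral_mono [OF integrable_abs [OF I] integrable.intros [OF h [OF t]] le])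
  also have "\<dots> = ?c * (t powr (a + 1/2) / (a + 1/2))"
    using h [OF t] by (rule has_bochner_integral_integral_eq)
  finally show "\<bar>\<integral>r. indicator {..<t} r * (rl_kernel a r * frac_path a u r) \<partial>lborel\<bar>
      \<le> ?c * (t powr (a + 1/2) / (a + 1/2))" .
qed

section \<open>The kernel operator expressed through one fractional integral\<close>

definition inner_kernel :: "real \<Rightarrow> real \<Rightarrow> real \<Rightarrow> real" where
  "inner_kernel a t s =
     rl_kernel (1 - a) s * (\<integral>r. indicator {..<t} r * rl_kernel a r * rl_kernel (1 + a) (r - s) \<partial>lborel)"

text \<open>\<open>inner_kernel\<close> is the integral term of \<open>K_kernel\<close> without its
  constants. Exchanging the order of integration recreates the fractional path inside, so the double
  integral becomes a weighted primitive of that path.\<close>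

lemma Fubini_inner_kernel:
  assumes a: "\<bar>a\<bar> < 1/2" and u: "sq_integrable u"
  shows "integrable lborel (\<lambda>s. inner_kernel a t s * u s)"
    and "(\<integral>s. inner_kernel a t s * u s \<partial>lborel)
      = (\<integral>r. indicator {..<t} r * (rl_kernel a r * frac_path a u r) \<partial>lborel)"
proof -
  have [measurable]: "u \<in> borel_measurable borel" using u by auto
  let ?F = "\<lambda>r s. indicator {..<t} r * rl_kernel a r * (weighted_kernel a r s * u s)"
  have m: "case_prod ?F \<in> borel_measurable (lborel \<Otimes>\<^sub>M lborel)"
    unfolding weighted_kernel_def by measurable
  have int1: "integrable lborel (\<lambda>s. ?F r s)" for r
    by (intro integrable_mult_right integrable_frac_path a u)
  have "(\<lambda>r. \<integral>s. \<bar>?F r s\<bar> \<partial>lborel)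
      = (\<lambda>r. indicator {..<t} r * (rl_kernel a r * frac_path a (\<lambda>s. \<bar>u s\<bar>) r))"
    by (simp add: abs_mult frac_path_def mult.assoc)
  then have int2: "integrable lborel (\<lambda>r. \<integral>s. \<bar>?F r s\<bar> \<partial>lborel)"
    using integrable_weighted_frac_path(1) [OF a sq_integrable_abs [OF u]] by simp
  have eq: "(\<integral>r. ?F r s \<partial>lborel) = inner_kernel a t s * u s" for s
  proof -
    have "(\<lambda>r. ?F r s) = (\<lambda>r. (rl_kernel (1 - a) s * u s)
        * (indicator {..<t} r * rl_kernel a r * rl_kernel (1 + a) (r - s)))"
      by (simp add: weighted_kernel_def fun_eq_iff)
    then show ?thesis by (simp only: integral_mult_right_zero inner_kernel_def) (simp add: ac_simps)
  qed
  show "integrable lborel (\<lambda>s. inner_kernel a t s * u s)"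
    using Fubini_lborel(1) [OF m int1 int2] by (simp add: eq)
  show "(\<integral>s. inner_kernel a t s * u s \<partial>lborel)
      = (\<integral>r. indicator {..<t} r * (rl_kernel a r * frac_path a u r) \<partial>lborel)"
    using Fubini_lborel(2) [OF m int1 int2]
    unfolding eq integral_mult_right_zero frac_path_def [symmetric] by (simp add: mult.assoc)
qed

lemma K_kernel_eq:
  assumes "0 < s" "s < t"
  shows "K_kernel H t s = c_H H *
    (t powr (H - 1/2) * weighted_kernel (H - 1/2) t s - (H - 1/2) * inner_kernel (H - 1/2) t s)"
proof -
  define a where "a = H - 1/2"
  have m: "(\<lambda>r. indicator {s..t} r * (r powr (a - 1) * (r - s) powr a)) \<in> borel_measurable lborel"
    by measurable
  have "(LINT r:{s..t}|lebesgue. r powr (a - 1) * (r - s) powr a)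
      = (\<integral>r. indicator {s..t} r * (r powr (a - 1) * (r - s) powr a) \<partial>lborel)"
    using integral_completion [OF m] by (simp add: set_lebesgue_integral_def)
  also have "\<dots> = (\<integral>r. indicator {..<t} r * rl_kernel a r * rl_kernel (1 + a) (r - s) \<partial>lborel)"
  proof (rule integral_cong_AE)
    show "AE r in lborel. indicator {s..t} r * (r powr (a - 1) * (r - s) powr a)
        = indicator {..<t} r * rl_kernel a r * rl_kernel (1 + a) (r - s)"
      using AE_lborel_singleton [of t] AE_lborel_singleton [of s]
      by eventually_elim (use assms in \<open>auto simp: indicator_def rl_kernel_def\<close>)
  qed measurable
  finally have J: "(LINT r:{s..t}|lebesgue. r powr (a - 1) * (r - s) powr a)
      = (\<integral>r. indicator {..<t} r * rl_kernel a r * rl_kernel (1 + a) (r - s) \<partial>lborel)" .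
  have e: "H - 3/2 = a - 1" "1/2 - H = - a" "H - 1/2 = a" by (simp_all add: a_def)
  have "(t / s) powr a = t powr a * rl_kernel (1 - a) s"
    using assms by (simp add: powr_divide rl_kernel_def powr_minus divide_simps)
  then show ?thesis
    unfolding K_kernel_def e J using assms
    by (simp add: weighted_kernel_def inner_kernel_def rl_kernel_pos)
qed

definition K_scalar :: "real \<Rightarrow> (real \<Rightarrow> real) \<Rightarrow> real \<Rightarrow> real" where
  "K_scalar H u t = (\<integral>s. indicator {0<..<t} s * (K_kernel H t s * u s) \<partial>lborel)"

lemma inner_kernel_eq_0:
  assumes "s \<notin> {0<..<t}"
  shows "inner_kernel a t s = 0"
proof (cases "s \<le> 0")
  case False
  then have "(\<lambda>r. indicator {..<t} r * rl_kernel a r * rl_kernel (1 + a) (r - s)) = (\<lambda>r. 0)"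
    using assms by (auto simp: indicator_def rl_kernel_def)
  then show ?thesis unfolding inner_kernel_def by (simp only:) simp
qed (simp add: inner_kernel_def rl_kernel_nonpos)

text \<open>The right-hand side is what integration by parts makes of the Stieltjes integral of
  \<open>r powr (H - 1/2)\<close> against the fractional path. In this form no derivative of the
  path appears, and both signs of \<open>H - 1/2\<close> are covered at once.\<close>

lemma
  assumes H: "0 < H" "H < 1" and u: "sq_integrable u"
  shows integrable_K_scalar: "integrable lborel (\<lambda>s. indicator {0<..<t} s * (K_kernel H t s * u s))"
    and K_scalar_eq: "K_scalar H u t = c_H H *
      (t powr (H - 1/2) * frac_path (H - 1/2) u t
        - (H - 1/2) * (\<integral>r. indicator {..<t} r * (rl_kernel (H - 1/2) r * frac_path (H - 1/2) u r) \<partial>lborel))"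
proof -
  define a where "a = H - 1/2"
  have a: "\<bar>a\<bar> < 1/2" using H by (auto simp: a_def abs_if)
  have eq: "(\<lambda>s. indicator {0<..<t} s * (K_kernel H t s * u s)) = (\<lambda>s. c_H H *
      (t powr a * (weighted_kernel a t s * u s) - a * (inner_kernel a t s * u s)))"
  proof
    fix s
    show "indicator {0<..<t} s * (K_kernel H t s * u s) = c_H H *
      (t powr a * (weighted_kernel a t s * u s) - a * (inner_kernel a t s * u s))"
    proof (cases "s \<in> {0<..<t}")
      case True
      then have K: "K_kernel H t s = c_H H * (t powr a * weighted_kernel a t s - a * inner_kernel a t s)"
        using K_kernel_eq [of s t H] by (simp add: a_def)
      from True show ?thesis unfolding K by (simp add: algebra_simps)
    qed (simp add: weighted_kernel_eq_0 inner_kernel_eq_0)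
  qed
  show "integrable lborel (\<lambda>s. indicator {0<..<t} s * (K_kernel H t s * u s))"
    unfolding eq
    by (intro integrable_mult_right Bochner_Integration.integrable_diff integrable_frac_path
        Fubini_inner_kernel a u)
  show "K_scalar H u t = c_H H * (t powr (H - 1/2) * frac_path (H - 1/2) u t
        - (H - 1/2) * (\<integral>r. indicator {..<t} r * (rl_kernel (H - 1/2) r * frac_path (H - 1/2) u r) \<partial>lborel))"
    using integrable_frac_path [OF a u, of t] Fubini_inner_kernel [OF a u, of t]
    unfolding K_scalar_def eq a_def [symmetric] by (simp add: frac_path_def)
qed

definition weighted_primitive :: "real \<Rightarrow> (real \<Rightarrow> real) \<Rightarrow> real \<Rightarrow> real" where
  "weighted_primitive a p t = integral {0..t} (\<lambda>r. r powr (a - 1) * p r)"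

lemma weighted_frac_path_integrable_on:
  assumes a: "\<bar>a\<bar> < 1/2" and u: "sq_integrable u"
  shows "(\<lambda>r. r powr (a - 1) * frac_path a u r) integrable_on {0..t}"
    and "weighted_primitive a (frac_path a u) t
      = (\<integral>r. indicator {..<t} r * (rl_kernel a r * frac_path a u r) \<partial>lborel)"
proof -
  have [measurable]: "u \<in> borel_measurable borel" using u by auto
  let ?f = "\<lambda>r. r powr (a - 1) * frac_path a u r"
  have AE: "AE r in lborel. indicator {..<t} r * (rl_kernel a r * frac_path a u r) = indicator {0..t} r *\<^sub>R ?f r"
    using AE_lborel_singleton [of t]
    by eventually_elim (auto simp: indicator_def rl_kernel_def frac_path_0)
  have I: "set_integrable lborel {0..t} ?f"
    unfolding set_integrable_def
    using integrable_weighted_frac_path(1) [OF a u, of t]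
    by (subst integrable_cong_AE [OF _ _ AE, symmetric]) auto
  from set_borel_integral_eq_integral [OF I] show "?f integrable_on {0..t}"
    "weighted_primitive a (frac_path a u) t
      = (\<integral>r. indicator {..<t} r * (rl_kernel a r * frac_path a u r) \<partial>lborel)"
    using integral_cong_AE [OF _ _ AE]
    by (simp_all add: weighted_primitive_def set_lebesgue_integral_def)
qed

lemma K_scalar_eq_primitive:
  assumes "0 < H" "H < 1" "sq_integrable u"
  shows "K_scalar H u t = c_H H * (t powr (H - 1/2) * frac_path (H - 1/2) u t
    - (H - 1/2) * weighted_primitive (H - 1/2) (frac_path (H - 1/2) u) t)"
  using assms by (subst weighted_frac_path_integrable_on(2)) (auto simp: K_scalar_eq abs_if)

lemma powr_frac_path_bound:
  assumes a: "\<bar>a\<bar> < 1/2" and u: "sq_integrable u" and t: "0 \<le> t"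
  shows "\<bar>t powr a * frac_path a u t\<bar> \<le> sqrt (kernel_const a) * sqrt (energy u t) * t powr (a + 1/2)"
proof -
  have "\<bar>t powr a * frac_path a u t\<bar> \<le> t powr a * (sqrt (kernel_const a * t) * sqrt (energy u t))"
    unfolding abs_mult using frac_path_bound [OF a u t] by (simp add: mult_left_mono)
  also have "\<dots> = sqrt (kernel_const a) * sqrt (energy u t) * t powr (a + 1/2)"
    using t by (simp add: powr_add powr_half_sqrt real_sqrt_mult)
  finally show ?thesis .
qed

lemma K_scalar_bound:
  assumes H: "0 < H" "H < 1"
  obtains C where "0 \<le> C"
    "\<And>u t. sq_integrable u \<Longrightarrow> 0 \<le> t \<Longrightarrow> \<bar>K_scalar H u t\<bar> \<le> C * t powr H * sqrt (energy u t)"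
proof
  define a where "a = H - 1/2"
  have a: "\<bar>a\<bar> < 1/2" using H by (auto simp: a_def abs_if)
  let ?B = "sqrt (kernel_const a)"
  let ?C = "\<bar>c_H H\<bar> * (?B + \<bar>a\<bar> * (?B / H))"
  show "0 \<le> ?C" using kernel_const_nonneg [OF a] H by simp
  fix u t assume u: "sq_integrable u" and t: "0 \<le> (t::real)"
  have aH: "a + 1/2 = H" by (simp add: a_def)
  let ?I = "\<integral>r. indicator {..<t} r * (rl_kernel a r * frac_path a u r) \<partial>lborel"
  have "\<bar>K_scalar H u t\<bar> = \<bar>c_H H\<bar> * \<bar>t powr a * frac_path a u t - a * ?I\<bar>"
    using K_scalar_eq [OF H u] by (simp add: a_def abs_mult)
  also have "\<dots> \<le> \<bar>c_H H\<bar> * (\<bar>t powr a * frac_path a u t\<bar> + \<bar>a\<bar> * \<bar>?I\<bar>)"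
    by (intro mult_left_mono order_trans [OF abs_triangle_ineq4]) (auto simp: abs_mult)
  also have "\<dots> \<le> \<bar>c_H H\<bar> * (?B * sqrt (energy u t) * t powr H
      + \<bar>a\<bar> * (?B * sqrt (energy u t) * (t powr H / H)))"
    using powr_frac_path_bound [OF a u t] integrable_weighted_frac_path(2) [OF a u t]
    unfolding aH by (intro mult_left_mono add_mono) auto
  also have "\<dots> = ?C * t powr H * sqrt (energy u t)"
    by (simp add: algebra_simps)
  finally show "\<bar>K_scalar H u t\<bar> \<le> ?C * t powr H * sqrt (energy u t)" .
qed

text \<open>Only \<open>t = 0\<close> is delicate, since \<open>t powr a\<close> blows up there for
  negative \<open>a\<close>. The product is of order \<open>t powr (a + 1/2)\<close>, a positive
  power.\<close>

lemma continuous_on_powr_frac_path: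
  assumes a: "\<bar>a\<bar> < 1/2" and u: "sq_integrable u"
  shows "continuous_on {0..T} (\<lambda>t. t powr a * frac_path a u t)"
  unfolding continuous_on_def
proof
  fix t assume t: "t \<in> {0..T}"
  show "((\<lambda>t. t powr a * frac_path a u t) \<longlongrightarrow> t powr a * frac_path a u t) (at t within {0..T})"
  proof (cases "t = 0")
    case False
    have "(frac_path a u \<longlongrightarrow> frac_path a u t) (at t within {0..T})"
      using continuous_on_frac_path [OF a u, of T] t by (simp add: continuous_on_def)
    then show ?thesis
      by (intro tendsto_mult tendsto_powr tendsto_ident_at tendsto_const) (use False in auto)
  next
    case True
    let ?c = "sqrt (kernel_const a) * sqrt (energy u T)"
    have "((\<lambda>t::real. t powr (a + 1/2)) \<longlongrightarrow> 0 powr (a + 1/2)) (at 0 within {0..T})"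
      using a by (intro tendsto_powr2) (auto intro!: tendsto_eq_intros simp: eventually_at_filter abs_if split: if_splits)
    then have "((\<lambda>t. ?c * t powr (a + 1/2)) \<longlongrightarrow> 0) (at 0 within {0..T})"
      using tendsto_mult_right_zero by (simp add: tendsto_mult_right_zero)
    then have "((\<lambda>t. t powr a * frac_path a u t) \<longlongrightarrow> 0) (at 0 within {0..T})"
    proof (rule Lim_null_comparison [rotated])
      show "\<forall>\<^sub>F t in at 0 within {0..T}. norm (t powr a * frac_path a u t) \<le> ?c * t powr (a + 1/2)"
        unfolding eventually_at_filter
      proof (intro always_eventually allI impI)
        fix s assume s: "s \<in> {0..T}"
        have "norm (s powr a * frac_path a u s) \<le> sqrt (kernel_const a) * sqrt (energy u s) * s powr (a + 1/2)"
          using powr_frac_path_bound [OF a u, of s] s by simp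
        also have "\<dots> \<le> ?c * s powr (a + 1/2)"
          by (intro mult_right_mono mult_left_mono real_sqrt_le_mono energy_mono u)
            (use s kernel_const_nonneg [OF a] in auto)
        finally show "norm (s powr a * frac_path a u s) \<le> ?c * s powr (a + 1/2)" .
      qed
    qed
    then show ?thesis using True by simp
  qed
qed

lemma continuous_on_K_scalar:
  assumes H: "0 < H" "H < 1" and u: "sq_integrable u"
  shows "continuous_on {0..T} (K_scalar H u)"
proof -
  define a where "a = H - 1/2"
  have a: "\<bar>a\<bar> < 1/2" using H by (auto simp: a_def abs_if)
  have "continuous_on {0..T} (weighted_primitive a (frac_path a u))"
    unfolding weighted_primitive_def
    by (rule indefinite_integral_continuous_1 [OF weighted_frac_path_integrable_on(1) [OF a u]])
  then have "continuous_on {0..T} (\<lambda>t. c_H H * (t powr a * frac_path a u t - a * weighted_primitive a (frac_path a u) t))"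
    by (intro continuous_intros continuous_on_powr_frac_path a u)
  then show ?thesis
    using K_scalar_eq_primitive [OF H u] by (simp add: a_def)
qed

text \<open>With \<open>p\<close> the fractional path, the increment is \<open>c_H H\<close> times
  \<open>t powr a * (p t' - p t)\<close> plus the integral of
  \<open>a * r powr (a - 1) * (p t' - p r)\<close> over \<open>[t, t']\<close>. For positive
  \<open>a\<close> these weights are nonnegative with total \<open>t' powr a\<close>, so the
  Hoelder-1/2 bound of \<open>p\<close> is inherited.\<close>

lemma K_scalar_increment:
  assumes H: "1/2 < H" "H < 1" and u: "sq_integrable u" and t: "0 \<le> t" "t \<le> t'" "t' \<le> T"
  shows "\<bar>K_scalar H u t' - K_scalar H u t\<bar>
    \<le> \<bar>c_H H\<bar> * (T powr (H - 1/2) * sqrt (kernel_const (H - 1/2))) * sqrt (t' - t) * sqrt (energy u t')"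
proof -
  define a where "a = H - 1/2"
  have a: "0 < a" "a < 1/2" "\<bar>a\<bar> < 1/2" using H by (auto simp: a_def)
  define p where "p = frac_path a u"
  define w where "w = sqrt (kernel_const a * (t' - t)) * sqrt (energy u t')"
  have w: "\<bar>p t' - p r\<bar> \<le> w" if "r \<in> {t..t'}" for r
  proof -
    have "\<bar>p t' - p r\<bar> \<le> sqrt (kernel_const a * (t' - r)) * sqrt (energy u t')"
      unfolding p_def by (rule frac_path_increment_nonneg) (use a u t that in auto)
    also have "\<dots> \<le> w"
      unfolding w_def using that kernel_const_nonneg [OF a(3)]
      by (intro mult_right_mono real_sqrt_le_mono mult_left_mono) auto
    finally show ?thesis .
  qed
  have I: "(\<lambda>r. r powr (a - 1) * p r) integrable_on {0..t'}"
    using weighted_frac_path_integrable_on(1) [OF a(3) u] by (simp add: p_def)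
  have J: "((\<lambda>r. a * r powr (a - 1)) has_integral (t' powr a - t powr a)) {t..t'}"
  proof (rule fundamental_theorem_of_calculus_interior [OF t(2)])
    show "continuous_on {t..t'} (\<lambda>r. r powr a)"
      by (rule continuous_on_powr') (use t a in \<open>auto intro!: continuous_intros\<close>)
    fix r assume "r \<in> {t<..<t'}"
    then show "((\<lambda>r. r powr a) has_vector_derivative a * r powr (a - 1)) (at r)"
      using t unfolding has_real_derivative_iff_has_vector_derivative [symmetric]
      by (auto intro!: derivative_eq_intros)
  qed
  have It: "(\<lambda>r. r powr (a - 1) * p r) integrable_on {t..t'}"
    by (rule integrable_on_subinterval [OF I]) (use t in auto)
  have split: "weighted_primitive a p t' - weighted_primitive a p t = integral {t..t'} (\<lambda>r. r powr (a - 1) * p r)"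
    unfolding weighted_primitive_def
    using Henstock_Kurzweil_Integration.integral_combine [OF t(1,2) I] by simp
  have D: "((\<lambda>r. a * r powr (a - 1) * (p t' - p r)) has_integral
      (t' powr a - t powr a) * p t' - a * integral {t..t'} (\<lambda>r. r powr (a - 1) * p r)) {t..t'}"
    using has_integral_diff [OF has_integral_mult_left [OF J, of "p t'"]
        has_integral_mult_right [OF integrable_integral [OF It], of a]]
    by (simp add: algebra_simps)
  have W: "((\<lambda>r. a * r powr (a - 1) * w) has_integral (t' powr a - t powr a) * w) {t..t'}"
    by (rule has_integral_mult_left [OF J])
  have le: "norm (integral {t..t'} (\<lambda>r. a * r powr (a - 1) * (p t' - p r))) \<le> integral {t..t'} (\<lambda>r. a * r powr (a - 1) * w)"
    by (rule integral_norm_bound_integral)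
      (use D W w a in \<open>auto simp: abs_mult intro!: mult_left_mono\<close>)
  have K: "K_scalar H u s = c_H H * (s powr a * p s - a * weighted_primitive a p s)" for s
    using K_scalar_eq_primitive [of H u s] H u by (simp add: a_def p_def)
  have "K_scalar H u t' - K_scalar H u t =
      c_H H * (t powr a * (p t' - p t) + integral {t..t'} (\<lambda>r. a * r powr (a - 1) * (p t' - p r)))"
    unfolding K integral_unique [OF D] split [symmetric] by (simp add: algebra_simps)
  also have "\<bar>\<dots>\<bar> \<le> \<bar>c_H H\<bar> * (t powr a * w + (t' powr a - t powr a) * w)"
    unfolding abs_mult [of "c_H H"]
    using le integral_unique [OF W] w [of t] t
    by (intro mult_left_mono order_trans [OF abs_triangle_ineq] add_mono) (auto simp: abs_mult intro!: mult_left_mono)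
  also have "\<dots> = \<bar>c_H H\<bar> * (t' powr a * w)" by (simp add: algebra_simps)
  also have "\<dots> \<le> \<bar>c_H H\<bar> * (T powr a * w)"
    using t a kernel_const_nonneg [OF a(3)]
    by (intro mult_left_mono mult_right_mono powr_mono2) (auto simp: w_def)
  also have "\<dots> = \<bar>c_H H\<bar> * (T powr a * sqrt (kernel_const a)) * sqrt (t' - t) * sqrt (energy u t')"
    by (simp add: w_def real_sqrt_mult)
  finally show ?thesis by (simp add: a_def)
qed

lemma weighted_primitive_has_real_derivative:
  assumes I: "(\<lambda>r. r powr (a - 1) * p r) integrable_on {0..T}" and p: "continuous_on {0..T} p"
    and t: "0 < t" "t < T"
  shows "(weighted_primitive a p has_real_derivative t powr (a - 1) * p t) (at t)"
proof -
  have "continuous_on {0<..<T} (\<lambda>r. r powr (a - 1) * p r)"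
    by (intro continuous_intros continuous_on_subset [OF p]) auto
  then have "isCont (\<lambda>r. r powr (a - 1) * p r) t"
    using t by (simp add: continuous_on_eq_continuous_at)
  then have "((\<lambda>u. integral {0..u} (\<lambda>r. r powr (a - 1) * p r)) has_vector_derivative t powr (a - 1) * p t)
      (at t within {0..T} - {})"
    using integral_has_vector_derivative_continuous_at [OF I, of t "{}"] t
    by (auto intro: continuous_at_imp_continuous_at_within)
  moreover have "at t within {0..T} = at t"
    using t by (intro at_within_interior) (auto simp: interior_atLeastAtMost_real)
  ultimately show ?thesis
    unfolding weighted_primitive_def has_real_derivative_iff_has_vector_derivative by simp
qed

text \<open>The hypothesis says \<open>s powr a * p s = a * S s\<close> for the weighted primitive
  \<open>S\<close>, whose derivative is \<open>s powr (a - 1) * p s\<close>. Hence \<open>p\<close>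
  is differentiable inside the interval, and the product rule gives derivative 0; continuity and
  \<open>p 0 = 0\<close> finish.\<close>

lemma frac_path_eq_0:
  assumes H: "0 < H" "H < 1" and c: "c_H H \<noteq> 0" and u: "sq_integrable u"
    and z: "\<And>t. t \<in> {0..T} \<Longrightarrow> K_scalar H u t = 0" and t: "t \<in> {0..T}"
  shows "frac_path (H - 1/2) u t = 0"
proof -
  define a where "a = H - 1/2"
  have a: "\<bar>a\<bar> < 1/2" using H by (auto simp: a_def abs_if)
  define p where "p = frac_path a u"
  have pc: "continuous_on {0..T} p" unfolding p_def by (rule continuous_on_frac_path [OF a u])
  have eq: "t powr a * p t = a * weighted_primitive a p t" if "t \<in> {0..T}" for t
    using z [OF that] c K_scalar_eq_primitive [OF H u, of t] by (simp add: a_def p_def)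
  have eq': "p s = s powr - a * (a * weighted_primitive a p s)" if "s \<in> {0<..<T}" for s
    using eq [of s, symmetric] that by (simp add: powr_minus field_simps)
  have d: "(p has_real_derivative 0) (at s)" if s: "s \<in> {0<..<T}" for s
  proof -
    have "((\<lambda>s. s powr - a * (a * weighted_primitive a p s)) has_real_derivative
        s powr - a * (a * (s powr (a - 1) * p s)) + (- a * s powr (- a - 1)) * (a * weighted_primitive a p s)) (at s)"
      using s weighted_frac_path_integrable_on(1) [OF a u, folded p_def, of T]
      by (auto intro!: derivative_eq_intros weighted_primitive_has_real_derivative pc)
    also have "s powr - a * (a * (s powr (a - 1) * p s)) + (- a * s powr (- a - 1)) * (a * weighted_primitive a p s) = 0"
    proof -
      have "s powr - a * (a * (s powr (a - 1) * p s)) = a * p s * (s powr - a * s powr (a - 1))"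
        by simp
      also have "s powr - a * s powr (a - 1) = s powr (- a - 1) * s powr a"
        by (simp add: powr_add [symmetric])
      also have "a * p s * (s powr (- a - 1) * s powr a) = a * s powr (- a - 1) * (s powr a * p s)"
        by simp
      also have "s powr a * p s = a * weighted_primitive a p s" using eq s by simp
      finally show ?thesis by simp
    qed
    finally show ?thesis
      by (rule has_field_derivative_transform_within_open [where S = "{0<..<T}"]) (use s eq' in auto)
  qed
  show ?thesis
  proof (cases "0 < t")
    case False
    then show ?thesis by (intro frac_path_0) simp
  next
    case True
    have "p t = p 0"
    proof (rule DERIV_isconst_end [OF True])
      show "continuous_on {0..t} p" by (rule continuous_on_subset [OF pc]) (use t in auto)
      show "(p has_real_derivative 0) (at x)" if "0 < x" "x < t" for x
        using that t by (intro d) auto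
    qed
    then show ?thesis by (simp add: p_def a_def frac_path_0)
  qed
qed

subsection \<open>Injectivity of the kernel operator\<close>

text \<open>Half-lines are an intersection-stable generator of the Borel sets, so by Dynkin
  induction the integral of \<open>w\<close> vanishes over every Borel set; \<open>tot\<close>
  serves the step to complements. Sets on which \<open>w\<close> has constant sign then give the
  claim.\<close>

lemma AE_eq_0_of_integral_lessThan:
  fixes w :: "real \<Rightarrow> real"
  assumes w: "integrable lborel w" and z: "\<And>t. (\<integral>s. indicator {..<t} s * w s \<partial>lborel) = 0"
    and tot: "(\<integral>s. w s \<partial>lborel) = 0"
  shows "AE s in lborel. w s = 0"
proof -
  have si: "set_integrable lborel A w" if "A \<in> sets borel" for A
    unfolding set_integrable_def by (rule integrable_mult_indicator) (use w that in auto)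
  have P: "(LINT s:A|lborel. w s) = 0" if "A \<in> sets borel" for A
  proof -
    have IS: "Int_stable (range (\<lambda>a::real. {..<a}))"
    proof -
      have "{..<a} \<inter> {..<b} = {..<min a b}" for a b :: real by auto
      then show ?thesis by (auto simp: Int_stable_def)
    qed
    have "A \<in> sigma_sets UNIV (range (\<lambda>a::real. {..<a}))"
      using that by (simp add: borel_Iio)
    with IS subset_UNIV [of "range (\<lambda>a::real. {..<a})", folded Pow_UNIV] show ?thesis
    proof (induction rule: sigma_sets_induct_disjoint)
      case (basic A)
      then show ?case using z by (auto simp: set_lebesgue_integral_def)
    next
      case empty
      then show ?case by (simp add: set_lebesgue_integral_def)
    next
      case (compl A)
      then have A: "A \<in> sets borel" by (simp add: borel_Iio)
      have "(LINT s:UNIV - A|lborel. w s) = (LINT s|lborel. w s - indicator A s * w s)"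
        unfolding set_lebesgue_integral_def
        by (intro Bochner_Integration.integral_cong) (auto simp: indicator_def)
      also have "\<dots> = 0"
        using si [OF A] compl w tot by (simp add: set_integrable_def set_lebesgue_integral_def)
      finally show ?case .
    next
      case (union A)
      then have A: "A i \<in> sets borel" for i by (auto simp: borel_Iio)
      have "(LINT s:(\<Union>i. A i)|lborel. w s) = (\<Sum>i. (LINT s:(A i)|lborel. w s))"
        by (rule lebesgue_integral_countable_add)
          (use A union in \<open>auto simp: disjoint_family_on_def intro!: si\<close>)
      then show ?case using union by simp
    qed
  qed
  have [measurable]: "w \<in> borel_measurable borel" using w by auto
  \<comment> \<open>The values \<open>e = 1\<close> and \<open>e = - 1\<close> yield the positive
    and the negative part; each is a nonnegative function with integral 0.\<close>
  have "AE s in lborel. indicator {s. 0 \<le> e * w s} s * (e * w s) = 0" for e :: real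
  proof -
    have I: "integrable lborel (\<lambda>s. indicator {s. 0 \<le> e * w s} s * (e * w s))"
      using w by (intro integrable_real_mult_indicator [where f = "\<lambda>s. e * w s", simplified mult.commute]
          integrable_mult_right) auto
    have "(\<integral>s. indicator {s. 0 \<le> e * w s} s * (e * w s) \<partial>lborel) = e * (LINT s:{s. 0 \<le> e * w s}|lborel. w s)"
      unfolding set_lebesgue_integral_def
      by (subst integral_mult_right_zero [symmetric]) (simp add: ac_simps)
    also have "\<dots> = 0" by (subst P) auto
    finally show ?thesis
      by (subst (asm) integral_nonneg_eq_0_iff_AE [OF I]) (auto simp: indicator_def)
  qed
  from this [of 1] this [of "-1"] show ?thesis
    by eventually_elim (auto simp: indicator_def split: if_splits)
qed

definition frac_integral :: "real \<Rightarrow> (real \<Rightarrow> real) \<Rightarrow> real \<Rightarrow> real" where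
  "frac_integral a w t = (\<integral>s. rl_kernel a (t - s) * w s \<partial>lborel)"

text \<open>For \<open>a + b \<ge> 1\<close> the composed kernel is bounded, so no further integrability is needed.\<close>

lemma frac_integral_compose:
  assumes ab: "0 < a" "0 < b" "1 \<le> a + b"
    and w: "integrable lborel w" and w0: "\<And>s. s \<le> 0 \<Longrightarrow> w s = 0"
  shows "integrable lborel (\<lambda>r. rl_kernel a (t - r) * frac_integral b w r)"
    and "frac_integral a (frac_integral b w) t = Beta a b * frac_integral (a + b) w t"
    and "integrable lborel (\<lambda>s. rl_kernel (a + b) (t - s) * w s)"
proof -
  have [measurable]: "w \<in> borel_measurable borel" using w by auto
  let ?K = "\<lambda>r s. rl_kernel a (t - r) * rl_kernel b (r - s)"
  show int: "integrable lborel (\<lambda>s. rl_kernel (a + b) (t - s) * w s)"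
  proof (rule Bochner_Integration.integrable_bound)
    show "integrable lborel (\<lambda>s. (\<bar>t\<bar> powr (a + b - 1)) * w s)"
      using w by simp
    have "\<bar>rl_kernel (a + b) (t - s) * w s\<bar> \<le> \<bar>t\<bar> powr (a + b - 1) * \<bar>w s\<bar>" for s
    proof (cases "0 < s")
      case True
      have "rl_kernel (a + b) (t - s) \<le> \<bar>t\<bar> powr (a + b - 1)"
        using ab True by (auto simp: rl_kernel_def intro!: powr_mono2)
      then show ?thesis by (simp add: abs_mult mult_right_mono)
    qed (simp add: w0)
    then show "AE s in lborel. norm (rl_kernel (a + b) (t - s) * w s) \<le> norm (\<bar>t\<bar> powr (a + b - 1) * w s)"
      by (auto simp: abs_mult)
  qed measurable
  have m: "case_prod ?K \<in> borel_measurable (lborel \<Otimes>\<^sub>M lborel)" by measurable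
  have int2: "integrable lborel (\<lambda>s. (\<integral>r. ?K r s \<partial>lborel) * w s)"
    using int by (simp add: integral_rl_kernel [OF ab(1,2)] mult.assoc)
  note F = Fubini_kernel [OF m _ _ integrable_rl_kernel [OF ab(1,2)] int2]
  have e: "(\<integral>s. ?K r s * w s \<partial>lborel) = rl_kernel a (t - r) * frac_integral b w r" for r
    by (simp add: frac_integral_def mult.assoc)
  show "integrable lborel (\<lambda>r. rl_kernel a (t - r) * frac_integral b w r)"
    using F(1) by (simp add: e)
  show "frac_integral a (frac_integral b w) t = Beta a b * frac_integral (a + b) w t"
    using F(2) unfolding e
    by (simp add: frac_integral_def [of a] frac_integral_def [of "a + b"] integral_rl_kernel [OF ab(1,2)] mult.assoc)
qed

lemma frac_path_eq_frac_integral: "frac_path a u t = frac_integral (1 + a) (\<lambda>s. rl_kernel (1 - a) s * u s) t"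
  by (simp add: frac_path_def frac_integral_def weighted_kernel_def mult.assoc)

lemma integrable_weighted:
  assumes a: "a < 1/2" and u: "sq_integrable u" and u0: "\<And>s. s \<notin> {0<..<T} \<Longrightarrow> u s = 0"
  shows "integrable lborel (\<lambda>s. rl_kernel (1 - a) s * u s)"
proof (cases "0 \<le> T")
  case True
  have [measurable]: "u \<in> borel_measurable borel" using u by auto
  have "integrable lborel (\<lambda>s. (indicator {..<T} s * rl_kernel (1 - a) s)\<^sup>2)"
  proof -
    have "(\<lambda>s. (indicator {..<T} s * rl_kernel (1 - a) s)\<^sup>2) = (\<lambda>s. indicator {..<T} s * rl_kernel (1 - 2 * a) s)"
      by (auto simp: indicator_def power2_eq_square rl_kernel_mult algebra_simps)
    then show ?thesis
      using has_bochner_integral_indicator_rl_kernel [of "1 - 2 * a" T] a True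
      by (auto intro: integrable.intros)
  qed
  then have "integrable lborel (\<lambda>s. indicator {..<T} s * rl_kernel (1 - a) s * u s)"
    by (intro integrable_square_mult u) measurable
  moreover have "(\<lambda>s. indicator {..<T} s * rl_kernel (1 - a) s * u s) = (\<lambda>s. rl_kernel (1 - a) s * u s)"
  proof
    fix s show "indicator {..<T} s * rl_kernel (1 - a) s * u s = rl_kernel (1 - a) s * u s"
      using u0 [of s] by (cases "s \<in> {0<..<T}") auto
  qed
  ultimately show ?thesis by simp
next
  case False
  then show ?thesis using u0 by simp
qed

text \<open>Order two is the double primitive. Differentiating once shows that the primitive
  \<open>W\<close> vanishes on \<open>(0, T)\<close>, and the integrals over half-lines determine
  \<open>w\<close> almost everywhere.\<close>

lemma AE_eq_0_of_frac_integral_2: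
  assumes w: "integrable lborel w" and w0: "\<And>s. s \<notin> {0<..<T} \<Longrightarrow> w s = 0"
    and z: "\<And>t. t \<in> {0..T} \<Longrightarrow> frac_integral 2 w t = 0"
  shows "AE s in lborel. w s = 0"
proof (cases "0 < T")
  case False
  then show ?thesis using w0 by auto
next
  case T: True
  have wi: "w integrable_on {0..t}" for t
    using integrable_on_subinterval [of w UNIV 0 t] has_integral_integral_lborel [OF w]
    by (auto simp: integrable_on_def [symmetric] has_integral_integrable)
  define W where "W t = integral {0..t} w" for t
  have W: "W t = (\<integral>s. indicator {..<t} s * w s \<partial>lborel)" for t
  proof -
    have AE: "AE s in lborel. indicator {0..t} s *\<^sub>R w s = indicator {..<t} s * w s"
      using AE_lborel_singleton [of t] by eventually_elim (use w0 in \<open>auto simp: indicator_def\<close>)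
    have I: "set_integrable lborel {0..t} w"
      unfolding set_integrable_def by (rule integrable_mult_indicator) (use w in auto)
    have "W t = (LINT s:{0..t}|lborel. w s)"
      using set_borel_integral_eq_integral [OF I] by (simp add: W_def)
    also have "\<dots> = (\<integral>s. indicator {..<t} s * w s \<partial>lborel)"
      unfolding set_lebesgue_integral_def by (rule integral_cong_AE [OF _ _ AE]) (use w in auto)
    finally show ?thesis .
  qed
  have W': "W t = frac_integral 1 w t" for t
    unfolding W frac_integral_def by (simp add: rl_kernel_1 indicator_def)
  have cW: "continuous_on {0..t} W" for t
    unfolding W_def by (rule indefinite_integral_continuous_1 [OF wi])
  have iW: "integral {0..t} W = 0" if t: "t \<in> {0..T}" for t
  proof -
    have w0': "\<And>s. s \<le> 0 \<Longrightarrow> w s = 0" using w0 by auto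
    note c = frac_integral_compose [of 1 1, OF _ _ _ w w0', simplified]
    have nz: "0 < x" if "w x \<noteq> 0" for x using w0 [of x] that by (cases "0 < x") auto
    have AE: "AE r in lborel. indicator {0..t} r *\<^sub>R W r = rl_kernel 1 (t - r) * frac_integral 1 w r"
      using AE_lborel_singleton [of t]
      by eventually_elim (auto simp: indicator_def W' rl_kernel_1 frac_integral_def w0' not_less
          intro!: integral_eq_zero_AE AE_I2 dest!: nz)
    have "set_integrable lborel {0..t} W" by (rule borel_integrable_atLeastAtMost') (rule cW)
    then have "integral {0..t} W = (\<integral>r. indicator {0..t} r *\<^sub>R W r \<partial>lborel)"
      by (simp add: set_borel_integral_eq_integral(2) [symmetric] set_lebesgue_integral_def)
    also have "\<dots> = frac_integral 1 (frac_integral 1 w) t"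
      unfolding frac_integral_def [of 1 "frac_integral 1 w"]
      by (rule integral_cong_AE [OF _ _ AE])
        (use c(1) \<open>set_integrable lborel {0..t} W\<close> in \<open>auto simp: set_integrable_def\<close>)
    also have "\<dots> = 0" using c(2) z [OF t] by (simp add: one_add_one)
    finally show ?thesis .
  qed
  have W0: "W t = 0" if t: "t \<in> {0<..<T}" for t
  proof -
    have "((\<lambda>u. integral {0..u} W) has_real_derivative W t) (at t within {0..T})"
      using integral_has_vector_derivative [OF cW, of t] t
      by (auto simp: has_real_derivative_iff_has_vector_derivative)
    then have 1: "((\<lambda>u. integral {0..u} W) has_real_derivative W t) (at t)"
      using t at_within_interior [of t "{0..T}"] by (simp add: interior_atLeastAtMost_real)
    have "((\<lambda>u. integral {0..u} W) has_real_derivative 0) (at t)"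
      by (rule has_field_derivative_transform_within_open [where S = "{0<..<T}" and f = "\<lambda>_. 0"])
        (use t iW in auto)
    with 1 show ?thesis by (rule DERIV_unique)
  qed
  have WT: "W T = 0"
  proof -
    have "continuous_on (closure {0<..<T}) W" using cW [of T] T by simp
    from continuous_constant_on_closure [OF this, of 0] W0 T show ?thesis by simp
  qed
  \<comment> \<open>The measure-theoretic lemma quantifies over all half-lines; the support of
    \<open>w\<close> extends the vanishing of \<open>W\<close> beyond \<open>[0, T]\<close>.\<close>
  have Wz: "W t = 0" for t
  proof -
    consider "t \<le> 0" | "t \<in> {0<..<T}" | "T \<le> t" by fastforce
    then show ?thesis
    proof cases
      case 1
      then have "(\<lambda>s. indicator {..<t} s * w s) = (\<lambda>s. 0)" using w0 by (auto simp: indicator_def)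
      then show ?thesis unfolding W by simp
    next
      case 3
      then have "(\<lambda>s. indicator {..<t} s * w s) = (\<lambda>s. indicator {..<T} s * w s)"
        using w0 by (auto simp: indicator_def)
      then show ?thesis using WT unfolding W by simp
    qed (rule W0)
  qed
  show ?thesis
  proof (rule AE_eq_0_of_integral_lessThan [OF w])
    show "(\<integral>s. indicator {..<t} s * w s \<partial>lborel) = 0" for t using Wz W by metis
    have "(\<lambda>s. indicator {..<T} s * w s) = w"
    proof
      fix s show "indicator {..<T} s * w s = w s"
        using w0 [of s] by (cases "s \<in> {0<..<T}") auto
    qed
    then show "(\<integral>s. w s \<partial>lborel) = 0" using WT unfolding W by simp
  qed
qed

lemma Beta_neq_0: "0 < a \<Longrightarrow> 0 < b \<Longrightarrow> Beta a b \<noteq> (0::real)"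
  by (simp add: Beta_def Gamma_real_pos [THEN less_imp_neq, symmetric])

text \<open>Abel inversion by the complementary order: composing order \<open>1 + a\<close> with
  order \<open>1 - a\<close> gives order two for either sign of \<open>a\<close>, so no fractional
  derivative has to be taken.\<close>

lemma K_scalar_inj:
  assumes H: "0 < H" "H < 1" and c: "c_H H \<noteq> 0" and u: "sq_integrable u"
    and u0: "\<And>s. s \<notin> {0<..<T} \<Longrightarrow> u s = 0"
    and z: "\<And>t. t \<in> {0..T} \<Longrightarrow> K_scalar H u t = 0"
  shows "AE s in lborel. u s = 0"
proof -
  define a where "a = H - 1/2"
  have a: "\<bar>a\<bar> < 1/2" using H by (auto simp: a_def abs_if)
  define w where "w s = rl_kernel (1 - a) s * u s" for s
  have w: "integrable lborel w"
    using integrable_weighted [OF _ u u0, of a] a by (simp add: w_def [abs_def])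
  have w0: "w s = 0" if "s \<notin> {0<..<T}" for s using u0 [OF that] by (simp add: w_def)
  have p: "frac_integral (1 + a) w t = 0" if "t \<le> T" for t
  proof (cases "0 \<le> t")
    case True
    then show ?thesis
      using frac_path_eq_0 [OF H c u z, of T t] that
      by (simp add: frac_path_eq_frac_integral a_def w_def [abs_def])
  next
    case False
    then show ?thesis
      using frac_path_0 [of t a u] by (simp add: frac_path_eq_frac_integral w_def [abs_def])
  qed
  have "frac_integral 2 w t = 0" if t: "t \<in> {0..T}" for t
  proof -
    have "(\<lambda>r. rl_kernel (1 - a) (t - r) * frac_integral (1 + a) w r) = (\<lambda>r. 0)"
      using p t by (auto simp: rl_kernel_def)
    then have "frac_integral (1 - a) (frac_integral (1 + a) w) t = 0"
      by (simp add: frac_integral_def [of "1 - a"])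
    moreover have "frac_integral (1 - a) (frac_integral (1 + a) w) t = Beta (1 - a) (1 + a) * frac_integral 2 w t"
      using frac_integral_compose(2) [of "1 - a" "1 + a" w t] a w w0 by simp
    ultimately show ?thesis using Beta_neq_0 [of "1 - a" "1 + a"] a by simp
  qed
  then have "AE s in lborel. w s = 0"
    by (intro AE_eq_0_of_frac_integral_2 [OF w w0])
  then show ?thesis
  proof eventually_elim
    case (elim s)
    then show ?case using u0 [of s] by (cases "0 < s") (auto simp: w_def rl_kernel_def)
  qed
qed

subsection \<open>Preimages of absolutely continuous paths\<close>

text \<open>The datum of the Abel equation: the fractional path \<open>p\<close> of a preimage must
  satisfy \<open>p' s = s powr - a * f s\<close>, because \<open>s powr a * p' s\<close> is the
  derivative of the kernel operator up to \<open>c_H H\<close>.\<close>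

definition weighted_path :: "real \<Rightarrow> real \<Rightarrow> (real \<Rightarrow> real) \<Rightarrow> real \<Rightarrow> real" where
  "weighted_path a T f s = (if s \<in> {0..T} then rl_kernel (1 - a) s * f s else 0)"

lemma weighted_path_measurable [measurable]:
  assumes "continuous_on {0..T} f"
  shows "weighted_path a T f \<in> borel_measurable borel"
proof -
  have "(\<lambda>s. if s \<in> {0..T} then f s else 0) \<in> borel_measurable borel"
    by (rule borel_measurable_continuous_on_if) (use assms in auto)
  then have "(\<lambda>s. rl_kernel (1 - a) s * (if s \<in> {0..T} then f s else 0)) \<in> borel_measurable borel"
    by measurable
  also have "(\<lambda>s. rl_kernel (1 - a) s * (if s \<in> {0..T} then f s else 0)) = weighted_path a T f"
    by (auto simp: weighted_path_def)
  finally show ?thesis .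
qed

lemma weighted_path_nonpos: "s \<le> 0 \<Longrightarrow> weighted_path a T f s = 0"
  by (simp add: weighted_path_def rl_kernel_nonpos)

lemma weighted_path_bound:
  assumes "\<And>r. r \<in> {0..s} \<Longrightarrow> \<bar>f r\<bar> \<le> N" "r \<le> s"
  shows "\<bar>weighted_path a T f r\<bar> \<le> N * rl_kernel (1 - a) r"
proof (cases "0 < r")
  case True
  have f: "\<bar>f r\<bar> \<le> N" using assms True by simp
  have "rl_kernel (1 - a) r * \<bar>f r\<bar> \<le> rl_kernel (1 - a) r * N"
    by (intro mult_left_mono f) simp
  moreover have "0 \<le> N * rl_kernel (1 - a) r" using f by simp
  ultimately show ?thesis by (simp add: weighted_path_def abs_mult mult.commute)
qed (simp add: weighted_path_nonpos rl_kernel_nonpos)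

lemma integrable_weighted_path:
  assumes a: "a < 1" and T: "0 \<le> T" and f: "continuous_on {0..T} f"
  shows "integrable lborel (weighted_path a T f)"
proof -
  have "bounded (f ` {0..T})" by (intro compact_imp_bounded compact_continuous_image f) auto
  then obtain N where "\<forall>x\<in>f ` {0..T}. norm x \<le> N" unfolding bounded_iff by blast
  then have N: "\<And>r. r \<in> {0..T} \<Longrightarrow> \<bar>f r\<bar> \<le> N" by simp
  have le: "\<bar>weighted_path a T f r\<bar> \<le> N * (indicator {..<T} r * rl_kernel (1 - a) r)" if "r \<noteq> T" for r
  proof (cases "r < T")
    case True
    then show ?thesis using weighted_path_bound [where a = a and T = T, OF N, of r] by simp
  next
    case False
    then show ?thesis using that by (simp add: weighted_path_def)
  qed
  show ?thesis
  proof (rule Bochner_Integration.integrable_bound)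
    show "integrable lborel (\<lambda>r. N * (indicator {..<T} r * rl_kernel (1 - a) r))"
      using has_bochner_integral_indicator_rl_kernel [of "1 - a" T] a T
      by (auto intro: integrable.intros)
    show "AE r in lborel. norm (weighted_path a T f r) \<le> norm (N * (indicator {..<T} r * rl_kernel (1 - a) r))"
      using AE_lborel_singleton [of T] by eventually_elim (use order_trans [OF le abs_ge_self] in auto)
  qed (use f in measurable)
qed

lemma weighted_primitive_eq_frac_integral:
  assumes a: "a < 1" and f: "continuous_on {0..T} f" and t: "t \<in> {0..T}"
  shows "(\<lambda>r. r powr (1 - a - 1) * f r) integrable_on {0..t}"
    and "weighted_primitive (1 - a) f t = frac_integral 1 (weighted_path a T f) t"
proof -
  let ?g = "\<lambda>r. r powr (1 - a - 1) * f r"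
  have W: "integrable lborel (weighted_path a T f)" using integrable_weighted_path [OF a _ f] t by simp
  have [measurable]: "weighted_path a T f \<in> borel_measurable borel" using f by measurable
  have e: "(\<lambda>r. indicator {0..t} r *\<^sub>R ?g r) = (\<lambda>r. indicator {0..t} r * weighted_path a T f r)"
    using t by (auto simp: indicator_def weighted_path_def rl_kernel_def)
  have I: "set_integrable lborel {0..t} ?g"
    unfolding set_integrable_def e by (rule integrable_real_mult_indicator [where f = "weighted_path a T f",
        simplified mult.commute]) (use W in auto)
  show "?g integrable_on {0..t}" using set_borel_integral_eq_integral(1) [OF I] .
  have "weighted_primitive (1 - a) f t = (\<integral>r. indicator {0..t} r * weighted_path a T f r \<partial>lborel)"
    using set_borel_integral_eq_integral(2) [OF I]
    by (simp only: weighted_primitive_def set_lebesgue_integral_def e)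
  also have "\<dots> = frac_integral 1 (weighted_path a T f) t"
    unfolding frac_integral_def
  proof (rule integral_cong_AE)
    show "AE r in lborel. indicator {0..t} r * weighted_path a T f r = rl_kernel 1 (t - r) * weighted_path a T f r"
      using AE_lborel_singleton [of t]
      by eventually_elim (use t in \<open>auto simp: indicator_def rl_kernel_1 weighted_path_def\<close>)
  qed measurable
  finally show "weighted_primitive (1 - a) f t = frac_integral 1 (weighted_path a T f) t" .
qed

text \<open>If \<open>p\<close> is a primitive of \<open>s powr - a * f s\<close>, then in the
  derivative of \<open>t powr a * p t\<close> minus \<open>a\<close> times its weighted primitive
  the two terms with \<open>p\<close> cancel and \<open>f\<close> remains. The order
  \<open>1 - a\<close> of \<open>weighted_primitive\<close> stands for the exponent
  \<open>- a\<close>.\<close>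

lemma K_scalar_of_frac_path:
  assumes H: "0 < H" "H < 1" and v: "sq_integrable v" and f: "continuous_on {0..T} f"
    and p: "\<And>t. t \<in> {0..T} \<Longrightarrow> frac_path (H - 1/2) v t = weighted_primitive (1 - (H - 1/2)) f t"
    and t: "t \<in> {0..T}"
  shows "K_scalar H v t = c_H H * integral {0..t} f"
proof (cases "0 < t")
  case False
  then have "t = 0" using t by simp
  then show ?thesis by (simp add: K_scalar_eq_primitive [OF H v] frac_path_0 weighted_primitive_def)
next
  case True
  define a where "a = H - 1/2"
  have a: "\<bar>a\<bar> < 1/2" using H by (auto simp: a_def abs_if)
  define p where "p = frac_path a v"
  have pe: "p s = weighted_primitive (1 - a) f s" if "s \<in> {0..T}" for s
    using p [OF that] by (simp add: p_def a_def)
  have pc: "continuous_on {0..T} p" unfolding p_def by (rule continuous_on_frac_path [OF a v])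
  have Sint: "(\<lambda>r. r powr (a - 1) * p r) integrable_on {0..s}" for s
    using weighted_frac_path_integrable_on(1) [OF a v] by (simp add: p_def)
  define G where "G s = s powr a * p s - a * weighted_primitive a p s - integral {0..s} f" for s
  have fint: "f integrable_on {0..T}" by (rule integrable_continuous_interval [OF f])
  have cG: "continuous_on {0..T} G"
    unfolding G_def
    using continuous_on_powr_frac_path [OF a v, of T] indefinite_integral_continuous_1 [OF Sint, of T]
      indefinite_integral_continuous_1 [OF fint]
    by (intro continuous_on_diff continuous_on_mult_left) (auto simp: p_def weighted_primitive_def)
  have dG: "(G has_real_derivative 0) (at s)" if s: "s \<in> {0<..<T}" for s
  proof -
    have "(weighted_primitive (1 - a) f has_real_derivative s powr (1 - a - 1) * f s) (at s)"
      by (rule weighted_primitive_has_real_derivative)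
        (use a f s weighted_primitive_eq_frac_integral(1) [of a T f T] in auto)
    then have dp: "(p has_real_derivative s powr (1 - a - 1) * f s) (at s)"
      by (rule has_field_derivative_transform_within_open [where S = "{0<..<T}"]) (use s pe in auto)
    have df: "((\<lambda>u. integral {0..u} f) has_real_derivative f s) (at s)"
      using integral_has_vector_derivative [OF f, of s] s at_within_interior [of s "{0..T}"]
      by (simp add: has_real_derivative_iff_has_vector_derivative interior_atLeastAtMost_real)
    have dS: "(weighted_primitive a p has_real_derivative s powr (a - 1) * p s) (at s)"
      by (rule weighted_primitive_has_real_derivative [OF Sint pc]) (use s in auto)
    have "(G has_real_derivative (a * s powr (a - 1) * p s + s powr (1 - a - 1) * f s * s powr a
        - a * (s powr (a - 1) * p s) - f s)) (at s)"
      unfolding G_def using s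
      by (intro DERIV_diff DERIV_cmult df dS DERIV_mult dp)
        (auto intro!: derivative_eq_intros)
    also have "a * s powr (a - 1) * p s + s powr (1 - a - 1) * f s * s powr a
        - a * (s powr (a - 1) * p s) - f s = 0"
      using s by (simp add: powr_minus)
    finally show ?thesis .
  qed
  have "G t = G 0"
  proof (rule DERIV_isconst_end [OF True])
    show "continuous_on {0..t} G" by (rule continuous_on_subset [OF cG]) (use t in auto)
    show "(G has_real_derivative 0) (at x)" if "0 < x" "x < t" for x
      using that t by (intro dG) auto
  qed
  then have "G t = 0" by (simp add: G_def weighted_primitive_def)
  then show ?thesis
    by (simp add: K_scalar_eq_primitive [OF H v] G_def a_def p_def)
qed

text \<open>
  The preimage is \<open>v s = s powr a * w s\<close> up to a constant, where \<open>w\<close> solves an Abel equation.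
\<close>

lemma preimage_of_Abel_solution:
  assumes H: "0 < H" "H < 1" and c: "c_H H \<noteq> 0" and T: "0 < T" and f: "continuous_on {0..T} f"
    and w [measurable]: "w \<in> borel_measurable borel" and w0: "\<And>s. s \<le> 0 \<Longrightarrow> w s = 0"
    and Abel: "\<And>t. t \<in> {0..T} \<Longrightarrow>
      frac_integral (1 + (H - 1/2)) w t = frac_integral 1 (weighted_path (H - 1/2) T f) t"
    and bound: "\<And>s N. s \<in> {0<..T} \<Longrightarrow> P s N \<Longrightarrow> \<bar>w s\<bar> \<le> C * N * s powr (- 2 * (H - 1/2))"
    and P: "\<And>s. s \<in> {0<..T} \<Longrightarrow> P s N0"
  obtains v where "sq_integrable v" "\<And>s. s \<notin> {0<..<T} \<Longrightarrow> v s = 0"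
    "\<And>t. t \<in> {0..T} \<Longrightarrow> K_scalar H v t = integral {0..t} f"
    "\<And>s N. s \<in> {0<..T} \<Longrightarrow> P s N \<Longrightarrow> \<bar>v s\<bar> \<le> C / \<bar>c_H H\<bar> * N * s powr - (H - 1/2)"
proof -
  define a where "a = H - 1/2"
  have a: "\<bar>a\<bar> < 1/2" using H by (auto simp: a_def abs_if)
  \<comment> \<open>The power undoes the weight inside \<open>frac_path\<close>. Cutting off outside
    \<open>(0, T)\<close> leaves \<open>frac_path\<close> unchanged up to time \<open>T\<close>,
    since its kernel at time \<open>t\<close> lives on \<open>(0, t)\<close>.\<close>
  define v where "v s = indicator {0<..<T} s * (s powr a * w s)" for s
  have vm [measurable]: "v \<in> borel_measurable borel" unfolding v_def by measurable
  have vb: "\<bar>v s\<bar> \<le> C * N * s powr - a" if "s \<in> {0<..T}" "P s N" for s N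
  proof -
    have "\<bar>v s\<bar> \<le> s powr a * \<bar>w s\<bar>" by (auto simp: v_def abs_mult indicator_def)
    also have "\<dots> \<le> s powr a * (C * N * s powr (- 2 * a))"
      using bound [OF that] by (intro mult_left_mono) (auto simp: a_def)
    also have "\<dots> = C * N * (s powr a * s powr (- 2 * a))" by simp
    also have "s powr a * s powr (- 2 * a) = s powr - a" by (simp add: powr_add [symmetric])
    finally show ?thesis .
  qed
  have vsq: "sq_integrable v"
    unfolding sq_integrable_def
  proof (rule conjI [OF vm Bochner_Integration.integrable_bound])
    show "integrable lborel (\<lambda>s. (C * N0)\<^sup>2 * (indicator {..<T} s * rl_kernel (1 - 2 * a) s))"
      by (intro integrable_mult_right integrable.intros [OF has_bochner_integral_indicator_rl_kernel])
        (use a T in auto)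
    have "(v s)\<^sup>2 \<le> (C * N0)\<^sup>2 * (indicator {..<T} s * rl_kernel (1 - 2 * a) s)" for s
    proof (cases "s \<in> {0<..<T}")
      case True
      then have "\<bar>v s\<bar>\<^sup>2 \<le> (C * N0 * s powr - a)\<^sup>2"
        by (intro power_mono vb P) auto
      also have "\<dots> = (C * N0)\<^sup>2 * (s powr - a * s powr - a)" by (simp add: power2_eq_square)
      also have "s powr - a * s powr - a = s powr (- 2 * a)" by (simp add: powr_add [symmetric])
      finally show ?thesis using True by (simp add: rl_kernel_def)
    qed (simp add: v_def)
    then show "AE s in lborel. norm ((v s)\<^sup>2) \<le> norm ((C * N0)\<^sup>2 * (indicator {..<T} s * rl_kernel (1 - 2 * a) s))"
      by (intro AE_I2) (simp add: order_trans [OF _ abs_ge_self])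
  qed measurable
  \<comment> \<open>Dividing removes the constant in front of the kernel operator, and the bound
    changes accordingly.\<close>
  let ?v = "\<lambda>s. v s / c_H H"
  have v: "sq_integrable ?v" using vsq by (auto simp: sq_integrable_def power_divide)
  have fp: "frac_path a v t = weighted_primitive (1 - a) f t" if t: "t \<in> {0..T}" for t
  proof -
    have "frac_path a v t = frac_integral (1 + a) w t"
      unfolding frac_path_eq_frac_integral frac_integral_def
    proof (intro Bochner_Integration.integral_cong refl)
      fix s
      show "rl_kernel (1 + a) (t - s) * (rl_kernel (1 - a) s * v s) = rl_kernel (1 + a) (t - s) * w s"
        using t by (cases "0 < s \<and> s < t")
          (auto simp: v_def rl_kernel_def w0 indicator_def mult.assoc [symmetric] powr_add [symmetric])
    qed
    also have "\<dots> = frac_integral 1 (weighted_path a T f) t"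
      using Abel [OF t] by (simp add: a_def)
    also have "\<dots> = weighted_primitive (1 - a) f t"
      by (rule weighted_primitive_eq_frac_integral(2) [symmetric]) (use a f t in auto)
    finally show ?thesis .
  qed
  have K: "K_scalar H ?v t = integral {0..t} f" if "t \<in> {0..T}" for t
  proof -
    have "K_scalar H v t = c_H H * integral {0..t} f"
      by (rule K_scalar_of_frac_path [OF H vsq f _ that]) (use fp in \<open>simp add: a_def\<close>)
    then show ?thesis using c by (simp add: K_scalar_def)
  qed
  show ?thesis
  proof (rule that [of ?v])
    show "\<bar>v s / c_H H\<bar> \<le> C / \<bar>c_H H\<bar> * N * s powr - (H - 1/2)" if "s \<in> {0<..T}" "P s N" for s N
      using vb [OF that] c by (simp add: a_def [symmetric] divide_right_mono)
  qed (use v K in \<open>auto simp: v_def\<close>)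
qed

text \<open>For negative \<open>a\<close> the missing order \<open>- a\<close> is positive, so
  integrating the datum by that order solves the equation outright. Boundedness of \<open>f\<close>
  then suffices for the estimate, which is a Beta integral of two powers.\<close>

lemma Abel_solution_neg:
  assumes a: "- 1/2 < a" "a < 0" and T: "0 < T" and f: "continuous_on {0..T} f"
  defines "w \<equiv> \<lambda>s. frac_integral (- a) (weighted_path a T f) s / Beta (1 + a) (- a)"
  shows "w \<in> borel_measurable borel" "\<And>s. s \<le> 0 \<Longrightarrow> w s = 0"
    "\<And>t. frac_integral (1 + a) w t = frac_integral 1 (weighted_path a T f) t"
    "\<And>s N. 0 < s \<Longrightarrow> (\<And>r. r \<in> {0..s} \<Longrightarrow> \<bar>f r\<bar> \<le> N) \<Longrightarrow>
      \<bar>w s\<bar> \<le> Beta (- a) (1 - a) / Beta (1 + a) (- a) * N * s powr (- 2 * a)"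
proof -
  have [measurable]: "weighted_path a T f \<in> borel_measurable borel" using f by measurable
  show "w \<in> borel_measurable borel" unfolding w_def frac_integral_def by measurable
  show "w s = 0" if "s \<le> 0" for s
  proof -
    have "(\<lambda>r. rl_kernel (- a) (s - r) * weighted_path a T f r) = (\<lambda>r. 0)"
      using that by (auto simp: rl_kernel_def weighted_path_nonpos)
    then show ?thesis by (simp add: w_def frac_integral_def)
  qed
  have W: "integrable lborel (weighted_path a T f)" by (rule integrable_weighted_path) (use a T f in auto)
  have B: "0 < Beta (1 + a) (- a)"
    using a by (auto simp: Beta_def intro!: divide_pos_pos mult_pos_pos Gamma_real_pos)
  show "frac_integral (1 + a) w t = frac_integral 1 (weighted_path a T f) t" for t
    using frac_integral_compose(2) [of "1 + a" "- a" "weighted_path a T f" t] a W B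
    by (simp add: weighted_path_nonpos w_def frac_integral_def [of "1 + a"])
  fix s :: real and N assume s: "0 < s" and N: "\<And>r. r \<in> {0..s} \<Longrightarrow> \<bar>f r\<bar> \<le> N"
  have h: "has_bochner_integral lborel (\<lambda>r. N * (rl_kernel (- a) (s - r) * rl_kernel (1 - a) (r - 0)))
      (N * (Beta (- a) (1 - a) * rl_kernel (- a + (1 - a)) (s - 0)))"
    by (intro has_bochner_integral_mult_right has_bochner_integral_rl_kernel) (use a in auto)
  have le: "\<bar>rl_kernel (- a) (s - r) * weighted_path a T f r\<bar> \<le> N * (rl_kernel (- a) (s - r) * rl_kernel (1 - a) (r - 0))" for r
  proof (cases "r \<le> s")
    case True
    then show ?thesis
      using weighted_path_bound [where a = a and T = T, OF N True]
      by (simp add: abs_mult mult.left_commute [of N] mult_left_mono)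
  qed (simp add: rl_kernel_nonpos)
  have "\<bar>frac_integral (- a) (weighted_path a T f) s\<bar> \<le> (\<integral>r. \<bar>rl_kernel (- a) (s - r) * weighted_path a T f r\<bar> \<partial>lborel)"
    unfolding frac_integral_def
    using integral_norm_bound [of lborel "\<lambda>r. rl_kernel (- a) (s - r) * weighted_path a T f r"] by simp
  also have "\<dots> \<le> N * (Beta (- a) (1 - a) * rl_kernel (- a + (1 - a)) (s - 0))"
    unfolding has_bochner_integral_integral_eq [OF h, symmetric]
    by (rule integral_mono' [OF integrable.intros [OF h] le]) (use order_trans [OF abs_ge_zero le] in auto)
  also have "\<dots> = Beta (- a) (1 - a) * N * s powr (- 2 * a)"
    using s by (simp add: rl_kernel_def)
  finally show "\<bar>w s\<bar> \<le> Beta (- a) (1 - a) / Beta (1 + a) (- a) * N * s powr (- 2 * a)"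
    using B unfolding w_def by (simp add: abs_divide divide_right_mono)
qed

section \<open>Abel's equation for positive \<open>a\<close>: the Marchaud derivative\<close>

definition truncated_mass :: "real \<Rightarrow> real \<Rightarrow> real \<Rightarrow> real" where
  "truncated_mass a \<epsilon> L = (if \<epsilon> < L then \<epsilon> powr - a - L powr - a else 0)"

lemma has_bochner_integral_truncated:
  assumes e: "0 < \<epsilon>"
  shows "has_bochner_integral lborel (\<lambda>x. indicator {\<epsilon><..<L} x * (a * rl_kernel (- a) x)) (truncated_mass a \<epsilon> L)"
proof (cases "\<epsilon> < L")
  case False
  then show ?thesis by (auto simp: truncated_mass_def has_bochner_integral_zero)
next
  case True
  have h: "has_bochner_integral lborel (\<lambda>x. indicator {\<epsilon>..L} x *\<^sub>R (a * x powr (- a - 1)))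
      (- (L powr - a) - - (\<epsilon> powr - a))"
  proof (rule has_bochner_integral_FTC_Icc)
    fix x assume x: "\<epsilon> \<le> x" "x \<le> L"
    then have "((\<lambda>x. - (x powr - a)) has_real_derivative a * x powr (- a - 1)) (at x within {\<epsilon>..L})"
      using e by (auto intro!: derivative_eq_intros)
    then show "((\<lambda>x. - (x powr - a)) has_vector_derivative a * x powr (- a - 1)) (at x within {\<epsilon>..L})"
      by (simp add: has_real_derivative_iff_has_vector_derivative)
  next
    show "continuous_on {\<epsilon>..L} (\<lambda>x. a * x powr (- a - 1))"
      using e by (intro continuous_intros) auto
  qed (use True in auto)
  have "AE x in lborel. indicator {\<epsilon>..L} x *\<^sub>R (a * x powr (- a - 1))
      = indicator {\<epsilon><..<L} x * (a * rl_kernel (- a) x)"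
    using AE_lborel_singleton [of \<epsilon>] AE_lborel_singleton [of L]
    by eventually_elim (use e in \<open>auto simp: indicator_def rl_kernel_def\<close>)
  then show ?thesis
    using h True by (subst (asm) has_bochner_integral_cong_AE) (auto simp: truncated_mass_def)
qed

text \<open>Integrated over \<open>r\<close>, the truncated kernel sees the distance from
  \<open>s\<close> to the left end 0; integrated over \<open>s\<close>, as in the next lemma, it
  sees the distance from \<open>r\<close> to the right end \<open>t\<close>.\<close>

lemma has_bochner_integral_truncated_left:
  assumes "0 < \<epsilon>"
  shows "has_bochner_integral lborel
    (\<lambda>r. indicator {0<..} r * (indicator {\<epsilon><..} (s - r) * (a * rl_kernel (- a) (s - r)))) (truncated_mass a \<epsilon> s)"
proof -
  have "(\<lambda>r. indicator {\<epsilon><..<s} (s + - 1 * r) * (a * rl_kernel (- a) (s + - 1 * r)))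
      = (\<lambda>r. indicator {0<..} r * (indicator {\<epsilon><..} (s - r) * (a * rl_kernel (- a) (s - r))))"
    by (auto simp: indicator_def fun_eq_iff)
  then show ?thesis
    using has_bochner_integral_truncated [OF assms, of s a]
      lborel_has_bochner_integral_real_affine_iff [of "-1" "\<lambda>x. indicator {\<epsilon><..<s} x * (a * rl_kernel (- a) x)" _ s]
    by simp
qed

lemma has_bochner_integral_truncated_right:
  assumes "0 < \<epsilon>"
  shows "has_bochner_integral lborel
    (\<lambda>s. indicator {..<t} s * (indicator {\<epsilon><..} (s - r) * (a * rl_kernel (- a) (s - r)))) (truncated_mass a \<epsilon> (t - r))"
proof -
  have "(\<lambda>s. indicator {\<epsilon><..<t - r} (- r + 1 * s) * (a * rl_kernel (- a) (- r + 1 * s)))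
      = (\<lambda>s. indicator {..<t} s * (indicator {\<epsilon><..} (s - r) * (a * rl_kernel (- a) (s - r))))"
    by (auto simp: indicator_def fun_eq_iff)
  then show ?thesis
    using has_bochner_integral_truncated [OF assms, of "t - r" a]
      lborel_has_bochner_integral_real_affine_iff [of 1 "\<lambda>x. indicator {\<epsilon><..<t - r} x * (a * rl_kernel (- a) x)" _ "- r"]
    by simp
qed

text \<open>
  Marchaud's form of the fractional derivative. Truncating the kernel at distance \<open>\<epsilon>\<close> allows the two
  halves of \<open>F s - F r\<close> to be integrated separately; the terms \<open>\<epsilon> powr - a\<close>, which diverge
  individually, cancel in the limit.
\<close>

definition marchaud_integrand :: "real \<Rightarrow> (real \<Rightarrow> real) \<Rightarrow> real \<Rightarrow> real \<Rightarrow> real" where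
  "marchaud_integrand a F s r = indicator {0<..} r * (rl_kernel (- a) (s - r) * (F s - F r))"

definition marchaud :: "real \<Rightarrow> real \<Rightarrow> (real \<Rightarrow> real) \<Rightarrow> real \<Rightarrow> real" where
  "marchaud a T F s = indicator {0<..T} s *
     (rl_kernel (1 - a) s * F s + a * (\<integral>r. marchaud_integrand a F s r \<partial>lborel))"

text \<open>The bound is uniform in the truncation, as dominated convergence requires. The terms
  \<open>\<epsilon> powr - a\<close> either cancel or survive alone, and in the latter case
  \<open>\<epsilon>\<close> is at least one of the two lengths, so the term is below the power of
  that length.\<close>

lemma truncated_mass_diff_bound:
  assumes a: "0 < a" and e: "0 < \<epsilon>" and s: "0 < s" "s < t"
  shows "\<bar>truncated_mass a \<epsilon> s - truncated_mass a \<epsilon> (t - s)\<bar> \<le> s powr - a + (t - s) powr - a"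
proof -
  have 1: "x powr - a \<le> y powr - a" if "0 < y" "y \<le> x" for x y :: real
    using that a by (intro powr_mono2') auto
  define x y z where "x = s powr - a" and "y = (t - s) powr - a" and "z = \<epsilon> powr - a"
  have "0 \<le> x" "0 \<le> y" "0 \<le> z" by (simp_all add: x_def y_def z_def)
  moreover have "\<epsilon> < s \<Longrightarrow> x \<le> z" "\<not> \<epsilon> < s \<Longrightarrow> z \<le> x" "\<epsilon> < t - s \<Longrightarrow> y \<le> z" "\<not> \<epsilon> < t - s \<Longrightarrow> z \<le> y"
    using 1 e s unfolding x_def y_def z_def by auto
  ultimately show ?thesis
    unfolding truncated_mass_def x_def [symmetric] y_def [symmetric] z_def [symmetric]
    by (auto simp: abs_if)
qed

text \<open>After truncation the kernel is bounded, so the halves with \<open>F s\<close> and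
  \<open>F r\<close> can be integrated separately. The first yields
  \<open>truncated_mass a \<epsilon> s\<close> directly, the second yields
  \<open>truncated_mass a \<epsilon> (t - r)\<close> after Fubini, and renaming \<open>r\<close>
  merges them.\<close>

lemma integral_truncated_difference:
  assumes a: "0 < a" and e: "0 < \<epsilon>" and F: "integrable lborel F" and F0: "\<And>s. s \<le> 0 \<Longrightarrow> F s = 0"
  shows "(\<integral>s. (\<integral>r. indicator {..<t} s * (indicator {\<epsilon><..} (s - r) * (a * marchaud_integrand a F s r)) \<partial>lborel) \<partial>lborel)
    = (\<integral>s. indicator {..<t} s * (truncated_mass a \<epsilon> s - truncated_mass a \<epsilon> (t - s)) * F s \<partial>lborel)"
proof -
  have [measurable]: "F \<in> borel_measurable borel" using F by auto
  have [measurable]: "truncated_mass a \<epsilon> \<in> borel_measurable borel"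
    unfolding truncated_mass_def by measurable
  let ?k = "\<lambda>s r. indicator {\<epsilon><..} (s - r) * (a * rl_kernel (- a) (s - r))"
  let ?K = "\<lambda>s r. indicator {..<t} s * ?k s r"
  have kb: "\<bar>?k s r\<bar> \<le> a * \<epsilon> powr (- a - 1)" for s r
    using a e by (auto simp: indicator_def rl_kernel_def intro!: mult_left_mono powr_mono2')
  have tb: "\<bar>truncated_mass a \<epsilon> L\<bar> \<le> \<epsilon> powr - a" for L
  proof (cases "\<epsilon> < L")
    case True
    then have "L powr - a \<le> \<epsilon> powr - a" using a e by (intro powr_mono2') auto
    moreover have "0 \<le> L powr - a" by simp
    ultimately show ?thesis using True by (simp add: truncated_mass_def)
  qed (simp add: truncated_mass_def)
  have bI: "integrable lborel (\<lambda>s. g s * F s)" if g [measurable]: "g \<in> borel_measurable borel" and "\<And>s. \<bar>g s\<bar> \<le> B" for g B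
  proof (rule Bochner_Integration.integrable_bound)
    show "integrable lborel (\<lambda>s. B * F s)" using F by simp
    have "0 \<le> B" using that(2) [of 0] by linarith
    then show "AE s in lborel. norm (g s * F s) \<le> norm (B * F s)"
      using that(2) by (auto simp: abs_mult intro!: mult_right_mono)
  qed measurable
  have m: "case_prod ?K \<in> borel_measurable (lborel \<Otimes>\<^sub>M lborel)" by measurable
  have nonneg: "0 \<le> ?K s r" for s r using a by (simp add: indicator_def)
  note hR = has_bochner_integral_truncated_right [OF e, unfolded has_bochner_integral_iff]
  note hL = has_bochner_integral_truncated_left [OF e, unfolded has_bochner_integral_iff]
  have I2: "integrable lborel (\<lambda>r. (\<integral>s. ?K s r \<partial>lborel) * F r)"
  proof -
    have "integrable lborel (\<lambda>r. truncated_mass a \<epsilon> (t - r) * F r)" by (rule bI [OF _ tb]) measurable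
    then show ?thesis using hR by simp
  qed
  note Fub = Fubini_kernel [OF m _ nonneg hR [THEN conjunct1] I2]
  \<comment> \<open>Since \<open>F r = 0\<close> for \<open>r \<le> 0\<close>, the restriction to
    positive \<open>r\<close> may be dropped in the half containing \<open>F r\<close>, while the
    half containing \<open>F s\<close> keeps it.\<close>
  have "indicator {..<t} s * (indicator {\<epsilon><..} (s - r) * (a * marchaud_integrand a F s r))
      = (indicator {..<t} s * F s) * (indicator {0<..} r * ?k s r) - ?K s r * F r" for s r
    using F0 [of r] by (auto simp: marchaud_integrand_def indicator_def algebra_simps)
  then have "(\<integral>r. indicator {..<t} s * (indicator {\<epsilon><..} (s - r) * (a * marchaud_integrand a F s r)) \<partial>lborel)
      = (\<integral>r. (indicator {..<t} s * F s) * (indicator {0<..} r * ?k s r) - ?K s r * F r \<partial>lborel)" for s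
    by simp
  also have "\<dots> s = (indicator {..<t} s * F s) * truncated_mass a \<epsilon> s - (\<integral>r. ?K s r * F r \<partial>lborel)" for s
  proof -
    have "integrable lborel (\<lambda>r. ?K s r * F r)"
    proof (rule bI)
      show "\<bar>?K s r\<bar> \<le> a * \<epsilon> powr (- a - 1)" for r
        using kb [of s r] a by (cases "s < t") auto
    qed measurable
    then show ?thesis
      using hL [of s a] by (subst Bochner_Integration.integral_diff) (auto intro: integrable_mult_right)
  qed
  finally have inner: "(\<integral>r. indicator {..<t} s * (indicator {\<epsilon><..} (s - r) * (a * marchaud_integrand a F s r)) \<partial>lborel)
      = (indicator {..<t} s * F s) * truncated_mass a \<epsilon> s - (\<integral>r. ?K s r * F r \<partial>lborel)" for s .
  have I1: "integrable lborel (\<lambda>s. (indicator {..<t} s * F s) * truncated_mass a \<epsilon> s)"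
  proof -
    have "integrable lborel (\<lambda>s. (indicator {..<t} s * truncated_mass a \<epsilon> s) * F s)"
    proof (rule bI)
      show "\<bar>indicator {..<t} s * truncated_mass a \<epsilon> s\<bar> \<le> \<epsilon> powr - a" for s
        using tb [of s] by (simp add: indicator_def)
    qed measurable
    then show ?thesis by (simp add: ac_simps)
  qed
  have "(\<integral>s. (\<integral>r. indicator {..<t} s * (indicator {\<epsilon><..} (s - r) * (a * marchaud_integrand a F s r)) \<partial>lborel) \<partial>lborel)
      = (\<integral>s. (indicator {..<t} s * F s) * truncated_mass a \<epsilon> s \<partial>lborel)
        - (\<integral>s. truncated_mass a \<epsilon> (t - s) * F s \<partial>lborel)"
    unfolding inner using Fub(2) hR
    by (subst Bochner_Integration.integral_diff [OF I1 Fub(1)]) auto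
  also have "\<dots> = (\<integral>s. (indicator {..<t} s * F s) * truncated_mass a \<epsilon> s - truncated_mass a \<epsilon> (t - s) * F s \<partial>lborel)"
    by (rule Bochner_Integration.integral_diff [symmetric, OF I1 bI [OF _ tb]]) measurable
  also have "\<dots> = (\<integral>s. indicator {..<t} s * (truncated_mass a \<epsilon> s - truncated_mass a \<epsilon> (t - s)) * F s \<partial>lborel)"
    using e by (intro Bochner_Integration.integral_cong) (auto simp: indicator_def truncated_mass_def algebra_simps)
  finally show ?thesis .
qed

text \<open>The first Beta value comes from the Hoelder increment of \<open>f\<close>, the second
  from the increment of the weight \<open>r powr - a\<close>.\<close>

definition marchaud_const :: "real \<Rightarrow> real \<Rightarrow> real \<Rightarrow> real" where
  "marchaud_const a \<kappa> T = Beta (\<kappa> - a) 1 * T powr \<kappa> + Beta (1 - a) (1 - a)"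

text \<open>The increment of the weighted path splits into one of \<open>f\<close>, which gains
  \<open>(s - r) powr \<kappa>\<close>, and one of the weight, which gains a full factor
  \<open>s - r\<close>; both gains work against the singularity
  \<open>(s - r) powr (- a - 1)\<close>. The factor \<open>rl_kernel 1 (r - 0)\<close> is the
  indicator of \<open>r > 0\<close>, written so that the Beta integral applies.\<close>

lemma marchaud_integrand_bound:
  assumes a: "0 < a" "a < 1" and s: "0 < s" "s \<le> T"
    and N: "\<And>r. r \<in> {0..s} \<Longrightarrow> \<bar>f r\<bar> \<le> N"
    and hol: "\<And>r. r \<in> {0..s} \<Longrightarrow> \<bar>f s - f r\<bar> \<le> N * (s - r) powr \<kappa>"
  shows "\<bar>marchaud_integrand a (weighted_path a T f) s r\<bar>
    \<le> N * (s powr - a * (rl_kernel (\<kappa> - a) (s - r) * rl_kernel 1 (r - 0))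
      + inverse s * (rl_kernel (1 - a) (s - r) * rl_kernel (1 - a) (r - 0)))"
proof (cases "0 < r \<and> r < s")
  case False
  have "0 \<le> N" using N [of 0] s by force
  moreover have "marchaud_integrand a (weighted_path a T f) s r = 0"
    using False by (auto simp: marchaud_integrand_def rl_kernel_def indicator_def)
  ultimately show ?thesis using s by simp
next
  case True
  then have r: "0 < r" "r < s" by auto
  define x where "x = s - r"
  have x: "0 < x" using r by (simp add: x_def)
  have e: "weighted_path a T f s - weighted_path a T f r
      = s powr - a * (f s - f r) - (r powr - a - s powr - a) * f r"
    using r s by (simp add: weighted_path_def rl_kernel_def algebra_simps)
  have d0: "0 \<le> r powr - a - s powr - a"
    using r a powr_mono2' [of "- a" r s] by simp
  \<comment> \<open>From \<open>r / s \<le> (r / s) powr a\<close>, valid for exponents below one,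
    follows \<open>s powr - a \<ge> r powr - a * (r / s)\<close>; the difference is then at most
    \<open>r powr - a * (1 - r / s)\<close>.\<close>
  have d1: "r powr - a - s powr - a \<le> inverse s * (x * r powr - a)"
  proof -
    have "r / s \<le> (r / s) powr a"
      using powr_mono' [of a 1 "r / s"] r a by simp
    also have "(r / s) powr a = s powr - a / r powr - a"
      using r by (simp add: powr_divide powr_minus field_simps)
    finally have "r powr - a * (r / s) \<le> s powr - a"
      using r by (simp add: field_simps)
    moreover have "r powr - a - r powr - a * (r / s) = inverse s * (x * r powr - a)"
      using r s by (simp add: x_def field_simps)
    ultimately show ?thesis by linarith
  qed
  have "\<bar>weighted_path a T f s - weighted_path a T f r\<bar>
      \<le> s powr - a * \<bar>f s - f r\<bar> + (r powr - a - s powr - a) * \<bar>f r\<bar>"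
    unfolding e using d0 by (intro order_trans [OF abs_triangle_ineq4]) (simp add: abs_mult)
  also have "\<dots> \<le> s powr - a * (N * x powr \<kappa>) + inverse s * (x * r powr - a) * N"
    using hol [of r] N [of r] r d0 d1 x unfolding x_def [symmetric]
    by (intro add_mono mult_mono) auto
  finally have "x powr (- a - 1) * \<bar>weighted_path a T f s - weighted_path a T f r\<bar>
      \<le> x powr (- a - 1) * (s powr - a * (N * x powr \<kappa>) + inverse s * (x * r powr - a) * N)"
    by (rule mult_left_mono) simp
  also have "\<dots> = N * (s powr - a * (x powr (- a - 1) * x powr \<kappa>) + inverse s * ((x powr (- a - 1) * x powr 1) * r powr - a))"
    using x by (simp add: algebra_simps)
  also have "\<dots> = N * (s powr - a * x powr (\<kappa> - a - 1) + inverse s * (x powr - a * r powr - a))"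
    by (simp only: powr_add [symmetric]) (simp add: algebra_simps)
  finally show ?thesis
    using r x by (simp add: marchaud_integrand_def rl_kernel_def abs_mult x_def [symmetric])
qed

text \<open>The condition \<open>a < \<kappa>\<close> makes the first Beta integral converge. Both
  terms scale like \<open>s powr (- 2 * a)\<close>, the first with an extra
  \<open>s powr \<kappa>\<close>, which is replaced by its value at \<open>T\<close>.\<close>

lemma marchaud_integrand_integral:
  assumes a: "0 < a" "a < 1/2" "a < \<kappa>" and s: "0 < s" "s \<le> T" and f: "continuous_on {0..T} f"
    and N: "\<And>r. r \<in> {0..s} \<Longrightarrow> \<bar>f r\<bar> \<le> N"
    and hol: "\<And>r. r \<in> {0..s} \<Longrightarrow> \<bar>f s - f r\<bar> \<le> N * (s - r) powr \<kappa>"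
  shows "integrable lborel (marchaud_integrand a (weighted_path a T f) s)"
    and "(\<integral>r. \<bar>marchaud_integrand a (weighted_path a T f) s r\<bar> \<partial>lborel) \<le> marchaud_const a \<kappa> T * N * s powr (- 2 * a)"
proof -
  have [measurable]: "weighted_path a T f \<in> borel_measurable borel" using f by measurable
  have N0: "0 \<le> N" using N [of 0] s by force
  let ?E = "\<lambda>r. N * (s powr - a * (rl_kernel (\<kappa> - a) (s - r) * rl_kernel 1 (r - 0))
      + inverse s * (rl_kernel (1 - a) (s - r) * rl_kernel (1 - a) (r - 0)))"
  have hE: "has_bochner_integral lborel ?E
     (N * (s powr - a * (Beta (\<kappa> - a) 1 * rl_kernel (\<kappa> - a + 1) (s - 0))
      + inverse s * (Beta (1 - a) (1 - a) * rl_kernel (1 - a + (1 - a)) (s - 0))))"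
    by (intro has_bochner_integral_mult_right has_bochner_integral_add has_bochner_integral_rl_kernel)
      (use a in auto)
  have le: "\<bar>marchaud_integrand a (weighted_path a T f) s r\<bar> \<le> ?E r" for r
    by (rule marchaud_integrand_bound [OF _ _ s N hol]) (use a in auto)
  have m: "marchaud_integrand a (weighted_path a T f) s \<in> borel_measurable borel"
    unfolding marchaud_integrand_def [abs_def] by measurable
  show "integrable lborel (marchaud_integrand a (weighted_path a T f) s)"
    by (rule Bochner_Integration.integrable_bound [OF integrable.intros [OF hE]])
      (use m in \<open>auto intro!: AE_I2 order_trans [OF le]\<close>)
  have "(\<integral>r. \<bar>marchaud_integrand a (weighted_path a T f) s r\<bar> \<partial>lborel) \<le> integral\<^sup>L lborel ?E"
    by (rule integral_mono' [OF integrable.intros [OF hE] le]) (use order_trans [OF abs_ge_zero le] in auto)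
  also have "\<dots> = N * (Beta (\<kappa> - a) 1 * (s powr - a * s powr (\<kappa> - a)) + Beta (1 - a) (1 - a) * (inverse s * s powr (1 - 2 * a)))"
    unfolding has_bochner_integral_integral_eq [OF hE]
    using s by (simp add: rl_kernel_def algebra_simps)
  also have "s powr - a * s powr (\<kappa> - a) = s powr \<kappa> * s powr (- 2 * a)"
    by (simp add: powr_add [symmetric])
  also have "inverse s * s powr (1 - 2 * a) = s powr (- 2 * a)"
    using s powr_diff [of s "1 - 2 * a" 1] by (simp add: divide_inverse mult.commute)
  also have "N * (Beta (\<kappa> - a) 1 * (s powr \<kappa> * s powr (- 2 * a)) + Beta (1 - a) (1 - a) * s powr (- 2 * a))
      \<le> N * (Beta (\<kappa> - a) 1 * (T powr \<kappa> * s powr (- 2 * a)) + Beta (1 - a) (1 - a) * s powr (- 2 * a))"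
  proof -
    have "0 \<le> Beta (\<kappa> - a) 1"
      using a by (auto simp: Beta_def intro!: divide_nonneg_nonneg mult_nonneg_nonneg less_imp_le [OF Gamma_real_pos])
    then show ?thesis
      using N0 s a by (intro mult_left_mono add_mono mult_right_mono powr_mono2) auto
  qed
  also have "\<dots> = marchaud_const a \<kappa> T * N * s powr (- 2 * a)"
    by (simp add: marchaud_const_def algebra_simps)
  finally show "(\<integral>r. \<bar>marchaud_integrand a (weighted_path a T f) s r\<bar> \<partial>lborel) \<le> marchaud_const a \<kappa> T * N * s powr (- 2 * a)" .
qed

lemma marchaud_nonpos: "s \<le> 0 \<Longrightarrow> marchaud a T F s = 0"
  by (simp add: marchaud_def)

lemma marchaud_bound:
  assumes a: "0 < a" "a < 1/2" "a < \<kappa>" and s: "0 < s" "s \<le> T" and f: "continuous_on {0..T} f"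
    and N: "\<And>r. r \<in> {0..s} \<Longrightarrow> \<bar>f r\<bar> \<le> N"
    and hol: "\<And>r. r \<in> {0..s} \<Longrightarrow> \<bar>f s - f r\<bar> \<le> N * (s - r) powr \<kappa>"
  shows "\<bar>marchaud a T (weighted_path a T f) s\<bar> \<le> (1 + a * marchaud_const a \<kappa> T) * N * s powr (- 2 * a)"
proof -
  let ?F = "weighted_path a T f"
  have "\<bar>rl_kernel (1 - a) s * ?F s\<bar> \<le> rl_kernel (1 - a) s * (N * rl_kernel (1 - a) s)"
    using weighted_path_bound [where a = a and T = T, OF N order_refl]
    by (simp add: abs_mult mult_left_mono)
  also have "\<dots> = N * (rl_kernel (1 - a) s * rl_kernel (1 - a) s)" by simp
  also have "\<dots> = N * s powr (- 2 * a)"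
    unfolding rl_kernel_mult using s by (simp add: rl_kernel_def)
  finally have 1: "\<bar>rl_kernel (1 - a) s * ?F s\<bar> \<le> N * s powr (- 2 * a)" .
  have 2: "\<bar>\<integral>r. marchaud_integrand a ?F s r \<partial>lborel\<bar> \<le> marchaud_const a \<kappa> T * N * s powr (- 2 * a)"
    using order_trans [OF integral_norm_bound [of lborel "marchaud_integrand a ?F s", unfolded real_norm_def]
      marchaud_integrand_integral(2) [OF a s f N hol]] .
  have "\<bar>marchaud a T ?F s\<bar> \<le> \<bar>rl_kernel (1 - a) s * ?F s\<bar> + a * \<bar>\<integral>r. marchaud_integrand a ?F s r \<partial>lborel\<bar>"
    using s a unfolding marchaud_def by (auto intro!: order_trans [OF abs_triangle_ineq] simp: abs_mult)
  also have "\<dots> \<le> N * s powr (- 2 * a) + a * (marchaud_const a \<kappa> T * N * s powr (- 2 * a))"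
    using a by (intro add_mono mult_left_mono 1 2) auto
  finally show ?thesis by (simp add: algebra_simps)
qed

text \<open>The truncated double integral has two limits as the truncation disappears: dominated
  convergence under the Hoelder bound gives the Marchaud term, and the explicit masses give the
  weight \<open>(t - s) powr - a - s powr - a\<close> against \<open>F\<close>. The part
  \<open>s powr - a\<close> is restored by the first summand of \<open>marchaud\<close>, and the
  rest is the fractional integral of order \<open>1 - a\<close>.\<close>

lemma frac_integral_marchaud:
  assumes a: "0 < a" "a < 1/2" "a < \<kappa>" and T: "0 < T" and f: "continuous_on {0..T} f"
    and N: "\<And>r. r \<in> {0..T} \<Longrightarrow> \<bar>f r\<bar> \<le> N"
    and hol: "\<And>r s. 0 \<le> r \<Longrightarrow> r \<le> s \<Longrightarrow> s \<le> T \<Longrightarrow> \<bar>f s - f r\<bar> \<le> N * (s - r) powr \<kappa>"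
  defines "F \<equiv> weighted_path a T f"
  shows "marchaud a T F \<in> borel_measurable borel"
    and "integrable lborel (marchaud a T F)"
    and "t \<in> {0..T} \<Longrightarrow> frac_integral 1 (marchaud a T F) t = frac_integral (1 - a) F t"
proof -
  have Fm [measurable]: "F \<in> borel_measurable borel" unfolding F_def using f by measurable
  have F: "integrable lborel F" unfolding F_def by (rule integrable_weighted_path) (use a T f in auto)
  have F0: "F s = 0" if "s \<le> 0" for s using that by (simp add: F_def weighted_path_nonpos)
  have Fb: "\<bar>F r\<bar> \<le> N * rl_kernel (1 - a) r" if "r \<le> T" for r
    unfolding F_def using that by (intro weighted_path_bound [where s = T] N) auto
  have N0: "0 \<le> N" using N [of 0] T by force
  define D where "D = marchaud_integrand a F"
  have Dm [measurable]: "case_prod D \<in> borel_measurable (borel \<Otimes>\<^sub>M borel)"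
    unfolding D_def marchaud_integrand_def by measurable
  have Dm1 [measurable]: "D s \<in> borel_measurable borel" for s
    unfolding D_def marchaud_integrand_def [abs_def] by measurable
  let ?C = "marchaud_const a \<kappa> T * N"
  have Dint: "integrable lborel (D s)" "(\<integral>r. \<bar>D s r\<bar> \<partial>lborel) \<le> ?C * s powr (- 2 * a)"
    if "0 < s" "s \<le> T" for s
    using marchaud_integrand_integral [OF a that f, of N] N hol that by (auto simp: D_def F_def)
  show m: "marchaud a T F \<in> borel_measurable borel"
    unfolding marchaud_def [abs_def] D_def [symmetric] by measurable
  have rI: "integrable lborel (\<lambda>s. indicator {..<t} s * rl_kernel (1 - 2 * a) s)" if "0 \<le> t" for t
    using has_bochner_integral_indicator_rl_kernel [of "1 - 2 * a" t] a that by (auto intro: integrable.intros)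
  show mI: "integrable lborel (marchaud a T F)"
  proof (rule Bochner_Integration.integrable_bound)
    show "integrable lborel (\<lambda>s. (1 + a * marchaud_const a \<kappa> T) * N * (indicator {..<T} s * rl_kernel (1 - 2 * a) s))"
      by (intro integrable_mult_right rI) (use T in auto)
    have "\<bar>marchaud a T F s\<bar> \<le> (1 + a * marchaud_const a \<kappa> T) * N * (indicator {..<T} s * rl_kernel (1 - 2 * a) s)"
      if "s \<noteq> T" for s
    proof (cases "s \<in> {0<..<T}")
      case True
      then have "\<bar>marchaud a T F s\<bar> \<le> (1 + a * marchaud_const a \<kappa> T) * N * s powr (- 2 * a)"
        unfolding F_def by (intro marchaud_bound a f N hol) auto
      then show ?thesis using True by (simp add: rl_kernel_def)
    next
      case False
      then show ?thesis using that by (auto simp: marchaud_def indicator_def rl_kernel_nonpos)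
    qed
    note le = this
    from AE_lborel_singleton [of T] show "AE s in lborel. norm (marchaud a T F s)
        \<le> norm ((1 + a * marchaud_const a \<kappa> T) * N * (indicator {..<T} s * rl_kernel (1 - 2 * a) s))"
    proof eventually_elim
      case (elim s)
      show ?case using order_trans [OF le [OF elim] abs_ge_self] by simp
    qed
  qed (use m in measurable)
  assume t: "t \<in> {0..T}"
  \<comment> \<open>The kernel is cut off at distance \<open>1 / (n + 1)\<close>, so that the limit
    runs along a sequence and dominated convergence applies.\<close>
  define G where "G n s = (\<integral>r. indicator {..<t} s * (indicator {inverse (real (Suc n))<..} (s - r) * (a * D s r)) \<partial>lborel)" for n s
  let ?\<epsilon> = "\<lambda>n. inverse (real (Suc n))"
  have epos: "0 < ?\<epsilon> n" for n by simp
  have elim: "?\<epsilon> \<longlonglongrightarrow> 0" by (rule LIMSEQ_inverse_real_of_nat)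
  have Gm [measurable]: "G n \<in> borel_measurable borel" for n
    unfolding G_def [abs_def] by measurable
  have lim1: "(\<lambda>n. \<integral>s. G n s \<partial>lborel) \<longlonglongrightarrow> (\<integral>s. indicator {..<t} s * (a * (\<integral>r. D s r \<partial>lborel)) \<partial>lborel)"
  proof (rule integral_dominated_convergence)
    show "integrable lborel (\<lambda>s. a * ?C * (indicator {..<t} s * rl_kernel (1 - 2 * a) s))"
      by (intro integrable_mult_right rI) (use t in auto)
    show "AE s in lborel. (\<lambda>n. G n s) \<longlonglongrightarrow> indicator {..<t} s * (a * (\<integral>r. D s r \<partial>lborel))"
    proof (rule AE_I2)
      fix s
      show "(\<lambda>n. G n s) \<longlonglongrightarrow> indicator {..<t} s * (a * (\<integral>r. D s r \<partial>lborel))"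
      proof (cases "0 < s \<and> s < t")
        case False
        have "D s r = 0" if "s \<le> 0" for r
          using that by (auto simp: D_def marchaud_integrand_def rl_kernel_def indicator_def)
        then have "G n s = indicator {..<t} s * (a * (\<integral>r. D s r \<partial>lborel))" for n
          using False unfolding G_def by (cases "s \<le> 0") auto
        then show ?thesis by simp
      next
        case True
        have "(\<lambda>n. G n s) \<longlonglongrightarrow> (\<integral>r. indicator {..<t} s * (a * D s r) \<partial>lborel)"
          unfolding G_def
        proof (rule integral_dominated_convergence)
          show "integrable lborel (\<lambda>r. a * \<bar>D s r\<bar>)"
            using Dint(1) [of s] True t by auto
          show "AE r in lborel. (\<lambda>n. indicator {..<t} s * (indicator {?\<epsilon> n<..} (s - r) * (a * D s r)))
              \<longlonglongrightarrow> indicator {..<t} s * (a * D s r)"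
          proof (rule AE_I2)
            fix r
            show "(\<lambda>n. indicator {..<t} s * (indicator {?\<epsilon> n<..} (s - r) * (a * D s r)))
              \<longlonglongrightarrow> indicator {..<t} s * (a * D s r)"
            proof (cases "r < s")
              case False
              then show ?thesis by (simp add: D_def marchaud_integrand_def rl_kernel_nonpos)
            next
              case True
              then have "\<forall>\<^sub>F n in sequentially. ?\<epsilon> n < s - r"
                using order_tendstoD(2) [OF elim, of "s - r"] by simp
              then have "\<forall>\<^sub>F n in sequentially. indicator {..<t} s * (a * D s r)
                = indicator {..<t} s * (indicator {?\<epsilon> n<..} (s - r) * (a * D s r))"
                by eventually_elim simp
              then show ?thesis by (rule Lim_transform_eventually [OF tendsto_const])
            qed
          qed
          show "AE r in lborel. norm (indicator {..<t} s * (indicator {?\<epsilon> n<..} (s - r) * (a * D s r))) \<le> a * \<bar>D s r\<bar>" for n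
            using a by (intro AE_I2) (auto simp: indicator_def abs_mult)
        qed measurable
        then show ?thesis by simp
      qed
    qed
    show "AE s in lborel. norm (G n s) \<le> a * ?C * (indicator {..<t} s * rl_kernel (1 - 2 * a) s)" for n
    proof (rule AE_I2)
      fix s
      show "norm (G n s) \<le> a * ?C * (indicator {..<t} s * rl_kernel (1 - 2 * a) s)"
      proof (cases "0 < s \<and> s < t")
        case False
        have "D s r = 0" if "s \<le> 0" for r
          using that by (auto simp: D_def marchaud_integrand_def rl_kernel_def indicator_def)
        then have "G n s = 0" using False unfolding G_def by (cases "s \<le> 0") auto
        moreover have z: "indicator {..<t} s * rl_kernel (1 - 2 * a) s = 0"
          using False by (auto simp: indicator_def rl_kernel_nonpos)
        ultimately show ?thesis unfolding z by simp
      next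
        case True
        then have s: "0 < s" "s \<le> T" using t by auto
        have "norm (G n s) \<le> (\<integral>r. a * \<bar>D s r\<bar> \<partial>lborel)"
          unfolding G_def
        proof (rule order_trans [OF integral_norm_bound integral_mono'])
          show "integrable lborel (\<lambda>r. a * \<bar>D s r\<bar>)" using Dint(1) [OF s] by auto
        qed (use a in \<open>auto simp: indicator_def abs_mult\<close>)
        also have "\<dots> \<le> a * (?C * s powr (- 2 * a))"
          using Dint(2) [OF s] a by simp
        finally show ?thesis using True by (simp add: rl_kernel_def)
      qed
    qed
  qed measurable
  \<comment> \<open>The pointwise limit of the difference of the truncated masses: once the
    truncation is below both \<open>s\<close> and \<open>t - s\<close>, its powers cancel
    exactly.\<close>
  define h where "h s = rl_kernel (1 - a) (t - s) - indicator {..<t} s * rl_kernel (1 - a) s" for s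
  have hm [measurable]: "h \<in> borel_measurable borel" unfolding h_def by measurable
  have I1: "integrable lborel (\<lambda>s. rl_kernel (1 - a) (t - s) * F s)"
  proof (rule Bochner_Integration.integrable_bound)
    show "integrable lborel (\<lambda>s. N * (rl_kernel (1 - a) (t - s) * rl_kernel (1 - a) (s - 0)))"
      by (intro integrable_mult_right integrable_rl_kernel) (use a in auto)
    show "AE s in lborel. norm (rl_kernel (1 - a) (t - s) * F s)
        \<le> norm (N * (rl_kernel (1 - a) (t - s) * rl_kernel (1 - a) (s - 0)))"
    proof (rule AE_I2)
      fix s
      show "norm (rl_kernel (1 - a) (t - s) * F s) \<le> norm (N * (rl_kernel (1 - a) (t - s) * rl_kernel (1 - a) (s - 0)))"
      proof (cases "s < t")
        case True
        then have "rl_kernel (1 - a) (t - s) * \<bar>F s\<bar> \<le> rl_kernel (1 - a) (t - s) * (N * rl_kernel (1 - a) s)"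
          using Fb [of s] t by (intro mult_left_mono) auto
        then show ?thesis using N0 by (simp add: abs_mult ac_simps)
      qed (simp add: rl_kernel_nonpos)
    qed
  qed measurable
  have I2: "integrable lborel (\<lambda>s. indicator {..<t} s * (rl_kernel (1 - a) s * F s))"
  proof (rule Bochner_Integration.integrable_bound)
    show "integrable lborel (\<lambda>s. N * (indicator {..<t} s * rl_kernel (1 - 2 * a) s))"
      by (intro integrable_mult_right rI) (use t in auto)
    show "AE s in lborel. norm (indicator {..<t} s * (rl_kernel (1 - a) s * F s))
        \<le> norm (N * (indicator {..<t} s * rl_kernel (1 - 2 * a) s))"
    proof (rule AE_I2)
      fix s
      show "norm (indicator {..<t} s * (rl_kernel (1 - a) s * F s))
        \<le> norm (N * (indicator {..<t} s * rl_kernel (1 - 2 * a) s))"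
      proof (cases "s < t")
        case True
        have "rl_kernel (1 - a) s * \<bar>F s\<bar> \<le> rl_kernel (1 - a) s * (N * rl_kernel (1 - a) s)"
          using Fb [of s] True t by (intro mult_left_mono) auto
        also have "\<dots> = N * (rl_kernel (1 - a) s * rl_kernel (1 - a) s)" by simp
        also have "\<dots> = N * rl_kernel (1 - 2 * a) s"
          unfolding rl_kernel_mult by simp
        finally show ?thesis using True N0 by (simp add: abs_mult)
      qed simp
    qed
  qed measurable
  have lim2: "(\<lambda>n. \<integral>s. G n s \<partial>lborel) \<longlonglongrightarrow> (\<integral>s. h s * F s \<partial>lborel)"
  proof -
    let ?g = "\<lambda>n s. indicator {..<t} s * (truncated_mass a (?\<epsilon> n) s - truncated_mass a (?\<epsilon> n) (t - s)) * F s"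
    have "(\<integral>s. G n s \<partial>lborel) = (\<integral>s. ?g n s \<partial>lborel)" for n
      unfolding G_def D_def by (rule integral_truncated_difference [OF a(1) epos F F0])
    moreover have "(\<lambda>n. \<integral>s. ?g n s \<partial>lborel) \<longlonglongrightarrow> (\<integral>s. h s * F s \<partial>lborel)"
    proof (rule integral_dominated_convergence)
      show "integrable lborel (\<lambda>s. \<bar>rl_kernel (1 - a) (t - s) * F s\<bar> + \<bar>indicator {..<t} s * (rl_kernel (1 - a) s * F s)\<bar>)"
        using I1 I2 by (intro Bochner_Integration.integrable_add integrable_abs)
      show "AE s in lborel. (\<lambda>n. ?g n s) \<longlonglongrightarrow> h s * F s"
      proof (rule AE_I2)
        fix s
        show "(\<lambda>n. ?g n s) \<longlonglongrightarrow> h s * F s"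
        proof (cases "0 < s \<and> s < t")
          case False
          then show ?thesis by (cases "s \<le> 0") (auto simp: F0 h_def rl_kernel_nonpos)
        next
          case True
          have "\<forall>\<^sub>F n in sequentially. ?\<epsilon> n < s" "\<forall>\<^sub>F n in sequentially. ?\<epsilon> n < t - s"
            using order_tendstoD(2) [OF elim, of s] order_tendstoD(2) [OF elim, of "t - s"] True by auto
          then have "\<forall>\<^sub>F n in sequentially. h s * F s = ?g n s"
            by eventually_elim (use True in \<open>simp add: truncated_mass_def h_def rl_kernel_def\<close>)
          then show ?thesis by (rule Lim_transform_eventually [OF tendsto_const])
        qed
      qed
      show "AE s in lborel. norm (?g n s)
          \<le> \<bar>rl_kernel (1 - a) (t - s) * F s\<bar> + \<bar>indicator {..<t} s * (rl_kernel (1 - a) s * F s)\<bar>" for n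
      proof (rule AE_I2)
        fix s
        show "norm (?g n s)
          \<le> \<bar>rl_kernel (1 - a) (t - s) * F s\<bar> + \<bar>indicator {..<t} s * (rl_kernel (1 - a) s * F s)\<bar>"
        proof (cases "0 < s \<and> s < t")
          case False
          then show ?thesis by (cases "s \<le> 0") (auto simp: F0)
        next
          case True
          have "\<bar>truncated_mass a (?\<epsilon> n) s - truncated_mass a (?\<epsilon> n) (t - s)\<bar> * \<bar>F s\<bar>
              \<le> (s powr - a + (t - s) powr - a) * \<bar>F s\<bar>"
            using truncated_mass_diff_bound [OF a(1) epos, of s t n] True by (intro mult_right_mono) auto
          then show ?thesis using True by (simp add: abs_mult rl_kernel_def distrib_right add.commute)
        qed
      qed
    qed (unfold truncated_mass_def, measurable)
    ultimately show ?thesis by simp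
  qed
  have eq: "(\<integral>s. indicator {..<t} s * (a * (\<integral>r. D s r \<partial>lborel)) \<partial>lborel) = (\<integral>s. h s * F s \<partial>lborel)"
    using lim1 lim2 by (rule LIMSEQ_unique)
  have split: "rl_kernel 1 (t - s) * marchaud a T F s
      = indicator {..<t} s * (rl_kernel (1 - a) s * F s) + indicator {..<t} s * (a * (\<integral>r. D s r \<partial>lborel))" for s
  proof (cases "0 < s")
    case True
    then show ?thesis using t by (auto simp: rl_kernel_1 marchaud_def D_def indicator_def)
  next
    case False
    then have "D s r = 0" for r
      by (auto simp: D_def marchaud_integrand_def rl_kernel_def indicator_def)
    then show ?thesis using False by (simp add: marchaud_def F0)
  qed
  have "integrable lborel (\<lambda>s. rl_kernel 1 (t - s) * marchaud a T F s)"
  proof (rule Bochner_Integration.integrable_bound [OF mI])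
    show "AE s in lborel. norm (rl_kernel 1 (t - s) * marchaud a T F s) \<le> norm (marchaud a T F s)"
      by (intro AE_I2) (simp add: rl_kernel_1 indicator_def)
  qed (use m in measurable)
  then have I3: "integrable lborel (\<lambda>s. indicator {..<t} s * (a * (\<integral>r. D s r \<partial>lborel)))"
    using Bochner_Integration.integrable_diff [OF _ I2, of "\<lambda>s. rl_kernel 1 (t - s) * marchaud a T F s"]
    by (simp add: split)
  have "frac_integral 1 (marchaud a T F) t
      = (\<integral>s. indicator {..<t} s * (rl_kernel (1 - a) s * F s) \<partial>lborel) + (\<integral>s. h s * F s \<partial>lborel)"
    unfolding frac_integral_def split eq [symmetric] by (rule Bochner_Integration.integral_add [OF I2 I3])
  also have "(\<integral>s. h s * F s \<partial>lborel)
      = (\<integral>s. rl_kernel (1 - a) (t - s) * F s \<partial>lborel) - (\<integral>s. indicator {..<t} s * (rl_kernel (1 - a) s * F s) \<partial>lborel)"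
    unfolding h_def using Bochner_Integration.integral_diff [OF I1 I2] by (simp add: left_diff_distrib mult.assoc)
  finally show "frac_integral 1 (marchaud a T F) t = frac_integral (1 - a) F t"
    by (simp add: frac_integral_def)
qed

text \<open>A single number bounds the supremum and, for \<open>H > 1/2\<close>, the Hoelder
  constant. The exponent \<open>H / 2\<close> exceeds the order \<open>H - 1/2\<close> of the
  derivative to be taken and stays below the exponent 1/2 of the paths.\<close>

definition path_bound :: "real \<Rightarrow> (real \<Rightarrow> 'a::real_normed_vector) \<Rightarrow> real \<Rightarrow> real \<Rightarrow> bool" where
  "path_bound H f s N \<longleftrightarrow> (\<forall>r\<in>{0..s}. norm (f r) \<le> N) \<and>
     (1/2 < H \<longrightarrow> (\<forall>r\<in>{0..s}. \<forall>r'\<in>{0..s}. norm (f r - f r') \<le> N * \<bar>r - r'\<bar> powr (H / 2)))"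

lemma path_bound_subinterval: "path_bound H f t N \<Longrightarrow> s \<le> t \<Longrightarrow> path_bound H f s N"
  by (simp add: path_bound_def)

lemma c_H_pos:
  assumes "0 < H" "H < 1"
  shows "0 < c_H H"
  unfolding c_H_def using assms
  by (auto intro!: divide_pos_pos mult_pos_pos Gamma_real_pos)

text \<open>Order \<open>a\<close> is applied to both sides of the identity for the Marchaud
  derivative: on the left it composes with order 1 and produces \<open>Beta a 1\<close>, on the
  right with order \<open>1 - a\<close> and produces \<open>Beta a (1 - a)\<close>. Their quotient
  is the normalising factor.\<close>

lemma Abel_solution_pos:
  assumes a: "0 < a" "a < 1/2" "a < \<kappa>" and T: "0 < T" and f: "continuous_on {0..T} f"
    and N: "\<And>r. r \<in> {0..T} \<Longrightarrow> \<bar>f r\<bar> \<le> N"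
    and hol: "\<And>r s. 0 \<le> r \<Longrightarrow> r \<le> s \<Longrightarrow> s \<le> T \<Longrightarrow> \<bar>f s - f r\<bar> \<le> N * (s - r) powr \<kappa>"
    and t: "t \<in> {0..T}"
  shows "frac_integral (1 + a) (\<lambda>s. Beta a 1 / Beta a (1 - a) * marchaud a T (weighted_path a T f) s) t
    = frac_integral 1 (weighted_path a T f) t"
proof -
  define F where "F = weighted_path a T f"
  define M where "M = marchaud a T F"
  note fm = frac_integral_marchaud [OF a T f N hol, folded F_def, folded M_def]
  have F: "integrable lborel F" unfolding F_def by (rule integrable_weighted_path) (use a T f in auto)
  have z: "frac_integral b g r = 0" if "r \<le> 0" "\<And>s. s \<le> 0 \<Longrightarrow> g s = 0" for b g r
  proof -
    have "(\<lambda>s. rl_kernel b (r - s) * g s) = (\<lambda>s. 0)"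
      using that by (auto simp: rl_kernel_def)
    then show ?thesis by (simp add: frac_integral_def)
  qed
  have F0: "F s = 0" and M0: "M s = 0" if "s \<le> 0" for s
    using that by (simp_all add: F_def M_def weighted_path_nonpos marchaud_nonpos)
  have "frac_integral a (frac_integral 1 M) t = frac_integral a (frac_integral (1 - a) F) t"
    unfolding frac_integral_def [of a]
  proof (intro Bochner_Integration.integral_cong refl)
    fix r
    \<comment> \<open>The Marchaud identity is known on \<open>[0, T]\<close> only; for
      \<open>r \<le> 0\<close> both fractional integrals vanish, and for \<open>r \<ge> t\<close>
      the outer kernel does.\<close>
    consider "r \<le> 0" | "r \<in> {0..T}" | "t \<le> r" using t by fastforce
    then show "rl_kernel a (t - r) * frac_integral 1 M r = rl_kernel a (t - r) * frac_integral (1 - a) F r"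
      using fm(3) [of r] by cases (auto simp: z F0 M0 rl_kernel_nonpos)
  qed
  then have "Beta a 1 * frac_integral (1 + a) M t = Beta a (1 - a) * frac_integral 1 F t"
    using frac_integral_compose(2) [of a 1 M t] frac_integral_compose(2) [of a "1 - a" F t] a F fm(2) F0 M0
    by (simp add: add.commute)
  moreover have "frac_integral (1 + a) (\<lambda>s. Beta a 1 / Beta a (1 - a) * M s) t
      = Beta a 1 / Beta a (1 - a) * frac_integral (1 + a) M t"
    unfolding frac_integral_def by (simp add: integral_mult_right_zero [symmetric] ac_simps)
  ultimately show ?thesis
    using Beta_neq_0 [of a "1 - a"] a by (simp add: F_def M_def)
qed

text \<open>The constant is chosen before \<open>f\<close>, and the estimate at \<open>s\<close>
  accepts any \<open>N\<close> valid on \<open>[0, s]\<close>; this uniformity and causality are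
  what the Gronwall argument consumes. The Abel equation is solved by fractional integration, not at
  all, or by fractional differentiation, according to the sign of \<open>a\<close>.\<close>

lemma K_scalar_preimage:
  assumes H: "0 < H" "H < 1" and T: "0 < T"
  obtains C where "0 \<le> C"
    "\<And>f N0. continuous_on {0..T} f \<Longrightarrow> path_bound H f T N0 \<Longrightarrow>
      \<exists>v. sq_integrable v \<and> (\<forall>s. s \<notin> {0<..<T} \<longrightarrow> v s = 0) \<and>
        (\<forall>t\<in>{0..T}. K_scalar H v t = integral {0..t} f) \<and>
        (\<forall>s\<in>{0<..T}. \<forall>N. path_bound H f s N \<longrightarrow> \<bar>v s\<bar> \<le> C * N * s powr - (H - 1/2))"
proof -
  define a where "a = H - 1/2"
  have a: "- 1/2 < a" "a < 1/2" using H by (auto simp: a_def)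
  have c: "c_H H \<noteq> 0" using c_H_pos [OF H] by simp
  have "\<exists>C\<ge>0. \<forall>f N0. continuous_on {0..T} f \<longrightarrow> path_bound H f T N0 \<longrightarrow>
      (\<exists>w. w \<in> borel_measurable borel \<and> (\<forall>s\<le>0. w s = 0) \<and>
        (\<forall>t\<in>{0..T}. frac_integral (1 + (H - 1/2)) w t = frac_integral 1 (weighted_path (H - 1/2) T f) t) \<and>
        (\<forall>s\<in>{0<..T}. \<forall>N. path_bound H f s N \<longrightarrow> \<bar>w s\<bar> \<le> C * N * s powr (- 2 * (H - 1/2))))"
    unfolding a_def [symmetric]
  proof -
    consider "a < 0" | "a = 0" | "0 < a" by linarith
    then show "\<exists>C\<ge>0. \<forall>f N0. continuous_on {0..T} f \<longrightarrow> path_bound H f T N0 \<longrightarrow>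
      (\<exists>w. w \<in> borel_measurable borel \<and> (\<forall>s\<le>0. w s = 0) \<and>
        (\<forall>t\<in>{0..T}. frac_integral (1 + a) w t = frac_integral 1 (weighted_path a T f) t) \<and>
        (\<forall>s\<in>{0<..T}. \<forall>N. path_bound H f s N \<longrightarrow> \<bar>w s\<bar> \<le> C * N * s powr (- 2 * a)))"
    proof cases
      case 1
      have B: "0 \<le> Beta (- a) (1 - a) / Beta (1 + a) (- a)"
        using a 1 by (auto simp: Beta_def intro!: divide_nonneg_nonneg mult_nonneg_nonneg less_imp_le [OF Gamma_real_pos])
      show ?thesis
        by (rule exI [of _ "Beta (- a) (1 - a) / Beta (1 + a) (- a)"], intro conjI B allI impI,
            rule_tac x = "\<lambda>s. frac_integral (- a) (weighted_path a T f) s / Beta (1 + a) (- a)" in exI)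
          (use Abel_solution_neg [OF a(1) 1 T] in \<open>auto simp: path_bound_def\<close>)
    next
      case 2
      \<comment> \<open>For \<open>H = 1/2\<close> both sides of the Abel equation have order one,
        and the datum itself is the solution.\<close>
      have "\<bar>weighted_path a T f s\<bar> \<le> 1 * N * s powr (- 2 * a)" if "s \<in> {0<..T}" "path_bound H f s N" for f s N
        using weighted_path_bound [of s f N s a T] that 2 by (auto simp: path_bound_def rl_kernel_1)
      then show ?thesis
        using 2 by (intro exI [of _ 1] conjI allI impI, simp, rule_tac x = "weighted_path a T f" in exI)
          (auto simp: weighted_path_nonpos intro!: weighted_path_measurable)
    next
      case 3
      have ak: "a < H / 2" using H by (simp add: a_def)
      have H2: "1/2 < H" using 3 by (simp add: a_def)
      let ?B = "Beta a 1 / Beta a (1 - a)"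
      let ?C = "?B * (1 + a * marchaud_const a (H/2) T)"
      have B: "0 \<le> ?B"
        using a 3 by (auto simp: Beta_def intro!: divide_nonneg_nonneg mult_nonneg_nonneg less_imp_le [OF Gamma_real_pos])
      have C: "0 \<le> ?C"
      proof -
        have "0 \<le> marchaud_const a (H/2) T"
          unfolding marchaud_const_def using a 3 ak
          by (auto simp: Beta_def intro!: add_nonneg_nonneg divide_nonneg_nonneg mult_nonneg_nonneg less_imp_le [OF Gamma_real_pos])
        then show ?thesis using B 3 by (intro mult_nonneg_nonneg) auto
      qed
      show ?thesis
      proof (rule exI [of _ ?C], intro conjI C allI impI)
        fix f :: "real \<Rightarrow> real" and N0 assume f: "continuous_on {0..T} f" and N0: "path_bound H f T N0"
        let ?w = "\<lambda>s. ?B * marchaud a T (weighted_path a T f) s"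
        have p: "\<bar>f r\<bar> \<le> N" "\<bar>f s - f r\<bar> \<le> N * (s - r) powr (H/2)"
          if "path_bound H f t N" "0 \<le> r" "r \<le> s" "s \<le> t" for t N r s
        proof -
          have rs: "r \<in> {0..t}" "s \<in> {0..t}" using that by auto
          show "\<bar>f r\<bar> \<le> N" using that(1) rs by (simp add: path_bound_def)
          have "norm (f s - f r) \<le> N * \<bar>s - r\<bar> powr (H/2)"
            using that(1) rs H2 unfolding path_bound_def by blast
          then show "\<bar>f s - f r\<bar> \<le> N * (s - r) powr (H/2)" using that by simp
        qed
        have "?w \<in> borel_measurable borel"
          using frac_integral_marchaud(1) [OF 3 a(2) ak T f, of N0] p [OF N0] by (intro borel_measurable_times) auto
        moreover have "\<forall>t\<in>{0..T}. frac_integral (1 + a) ?w t = frac_integral 1 (weighted_path a T f) t"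
        proof
          fix t assume t: "t \<in> {0..T}"
          show "frac_integral (1 + a) ?w t = frac_integral 1 (weighted_path a T f) t"
            by (rule Abel_solution_pos [OF 3 a(2) ak T f _ _ t, of N0]) (use p [OF N0] in auto)
        qed
        moreover have "\<bar>?w s\<bar> \<le> ?C * N * s powr (- 2 * a)" if s: "s \<in> {0<..T}" and N: "path_bound H f s N" for s N
        proof -
          have "\<bar>marchaud a T (weighted_path a T f) s\<bar> \<le> (1 + a * marchaud_const a (H/2) T) * N * s powr (- 2 * a)"
            by (rule marchaud_bound [OF 3 a(2) ak _ _ f]) (use s p [OF N] in auto)
          then have "?B * \<bar>marchaud a T (weighted_path a T f) s\<bar> \<le> ?B * ((1 + a * marchaud_const a (H/2) T) * N * s powr (- 2 * a))"
            by (rule mult_left_mono [OF _ B])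
          then show ?thesis using B by (simp only: abs_mult abs_of_nonneg [OF B] mult.assoc)
        qed
        ultimately show "\<exists>w. w \<in> borel_measurable borel \<and> (\<forall>s\<le>0. w s = 0) \<and>
          (\<forall>t\<in>{0..T}. frac_integral (1 + a) w t = frac_integral 1 (weighted_path a T f) t) \<and>
          (\<forall>s\<in>{0<..T}. \<forall>N. path_bound H f s N \<longrightarrow> \<bar>w s\<bar> \<le> ?C * N * s powr (- 2 * a))"
          by (intro exI [of _ ?w]) (auto simp: marchaud_nonpos)
      qed
    qed
  qed
  then obtain C where C: "0 \<le> C" and ex: "\<And>f N0. continuous_on {0..T} f \<Longrightarrow> path_bound H f T N0 \<Longrightarrow>
      (\<exists>w. w \<in> borel_measurable borel \<and> (\<forall>s\<le>0. w s = 0) \<and>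
        (\<forall>t\<in>{0..T}. frac_integral (1 + (H - 1/2)) w t = frac_integral 1 (weighted_path (H - 1/2) T f) t) \<and>
        (\<forall>s\<in>{0<..T}. \<forall>N. path_bound H f s N \<longrightarrow> \<bar>w s\<bar> \<le> C * N * s powr (- 2 * (H - 1/2))))"
    by metis
  show ?thesis
  proof (rule that [of "C / \<bar>c_H H\<bar>"])
    show "0 \<le> C / \<bar>c_H H\<bar>" using C by simp
    fix f :: "real \<Rightarrow> real" and N0 assume f: "continuous_on {0..T} f" and N0: "path_bound H f T N0"
    from ex [OF this] obtain w where w: "w \<in> borel_measurable borel" "\<And>s. s \<le> 0 \<Longrightarrow> w s = 0"
      "\<And>t. t \<in> {0..T} \<Longrightarrow> frac_integral (1 + (H - 1/2)) w t = frac_integral 1 (weighted_path (H - 1/2) T f) t"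
      "\<And>s N. s \<in> {0<..T} \<Longrightarrow> path_bound H f s N \<Longrightarrow> \<bar>w s\<bar> \<le> C * N * s powr (- 2 * (H - 1/2))"
      by blast
    have P: "path_bound H f s N0" if "s \<in> {0<..T}" for s
      using path_bound_subinterval [OF N0] that by simp
    show "\<exists>v. sq_integrable v \<and> (\<forall>s. s \<notin> {0<..<T} \<longrightarrow> v s = 0) \<and>
        (\<forall>t\<in>{0..T}. K_scalar H v t = integral {0..t} f) \<and>
        (\<forall>s\<in>{0<..T}. \<forall>N. path_bound H f s N \<longrightarrow> \<bar>v s\<bar> \<le> C / \<bar>c_H H\<bar> * N * s powr - (H - 1/2))"
    proof (rule preimage_of_Abel_solution [where P = "path_bound H f", OF H c T f w P])
      fix v assume v: "sq_integrable v" "\<And>s. s \<notin> {0<..<T} \<Longrightarrow> v s = 0"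
        "\<And>t. t \<in> {0..T} \<Longrightarrow> K_scalar H v t = integral {0..t} f"
        "\<And>s N. s \<in> {0<..T} \<Longrightarrow> path_bound H f s N \<Longrightarrow> \<bar>v s\<bar> \<le> C / \<bar>c_H H\<bar> * N * s powr - (H - 1/2)"
      show ?thesis
        by (intro exI [of _ v] conjI allI impI ballI v)
    qed assumption+
  qed
qed

text \<open>
  Integration by parts identifies the Young integral of a \<open>C\<^sup>1\<close> function against a continuous
  path: on each partition interval the error is an integral of \<open>s'\<close> against an oscillation of \<open>g\<close>.
\<close>

lemma Riemann_Stieltjes_by_parts:
  fixes s s' g :: "real \<Rightarrow> real"
  assumes t: "0 \<le> t" and s: "\<And>x. x \<in> {0..t} \<Longrightarrow> (s has_real_derivative s' x) (at x within {0..t})"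
    and s': "continuous_on {0..t} s'" and g: "continuous_on {0..t} g" and e: "0 < e"
  shows "\<exists>d>0. \<forall>p. p tagged_division_of {0..t} \<and> (\<lambda>x. ball x d) fine p \<longrightarrow>
    \<bar>(\<Sum>(x, K)\<in>p. s x * (g (Sup K) - g (Inf K))) - (s t * g t - s 0 * g 0 - integral {0..t} (\<lambda>r. s' r * g r))\<bar> < e"
proof -
  have "bounded (s' ` {0..t})" by (intro compact_imp_bounded compact_continuous_image s') auto
  then obtain M where "0 < M" "\<forall>x\<in>s' ` {0..t}. norm x \<le> M" unfolding bounded_pos by blast
  then have M: "0 < M" "\<And>x. x \<in> {0..t} \<Longrightarrow> \<bar>s' x\<bar> \<le> M" by auto
  \<comment> \<open>The errors will add up to \<open>M * e' * t\<close>; dividing by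
    \<open>t + 1\<close> rather than \<open>t\<close> covers \<open>t = 0\<close> and makes the
    final inequality strict.\<close>
  define e' where "e' = e / (M * (t + 1))"
  have e': "0 < e'" using e M t by (simp add: e'_def)
  have "uniformly_continuous_on {0..t} g" by (rule compact_uniformly_continuous [OF g]) simp
  then obtain d where d: "0 < d" and dg: "\<And>x y. x \<in> {0..t} \<Longrightarrow> y \<in> {0..t} \<Longrightarrow> dist y x < d \<Longrightarrow> dist (g y) (g x) < e'"
    using e' unfolding uniformly_continuous_on_def by metis
  \<comment> \<open>The claimed value of the integral as a function of its right end point. Its
    increments telescope over a division, so each summand only has to be compared with one
    increment.\<close>
  define \<Phi> where "\<Phi> x = s x * g x - integral {0..x} (\<lambda>r. s' r * g r)" for x
  have sgc: "continuous_on {0..t} (\<lambda>r. s' r * g r)" by (intro continuous_intros s' g)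
  have piece: "\<bar>s x * (g b - g a) - (\<Phi> b - \<Phi> a)\<bar> \<le> M * e' * (b - a)"
    if ab: "0 \<le> a" "a \<le> x" "x \<le> b" "b \<le> t" and sm: "b - a < d" for a x b
  proof -
    have J: "((\<lambda>r. s' r * (g y - g r)) has_integral ((s b' - s a') * g y - integral {a'..b'} (\<lambda>r. s' r * g r))) {a'..b'}"
      if "0 \<le> a'" "a' \<le> b'" "b' \<le> t" for a' b' y
    proof -
      have "(s' has_integral (s b' - s a')) {a'..b'}"
      proof (rule fundamental_theorem_of_calculus [OF that(2)])
        fix x assume "x \<in> {a'..b'}"
        then have "(s has_real_derivative s' x) (at x within {a'..b'})"
          using s [of x] that by (auto intro: DERIV_subset)
        then show "(s has_vector_derivative s' x) (at x within {a'..b'})"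
          by (simp add: has_real_derivative_iff_has_vector_derivative)
      qed
      from has_integral_mult_left [OF this, of "g y"]
      have 1: "((\<lambda>r. s' r * g y) has_integral (s b' - s a') * g y) {a'..b'}" .
      have 2: "((\<lambda>r. s' r * g r) has_integral integral {a'..b'} (\<lambda>r. s' r * g r)) {a'..b'}"
        by (intro integrable_integral integrable_continuous_interval continuous_on_subset [OF sgc]) (use that in auto)
      show ?thesis using has_integral_diff [OF 1 2] by (simp add: right_diff_distrib)
    qed
    have bd: "\<bar>(s b' - s a') * g y - integral {a'..b'} (\<lambda>r. s' r * g r)\<bar> \<le> M * e' * (b' - a')"
      if "a \<le> a'" "a' \<le> b'" "b' \<le> b" "y \<in> {a..b}" for a' b' y
    proof -
      have "norm ((s b' - s a') * g y - integral {a'..b'} (\<lambda>r. s' r * g r)) \<le> M * e' * measure lborel (cbox a' b')"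
      proof (rule has_integral_bound)
        show "((\<lambda>r. s' r * (g y - g r)) has_integral ((s b' - s a') * g y - integral {a'..b'} (\<lambda>r. s' r * g r))) (cbox a' b')"
          using J [of a' b' y] that ab by simp
        fix r assume "r \<in> cbox a' b'"
        then have r: "r \<in> {0..t}" "y \<in> {0..t}" "dist y r < d" using that ab sm by (auto simp: dist_real_def abs_if)
        show "norm (s' r * (g y - g r)) \<le> M * e'"
          unfolding norm_mult using M(2) [OF r(1)] dg [OF r] M(1)
          by (intro mult_mono) (auto simp: dist_real_def)
      qed (use M e' in auto)
      then show ?thesis using that by simp
    qed
    have I: "integral {0..b} (\<lambda>r. s' r * g r) = integral {0..a} (\<lambda>r. s' r * g r)
        + integral {a..x} (\<lambda>r. s' r * g r) + integral {x..b} (\<lambda>r. s' r * g r)"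
    proof -
      have "(\<lambda>r. s' r * g r) integrable_on {p..q}" if "0 \<le> p" "q \<le> t" for p q
        by (intro integrable_continuous_interval continuous_on_subset [OF sgc]) (use that in auto)
      then show ?thesis
        using Henstock_Kurzweil_Integration.integral_combine [of 0 a b "\<lambda>r. s' r * g r"]
          Henstock_Kurzweil_Integration.integral_combine [of a x b "\<lambda>r. s' r * g r"] ab by simp
    qed
    have "\<Phi> b - \<Phi> a - s x * (g b - g a)
        = ((s b - s x) * g b - integral {x..b} (\<lambda>r. s' r * g r)) + ((s x - s a) * g a - integral {a..x} (\<lambda>r. s' r * g r))"
      unfolding \<Phi>_def I by (simp add: algebra_simps)
    also have "\<bar>\<dots>\<bar> \<le> M * e' * (b - x) + M * e' * (x - a)"
      using ab by (intro order_trans [OF abs_triangle_ineq] add_mono bd) auto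
    finally show ?thesis by (simp add: algebra_simps abs_minus_commute)
  qed
  show ?thesis
  \<comment> \<open>Both ends of a partition interval lie within \<open>d / 2\<close> of its tag, so
    the interval is shorter than \<open>d\<close>.\<close>
  proof (intro exI [of _ "d / 2"] conjI allI impI)
    show "0 < d / 2" using d by simp
    fix p assume p: "p tagged_division_of {0..t} \<and> (\<lambda>x. ball x (d / 2)) fine p"
    then have pt: "p tagged_division_of {0..t}" by simp
    note pd = tagged_division_ofD [OF pt]
    have el: "\<bar>s x * (g (Sup K) - g (Inf K)) - (\<Phi> (Sup K) - \<Phi> (Inf K))\<bar> \<le> M * e' * (Sup K - Inf K)"
      if xK: "(x, K) \<in> p" for x K
    proof -
      obtain a b where K: "K = {a..b}" using pd(4) [OF xK] by auto
      have x: "x \<in> K" "K \<subseteq> {0..t}" using pd(2,3) [OF xK] by auto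
      then have ab: "0 \<le> a" "a \<le> x" "x \<le> b" "b \<le> t" using K by auto
      have "K \<subseteq> ball x (d / 2)" using p xK by (auto simp: fine_def)
      moreover have "a \<in> K" "b \<in> K" using K ab by auto
      ultimately have "a \<in> ball x (d / 2)" "b \<in> ball x (d / 2)" by blast+
      then have "b - a < d" using ab by (simp add: dist_real_def abs_if split: if_splits)
      from piece [OF ab this] show ?thesis using K ab by simp
    qed
    have tel: "(\<Sum>(x, K)\<in>p. f (Sup K) - f (Inf K)) = f t - f 0" for f :: "real \<Rightarrow> real"
      using additive_tagged_division_1 [OF t pt] by blast
    have "\<bar>(\<Sum>(x, K)\<in>p. s x * (g (Sup K) - g (Inf K))) - (\<Phi> t - \<Phi> 0)\<bar>
        = \<bar>\<Sum>(x, K)\<in>p. s x * (g (Sup K) - g (Inf K)) - (\<Phi> (Sup K) - \<Phi> (Inf K))\<bar>"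
      unfolding tel [symmetric] sum_subtractf [symmetric] by (simp add: case_prod_unfold)
    also have "\<dots> \<le> (\<Sum>(x, K)\<in>p. M * e' * (Sup K - Inf K))"
      by (rule order_trans [OF sum_abs sum_mono]) (use el in auto)
    also have "\<dots> = M * e' * (\<Sum>(x, K)\<in>p. Sup K - Inf K)"
      by (simp add: sum_distrib_left case_prod_unfold)
    also have "\<dots> = M * e' * t" using tel [of "\<lambda>x. x"] by simp
    also have "M * e' * t = e * t / (t + 1)" using M by (simp add: e'_def)
    also have "\<dots> < e" using e t by (simp add: pos_divide_less_eq algebra_simps)
    finally show "\<bar>(\<Sum>(x, K)\<in>p. s x * (g (Sup K) - g (Inf K))) - (s t * g t - s 0 * g 0 - integral {0..t} (\<lambda>r. s' r * g r))\<bar> < e"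
      by (simp add: \<Phi>_def algebra_simps)
  qed
qed

subsection \<open>Vector-valued paths and the diffusion coefficient\<close>

lemma has_young_integral_unique:
  assumes "has_young_integral A g a b I" "has_young_integral A g a b J"
  shows "I = J"
proof (rule ccontr)
  assume "I \<noteq> J"
  define e where "e = norm (I - J) / 2"
  have e: "0 < e" using \<open>I \<noteq> J\<close> by (simp add: e_def)
  from assms(1) [unfolded has_young_integral_def, rule_format, OF e]
  obtain d1 where d1: "d1 > 0" "\<forall>p. p tagged_division_of {a..b} \<and> (\<lambda>x. ball x d1) fine p \<longrightarrow>
      norm ((\<Sum>(x, K)\<in>p. A x *v (g (Sup K) - g (Inf K))) - I) < e"
    by (elim exE conjE)
  from assms(2) [unfolded has_young_integral_def, rule_format, OF e]
  obtain d2 where d2: "d2 > 0" "\<forall>p. p tagged_division_of {a..b} \<and> (\<lambda>x. ball x d2) fine p \<longrightarrow>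
      norm ((\<Sum>(x, K)\<in>p. A x *v (g (Sup K) - g (Inf K))) - J) < e"
    by (elim exE conjE)
  have "gauge (\<lambda>x::real. ball x (min d1 d2))" using d1 d2 by (intro gauge_ball) auto
  then obtain p where p: "p tagged_division_of {a..b}" "(\<lambda>x. ball x (min d1 d2)) fine p"
    by (rule fine_division_exists_real)
  have "(\<lambda>x. ball x d1) fine p" "(\<lambda>x. ball x d2) fine p"
    using p(2) by (auto simp: fine_def subset_iff)
  from d1(2) [rule_format, OF conjI, OF p(1) this(1)] d2(2) [rule_format, OF conjI, OF p(1) this(2)]
  have "norm (I - J) < 2 * e" by norm
  then show False by (simp add: e_def)
qed

lemma diag_mult: "(diag v *v w) $ i = v $ i * w $ i"
  by (simp add: diag_def matrix_vector_mult_def if_distrib if_distribR sum.delta cong: if_cong)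

lemma has_young_integral_diag:
  fixes \<sigma> \<sigma>' g :: "real \<Rightarrow> real ^ 'n::finite"
  assumes t: "0 \<le> t" and s: "\<And>i x. x \<in> {0..t} \<Longrightarrow> ((\<lambda>x. \<sigma> x $ i) has_real_derivative \<sigma>' x $ i) (at x within {0..t})"
    and s': "\<And>i. continuous_on {0..t} (\<lambda>x. \<sigma>' x $ i)" and g: "\<And>i. continuous_on {0..t} (\<lambda>x. g x $ i)"
  shows "has_young_integral (\<lambda>x. diag (\<sigma> x)) g 0 t
    (\<chi> i. \<sigma> t $ i * g t $ i - \<sigma> 0 $ i * g 0 $ i - integral {0..t} (\<lambda>r. \<sigma>' r $ i * g r $ i))"
    (is "has_young_integral _ _ _ _ ?I")
  unfolding has_young_integral_def
proof (intro allI impI)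
  fix e :: real assume "0 < e"
  define e' where "e' = e / real CARD('n)"
  have e': "0 < e'" using \<open>0 < e\<close> by (simp add: e'_def)
  have "\<exists>d>0. \<forall>p. p tagged_division_of {0..t} \<and> (\<lambda>x. ball x d) fine p \<longrightarrow>
    \<bar>(\<Sum>(x, K)\<in>p. \<sigma> x $ i * (g (Sup K) $ i - g (Inf K) $ i)) - ?I $ i\<bar> < e'" for i
    using Riemann_Stieltjes_by_parts [OF t s s' g e', of i] by (simp only: vec_lambda_beta)
  then have "\<forall>i. \<exists>d. d > 0 \<and> (\<forall>p. p tagged_division_of {0..t} \<and> (\<lambda>x. ball x d) fine p \<longrightarrow>
    \<bar>(\<Sum>(x, K)\<in>p. \<sigma> x $ i * (g (Sup K) $ i - g (Inf K) $ i)) - ?I $ i\<bar> < e')" by blast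
  from choice [OF this] obtain D where D: "\<And>i. 0 < D i" "\<And>i p. p tagged_division_of {0..t} \<Longrightarrow> (\<lambda>x. ball x (D i)) fine p \<Longrightarrow>
    \<bar>(\<Sum>(x, K)\<in>p. \<sigma> x $ i * (g (Sup K) $ i - g (Inf K) $ i)) - ?I $ i\<bar> < e'"
    by blast
  define d where "d = Min (range D)"
  have d: "0 < d" "\<And>i. d \<le> D i" using D(1) by (auto simp: d_def)
  show "\<exists>d>0. \<forall>p. p tagged_division_of {0..t} \<and> (\<lambda>x. ball x d) fine p \<longrightarrow>
      norm ((\<Sum>(x, K)\<in>p. diag (\<sigma> x) *v (g (Sup K) - g (Inf K))) - ?I) < e"
  proof (intro exI [of _ d] conjI d allI impI)
    fix p assume p: "p tagged_division_of {0..t} \<and> (\<lambda>x. ball x d) fine p"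
    let ?S = "(\<Sum>(x, K)\<in>p. diag (\<sigma> x) *v (g (Sup K) - g (Inf K))) - ?I"
    have "\<bar>?S $ i\<bar> < e'" for i
    proof -
      have "(\<lambda>x. ball x (D i)) fine p" using p d(2) [of i] by (force simp: fine_def)
      from D(2) [OF _ this] p show ?thesis
        by (simp add: sum_component case_prod_unfold diag_mult)
    qed
    then have "(\<Sum>i\<in>UNIV. \<bar>?S $ i\<bar>) < (\<Sum>i\<in>(UNIV :: 'n set). e')"
      by (intro sum_strict_mono) auto
    also have "\<dots> = e" by (simp add: e'_def)
    finally show "norm ?S < e" using norm_le_l1_cart [of ?S] by linarith
  qed
qed

text \<open>This is the form in which the scalar results apply: Borel on the whole line and zero off
  the open interval. \<open>L2\<close> only asks for Lebesgue measurability on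
  \<open>{0..T}\<close>, so its elements enter through such representatives.\<close>

definition regular :: "real \<Rightarrow> (real \<Rightarrow> real ^ 'n::finite) \<Rightarrow> bool" where
  "regular T u \<longleftrightarrow> (\<forall>i. sq_integrable (\<lambda>s. u s $ i)) \<and> (\<forall>s. s \<notin> {0<..<T} \<longrightarrow> u s = 0)"

lemma regular_component: "regular T u \<Longrightarrow> sq_integrable (\<lambda>s. u s $ i)"
  by (simp add: regular_def)

lemma borel_measurable_vec_component:
  fixes f :: "'a \<Rightarrow> real ^ 'n::finite"
  assumes "f \<in> borel_measurable M"
  shows "(\<lambda>x. f x $ i) \<in> borel_measurable M"
  by (rule measurable_compose [OF assms])
    (intro borel_measurable_continuous_onI continuous_intros)

lemma borel_measurable_vecI:
  fixes f :: "'a \<Rightarrow> real ^ 'n::finite"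
  assumes "\<And>i. (\<lambda>x. f x $ i) \<in> borel_measurable M"
  shows "f \<in> borel_measurable M"
proof -
  have "f = (\<lambda>x. \<Sum>i\<in>UNIV. f x $ i *\<^sub>R axis i 1)"
    by (auto simp: vec_eq_iff axis_def if_distrib sum.delta cong: if_cong)
  also have "\<dots> \<in> borel_measurable M" using assms by measurable
  finally show ?thesis .
qed

lemma regular_measurable:
  assumes "regular T u"
  shows "u \<in> borel_measurable borel"
  by (rule borel_measurable_vecI) (use assms in \<open>auto simp: regular_def sq_integrable_def\<close>)

lemma norm_square_cart: "(norm x)\<^sup>2 = (\<Sum>i\<in>UNIV. (x $ i)\<^sup>2)" for x :: "real ^ 'n::finite"
  by (simp add: norm_vec_def L2_set_def sum_nonneg)

lemma regular_L2:
  assumes u: "regular T u"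
  shows "u \<in> L2 T"
proof -
  have [measurable]: "u \<in> borel_measurable borel" by (rule regular_measurable [OF u])
  have i: "integrable lborel (\<lambda>s. indicator {0..T} s *\<^sub>R (norm (u s))\<^sup>2)"
    unfolding norm_square_cart
    using regular_component [OF u] by (intro integrable_mult_indicator Bochner_Integration.integrable_sum) auto
  have m: "(\<lambda>s. indicator {0..T} s *\<^sub>R (norm (u s))\<^sup>2) \<in> borel_measurable lborel" by measurable
  have m2: "(\<lambda>s. indicator {0..T} s *\<^sub>R u s) \<in> borel_measurable lborel" by measurable
  show ?thesis
    using i integrable_completion [OF m] measurable_completion [OF m2]
    by (simp add: L2_def set_borel_measurable_def set_integrable_def)
qed

lemma L2_sqnorm_regular:
  assumes u: "regular T u"
  shows "L2_sqnorm t u = (\<Sum>i\<in>UNIV. energy (\<lambda>s. u s $ i) t)"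
proof -
  have [measurable]: "u \<in> borel_measurable borel" by (rule regular_measurable [OF u])
  have m: "(\<lambda>s. indicator {0..t} s *\<^sub>R (norm (u s))\<^sup>2) \<in> borel_measurable lborel" by measurable
  have "L2_sqnorm t u = (\<integral>s. indicator {0..t} s *\<^sub>R (norm (u s))\<^sup>2 \<partial>lborel)"
    using integral_completion [OF m] by (simp add: L2_sqnorm_def set_lebesgue_integral_def)
  also have "\<dots> = (\<integral>s. (\<Sum>i\<in>UNIV. indicator {0<..<t} s * (u s $ i)\<^sup>2) \<partial>lborel)"
  proof (rule integral_cong_AE)
    show "(\<lambda>s. \<Sum>i\<in>UNIV. indicator {0<..<t} s * (u s $ i)\<^sup>2) \<in> borel_measurable lborel"
      using borel_measurable_vec_component [of u borel] by measurable
    show "AE s in lborel. indicator {0..t} s *\<^sub>R (norm (u s))\<^sup>2 = (\<Sum>i\<in>UNIV. indicator {0<..<t} s * (u s $ i)\<^sup>2)"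
      using AE_lborel_singleton [of t] AE_lborel_singleton [of 0]
      by eventually_elim (auto simp: indicator_def norm_square_cart)
  qed measurable
  also have "\<dots> = (\<Sum>i\<in>UNIV. energy (\<lambda>s. u s $ i) t)"
    unfolding energy_def
    by (rule Bochner_Integration.integral_sum) (rule energy_integrable [OF regular_component [OF u]])
  finally show ?thesis .
qed

text \<open>A function measurable for the completion agrees almost everywhere with a Borel one,
  component by component. Cutting off to the open interval discards only the two end points, a null
  set.\<close>

lemma L2_representative:
  fixes u :: "real \<Rightarrow> real ^ 'n::finite"
  assumes u: "u \<in> L2 T"
  obtains u' where "regular T u'" "AE s in lebesgue. s \<in> {0<..<T} \<longrightarrow> u' s = u s"
proof -
  have m: "(\<lambda>s. indicator {0..T} s *\<^sub>R u s) \<in> borel_measurable lebesgue"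
    and I: "integrable lebesgue (\<lambda>s. indicator {0..T} s *\<^sub>R (norm (u s))\<^sup>2)"
    using u by (auto simp: L2_def set_borel_measurable_def set_integrable_def)
  have "\<exists>g. g \<in> borel_measurable lborel \<and> (AE s in lborel. (indicator {0..T} s *\<^sub>R u s) $ i = g s)" for i
    using completion_ex_borel_measurable_real [OF borel_measurable_vec_component [OF m, of i]] by auto
  then obtain g where gm [measurable]: "\<And>i. g i \<in> borel_measurable lborel"
    and g: "\<And>i. AE s in lborel. (indicator {0..T} s *\<^sub>R u s) $ i = g i s"
    by metis
  define u' where "u' s = (\<chi> i. indicator {0<..<T} s * g i s)" for s
  have "AE s in lborel. \<forall>i\<in>UNIV. (indicator {0..T} s *\<^sub>R u s) $ i = g i s"
    using g by (intro AE_finite_allI) auto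
  then have "AE s in lborel. s \<in> {0<..<T} \<longrightarrow> u' s = u s"
    by eventually_elim (auto simp: u'_def vec_eq_iff)
  then have eq: "AE s in lebesgue. s \<in> {0<..<T} \<longrightarrow> u' s = u s"
    by (rule AE_completion)
  have "sq_integrable (\<lambda>s. u' s $ i)" for i
    unfolding sq_integrable_def
  proof
    show mi: "(\<lambda>s. u' s $ i) \<in> borel_measurable borel"
      using gm [of i] by (simp add: u'_def)
    have "integrable lebesgue (\<lambda>s. (u' s $ i)\<^sup>2)"
    proof (rule Bochner_Integration.integrable_bound [OF I])
      show "AE s in lebesgue. norm ((u' s $ i)\<^sup>2) \<le> norm (indicator {0..T} s *\<^sub>R (norm (u s))\<^sup>2)"
        using eq
      proof eventually_elim
        case (elim s)
        have "(u s $ i)\<^sup>2 \<le> (norm (u s))\<^sup>2"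
          using component_le_norm_cart [of "u s" i] by (metis abs_ge_zero power2_abs power_mono)
        moreover have "u' s = 0" if "s \<notin> {0<..<T}" using that by (simp add: u'_def vec_eq_iff)
        ultimately show ?case using elim by (cases "s \<in> {0<..<T}") auto
      qed
    qed (use mi in \<open>auto intro: measurable_completion\<close>)
    then show "integrable lborel (\<lambda>s. (u' s $ i)\<^sup>2)"
      using mi by (subst (asm) integrable_completion) auto
  qed
  then have "regular T u'" by (auto simp: regular_def u'_def vec_eq_iff)
  then show ?thesis using eq that by blast
qed

lemma L2_sqnorm_cong_AE:
  assumes u: "u \<in> L2 T" and v: "v \<in> L2 T" and eq: "AE s in lebesgue. s \<in> {0<..<T} \<longrightarrow> u s = v s"
    and t: "t \<le> T"
  shows "L2_sqnorm t u = L2_sqnorm t v"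
  unfolding L2_sqnorm_def set_lebesgue_integral_def
proof (rule integral_cong_AE)
  have m: "(\<lambda>s. indicator {0..t} s *\<^sub>R (norm (w s))\<^sup>2) \<in> borel_measurable lebesgue" if "w \<in> L2 T" for w :: "real \<Rightarrow> real ^ 'a"
  proof -
    have "(\<lambda>s. indicator {0..T} s *\<^sub>R (norm (w s))\<^sup>2) \<in> borel_measurable lebesgue"
      using that by (auto simp: L2_def set_integrable_def dest: borel_measurable_integrable)
    then have "(\<lambda>s. indicator {0..t} s *\<^sub>R (indicator {0..T} s *\<^sub>R (norm (w s))\<^sup>2)) \<in> borel_measurable lebesgue"
      by (rule borel_measurable_scaleR [rotated]) (rule borel_measurable_indicator, simp)
    also have "(\<lambda>s. indicator {0..t} s *\<^sub>R (indicator {0..T} s *\<^sub>R (norm (w s))\<^sup>2)) = (\<lambda>s. indicator {0..t} s *\<^sub>R (norm (w s))\<^sup>2)"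
      using t by (auto simp: indicator_def)
    finally show ?thesis .
  qed
  show "(\<lambda>s. indicator {0..t} s *\<^sub>R (norm (u s))\<^sup>2) \<in> borel_measurable lebesgue"
    "(\<lambda>s. indicator {0..t} s *\<^sub>R (norm (v s))\<^sup>2) \<in> borel_measurable lebesgue"
    using m u v by auto
  have "AE s in lebesgue. s \<noteq> T" "AE s in lebesgue. s \<noteq> 0"
    using AE_completion [OF AE_lborel_singleton] by auto
  then show "AE s in lebesgue. indicator {0..t} s *\<^sub>R (norm (u s))\<^sup>2 = indicator {0..t} s *\<^sub>R (norm (v s))\<^sup>2"
    using eq by eventually_elim (use t in \<open>auto simp: indicator_def\<close>)
qed

lemma K_kernel_measurable:
  "(\<lambda>s. indicator {0<..<t} s * K_kernel H t s) \<in> borel_measurable borel"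
proof -
  let ?k = "\<lambda>s. indicator {0<..<t} s * (c_H H *
    (t powr (H - 1/2) * weighted_kernel (H - 1/2) t s - (H - 1/2) * inner_kernel (H - 1/2) t s))"
  have "?k \<in> borel_measurable borel" unfolding inner_kernel_def by measurable
  also have "?k = (\<lambda>s. indicator {0<..<t} s * K_kernel H t s)"
    using K_kernel_eq [of _ t H] by (auto simp: indicator_def fun_eq_iff)
  finally show ?thesis .
qed

lemma K_op_cong_AE:
  fixes u v :: "real \<Rightarrow> real ^ 'n::finite"
  assumes u: "u \<in> L2 T" and v: "v \<in> L2 T" and eq: "AE s in lebesgue. s \<in> {0<..<T} \<longrightarrow> u s = v s"
    and t: "t \<le> T"
  shows "K_op H u t = K_op H v t"
  unfolding K_op_def set_lebesgue_integral_def
proof (rule integral_cong_AE)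
  have m: "(\<lambda>s. indicator {0<..<t} s *\<^sub>R K_kernel H t s *\<^sub>R w s) \<in> borel_measurable lebesgue" if "w \<in> L2 T" for w :: "real \<Rightarrow> real ^ 'n"
  proof -
    have "(\<lambda>s. indicator {0..T} s *\<^sub>R w s) \<in> borel_measurable lebesgue"
      using that by (auto simp: L2_def set_borel_measurable_def)
    then have "(\<lambda>s. (indicator {0<..<t} s * K_kernel H t s) *\<^sub>R (indicator {0..T} s *\<^sub>R w s)) \<in> borel_measurable lebesgue"
      by (rule borel_measurable_scaleR [rotated]) (use K_kernel_measurable [of t H] in \<open>auto intro: measurable_completion\<close>)
    also have "(\<lambda>s. (indicator {0<..<t} s * K_kernel H t s) *\<^sub>R (indicator {0..T} s *\<^sub>R w s))
        = (\<lambda>s. indicator {0<..<t} s *\<^sub>R K_kernel H t s *\<^sub>R w s)"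
      using t by (auto simp: indicator_def)
    finally show ?thesis .
  qed
  show "(\<lambda>s. indicator {0<..<t} s *\<^sub>R K_kernel H t s *\<^sub>R u s) \<in> borel_measurable lebesgue"
    "(\<lambda>s. indicator {0<..<t} s *\<^sub>R K_kernel H t s *\<^sub>R v s) \<in> borel_measurable lebesgue"
    using m u v by auto
  show "AE s in lebesgue. indicator {0<..<t} s *\<^sub>R K_kernel H t s *\<^sub>R u s = indicator {0<..<t} s *\<^sub>R K_kernel H t s *\<^sub>R v s"
    using eq by eventually_elim (use t in \<open>auto simp: indicator_def\<close>)
qed

lemma K_op_component:
  fixes u :: "real \<Rightarrow> real ^ 'n::finite"
  assumes H: "0 < H" "H < 1" and u: "regular T u"
  shows "K_op H u t $ i = K_scalar H (\<lambda>s. u s $ i) t"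
proof -
  have um [measurable]: "u \<in> borel_measurable borel" by (rule regular_measurable [OF u])
  let ?f = "\<lambda>s. indicator {0<..<t} s *\<^sub>R K_kernel H t s *\<^sub>R u s"
  have comp: "?f s $ j = indicator {0<..<t} s * (K_kernel H t s * u s $ j)" for s j by simp
  have fm: "?f \<in> borel_measurable lborel"
    using borel_measurable_scaleR [OF K_kernel_measurable [of t H] um] by simp
  have I: "integrable lborel (\<lambda>s. ?f s $ j)" for j
    unfolding comp by (rule integrable_K_scalar [OF H regular_component [OF u]])
  have fe: "?f = (\<lambda>s. \<Sum>j\<in>UNIV. (?f s $ j) *\<^sub>R axis j 1)"
    by (auto simp: vec_eq_iff axis_def if_distrib sum.delta cong: if_cong)
  have fI: "integrable lborel ?f"
    by (subst fe, intro Bochner_Integration.integrable_sum integrable_scaleR_left I)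
  have "K_op H u t = integral\<^sup>L lborel ?f"
    using integral_completion [OF fm] by (simp add: K_op_def set_lebesgue_integral_def)
  then have "K_op H u t $ i = (\<integral>s. ?f s $ i \<partial>lborel)"
    using integral_bounded_linear [OF bounded_linear_vec_nth fI, of i] by simp
  then show ?thesis unfolding comp K_scalar_def .
qed

section \<open>The operator with diffusion coefficient\<close>

locale cameron_martin =
  fixes H T m M :: real and \<sigma> \<sigma>' :: "real \<Rightarrow> real ^ 'n::finite"
  assumes H: "0 < H" "H < 1" and T: "0 < T" and m: "0 < m"
    and \<sigma>_bounds: "\<And>t i. t \<in> {0..T} \<Longrightarrow> m \<le> \<sigma> t $ i \<and> \<sigma> t $ i \<le> M"
    and \<sigma>_deriv: "\<And>t i. t \<in> {0..T} \<Longrightarrow> ((\<lambda>s. \<sigma> s $ i) has_real_derivative \<sigma>' t $ i) (at t within {0..T})"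
    and \<sigma>'_cont: "\<And>i. continuous_on {0..T} (\<lambda>s. \<sigma>' s $ i)"
    and \<sigma>'_bound: "\<And>t i. t \<in> {0..T} \<Longrightarrow> \<bar>\<sigma>' t $ i\<bar> \<le> M"

lemma admissible_diffusion_cameron_martin:
  fixes \<sigma> :: "real \<Rightarrow> real ^ 'n::finite"
  assumes "admissible_diffusion T \<sigma>" "0 < H" "H < 1" "0 < T"
  obtains m M \<sigma>' where "cameron_martin H T m M \<sigma> \<sigma>'"
proof -
  have "\<forall>i. \<exists>s'. (\<forall>t\<in>{0..T}. ((\<lambda>s. \<sigma> s $ i) has_real_derivative s' t) (at t within {0..T})) \<and> continuous_on {0..T} s'"
    using assms(1) by (simp add: admissible_diffusion_def)
  from choice [OF this] obtain s' where s': "\<And>i t. t \<in> {0..T} \<Longrightarrow> ((\<lambda>s. \<sigma> s $ i) has_real_derivative s' i t) (at t within {0..T})"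
    "\<And>i. continuous_on {0..T} (s' i)" by blast
  have "\<forall>i. \<exists>mM. 0 < fst mM \<and> (\<forall>t\<in>{0..T}. fst mM \<le> \<sigma> t $ i \<and> \<sigma> t $ i \<le> snd mM)"
    using assms(1) by (simp add: admissible_diffusion_def)
  from choice [OF this] obtain mM where mM: "\<And>i. 0 < fst (mM i)"
    "\<And>i t. t \<in> {0..T} \<Longrightarrow> fst (mM i) \<le> \<sigma> t $ i \<and> \<sigma> t $ i \<le> snd (mM i)" by blast
  have "\<forall>i. \<exists>B. \<forall>t\<in>{0..T}. \<bar>s' i t\<bar> \<le> B"
  proof
    fix i
    have "bounded (s' i ` {0..T})" by (intro compact_imp_bounded compact_continuous_image s') auto
    then show "\<exists>B. \<forall>t\<in>{0..T}. \<bar>s' i t\<bar> \<le> B" by (simp add: bounded_iff)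
  qed
  from choice [OF this] obtain B where B: "\<And>i t. t \<in> {0..T} \<Longrightarrow> \<bar>s' i t\<bar> \<le> B i" by blast
  define m where "m = Min (range (\<lambda>i. fst (mM i)))"
  define M where "M = Max (range (\<lambda>i. max (snd (mM i)) (B i)))"
  have m: "0 < m" "\<And>i. m \<le> fst (mM i)" using mM(1) by (auto simp: m_def)
  have M: "snd (mM i) \<le> M" "B i \<le> M" for i
  proof -
    have "max (snd (mM i)) (B i) \<le> M" unfolding M_def by (intro Max_ge) auto
    then show "snd (mM i) \<le> M" "B i \<le> M" by auto
  qed
  have bounds: "m \<le> \<sigma> t $ i \<and> \<sigma> t $ i \<le> M" "\<bar>s' i t\<bar> \<le> M" if "t \<in> {0..T}" for t i
    using mM(2) [OF that, of i] m(2) [of i] M [of i] B [OF that, of i] by linarith+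
  have "cameron_martin H T m M \<sigma> (\<lambda>t. \<chi> i. s' i t)"
    by unfold_locales (use assms(2-4) m(1) bounds s' in simp_all)
  then show ?thesis by (rule that)
qed

context cameron_martin
begin

text \<open>The Young integral of the \<open>i\<close>-th diffusion coefficient against a path
  \<open>g\<close> with \<open>g 0 = 0\<close>, after integration by parts.\<close>

definition sigma_op :: "'n \<Rightarrow> (real \<Rightarrow> real) \<Rightarrow> real \<Rightarrow> real" where
  "sigma_op i g t = \<sigma> t $ i * g t - integral {0..t} (\<lambda>r. \<sigma>' r $ i * g r)"

lemma \<sigma>_cont: "continuous_on {0..T} (\<lambda>s. \<sigma> s $ i)"
  using \<sigma>_deriv by (intro DERIV_continuous_on)

lemma M_pos: "0 < M"
  using \<sigma>_bounds [of 0] T m by force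

lemma \<sigma>_pos: "t \<in> {0..T} \<Longrightarrow> 0 < \<sigma> t $ i"
  using \<sigma>_bounds [of t i] m by linarith

lemma \<sigma>_abs: "t \<in> {0..T} \<Longrightarrow> \<bar>\<sigma> t $ i\<bar> \<le> M"
  using \<sigma>_bounds [of t i] m by linarith

lemma sigma_op_integrable:
  assumes "continuous_on {0..T} g" "0 \<le> s" "t \<le> T"
  shows "(\<lambda>r. \<sigma>' r $ i * g r) integrable_on {s..t}"
  by (intro integrable_continuous_interval continuous_intros continuous_on_subset [OF \<sigma>'_cont]
      continuous_on_subset [OF assms(1)]) (use assms in auto)

lemma sigma_op_cont:
  assumes g: "continuous_on {0..T} g"
  shows "continuous_on {0..T} (sigma_op i g)"
  unfolding sigma_op_def
  by (intro continuous_on_diff continuous_on_mult \<sigma>_cont g indefinite_integral_continuous_1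
      sigma_op_integrable) auto

lemma sigma_op_integral_bound:
  assumes g: "continuous_on {0..T} g" and st: "0 \<le> s" "s \<le> t" "t \<le> T" and B: "\<And>r. r \<in> {0..t} \<Longrightarrow> \<bar>g r\<bar> \<le> B"
  shows "\<bar>integral {s..t} (\<lambda>r. \<sigma>' r $ i * g r)\<bar> \<le> M * B * (t - s)"
proof -
  have "norm (integral {s..t} (\<lambda>r. \<sigma>' r $ i * g r)) \<le> M * B * (t - s)"
  proof (rule integral_bound)
    show "continuous_on {s..t} (\<lambda>r. \<sigma>' r $ i * g r)"
      by (intro continuous_intros continuous_on_subset [OF \<sigma>'_cont] continuous_on_subset [OF g]) (use st in auto)
    fix r assume "r \<in> {s..t}"
    then show "norm (\<sigma>' r $ i * g r) \<le> M * B"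
      unfolding norm_mult using \<sigma>'_bound [of r i] B [of r] st M_pos by (intro mult_mono) auto
  qed (use st in auto)
  then show ?thesis by simp
qed

lemma sigma_op_bound:
  assumes g: "continuous_on {0..T} g" and t: "t \<in> {0..T}" and B: "\<And>r. r \<in> {0..t} \<Longrightarrow> \<bar>g r\<bar> \<le> B"
  shows "\<bar>sigma_op i g t\<bar> \<le> M * (1 + T) * B"
proof -
  have B0: "0 \<le> B" using B [of 0] t by force
  have "\<bar>sigma_op i g t\<bar> \<le> \<bar>\<sigma> t $ i * g t\<bar> + \<bar>integral {0..t} (\<lambda>r. \<sigma>' r $ i * g r)\<bar>"
    unfolding sigma_op_def by (rule abs_triangle_ineq4)
  also have "\<dots> \<le> M * B + M * B * (t - 0)"
    using \<sigma>_abs [OF t, of i] B [of t] t M_pos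
    by (intro add_mono sigma_op_integral_bound g B) (auto simp: abs_mult intro!: mult_mono)
  also have "\<dots> \<le> M * B + M * B * T" using M_pos B0 t by (intro add_left_mono mult_left_mono) auto
  finally show ?thesis by (simp add: algebra_simps)
qed

lemma sigma_op_increment:
  assumes g: "continuous_on {0..T} g" and st: "0 \<le> s" "s \<le> t" "t \<le> T" and B: "\<And>r. r \<in> {0..t} \<Longrightarrow> \<bar>g r\<bar> \<le> B"
    and inc: "\<bar>g t - g s\<bar> \<le> L * sqrt (t - s)"
  shows "\<bar>sigma_op i g t - sigma_op i g s\<bar> \<le> M * (L + 2 * sqrt T * B) * sqrt (t - s)"
proof -
  have B0: "0 \<le> B" using B [of 0] st by force
  \<comment> \<open>The contributions of the diffusion coefficient are linear in
    \<open>t - s\<close>; this absorbs them into the Hoelder-1/2 estimate.\<close>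
  have ts: "t - s \<le> sqrt T * sqrt (t - s)"
  proof -
    have "t - s = sqrt (t - s) * sqrt (t - s)" using st by simp
    also have "\<dots> \<le> sqrt T * sqrt (t - s)" using st by (intro mult_right_mono) auto
    finally show ?thesis .
  qed
  have sig: "\<bar>\<sigma> t $ i - \<sigma> s $ i\<bar> \<le> M * (t - s)"
  proof -
    have "norm (\<sigma> t $ i - \<sigma> s $ i) \<le> M * norm (t - s)"
      by (rule field_differentiable_bound [of "{0..T}" "\<lambda>s. \<sigma> s $ i" "\<lambda>r. \<sigma>' r $ i"])
        (use \<sigma>_deriv \<sigma>'_bound st in auto)
    then show ?thesis using st by simp
  qed
  have "integral {0..t} (\<lambda>r. \<sigma>' r $ i * g r) = integral {0..s} (\<lambda>r. \<sigma>' r $ i * g r) + integral {s..t} (\<lambda>r. \<sigma>' r $ i * g r)"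
    using Henstock_Kurzweil_Integration.integral_combine [OF st(1,2) sigma_op_integrable [OF g order_refl st(3)]] by simp
  then have "sigma_op i g t - sigma_op i g s
      = \<sigma> t $ i * (g t - g s) + (\<sigma> t $ i - \<sigma> s $ i) * g s - integral {s..t} (\<lambda>r. \<sigma>' r $ i * g r)"
    by (simp add: sigma_op_def algebra_simps)
  also have "\<bar>\<dots>\<bar> \<le> \<bar>\<sigma> t $ i * (g t - g s)\<bar> + \<bar>(\<sigma> t $ i - \<sigma> s $ i) * g s\<bar> + \<bar>integral {s..t} (\<lambda>r. \<sigma>' r $ i * g r)\<bar>"
    by linarith
  also have "\<dots> \<le> M * (L * sqrt (t - s)) + M * (t - s) * B + M * B * (t - s)"
    using \<sigma>_abs [of t i] st inc sig B [of s] M_pos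
    by (intro add_mono sigma_op_integral_bound g B) (auto simp: abs_mult intro!: mult_mono)
  also have "\<dots> = M * (L * sqrt (t - s)) + 2 * (M * B) * (t - s)" by simp
  also have "\<dots> \<le> M * (L * sqrt (t - s)) + 2 * (M * B) * (sqrt T * sqrt (t - s))"
    using ts M_pos B0 by (intro add_left_mono mult_left_mono) auto
  finally show ?thesis by (simp add: algebra_simps)
qed

lemma sigma_op_primitive_deriv:
  assumes g: "continuous_on {0..T} g" and t: "t \<in> {0..T}"
  shows "((\<lambda>t. integral {0..t} (\<lambda>r. \<sigma>' r $ i * g r)) has_real_derivative \<sigma>' t $ i * g t) (at t within {0..T})"
  unfolding has_real_derivative_iff_has_vector_derivative
  by (rule integral_has_vector_derivative [OF _ t]) (intro continuous_intros \<sigma>'_cont g)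

text \<open>If the operator gives zero, then \<open>g\<close> is \<open>h\<close> divided by the
  coefficient, where \<open>h\<close> has derivative \<open>\<sigma>' t $ i * g t\<close>. The
  quotient rule makes this quotient constant, and it starts at 0.\<close>

lemma sigma_op_inj:
  assumes g: "continuous_on {0..T} g" and z: "\<And>t. t \<in> {0..T} \<Longrightarrow> sigma_op i g t = 0" and t: "t \<in> {0..T}"
  shows "g t = 0"
proof -
  define h where "h t = integral {0..t} (\<lambda>r. \<sigma>' r $ i * g r)" for t
  have gh: "g t = h t / \<sigma> t $ i" if "t \<in> {0..T}" for t
    using z [OF that] \<sigma>_pos [OF that, of i] by (simp add: sigma_op_def h_def field_simps)
  have "((\<lambda>t. h t / \<sigma> t $ i) has_real_derivative 0) (at t within {0..T})" if t: "t \<in> {0..T}" for t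
  proof -
    have "((\<lambda>t. h t / \<sigma> t $ i) has_real_derivative
        ((\<sigma>' t $ i * g t) * \<sigma> t $ i - h t * \<sigma>' t $ i) / (\<sigma> t $ i * \<sigma> t $ i)) (at t within {0..T})"
      unfolding h_def using \<sigma>_pos [OF t, of i]
      by (intro DERIV_divide sigma_op_primitive_deriv g t \<sigma>_deriv) auto
    also have "(\<sigma>' t $ i * g t) * \<sigma> t $ i - h t * \<sigma>' t $ i = 0"
      using gh [OF t] \<sigma>_pos [OF t, of i] by simp
    finally show ?thesis by simp
  qed
  then obtain c where c: "\<And>t. t \<in> {0..T} \<Longrightarrow> h t / \<sigma> t $ i = c"
    using has_field_derivative_zero_constant [of "{0..T}" "\<lambda>t. h t / \<sigma> t $ i"] by auto
  have "c = 0" using c [of 0] T by (simp add: h_def)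
  then show ?thesis using gh [OF t] c [OF t] by simp
qed

text \<open>Integrating against \<open>g\<close> with \<open>g' = f / \<sigma>\<close> restores
  \<open>f\<close>; both sides vanish at 0 and have the same derivative. This supplies the preimage
  of a primitive under \<open>sigma_op\<close>.\<close>

lemma sigma_op_integral:
  assumes f: "continuous_on {0..T} f" and g: "\<And>t. t \<in> {0..T} \<Longrightarrow> g t = integral {0..t} (\<lambda>r. f r / \<sigma> r $ i)"
    and t: "t \<in> {0..T}"
  shows "sigma_op i g t = integral {0..t} f"
proof -
  let ?G = "\<lambda>t. integral {0..t} (\<lambda>r. f r / \<sigma> r $ i)"
  have fs: "continuous_on {0..T} (\<lambda>r. f r / \<sigma> r $ i)"
    using \<sigma>_pos [THEN less_imp_neq] by (intro continuous_on_divide f \<sigma>_cont) (auto dest: sym)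
  have G: "continuous_on {0..T} ?G"
    by (intro indefinite_integral_continuous_1 integrable_continuous_interval fs)
  let ?h = "\<lambda>t. \<sigma> t $ i * ?G t - integral {0..t} (\<lambda>r. \<sigma>' r $ i * ?G r) - integral {0..t} f"
  have "(?h has_real_derivative 0) (at t within {0..T})" if t: "t \<in> {0..T}" for t
  proof -
    have dG: "(?G has_real_derivative f t / \<sigma> t $ i) (at t within {0..T})"
      unfolding has_real_derivative_iff_has_vector_derivative
      by (rule integral_has_vector_derivative [OF fs t])
    have df: "((\<lambda>t. integral {0..t} f) has_real_derivative f t) (at t within {0..T})"
      unfolding has_real_derivative_iff_has_vector_derivative
      by (rule integral_has_vector_derivative [OF f t])
    have "(?h has_real_derivative ((\<sigma>' t $ i * ?G t + f t / \<sigma> t $ i * \<sigma> t $ i) - \<sigma>' t $ i * ?G t - f t)) (at t within {0..T})"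
      by (intro DERIV_diff DERIV_mult \<sigma>_deriv t dG df sigma_op_primitive_deriv G)
    then show ?thesis using \<sigma>_pos [OF t, of i] by simp
  qed
  then obtain c where c: "\<And>t. t \<in> {0..T} \<Longrightarrow> ?h t = c"
    using has_field_derivative_zero_constant [of "{0..T}" ?h] by auto
  have "c = 0" using c [of 0] T by simp
  moreover have "sigma_op i g t = sigma_op i ?G t"
  proof -
    have "integral {0..t} (\<lambda>r. \<sigma>' r $ i * g r) = integral {0..t} (\<lambda>r. \<sigma>' r $ i * ?G r)"
      by (rule integral_cong) (use g t in auto)
    then show ?thesis using g [OF t] by (simp add: sigma_op_def)
  qed
  ultimately show ?thesis using c [OF t] by (simp add: sigma_op_def)
qed

lemma K_op_0: "K_op H u 0 = (0 :: real ^ 'n)"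
  by (simp add: K_op_def set_lebesgue_integral_def)

lemma K_sigma_regular:
  assumes u: "regular T u" and t: "t \<in> {0..T}"
  shows "K_sigma H \<sigma> u t $ i = sigma_op i (K_scalar H (\<lambda>s. u s $ i)) t"
proof -
  have g: "continuous_on {0..t} (\<lambda>x. K_op H u x $ j)" for j
    unfolding K_op_component [OF H u]
    by (rule continuous_on_subset [OF continuous_on_K_scalar [OF H regular_component [OF u], of T]]) (use t in auto)
  have Y: "has_young_integral (\<lambda>x. diag (\<sigma> x)) (K_op H u) 0 t
    (\<chi> i. \<sigma> t $ i * K_op H u t $ i - \<sigma> 0 $ i * K_op H u 0 $ i - integral {0..t} (\<lambda>r. \<sigma>' r $ i * K_op H u r $ i))"
  proof (rule has_young_integral_diag)
    fix i x assume "x \<in> {0..t}"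
    then show "((\<lambda>x. \<sigma> x $ i) has_real_derivative \<sigma>' x $ i) (at x within {0..t})"
      using \<sigma>_deriv [of x i] t by (auto intro: DERIV_subset)
  qed (use t g continuous_on_subset [OF \<sigma>'_cont] in auto)
  have "K_sigma H \<sigma> u t =
    (\<chi> i. \<sigma> t $ i * K_op H u t $ i - \<sigma> 0 $ i * K_op H u 0 $ i - integral {0..t} (\<lambda>r. \<sigma>' r $ i * K_op H u r $ i))"
    unfolding K_sigma_def young_integral_def
    using Y has_young_integral_unique [OF _ Y] by (rule the_equality)
  then show ?thesis by (simp add: sigma_op_def K_op_0 K_op_component [OF H u])
qed

lemma has_young_integral_cong:
  assumes "\<And>x. x \<in> {a..b} \<Longrightarrow> g x = g' x"
  shows "has_young_integral A g a b = has_young_integral A g' a b"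
proof
  fix I
  have "(\<Sum>(x, K)\<in>p. A x *v (g (Sup K) - g (Inf K))) = (\<Sum>(x, K)\<in>p. A x *v (g' (Sup K) - g' (Inf K)))"
    if p: "p tagged_division_of {a..b}" for p
  proof (rule sum.cong [OF refl], clarify)
    fix x K assume xK: "(x, K) \<in> p"
    obtain c d where K: "K = {c..d}" using tagged_division_ofD(4) [OF p xK] by auto
    have "x \<in> K" "K \<subseteq> {a..b}" using tagged_division_ofD(2,3) [OF p xK] by auto
    then have "Sup K \<in> {a..b}" "Inf K \<in> {a..b}" using K by auto
    then show "A x *v (g (Sup K) - g (Inf K)) = A x *v (g' (Sup K) - g' (Inf K))" using assms by simp
  qed
  then have "(p tagged_division_of {a..b} \<and> (\<lambda>x. ball x d) fine p \<longrightarrow>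
        norm ((\<Sum>(x, K)\<in>p. A x *v (g (Sup K) - g (Inf K))) - I) < e)
      = (p tagged_division_of {a..b} \<and> (\<lambda>x. ball x d) fine p \<longrightarrow>
        norm ((\<Sum>(x, K)\<in>p. A x *v (g' (Sup K) - g' (Inf K))) - I) < e)" for p d e
    by auto
  then show "has_young_integral A g a b I = has_young_integral A g' a b I"
    unfolding has_young_integral_def by (simp only:)
qed

lemma K_sigma_representative:
  assumes u: "u \<in> L2 T"
  obtains u' where "regular T u'" "AE s in lebesgue. s \<in> {0<..<T} \<longrightarrow> u' s = u s"
    "\<And>t. t \<in> {0..T} \<Longrightarrow> K_sigma H \<sigma> u t = K_sigma H \<sigma> u' t" "\<And>t. t \<le> T \<Longrightarrow> L2_sqnorm t u = L2_sqnorm t u'"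
proof -
  obtain u' where u': "regular T u'" and eq: "AE s in lebesgue. s \<in> {0<..<T} \<longrightarrow> u' s = u s"
    by (rule L2_representative [OF u])
  have L: "u' \<in> L2 T" by (rule regular_L2 [OF u'])
  have "K_op H u' x = K_op H u x" if "x \<le> T" for x
    by (rule K_op_cong_AE [OF L u eq that])
  then have "K_sigma H \<sigma> u t = K_sigma H \<sigma> u' t" if "t \<in> {0..T}" for t
    unfolding K_sigma_def young_integral_def using that
    by (subst has_young_integral_cong [of 0 t "K_op H u" "K_op H u'"]) auto
  moreover have "L2_sqnorm t u = L2_sqnorm t u'" if "t \<le> T" for t
    by (rule L2_sqnorm_cong_AE [OF L u eq that, symmetric])
  ultimately show ?thesis using that u' eq by blast
qed

lemma energy_le_L2_sqnorm:
  assumes u: "regular T u"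
  shows "energy (\<lambda>s. u s $ i) t \<le> L2_sqnorm t u"
  unfolding L2_sqnorm_regular [OF u] by (rule member_le_sum) auto

lemma L2_sqnorm_nonneg [simp]: "0 \<le> L2_sqnorm t u"
  by (simp add: L2_sqnorm_def set_lebesgue_integral_def)

lemma continuous_on_K_sigma:
  assumes u: "u \<in> L2 T"
  shows "continuous_on {0..T} (K_sigma H \<sigma> u)"
proof -
  obtain u' where u': "regular T u'" and K: "\<And>t. t \<in> {0..T} \<Longrightarrow> K_sigma H \<sigma> u t = K_sigma H \<sigma> u' t"
    by (rule K_sigma_representative [OF u]) blast
  have "continuous_on {0..T} (\<lambda>t. \<chi> i. sigma_op i (K_scalar H (\<lambda>s. u' s $ i)) t)"
    by (intro continuous_on_vec_lambda sigma_op_cont continuous_on_K_scalar H regular_component [OF u'])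
  then show ?thesis
    by (rule continuous_on_eq) (simp add: vec_eq_iff K K_sigma_regular [OF u'])
qed

text \<open>The bounds contain the norm of \<open>u\<close> up to \<open>t\<close> only:
  \<open>sigma_op\<close> at \<open>t\<close> looks at its path on \<open>[0, t]\<close>, and the
  scalar estimates already have this form. For \<open>H > 1/2\<close> the Hoelder exponent 1/2
  survives because the coefficient is Lipschitz.\<close>

lemma K_sigma_estimates:
  obtains C where "0 \<le> C"
    "\<And>u t. u \<in> L2 T \<Longrightarrow> t \<in> {0..T} \<Longrightarrow> norm (K_sigma H \<sigma> u t) \<le> C * sqrt (L2_sqnorm t u)"
    "\<And>u s t. 1/2 < H \<Longrightarrow> u \<in> L2 T \<Longrightarrow> 0 \<le> s \<Longrightarrow> s \<le> t \<Longrightarrow> t \<le> T \<Longrightarrow>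
      norm (K_sigma H \<sigma> u t - K_sigma H \<sigma> u s) \<le> C * sqrt (t - s) * sqrt (L2_sqnorm t u)"
proof -
  obtain C0 where C0: "0 \<le> C0" "\<And>u t. sq_integrable u \<Longrightarrow> 0 \<le> t \<Longrightarrow> \<bar>K_scalar H u t\<bar> \<le> C0 * t powr H * sqrt (energy u t)"
    by (rule K_scalar_bound [OF H]) blast
  define L where "L = \<bar>c_H H\<bar> * (T powr (H - 1/2) * sqrt (kernel_const (H - 1/2)))"
  define B where "B = C0 * T powr H"
  have B0: "0 \<le> B" using C0 by (simp add: B_def)
  define n where "n = real CARD('n)"
  define C1 where "C1 = n * (M * (1 + T) * B)"
  define C2 where "C2 = n * (M * (L + 2 * sqrt T * B))"
  have C1: "0 \<le> C1" using M_pos T B0 by (simp add: C1_def n_def)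
  have bound: "\<bar>K_scalar H (\<lambda>s. u s $ i) r\<bar> \<le> B * sqrt (L2_sqnorm t u)"
    if u: "regular T u" and t: "t \<in> {0..T}" and r: "r \<in> {0..t}" for u :: "real \<Rightarrow> real ^ 'n" and t r i
  proof -
    have "\<bar>K_scalar H (\<lambda>s. u s $ i) r\<bar> \<le> C0 * r powr H * sqrt (energy (\<lambda>s. u s $ i) r)"
      using C0(2) [OF regular_component [OF u]] r by simp
    also have "\<dots> \<le> (C0 * T powr H) * sqrt (L2_sqnorm t u)"
      using energy_mono [OF regular_component [OF u], of r t i] energy_le_L2_sqnorm [OF u, of i t] r t C0(1) H
      by (intro mult_mono mult_left_mono real_sqrt_le_mono powr_mono2) auto
    finally show ?thesis by (simp add: B_def)
  qed
  have inc: "\<bar>K_scalar H (\<lambda>s. u s $ i) t - K_scalar H (\<lambda>s. u s $ i) s\<bar> \<le> (L * sqrt (L2_sqnorm t u)) * sqrt (t - s)"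
    if "1/2 < H" and u: "regular T u" and st: "0 \<le> s" "s \<le> t" "t \<le> T" for u :: "real \<Rightarrow> real ^ 'n" and s t i
  proof -
    have "\<bar>K_scalar H (\<lambda>s. u s $ i) t - K_scalar H (\<lambda>s. u s $ i) s\<bar> \<le> L * sqrt (t - s) * sqrt (energy (\<lambda>s. u s $ i) t)"
      unfolding L_def by (rule K_scalar_increment [OF that(1) H(2) regular_component [OF u] st])
    also have "\<dots> \<le> L * sqrt (t - s) * sqrt (L2_sqnorm t u)"
    proof -
      have "0 \<le> L" using kernel_const_nonneg [of "H - 1/2"] that(1) H unfolding L_def by (auto simp: abs_if)
      then show ?thesis using energy_le_L2_sqnorm [OF u, of i t] st by (intro mult_left_mono) auto
    qed
    finally show ?thesis by (simp add: ac_simps)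
  qed
  have norm_le: "norm x \<le> n * b" if "\<And>i. \<bar>x $ i\<bar> \<le> b" for x :: "real ^ 'n" and b
    using norm_le_l1_cart [of x] sum_mono [of UNIV "\<lambda>i. \<bar>x $ i\<bar>" "\<lambda>_. b"] that by (simp add: n_def)
  have r1: "norm (K_sigma H \<sigma> u t) \<le> C1 * sqrt (L2_sqnorm t u)" if u: "regular T u" and t: "t \<in> {0..T}" for u t
  proof -
    have "norm (K_sigma H \<sigma> u t) \<le> n * (M * (1 + T) * (B * sqrt (L2_sqnorm t u)))"
      by (rule norm_le, subst K_sigma_regular [OF u t],
          rule sigma_op_bound [OF continuous_on_K_scalar [OF H regular_component [OF u]] t bound [OF u t]])
    then show ?thesis by (simp add: C1_def ac_simps)
  qed
  have r2: "norm (K_sigma H \<sigma> u t - K_sigma H \<sigma> u s) \<le> C2 * sqrt (t - s) * sqrt (L2_sqnorm t u)"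
    if h: "1/2 < H" and u: "regular T u" and st: "0 \<le> s" "s \<le> t" "t \<le> T" for u s t
  proof -
    have t: "t \<in> {0..T}" "s \<in> {0..T}" using st by auto
    have "norm (K_sigma H \<sigma> u t - K_sigma H \<sigma> u s)
        \<le> n * (M * (L * sqrt (L2_sqnorm t u) + 2 * sqrt T * (B * sqrt (L2_sqnorm t u))) * sqrt (t - s))"
      by (rule norm_le) (unfold vector_minus_component K_sigma_regular [OF u t(1)] K_sigma_regular [OF u t(2)],
          rule sigma_op_increment [OF continuous_on_K_scalar [OF H regular_component [OF u]] st bound [OF u t(1)] inc [OF h u st]])
    then show ?thesis by (simp add: C2_def algebra_simps)
  qed
  show ?thesis
  proof (rule that [of "max C1 C2"])
    show "0 \<le> max C1 C2" using C1 by simp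
    fix u :: "real \<Rightarrow> real ^ 'n" assume u: "u \<in> L2 T"
    obtain u' where u': "regular T u'" and K: "\<And>t. t \<in> {0..T} \<Longrightarrow> K_sigma H \<sigma> u t = K_sigma H \<sigma> u' t"
      and S: "\<And>t. t \<le> T \<Longrightarrow> L2_sqnorm t u = L2_sqnorm t u'"
      by (rule K_sigma_representative [OF u]) blast
    show "norm (K_sigma H \<sigma> u t) \<le> max C1 C2 * sqrt (L2_sqnorm t u)" if t: "t \<in> {0..T}" for t
    proof -
      have "C1 * sqrt (L2_sqnorm t u') \<le> max C1 C2 * sqrt (L2_sqnorm t u')"
        by (intro mult_right_mono) auto
      then show ?thesis using r1 [OF u' t] K [OF t] S [of t] t by simp
    qed
    show "norm (K_sigma H \<sigma> u t - K_sigma H \<sigma> u s) \<le> max C1 C2 * sqrt (t - s) * sqrt (L2_sqnorm t u)"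
      if h: "1/2 < H" and st: "0 \<le> s" "s \<le> t" "t \<le> T" for s t
    proof -
      have "C2 * sqrt (t - s) * sqrt (L2_sqnorm t u') \<le> max C1 C2 * sqrt (t - s) * sqrt (L2_sqnorm t u')"
        by (intro mult_right_mono) (use st in auto)
      then show ?thesis using r2 [OF h u' st] K [of t] K [of s] S [of t] st by simp
    qed
  qed
qed

section \<open>Linearity and injectivity, and the irrelevance of the chosen preimage\<close>

lemma L2_diff:
  assumes u: "u \<in> L2 T" and v: "v \<in> L2 T"
  shows "(\<lambda>s. u s - v s :: real ^ 'n) \<in> L2 T"
proof -
  have m: "(\<lambda>s. indicator {0..T} s *\<^sub>R u s) \<in> borel_measurable lebesgue" "(\<lambda>s. indicator {0..T} s *\<^sub>R v s) \<in> borel_measurable lebesgue"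
    and I: "integrable lebesgue (\<lambda>s. indicator {0..T} s *\<^sub>R (norm (u s))\<^sup>2)" "integrable lebesgue (\<lambda>s. indicator {0..T} s *\<^sub>R (norm (v s))\<^sup>2)"
    using u v by (auto simp: L2_def set_borel_measurable_def set_integrable_def)
  have md: "(\<lambda>s. indicator {0..T} s *\<^sub>R (u s - v s)) \<in> borel_measurable lebesgue"
    using borel_measurable_diff [OF m] by (simp add: scaleR_diff_right)
  have mn: "(\<lambda>s. indicator {0..T} s *\<^sub>R (norm (u s - v s))\<^sup>2) \<in> borel_measurable lebesgue"
  proof -
    have "(\<lambda>s. (norm (indicator {0..T} s *\<^sub>R (u s - v s)))\<^sup>2) \<in> borel_measurable lebesgue"
      using md by measurable
    also have "(\<lambda>s. (norm (indicator {0..T} s *\<^sub>R (u s - v s)))\<^sup>2) = (\<lambda>s. indicator {0..T} s *\<^sub>R (norm (u s - v s))\<^sup>2)"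
      by (auto simp: indicator_def)
    finally show ?thesis .
  qed
  have "integrable lebesgue (\<lambda>s. indicator {0..T} s *\<^sub>R (norm (u s - v s))\<^sup>2)"
  proof (rule Bochner_Integration.integrable_bound [OF _ mn])
    show "integrable lebesgue (\<lambda>s. 2 * (indicator {0..T} s *\<^sub>R (norm (u s))\<^sup>2) + 2 * (indicator {0..T} s *\<^sub>R (norm (v s))\<^sup>2))"
      using I by simp
    have "(norm (x - y))\<^sup>2 \<le> 2 * (norm x)\<^sup>2 + 2 * (norm y)\<^sup>2" for x y :: "real ^ 'n"
    proof -
      have "(norm (x - y))\<^sup>2 \<le> (norm x + norm y)\<^sup>2" by (intro power_mono norm_triangle_ineq4) auto
      also have "\<dots> \<le> 2 * (norm x)\<^sup>2 + 2 * (norm y)\<^sup>2"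
        using sum_squares_bound [of "norm x" "norm y"] by (simp add: power2_sum)
      finally show ?thesis .
    qed
    then show "AE s in lebesgue. norm (indicator {0..T} s *\<^sub>R (norm (u s - v s))\<^sup>2)
      \<le> norm (2 * (indicator {0..T} s *\<^sub>R (norm (u s))\<^sup>2) + 2 * (indicator {0..T} s *\<^sub>R (norm (v s))\<^sup>2))"
      by (intro AE_I2) (auto simp: indicator_def)
  qed
  then show ?thesis using md by (simp add: L2_def set_borel_measurable_def set_integrable_def)
qed

lemma regular_diff:
  assumes "regular T u" "regular T v"
  shows "regular T (\<lambda>s. u s - v s)"
proof -
  have "sq_integrable (\<lambda>s. u s $ i - v s $ i)" for i
  proof -
    have u: "(\<lambda>s. u s $ i) \<in> borel_measurable borel" "integrable lborel (\<lambda>s. (u s $ i)\<^sup>2)"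
      and v: "(\<lambda>s. v s $ i) \<in> borel_measurable borel" "integrable lborel (\<lambda>s. (v s $ i)\<^sup>2)"
      using assms by (auto simp: regular_def)
    have "integrable lborel (\<lambda>s. (u s $ i)\<^sup>2 - 2 * (u s $ i * v s $ i) + (v s $ i)\<^sup>2)"
      using u v by (intro Bochner_Integration.integrable_add Bochner_Integration.integrable_diff
          integrable_mult_right integrable_mult_square) auto
    then show ?thesis using u v by (simp add: sq_integrable_def power2_diff algebra_simps)
  qed
  then show ?thesis using assms by (simp add: regular_def)
qed

text \<open>Additivity of the integrals needs integrability of each kernel integral, which is
  established for \<open>regular\<close> inputs; hence the passage to Borel representatives.\<close>

lemma K_sigma_diff:
  assumes u: "u \<in> L2 T" and v: "v \<in> L2 T" and t: "t \<in> {0..T}"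
  shows "K_sigma H \<sigma> (\<lambda>s. u s - v s) t = K_sigma H \<sigma> u t - K_sigma H \<sigma> v t"
proof -
  obtain u' where u': "regular T u'" and eu: "AE s in lebesgue. s \<in> {0<..<T} \<longrightarrow> u' s = u s"
    and Ku: "\<And>t. t \<in> {0..T} \<Longrightarrow> K_sigma H \<sigma> u t = K_sigma H \<sigma> u' t"
    by (rule K_sigma_representative [OF u]) blast
  obtain v' where v': "regular T v'" and ev: "AE s in lebesgue. s \<in> {0<..<T} \<longrightarrow> v' s = v s"
    and Kv: "\<And>t. t \<in> {0..T} \<Longrightarrow> K_sigma H \<sigma> v t = K_sigma H \<sigma> v' t"
    by (rule K_sigma_representative [OF v]) blast
  have ed: "AE s in lebesgue. s \<in> {0<..<T} \<longrightarrow> u' s - v' s = u s - v s"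
    using eu ev by eventually_elim auto
  have rd: "regular T (\<lambda>s. u' s - v' s)" by (rule regular_diff [OF u' v'])
  have "K_op H (\<lambda>s. u' s - v' s) x = K_op H (\<lambda>s. u s - v s) x" if "x \<le> T" for x
    by (rule K_op_cong_AE [OF regular_L2 [OF rd] L2_diff [OF u v] ed that])
  then have 1: "K_sigma H \<sigma> (\<lambda>s. u s - v s) t = K_sigma H \<sigma> (\<lambda>s. u' s - v' s) t"
    unfolding K_sigma_def young_integral_def using t
    by (subst has_young_integral_cong [of 0 t "K_op H (\<lambda>s. u s - v s)" "K_op H (\<lambda>s. u' s - v' s)"]) auto
  have "K_sigma H \<sigma> (\<lambda>s. u' s - v' s) t $ i = (K_sigma H \<sigma> u' t - K_sigma H \<sigma> v' t) $ i" for i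
  proof -
    let ?a = "K_scalar H (\<lambda>s. u' s $ i)" and ?b = "K_scalar H (\<lambda>s. v' s $ i)"
    have k: "K_scalar H (\<lambda>s. u' s $ i - v' s $ i) r = ?a r - ?b r" for r
      using Bochner_Integration.integral_diff [OF integrable_K_scalar [OF H regular_component [OF u', of i], of r]
          integrable_K_scalar [OF H regular_component [OF v', of i], of r]]
      by (simp add: K_scalar_def right_diff_distrib)
    have i: "integral {0..t} (\<lambda>r. \<sigma>' r $ i * (?a r - ?b r))
        = integral {0..t} (\<lambda>r. \<sigma>' r $ i * ?a r) - integral {0..t} (\<lambda>r. \<sigma>' r $ i * ?b r)"
      unfolding right_diff_distrib
      by (rule Henstock_Kurzweil_Integration.integral_diff)
        (use t in \<open>auto intro!: sigma_op_integrable continuous_on_K_scalar H regular_component u' v'\<close>)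
    have "sigma_op i (K_scalar H (\<lambda>s. u' s $ i - v' s $ i)) t = sigma_op i ?a t - sigma_op i ?b t"
      unfolding sigma_op_def k i by (simp add: algebra_simps)
    then show ?thesis
      using K_sigma_regular [OF rd t, of i] K_sigma_regular [OF u' t, of i] K_sigma_regular [OF v' t, of i]
      by simp
  qed
  then show ?thesis using 1 Ku [OF t] Kv [OF t] by (simp add: vec_eq_iff)
qed

lemma K_sigma_inj:
  assumes u: "u \<in> L2 T" and z: "\<And>t. t \<in> {0..T} \<Longrightarrow> K_sigma H \<sigma> u t = 0"
  shows "AE s in lebesgue. s \<in> {0<..<T} \<longrightarrow> u s = 0"
proof -
  obtain u' where u': "regular T u'" and eu: "AE s in lebesgue. s \<in> {0<..<T} \<longrightarrow> u' s = u s"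
    and Ku: "\<And>t. t \<in> {0..T} \<Longrightarrow> K_sigma H \<sigma> u t = K_sigma H \<sigma> u' t"
    by (rule K_sigma_representative [OF u]) blast
  have "AE s in lborel. u' s $ i = 0" for i
  proof (rule K_scalar_inj [OF H _ regular_component [OF u', of i]])
    show "c_H H \<noteq> 0" using c_H_pos [OF H] by simp
    show "u' s $ i = 0" if "s \<notin> {0<..<T}" for s using u' that by (simp add: regular_def)
    show "K_scalar H (\<lambda>s. u' s $ i) t = 0" if t: "t \<in> {0..T}" for t
    proof (rule sigma_op_inj [OF continuous_on_K_scalar [OF H regular_component [OF u', of i]] _ t])
      show "sigma_op i (K_scalar H (\<lambda>s. u' s $ i)) t = 0" if "t \<in> {0..T}" for t
        using K_sigma_regular [OF u' that, of i] z [OF that] Ku [OF that] by simp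
    qed
  qed
  then have "AE s in lborel. \<forall>i\<in>UNIV. u' s $ i = 0" by (intro AE_finite_allI) auto
  then have "AE s in lebesgue. \<forall>i\<in>UNIV. u' s $ i = 0" by (rule AE_completion)
  with eu show ?thesis by eventually_elim (auto simp: vec_eq_iff)
qed

lemma L2_sqnorm_K_sigma_unique:
  assumes u: "u \<in> L2 T" and v: "v \<in> L2 T" and eq: "\<And>t. t \<in> {0..T} \<Longrightarrow> K_sigma H \<sigma> u t = K_sigma H \<sigma> v t"
    and t: "t \<le> T"
  shows "L2_sqnorm t u = L2_sqnorm t v"
proof (rule L2_sqnorm_cong_AE [OF u v _ t])
  have "AE s in lebesgue. s \<in> {0<..<T} \<longrightarrow> u s - v s = 0"
    by (rule K_sigma_inj [OF L2_diff [OF u v]]) (simp add: K_sigma_diff [OF u v] eq)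
  then show "AE s in lebesgue. s \<in> {0<..<T} \<longrightarrow> u s = v s" by eventually_elim auto
qed

text \<open>Two preimages of the same path agree almost everywhere, so the choice made by
  \<open>K_sigma_inv\<close> does not affect the norm. Through this lemma every norm in the problem
  becomes that of a preimage constructed by hand.\<close>

lemma L2_sqnorm_K_sigma_inv:
  assumes u: "u \<in> L2 T" and h: "\<And>t. t \<in> {0..T} \<Longrightarrow> h t = K_sigma H \<sigma> u t"
  shows "L2_sqnorm T (K_sigma_inv H T \<sigma> h) = L2_sqnorm T u"
proof -
  let ?P = "\<lambda>v. v \<in> L2 T \<and> (\<forall>t\<in>{0..T}. h t = K_sigma H \<sigma> v t)"
  have P: "?P (K_sigma_inv H T \<sigma> h)"
    unfolding K_sigma_inv_def by (rule someI [of ?P u]) (use u h in auto)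
  show ?thesis
  proof (rule L2_sqnorm_K_sigma_unique [OF conjunct1 [OF P] u _ order_refl])
    fix t assume t: "t \<in> {0..T}"
    show "K_sigma H \<sigma> (K_sigma_inv H T \<sigma> h) t = K_sigma H \<sigma> u t"
      using bspec [OF conjunct2 [OF P] t] h [OF t] by (rule trans [OF sym])
  qed
qed

lemma CM_norm_eq:
  assumes "u \<in> L2 T" "\<And>t. t \<in> {0..T} \<Longrightarrow> h t = K_sigma H \<sigma> u t"
  shows "CM_norm H T \<sigma> h = sqrt (L2_sqnorm T u)"
  unfolding CM_norm_def using L2_sqnorm_K_sigma_inv [of u h, OF assms] by simp

end

section \<open>Comparison of norms and Gronwall's inequality with a singular weight\<close>

lemma square_norm_diff_bound:
  fixes x y :: "'a::real_normed_vector"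
  assumes "0 < (l::real)"
  shows "(norm x)\<^sup>2 \<le> (1 + l) * (norm (x - y))\<^sup>2 + (1 + 1 / l) * (norm y)\<^sup>2"
proof -
  let ?a = "norm (x - y)" and ?b = "norm y"
  have "norm x \<le> ?a + ?b" using norm_triangle_ineq [of "x - y" y] by simp
  then have "(norm x)\<^sup>2 \<le> (?a + ?b)\<^sup>2" by (rule power_mono) simp
  also have "2 * (sqrt l * ?a) * (?b / sqrt l) \<le> (sqrt l * ?a)\<^sup>2 + (?b / sqrt l)\<^sup>2"
    by (rule sum_squares_bound)
  then have "(?a + ?b)\<^sup>2 \<le> (1 + l) * ?a\<^sup>2 + (1 + 1 / l) * ?b\<^sup>2"
    using assms by (simp add: power2_sum power_mult_distrib power_divide distrib_right)
  finally show ?thesis .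
qed

context cameron_martin
begin

lemma L2_set_integrable:
  assumes "u \<in> L2 T" "t \<le> T"
  shows "set_integrable lebesgue {0..t} (\<lambda>s. (norm (u s))\<^sup>2)"
  by (rule set_integrable_subset [of _ "{0..T}"]) (use assms in \<open>auto simp: L2_def\<close>)

lemma L2_sqnorm_le_combination:
  fixes u v w :: "real \<Rightarrow> real ^ 'n"
  assumes "u \<in> L2 T" "v \<in> L2 T" "w \<in> L2 T" and t: "t \<le> T"
    and le: "\<And>s. (norm (u s))\<^sup>2 \<le> a * (norm (v s))\<^sup>2 + b * (norm (w s))\<^sup>2"
  shows "L2_sqnorm t u \<le> a * L2_sqnorm t v + b * L2_sqnorm t w"
proof -
  note I = L2_set_integrable [OF assms(1) t] L2_set_integrable [OF assms(2) t] L2_set_integrable [OF assms(3) t]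
  have "L2_sqnorm t u \<le> (LINT s:{0..t}|lebesgue. a * (norm (v s))\<^sup>2 + b * (norm (w s))\<^sup>2)"
    unfolding L2_sqnorm_def by (rule set_integral_mono) (use I le in \<open>auto intro: set_integral_add\<close>)
  also have "\<dots> = a * L2_sqnorm t v + b * L2_sqnorm t w"
    unfolding L2_sqnorm_def using I by (subst set_integral_add) auto
  finally show ?thesis .
qed

text \<open>The free weight \<open>l\<close> decides how much of the main term is sacrificed:
  Gronwall uses \<open>l = 1\<close>, whereas the growth estimate needs \<open>l\<close> small
  compared with the gap assumed in the theorem.\<close>

lemma L2_sqnorm_diff_bound:
  fixes u v :: "real \<Rightarrow> real ^ 'n"
  assumes "u \<in> L2 T" "v \<in> L2 T" "t \<le> T" "0 < l"
  shows "L2_sqnorm t u \<le> (1 + l) * L2_sqnorm t (\<lambda>s. u s - v s) + (1 + 1 / l) * L2_sqnorm t v"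
  by (rule L2_sqnorm_le_combination) (use assms L2_diff square_norm_diff_bound in auto)

lemma L2_sqnorm_mono:
  fixes u :: "real \<Rightarrow> real ^ 'n"
  assumes "u \<in> L2 T" "s \<le> t" "t \<le> T"
  shows "L2_sqnorm s u \<le> L2_sqnorm t u"
proof -
  have "integrable lebesgue (\<lambda>r. indicator {0..s} r *\<^sub>R (norm (u r))\<^sup>2)" "integrable lebesgue (\<lambda>r. indicator {0..t} r *\<^sub>R (norm (u r))\<^sup>2)"
    using L2_set_integrable [OF assms(1)] assms by (auto simp: set_integrable_def)
  then show ?thesis
    unfolding L2_sqnorm_def set_lebesgue_integral_def
    by (rule integral_mono) (use assms in \<open>auto simp: indicator_def\<close>)
qed

lemma L2_sqnorm_le_integral:
  fixes v :: "real \<Rightarrow> real ^ 'n"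
  assumes v: "v \<in> L2 T" and t: "t \<le> T" and g: "(g has_integral I) {0..t}"
    and le: "\<And>s. s \<in> {0..t} \<Longrightarrow> (norm (v s))\<^sup>2 \<le> g s"
  shows "L2_sqnorm t v \<le> I"
proof -
  note I = L2_set_integrable [OF v t]
  have "L2_sqnorm t v = integral {0..t} (\<lambda>s. (norm (v s))\<^sup>2)"
    unfolding L2_sqnorm_def by (rule set_lebesgue_integral_eq_integral(2) [OF I])
  also have "\<dots> \<le> integral {0..t} g"
    by (rule integral_le) (use set_lebesgue_integral_eq_integral(1) [OF I] g le in auto)
  finally show ?thesis using g by (simp add: integral_unique)
qed

text \<open>By \<open>sigma_op_integral\<close> the \<open>i\<close>-th component has to be a scalar
  preimage of the primitive of \<open>f r $ i / \<sigma> r $ i\<close>. Dividing by the coefficient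
  enlarges \<open>path_bound\<close> by one fixed factor on every \<open>[0, s]\<close>, so
  causality is kept. The normalisation \<open>v 0 = 0\<close> makes pointwise comparisons valid at
  0, where \<open>powr\<close> takes the value 0.\<close>

lemma K_sigma_preimage:
  obtains C where "0 \<le> C"
    "\<And>f N0. continuous_on {0..T} f \<Longrightarrow> path_bound H f T N0 \<Longrightarrow>
      \<exists>v\<in>L2 T. v 0 = 0 \<and> (\<forall>t\<in>{0..T}. K_sigma H \<sigma> v t = integral {0..t} f) \<and>
        (\<forall>s\<in>{0<..T}. \<forall>N. path_bound H f s N \<longrightarrow> norm (v s) \<le> C * N * s powr - (H - 1/2))"
proof -
  obtain C0 where C0: "0 \<le> C0" and pre: "\<And>f N0. continuous_on {0..T} f \<Longrightarrow> path_bound H f T N0 \<Longrightarrow>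
      \<exists>v. sq_integrable v \<and> (\<forall>s. s \<notin> {0<..<T} \<longrightarrow> v s = 0) \<and>
        (\<forall>t\<in>{0..T}. K_scalar H v t = integral {0..t} f) \<and>
        (\<forall>s\<in>{0<..T}. \<forall>N. path_bound H f s N \<longrightarrow> \<bar>v s\<bar> \<le> C0 * N * s powr - (H - 1/2))"
    by (rule K_scalar_preimage [OF H T], rule that)
  \<comment> \<open>\<open>1 / m\<close> bounds the reciprocal of the coefficient. The second
    summand is its Hoelder constant: the Lipschitz constant \<open>M / m\<^sup>2\<close> of the
    reciprocal times \<open>T powr (1 - H / 2)\<close> to pass to the exponent
    \<open>H / 2\<close>.\<close>
  define D where "D = 1 / m + M * T powr (1 - H / 2) / m\<^sup>2"
  have D: "1 / m \<le> D" "0 < D" using m M_pos T by (auto simp: D_def intro!: add_pos_nonneg divide_nonneg_nonneg)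
  have pb: "path_bound H (\<lambda>r. f r $ i / \<sigma> r $ i) s (D * N)" if fN: "path_bound H f s N" and s: "s \<in> {0..T}" for f N s i
  proof -
    have fb: "norm (f r) \<le> N" if "r \<in> {0..s}" for r
      using fN that by (simp add: path_bound_def)
    have N0: "0 \<le> N" using order_trans [OF norm_ge_zero fb [of 0]] s by simp
    have fc: "\<bar>f r $ i\<bar> \<le> N" if "r \<in> {0..s}" for r
      using order_trans [OF component_le_norm_cart fb [OF that]] .
    have b1: "\<bar>f r $ i / \<sigma> r $ i\<bar> \<le> D * N" if "r \<in> {0..s}" for r
    proof -
      have "r \<in> {0..T}" using that s by auto
      then have "\<bar>f r $ i / \<sigma> r $ i\<bar> \<le> N / m"
        using fc [OF that] \<sigma>_bounds [of r i] m N0 by (auto simp: abs_divide intro!: frac_le)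
      also have "\<dots> \<le> D * N" using mult_right_mono [OF D(1) N0] by simp
      finally show ?thesis .
    qed
    have b2: "\<bar>f r $ i / \<sigma> r $ i - f q $ i / \<sigma> q $ i\<bar> \<le> D * N * \<bar>r - q\<bar> powr (H / 2)"
      if h: "1/2 < H" and r: "r \<in> {0..s}" and q: "q \<in> {0..s}" for r q
    proof -
      have rT: "r \<in> {0..T}" "q \<in> {0..T}" using r q s by auto
      have "norm (f r - f q) \<le> N * \<bar>r - q\<bar> powr (H / 2)" using fN h r q unfolding path_bound_def by blast
      then have hf: "\<bar>f r $ i - f q $ i\<bar> \<le> N * \<bar>r - q\<bar> powr (H / 2)"
        using component_le_norm_cart [of "f r - f q" i] by simp
      have "norm (\<sigma> q $ i - \<sigma> r $ i) \<le> M * norm (q - r)"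
        by (rule field_differentiable_bound [of "{0..T}" "\<lambda>s. \<sigma> s $ i" "\<lambda>r. \<sigma>' r $ i"])
          (use \<sigma>_deriv \<sigma>'_bound rT in auto)
      then have "\<bar>\<sigma> q $ i - \<sigma> r $ i\<bar> \<le> M * \<bar>r - q\<bar>" by (simp add: abs_minus_commute)
      also have "\<bar>r - q\<bar> \<le> T powr (1 - H / 2) * \<bar>r - q\<bar> powr (H / 2)"
      proof (cases "r = q")
        case False
        have "\<bar>r - q\<bar> = \<bar>r - q\<bar> powr (1 - H / 2) * \<bar>r - q\<bar> powr (H / 2)"
          using False by (simp add: powr_add [symmetric])
        also have "\<dots> \<le> T powr (1 - H / 2) * \<bar>r - q\<bar> powr (H / 2)"
          using H rT by (intro mult_right_mono powr_mono2) auto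
        finally show ?thesis .
      qed simp
      finally have hs: "\<bar>\<sigma> q $ i - \<sigma> r $ i\<bar> \<le> M * (T powr (1 - H / 2) * \<bar>r - q\<bar> powr (H / 2))"
        using M_pos by (simp add: mult_left_mono)
      have pos: "0 < \<sigma> r $ i" "0 < \<sigma> q $ i" "m \<le> \<sigma> r $ i" "m \<le> \<sigma> q $ i"
        using \<sigma>_pos \<sigma>_bounds rT by auto
      have "f r $ i / \<sigma> r $ i - f q $ i / \<sigma> q $ i
          = (f r $ i - f q $ i) / \<sigma> r $ i + f q $ i * (\<sigma> q $ i - \<sigma> r $ i) / (\<sigma> r $ i * \<sigma> q $ i)"
        using pos by (simp add: field_simps)
      also have "\<bar>\<dots>\<bar> \<le> \<bar>f r $ i - f q $ i\<bar> / \<sigma> r $ i + \<bar>f q $ i\<bar> * \<bar>\<sigma> q $ i - \<sigma> r $ i\<bar> / (\<sigma> r $ i * \<sigma> q $ i)"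
        using pos by (intro order_trans [OF abs_triangle_ineq]) (simp add: abs_mult abs_divide)
      also have "\<dots> \<le> N * \<bar>r - q\<bar> powr (H / 2) / m + N * (M * (T powr (1 - H / 2) * \<bar>r - q\<bar> powr (H / 2))) / (m * m)"
        using hf hs fc [OF q] pos m N0 M_pos
        by (intro add_mono frac_le mult_mono) auto
      also have "\<dots> = D * N * \<bar>r - q\<bar> powr (H / 2)"
        using m by (simp add: D_def power2_eq_square field_simps)
      finally show ?thesis .
    qed
    show ?thesis using b1 b2 by (simp add: path_bound_def)
  qed
  let ?C = "real CARD('n) * (C0 * D)"
  show ?thesis
  proof (rule that [of ?C])
    show "0 \<le> ?C" using C0 D by simp
    fix f :: "real \<Rightarrow> real ^ 'n" and N0 assume f: "continuous_on {0..T} f" and N0: "path_bound H f T N0"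
    have fi: "continuous_on {0..T} (\<lambda>r. f r $ i)" for i by (intro continuous_intros f)
    have fs: "continuous_on {0..T} (\<lambda>r. f r $ i / \<sigma> r $ i)" for i
      using \<sigma>_pos [THEN less_imp_neq] by (intro continuous_on_divide fi \<sigma>_cont) (auto dest: sym)
    have "\<forall>i. \<exists>v. sq_integrable v \<and> (\<forall>s. s \<notin> {0<..<T} \<longrightarrow> v s = 0) \<and>
        (\<forall>t\<in>{0..T}. K_scalar H v t = integral {0..t} (\<lambda>r. f r $ i / \<sigma> r $ i)) \<and>
        (\<forall>s\<in>{0<..T}. \<forall>N. path_bound H (\<lambda>r. f r $ i / \<sigma> r $ i) s N \<longrightarrow> \<bar>v s\<bar> \<le> C0 * N * s powr - (H - 1/2))"
      using pre [OF fs pb [OF N0]] T by simp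
    from choice [OF this] obtain V where V: "\<And>i. sq_integrable (V i)" "\<And>i s. s \<notin> {0<..<T} \<Longrightarrow> V i s = 0"
      "\<And>i t. t \<in> {0..T} \<Longrightarrow> K_scalar H (V i) t = integral {0..t} (\<lambda>r. f r $ i / \<sigma> r $ i)"
      "\<And>i s N. s \<in> {0<..T} \<Longrightarrow> path_bound H (\<lambda>r. f r $ i / \<sigma> r $ i) s N \<Longrightarrow> \<bar>V i s\<bar> \<le> C0 * N * s powr - (H - 1/2)"
      by blast
    define v where "v s = (\<chi> i. V i s)" for s
    have v: "regular T v" using V(1,2) by (auto simp: regular_def v_def vec_eq_iff)
    have K: "K_sigma H \<sigma> v t = integral {0..t} f" if t: "t \<in> {0..T}" for t
    proof -
      have "K_sigma H \<sigma> v t $ i = integral {0..t} f $ i" for i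
      proof -
        have "K_sigma H \<sigma> v t $ i = sigma_op i (K_scalar H (V i)) t"
          using K_sigma_regular [OF v t, of i] by (simp add: v_def)
        also have "\<dots> = integral {0..t} (\<lambda>r. f r $ i)" by (rule sigma_op_integral [OF fi V(3) t])
        also have "\<dots> = integral {0..t} f $ i"
          by (rule integral_component_eq_cart)
            (intro integrable_continuous_interval continuous_on_subset [OF f], use t in auto)
        finally show ?thesis .
      qed
      then show ?thesis by (simp add: vec_eq_iff)
    qed
    have bound: "norm (v s) \<le> ?C * N * s powr - (H - 1/2)" if s: "s \<in> {0<..T}" and N: "path_bound H f s N" for s N
    proof -
      have "\<bar>v s $ i\<bar> \<le> C0 * (D * N) * s powr - (H - 1/2)" for i
        using V(4) [OF s pb [OF N]] s by (simp add: v_def)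
      then have "(\<Sum>i\<in>UNIV. \<bar>v s $ i\<bar>) \<le> (\<Sum>i\<in>(UNIV::'n set). C0 * (D * N) * s powr - (H - 1/2))"
        by (intro sum_mono) auto
      then show ?thesis using norm_le_l1_cart [of "v s"] by (simp add: mult.assoc)
    qed
    show "\<exists>v\<in>L2 T. v 0 = 0 \<and> (\<forall>t\<in>{0..T}. K_sigma H \<sigma> v t = integral {0..t} f) \<and>
        (\<forall>s\<in>{0<..T}. \<forall>N. path_bound H f s N \<longrightarrow> norm (v s) \<le> ?C * N * s powr - (H - 1/2))"
      using K bound v regular_L2 [OF v] by (intro bexI [of _ v]) (auto simp: regular_def)
  qed
qed

text \<open>
  Gronwall's inequality for the singular weight \<open>s powr (- 2 * a)\<close>, in the form of a supremum bound
  for \<open>L2_sqnorm t u * exp (- 2 * A t)\<close> with \<open>A\<close> a primitive of the weight.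
\<close>

lemma singular_Gronwall:
  assumes a: "a < 1/2" and C: "0 \<le> C"
  obtains K where "0 < K"
    "\<And>u v :: real \<Rightarrow> real ^ 'n. u \<in> L2 T \<Longrightarrow> v \<in> L2 T \<Longrightarrow> v 0 = 0 \<Longrightarrow>
      \<forall>s\<in>{0<..T}. norm (v s) \<le> C * sqrt (L2_sqnorm s u) * s powr - a \<Longrightarrow>
      L2_sqnorm T u \<le> K * L2_sqnorm T (\<lambda>s. u s - v s)"
proof
  \<comment> \<open>\<open>A\<close> is a primitive of
    \<open>2 * C\<^sup>2 * s powr (- 2 * a)\<close>. The factor 2 makes the norm of \<open>v\<close>
    up to \<open>t\<close> at most \<open>S / 4 * exp (2 * A t)\<close>; the triangle inequality
    doubles this to \<open>S / 2\<close>, which can still be absorbed.\<close>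
  define A where "A t = 2 * C\<^sup>2 * (t powr (1 - 2 * a) / (1 - 2 * a))" for t :: real
  let ?K = "4 * exp (2 * A T)"
  show "0 < ?K" by simp
  fix u v :: "real \<Rightarrow> real ^ 'n"
  assume u: "u \<in> L2 T" and v: "v \<in> L2 T" and v0: "v 0 = 0"
  assume "\<forall>s\<in>{0<..T}. norm (v s) \<le> C * sqrt (L2_sqnorm s u) * s powr - a"
  then have bound: "norm (v s) \<le> C * sqrt (L2_sqnorm s u) * s powr - a" if "s \<in> {0<..T}" for s
    using that by blast
  define W where "W = L2_sqnorm T (\<lambda>s. u s - v s)"
  let ?\<phi> = "\<lambda>t. L2_sqnorm t u * exp (- 2 * A t)"
  define S where "S = (SUP t\<in>{0..T}. ?\<phi> t)"
  have A0: "0 \<le> A t" for t using a by (simp add: A_def)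
  have bdd: "bdd_above (?\<phi> ` {0..T})"
  proof (rule bdd_aboveI2)
    fix t assume t: "t \<in> {0..T}"
    have "?\<phi> t \<le> L2_sqnorm T u * 1"
      using L2_sqnorm_mono [OF u, of t T] t A0 [of t] by (intro mult_mono) auto
    then show "?\<phi> t \<le> L2_sqnorm T u" by simp
  qed
  have S: "L2_sqnorm t u \<le> S * exp (2 * A t)" if t: "t \<in> {0..T}" for t
  proof -
    have "?\<phi> t \<le> S" unfolding S_def by (rule cSUP_upper [OF t bdd])
    then have "?\<phi> t * exp (2 * A t) \<le> S * exp (2 * A t)" by (rule mult_right_mono) simp
    moreover have "exp (- 2 * A t) * exp (2 * A t) = 1" by (simp flip: exp_add)
    ultimately show ?thesis by (simp only: mult.assoc mult_1_right)
  qed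
  have S0: "0 \<le> S" using order_trans [OF L2_sqnorm_nonneg S [of 0]] T by (simp add: A_def)
  have step: "?\<phi> t \<le> 2 * W + S / 2" if t: "t \<in> {0..T}" for t
  proof -
    let ?g = "\<lambda>s. S / 4 * (4 * C\<^sup>2 * s powr (- 2 * a) * exp (2 * A s))"
    have "((\<lambda>s. 4 * C\<^sup>2 * s powr (- 2 * a) * exp (2 * A s)) has_integral exp (2 * A t) - exp (2 * A 0)) {0..t}"
    proof (rule fundamental_theorem_of_calculus_interior)
      show "continuous_on {0..t} (\<lambda>s. exp (2 * A s))"
        unfolding A_def by (intro continuous_intros continuous_on_powr') (use a in auto)
      fix s assume "s \<in> {0<..<t}"
      then have s: "0 < s" by simp
      have "((\<lambda>s. exp (2 * A s)) has_real_derivative exp (2 * A s) * (2 * (2 * C\<^sup>2 * ((1 - 2 * a) * s powr (1 - 2 * a - 1) / (1 - 2 * a))))) (at s)"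
        unfolding A_def using s by (auto intro!: derivative_eq_intros)
      also have "exp (2 * A s) * (2 * (2 * C\<^sup>2 * ((1 - 2 * a) * s powr (1 - 2 * a - 1) / (1 - 2 * a)))) = 4 * C\<^sup>2 * s powr (- 2 * a) * exp (2 * A s)"
        using a by simp
      finally show "((\<lambda>s. exp (2 * A s)) has_vector_derivative 4 * C\<^sup>2 * s powr (- 2 * a) * exp (2 * A s)) (at s)"
        by (simp add: has_real_derivative_iff_has_vector_derivative)
    qed (use t in auto)
    from has_integral_mult_right [OF this, of "S / 4"]
    have gI: "(?g has_integral S / 4 * (exp (2 * A t) - exp (2 * A 0))) {0..t}" .
    have "L2_sqnorm t v \<le> S / 4 * (exp (2 * A t) - exp (2 * A 0))"
    proof (rule L2_sqnorm_le_integral [OF v _ gI])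
      fix s assume s: "s \<in> {0..t}"
      show "(norm (v s))\<^sup>2 \<le> ?g s"
      \<comment> \<open>At 0 the comparison function vanishes because \<open>0 powr x = 0\<close>,
        so the value \<open>v 0 = 0\<close> is used.\<close>
      proof (cases "s = 0")
        case True
        then show ?thesis using v0 S0 by simp
      next
        case False
        then have sT: "s \<in> {0<..T}" "s \<in> {0..T}" using s t by auto
        have "(norm (v s))\<^sup>2 \<le> (C * sqrt (L2_sqnorm s u) * s powr - a)\<^sup>2"
          by (rule power_mono [OF bound [OF sT(1)]]) simp
        also have "\<dots> = C\<^sup>2 * L2_sqnorm s u * (s powr - a * s powr - a)"
          by (simp add: power_mult_distrib) (simp add: power2_eq_square)
        also have "s powr - a * s powr - a = s powr (- 2 * a)" by (simp add: powr_add [symmetric])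
        also have "C\<^sup>2 * L2_sqnorm s u * s powr (- 2 * a) \<le> C\<^sup>2 * (S * exp (2 * A s)) * s powr (- 2 * a)"
          by (intro mult_right_mono mult_left_mono S [OF sT(2)]) auto
        finally show ?thesis by (simp add: ac_simps)
      qed
    qed (use t in auto)
    also have "\<dots> \<le> S / 4 * exp (2 * A t)" using S0 by (intro mult_left_mono) auto
    finally have vb: "L2_sqnorm t v \<le> S / 4 * exp (2 * A t)" .
    have "L2_sqnorm t u \<le> 2 * L2_sqnorm t (\<lambda>s. u s - v s) + 2 * L2_sqnorm t v"
      using L2_sqnorm_diff_bound [OF u v, of t 1] t by simp
    also have "L2_sqnorm t (\<lambda>s. u s - v s) \<le> W"
      unfolding W_def by (rule L2_sqnorm_mono [OF L2_diff [OF u v]]) (use t in auto)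
    finally have "L2_sqnorm t u \<le> 2 * W + S / 2 * exp (2 * A t)" using vb by simp
    then have "?\<phi> t \<le> (2 * W + S / 2 * exp (2 * A t)) * exp (- 2 * A t)" by (rule mult_right_mono) simp
    also have "\<dots> = 2 * W * exp (- 2 * A t) + S / 2" by (simp add: exp_minus field_simps)
    also have "\<dots> \<le> 2 * W * 1 + S / 2"
      using A0 [of t] by (intro add_right_mono mult_left_mono) (auto simp: W_def)
    finally show ?thesis by simp
  qed
  \<comment> \<open>The supremum is finite by \<open>bdd\<close>, so half of it may be moved to the
    left.\<close>
  have "S \<le> 2 * W + S / 2"
    unfolding S_def by (rule cSUP_least) (use step T in \<open>auto simp: S_def\<close>)
  then have "S \<le> 4 * W" by simp
  have "L2_sqnorm T u \<le> S * exp (2 * A T)" using S [of T] T by simp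
  also have "\<dots> \<le> 4 * W * exp (2 * A T)" using \<open>S \<le> 4 * W\<close> by (rule mult_right_mono) simp
  finally show "L2_sqnorm T u \<le> ?K * L2_sqnorm T (\<lambda>s. u s - v s)"
    by (simp add: W_def ac_simps)
qed

lemma L2_sqnorm_power_bound:
  assumes a: "a < 1/2" and v: "v \<in> L2 T" and v0: "v 0 = 0"
    and bound: "\<And>s. s \<in> {0<..T} \<Longrightarrow> norm (v s :: real ^ 'n) \<le> N * s powr - a"
  shows "L2_sqnorm T v \<le> N\<^sup>2 * (T powr (1 - 2 * a) / (1 - 2 * a))"
proof (rule L2_sqnorm_le_integral [OF v order_refl])
  have "((\<lambda>s. s powr (- 2 * a)) has_integral T powr (- 2 * a + 1) / (- 2 * a + 1)) {0..T}"
    by (rule has_integral_powr_from_0) (use a T in auto)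
  from has_integral_mult_right [OF this, of "N\<^sup>2"]
  show "((\<lambda>s. N\<^sup>2 * s powr (- 2 * a)) has_integral N\<^sup>2 * (T powr (1 - 2 * a) / (1 - 2 * a))) {0..T}"
    by (simp add: algebra_simps)
  fix s assume s: "s \<in> {0..T}"
  show "(norm (v s))\<^sup>2 \<le> N\<^sup>2 * s powr (- 2 * a)"
  proof (cases "s = 0")
    case False
    then have "(norm (v s))\<^sup>2 \<le> (N * s powr - a)\<^sup>2" using s by (intro power_mono bound) auto
    also have "\<dots> = N\<^sup>2 * (s powr - a * s powr - a)" by (simp add: power2_eq_square)
    also have "s powr - a * s powr - a = s powr (- 2 * a)" by (simp add: powr_add [symmetric])
    finally show ?thesis .
  qed (simp add: v0)
qed

end

subsection \<open>Regularity of the drift\<close>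

lemma frechet_derivative_eq_partial_derivs:
  fixes f :: "real ^ 'n::finite \<Rightarrow> 'b::real_normed_vector"
  assumes "f differentiable (at x)"
  shows "frechet_derivative f (at x) = (\<lambda>y. \<Sum>i\<in>UNIV. y $ i *\<^sub>R partial_deriv i f x)"
proof
  fix y :: "real ^ 'n"
  have l: "linear (frechet_derivative f (at x))" by (rule linear_frechet_derivative [OF assms])
  have "y = (\<Sum>i\<in>UNIV. y $ i *\<^sub>R axis i 1)"
    by (auto simp: vec_eq_iff axis_def if_distrib sum.delta cong: if_cong)
  then have "frechet_derivative f (at x) y = frechet_derivative f (at x) (\<Sum>i\<in>UNIV. y $ i *\<^sub>R axis i 1)"
    by (rule arg_cong)
  also have "\<dots> = (\<Sum>i\<in>UNIV. y $ i *\<^sub>R partial_deriv i f x)"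
    using l by (simp add: linear_sum linear_scale partial_deriv_def)
  finally show "frechet_derivative f (at x) y = (\<Sum>i\<in>UNIV. y $ i *\<^sub>R partial_deriv i f x)" .
qed

lemma has_derivative_partial_derivs:
  fixes f :: "real ^ 'n::finite \<Rightarrow> 'b::real_normed_vector"
  assumes "f differentiable (at x)"
  shows "(f has_derivative (\<lambda>y. \<Sum>i\<in>UNIV. y $ i *\<^sub>R partial_deriv i f x)) (at x)"
  using iffD1 [OF frechet_derivative_works assms] frechet_derivative_eq_partial_derivs [OF assms] by simp

lemma partial_deriv_eqI:
  assumes "(f has_derivative f') (at x)"
  shows "partial_deriv i f x = f' (axis i 1)"
  using frechet_derivative_at [OF assms] by (simp add: partial_deriv_def)

lemma norm_sum_component_le:
  fixes y :: "real ^ 'n::finite"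
  assumes "\<And>i. norm (c i) \<le> K"
  shows "norm (\<Sum>i\<in>UNIV. y $ i *\<^sub>R c i) \<le> real CARD('n) * K * norm y"
proof -
  have "norm (\<Sum>i\<in>UNIV. y $ i *\<^sub>R c i) \<le> (\<Sum>i\<in>(UNIV :: 'n set). norm y * K)"
    by (rule sum_norm_le) (use assms component_le_norm_cart in \<open>auto intro!: mult_mono\<close>)
  then show ?thesis by (simp add: ac_simps)
qed

lemma partial_derivs_Lipschitz:
  fixes f :: "real ^ 'n::finite \<Rightarrow> 'b::real_normed_vector"
  assumes S: "convex S" "x \<in> S" "y \<in> S" and d: "\<And>z. z \<in> S \<Longrightarrow> f differentiable (at z)"
    and K: "\<And>i z. z \<in> S \<Longrightarrow> norm (partial_deriv i f z) \<le> K"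
  shows "norm (f x - f y) \<le> real CARD('n) * K * norm (x - y)"
proof (rule differentiable_bound [OF S(1) _ _ S(2,3)])
  fix z assume z: "z \<in> S"
  show "(f has_derivative (\<lambda>y. \<Sum>i\<in>UNIV. y $ i *\<^sub>R partial_deriv i f z)) (at z within S)"
    by (rule has_derivative_at_withinI [OF has_derivative_partial_derivs [OF d [OF z]]])
  show "onorm (\<lambda>y. \<Sum>i\<in>UNIV. y $ i *\<^sub>R partial_deriv i f z) \<le> real CARD('n) * K"
    by (rule onorm_le) (rule norm_sum_component_le [OF K [OF z]])
qed

text \<open>The mean value inequality is applied on the ball of radius \<open>norm y\<close> to
  \<open>f\<close> minus its linearization at \<open>x\<close>; the partial derivatives of this
  difference are at most \<open>L * norm y\<close> there.\<close>

lemma first_order_Taylor: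
  fixes f :: "real ^ 'n::finite \<Rightarrow> 'b::real_normed_vector"
  assumes d: "\<And>z. f differentiable (at z)" and L: "\<And>i z z'. norm (partial_deriv i f z - partial_deriv i f z') \<le> L * norm (z - z')"
    and L0: "0 \<le> L"
  shows "norm (f (x + y) - f x - (\<Sum>i\<in>UNIV. y $ i *\<^sub>R partial_deriv i f x)) \<le> real CARD('n) * L * (norm y)\<^sup>2"
proof -
  let ?g = "\<lambda>z. f z - (\<Sum>i\<in>UNIV. z $ i *\<^sub>R partial_deriv i f x)"
  have h: "(?g has_derivative (\<lambda>w. (\<Sum>i\<in>UNIV. w $ i *\<^sub>R partial_deriv i f z) - (\<Sum>i\<in>UNIV. w $ i *\<^sub>R partial_deriv i f x))) (at z)" for z
    by (intro has_derivative_diff has_derivative_partial_derivs d has_derivative_sum has_derivative_scaleR_left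
        bounded_linear.has_derivative [OF bounded_linear_vec_nth] has_derivative_ident)
  have "partial_deriv i ?g z = partial_deriv i f z - partial_deriv i f x" for i z
    unfolding partial_deriv_eqI [OF h] by (simp add: axis_def if_distrib if_distribR sum.delta cong: if_cong)
  moreover have "?g differentiable (at z)" for z using h by (auto simp: differentiable_def)
  ultimately have "norm (?g (x + y) - ?g x) \<le> real CARD('n) * (L * norm y) * norm (x + y - x)"
    by (intro partial_derivs_Lipschitz [of "cball x (norm y)"])
      (auto simp: dist_norm norm_minus_commute intro!: order_trans [OF L] mult_left_mono L0)
  also have "?g (x + y) - ?g x = f (x + y) - f x - (\<Sum>i\<in>UNIV. y $ i *\<^sub>R partial_deriv i f x)"
    by (simp add: scaleR_add_left sum.distrib)
  finally show ?thesis by (simp add: power2_eq_square ac_simps)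
qed

locale drift =
  fixes T K :: real and b :: "real \<Rightarrow> real ^ 'n::finite \<Rightarrow> real ^ 'n"
  assumes K0: "0 < K"
    and b_bound: "\<And>t x. t \<in> {0..T} \<Longrightarrow> norm (b t x) \<le> K"
    and b_diff: "\<And>t x. t \<in> {0..T} \<Longrightarrow> b t differentiable (at x)"
    and b_time: "\<And>s t x. s \<in> {0..T} \<Longrightarrow> t \<in> {0..T} \<Longrightarrow> norm (b t x - b s x) \<le> K * \<bar>t - s\<bar>"
    and P_bound: "\<And>i t x. t \<in> {0..T} \<Longrightarrow> norm (partial_deriv i (b t) x) \<le> K"
    and P_Lipschitz: "\<And>i t x y. t \<in> {0..T} \<Longrightarrow> norm (partial_deriv i (b t) x - partial_deriv i (b t) y) \<le> K * norm (x - y)"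
    and P_time: "\<And>i s t x. s \<in> {0..T} \<Longrightarrow> t \<in> {0..T} \<Longrightarrow>
      norm (partial_deriv i (b t) x - partial_deriv i (b s) x) \<le> K * sqrt \<bar>t - s\<bar>"
    and b_cont: "continuous_on ({0..T} \<times> UNIV) (\<lambda>(t, x). b t x)"
    and P_cont: "\<And>i. continuous_on ({0..T} \<times> UNIV) (\<lambda>(t, x). partial_deriv i (b t) x)"

text \<open>
  Only \<open>b\<close> itself is differentiable in time, but interpolating between its Lipschitz continuity in
  time and the second-order bound in space (a difference quotient with step \<open>sqrt \<bar>t - s\<bar>\<close>) makes the
  first spatial derivatives Hoelder continuous in time with exponent \<open>1/2\<close>.
\<close>

lemma Cb_1_3_drift:
  fixes b :: "real \<Rightarrow> real ^ 'n::finite \<Rightarrow> real ^ 'n"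
  assumes b: "Cb_1_3 T b"
  obtains K where "drift T K b"
proof -
  obtain b' where b': "\<And>t x. t \<in> {0..T} \<Longrightarrow> ((\<lambda>s. b s x) has_vector_derivative b' t x) (at t within {0..T})"
    and b'b: "bounded ((\<lambda>(t, x). b' t x) ` ({0..T} \<times> UNIV))"
    using b unfolding Cb_1_3_def bounded_continuous_on_def by blast
  have diff: "iterated_partial is (b t) differentiable (at x)" if "t \<in> {0..T}" "length is < 3" for t x "is"
    using b that unfolding Cb_1_3_def by blast
  have cont: "continuous_on ({0..T} \<times> UNIV) (\<lambda>(t, x). iterated_partial is (b t) x)"
    and bdd: "bounded ((\<lambda>(t, x). iterated_partial is (b t) x) ` ({0..T} \<times> UNIV))" if "length is \<le> 3" for "is"
    using b that unfolding Cb_1_3_def bounded_continuous_on_def by blast+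
  have bdd': "\<exists>B. \<forall>t\<in>{0..T}. \<forall>x. norm (iterated_partial is (b t) x) \<le> B" if len: "length is \<le> 3" for "is"
  proof -
    obtain B where "\<forall>z\<in>(\<lambda>(t, x). iterated_partial is (b t) x) ` ({0..T} \<times> UNIV). norm z \<le> B"
      using bdd [OF len] unfolding bounded_iff by blast
    then show ?thesis by (intro exI [of _ B]) auto
  qed
  have "\<exists>B. \<forall>t\<in>{0..T}. \<forall>x. norm (b t x) \<le> B" using bdd' [of "[]"] by simp
  then obtain B0 where B0: "\<And>t x. t \<in> {0..T} \<Longrightarrow> norm (b t x) \<le> B0" by blast
  have "\<forall>i. \<exists>B. \<forall>t\<in>{0..T}. \<forall>x. norm (partial_deriv i (b t) x) \<le> B" using bdd' [of "[_]"] by auto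
  from choice [OF this] obtain B1 where B1: "\<And>i t x. t \<in> {0..T} \<Longrightarrow> norm (partial_deriv i (b t) x) \<le> B1 i" by blast
  have "\<forall>ji. \<exists>B. \<forall>t\<in>{0..T}. \<forall>x. norm (partial_deriv (fst ji) (partial_deriv (snd ji) (b t)) x) \<le> B"
    using bdd' [of "[_, _]"] by auto
  from choice [OF this] obtain B2 where B2: "\<And>j i t x. t \<in> {0..T} \<Longrightarrow> norm (partial_deriv j (partial_deriv i (b t)) x) \<le> B2 (j, i)"
    by force
  obtain B3 where "\<forall>z\<in>(\<lambda>(t, x). b' t x) ` ({0..T} \<times> UNIV). norm z \<le> B3"
    using b'b unfolding bounded_iff by blast
  then have B3: "\<And>t x. t \<in> {0..T} \<Longrightarrow> norm (b' t x) \<le> B3" by auto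
  define n where "n = real CARD('n)"
  have n: "1 \<le> n" by (simp add: n_def)
  define L where "L = max 1 (max B0 (max B3 (max (Max (range B1)) (Max (range B2)))))"
  have LB: "1 \<le> L" "B0 \<le> L" "B3 \<le> L" "B1 i \<le> L" "B2 ji \<le> L" for i ji
  proof -
    have "B1 i \<le> Max (range B1)" "B2 ji \<le> Max (range B2)" by (auto intro!: Max_ge)
    then show "1 \<le> L" "B0 \<le> L" "B3 \<le> L" "B1 i \<le> L" "B2 ji \<le> L" unfolding L_def by linarith+
  qed
  have d0: "b t differentiable (at x)" and d1: "partial_deriv i (b t) differentiable (at x)" if "t \<in> {0..T}" for t x i
    using diff [OF that, of "[]"] diff [OF that, of "[i]"] by auto
  have P1: "norm (partial_deriv i (b t) x) \<le> L" if "t \<in> {0..T}" for i t x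
    using B1 [OF that, of i x] LB(4) [of i] by linarith
  have PL: "norm (partial_deriv i (b t) x - partial_deriv i (b t) y) \<le> n * L * norm (x - y)" if t: "t \<in> {0..T}" for i t x y
    unfolding n_def
    by (rule partial_derivs_Lipschitz [of UNIV])
      (use d1 [OF t] order_trans [OF B2 [OF t] LB(5)] in auto)
  have bt: "norm (b t x - b s x) \<le> L * \<bar>t - s\<bar>" if "s \<in> {0..T}" "t \<in> {0..T}" for s t x
  proof -
    have "norm (b t x - b s x) \<le> L * norm (t - s)"
    proof (rule differentiable_bound [of "{0..T}" "\<lambda>s. b s x" "\<lambda>r h. h *\<^sub>R b' r x"])
      fix r assume r: "r \<in> {0..T}"
      show "((\<lambda>s. b s x) has_derivative (\<lambda>h. h *\<^sub>R b' r x)) (at r within {0..T})"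
        using b' [OF r, of x] by (simp add: has_vector_derivative_def)
      show "onorm (\<lambda>h. h *\<^sub>R b' r x) \<le> L"
        by (rule onorm_le) (use B3 [OF r, of x] LB(3) in \<open>auto simp: mult.commute [of L] intro!: mult_left_mono\<close>)
    qed (use that in auto)
    then show ?thesis by simp
  qed
  \<comment> \<open>In the difference quotient \<open>2 * L\<close> pays for the two time increments
    of \<open>b\<close>, and \<open>2 * n * (n * L)\<close> for the two Taylor remainders in
    space.\<close>
  define K where "K = 2 * L + 2 * n * (n * L)"
  have KL: "L \<le> K" "n * L \<le> K"
  proof -
    have "n * L \<le> n * (n * L)" using n LB(1) by (simp add: mult_left_mono)
    moreover have "0 \<le> n * L" using n LB(1) by simp
    ultimately show "L \<le> K" "n * L \<le> K" using LB(1) unfolding K_def by linarith+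
  qed
  have Pt: "norm (partial_deriv i (b t) x - partial_deriv i (b s) x) \<le> K * sqrt \<bar>t - s\<bar>"
    if s: "s \<in> {0..T}" and t: "t \<in> {0..T}" for i s t x
  proof (cases "s = t")
    case False
    define h where "h = sqrt \<bar>t - s\<bar>"
    have h: "0 < h" "\<bar>t - s\<bar> = h * h" using False by (auto simp: h_def)
    let ?e = "h *\<^sub>R axis i (1::real) :: real ^ 'n"
    have sum_e: "(\<Sum>j\<in>UNIV. ?e $ j *\<^sub>R partial_deriv j (b r) x) = h *\<^sub>R partial_deriv i (b r) x" for r
      by (simp add: axis_def if_distrib if_distribR sum.delta cong: if_cong)
    have ne: "norm ?e = h" using h by (simp add: norm_axis_1)
    have T1: "norm (b r (x + ?e) - b r x - h *\<^sub>R partial_deriv i (b r) x) \<le> n * (n * L) * (h * h)" if r: "r \<in> {0..T}" for r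
      using first_order_Taylor [OF d0 [OF r] PL [OF r], of x ?e] n LB(1)
      unfolding sum_e ne n_def [symmetric] by (simp add: power2_eq_square)
    have eq: "h *\<^sub>R (partial_deriv i (b t) x - partial_deriv i (b s) x)
        = (b t (x + ?e) - b s (x + ?e)) - (b t x - b s x)
          - (b t (x + ?e) - b t x - h *\<^sub>R partial_deriv i (b t) x)
          + (b s (x + ?e) - b s x - h *\<^sub>R partial_deriv i (b s) x)"
      by (simp add: scaleR_diff_right)
    have "norm (h *\<^sub>R (partial_deriv i (b t) x - partial_deriv i (b s) x))
        \<le> L * \<bar>t - s\<bar> + L * \<bar>t - s\<bar> + n * (n * L) * (h * h) + n * (n * L) * (h * h)"
    proof -
      have gen: "norm (v1 - v2 - v3 + v4) \<le> norm v1 + norm v2 + norm v3 + norm v4" for v1 v2 v3 v4 :: "real ^ 'n"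
        by norm
      show ?thesis
        unfolding eq by (rule order_trans [OF gen add_mono [OF add_mono [OF add_mono]]])
          (rule bt [OF s t] T1 [OF t] T1 [OF s])+
    qed
    also have "\<dots> = K * h * h" by (simp add: h(2) K_def algebra_simps)
    finally have "h * norm (partial_deriv i (b t) x - partial_deriv i (b s) x) \<le> h * (K * h)"
      using h by (simp add: ac_simps)
    then show ?thesis using h(1) by (simp add: h_def)
  qed simp
  have "drift T K b"
  proof
    show "0 < K" using KL LB(1) by linarith
    show "norm (b t x) \<le> K" if "t \<in> {0..T}" for t x using B0 [OF that, of x] LB(2) KL by linarith
    show "norm (b t x - b s x) \<le> K * \<bar>t - s\<bar>" if "s \<in> {0..T}" "t \<in> {0..T}" for s t x
      by (rule order_trans [OF bt [OF that] mult_right_mono [OF KL(1)]]) simp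
    show "norm (partial_deriv i (b t) x) \<le> K" if "t \<in> {0..T}" for i t x using P1 [OF that, of i x] KL by linarith
    show "norm (partial_deriv i (b t) x - partial_deriv i (b t) y) \<le> K * norm (x - y)" if "t \<in> {0..T}" for i t x y
      by (rule order_trans [OF PL [OF that] mult_right_mono [OF KL(2)]]) simp
    show "continuous_on ({0..T} \<times> UNIV) (\<lambda>(t, x). b t x)" using cont [of "[]"] by simp
    show "continuous_on ({0..T} \<times> UNIV) (\<lambda>(t, x). partial_deriv i (b t) x)" for i using cont [of "[i]"] by simp
  qed (use d0 Pt in auto)
  then show ?thesis by (rule that)
qed

context drift
begin

lemma jacobian_eq:
  assumes "t \<in> {0..T}"
  shows "jacobian (b t) (at x) *v y = (\<Sum>i\<in>UNIV. y $ i *\<^sub>R partial_deriv i (b t) x)"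
proof -
  have "frechet_derivative (b t) (at x) y = jacobian (b t) (at x) *v y"
    unfolding jacobian_def using b_diff [OF assms] by (simp add: matrix_works linear_frechet_derivative)
  then show ?thesis by (simp add: frechet_derivative_eq_partial_derivs [OF b_diff [OF assms]])
qed

lemma b_Lipschitz:
  assumes "t \<in> {0..T}"
  shows "norm (b t x - b t y) \<le> real CARD('n) * K * norm (x - y)"
  by (rule partial_derivs_Lipschitz [of UNIV]) (use b_diff P_bound assms in auto)

lemma partial_deriv_diff:
  assumes "f differentiable (at x)" "g differentiable (at x)"
  shows "partial_deriv i (\<lambda>x. f x - g x) x = partial_deriv i f x - partial_deriv i g x"
  using partial_deriv_eqI [OF has_derivative_diff [OF iffD1 [OF frechet_derivative_works assms(1)] iffD1 [OF frechet_derivative_works assms(2)]]]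
  by (simp add: partial_deriv_def)

lemma partial_deriv_shift:
  assumes "f differentiable (at (x + y))"
  shows "(\<lambda>x. f (x + y)) differentiable (at x)" "partial_deriv i (\<lambda>x. f (x + y)) x = partial_deriv i f (x + y)"
proof -
  have "((\<lambda>x. x + y) has_derivative (\<lambda>h. h)) (at x)" by (auto intro!: derivative_eq_intros)
  from has_derivative_compose [OF this iffD1 [OF frechet_derivative_works assms]]
  have h: "((\<lambda>x. f (x + y)) has_derivative frechet_derivative f (at (x + y))) (at x)" .
  then show "(\<lambda>x. f (x + y)) differentiable (at x)" by (auto simp: differentiable_def)
  show "partial_deriv i (\<lambda>x. f (x + y)) x = partial_deriv i f (x + y)"
    using partial_deriv_eqI [OF h] by (simp add: partial_deriv_def)
qed

text \<open>A second difference, small in both increments: the function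
  \<open>x \<mapsto> b t (x + y) - b t x\<close> has partial derivatives of size
  \<open>K * norm y\<close>, and the mean value inequality supplies the other factor. This keeps the
  Hoelder constant of the Taylor remainder proportional to the perturbation when the base path
  moves.\<close>

lemma increment_space:
  assumes t: "t \<in> {0..T}"
  shows "norm ((b t (x + y) - b t x) - (b t (x' + y) - b t x')) \<le> real CARD('n) * (K * norm y) * norm (x - x')"
proof (rule partial_derivs_Lipschitz [of UNIV])
  fix z
  show "(\<lambda>x. b t (x + y) - b t x) differentiable (at z)"
    by (intro differentiable_diff partial_deriv_shift b_diff t)
  show "norm (partial_deriv i (\<lambda>x. b t (x + y) - b t x) z) \<le> K * norm y" for i
    using P_Lipschitz [OF t, of i "z + y" z]
    by (simp add: partial_deriv_diff partial_deriv_shift b_diff [OF t])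
qed auto

text \<open>The same second difference with time in place of the base point: the mean value
  inequality in space is applied to \<open>b t - b s\<close>, whose partial derivatives are
  controlled by \<open>P_time\<close>.\<close>

lemma increment_time:
  assumes t: "t \<in> {0..T}" "s \<in> {0..T}"
  shows "norm ((b t (x + y) - b t x) - (b s (x + y) - b s x)) \<le> real CARD('n) * (K * sqrt \<bar>t - s\<bar>) * norm y"
proof -
  have "norm ((b t (x + y) - b s (x + y)) - (b t x - b s x)) \<le> real CARD('n) * (K * sqrt \<bar>t - s\<bar>) * norm (x + y - x)"
    by (rule partial_derivs_Lipschitz [of UNIV])
      (use t P_time [OF t(2,1)] b_diff in \<open>auto simp: partial_deriv_diff\<close>)
  then show ?thesis by (simp add: algebra_simps)
qed

lemma remainder_bound:
  assumes t: "t \<in> {0..T}"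
  shows "norm (b t (x + y) - b t x - jacobian (b t) (at x) *v y) \<le> real CARD('n) * K * (norm y)\<^sup>2"
  unfolding jacobian_eq [OF t] by (rule first_order_Taylor) (use t K0 b_diff P_Lipschitz in auto)

end

text \<open>On a bounded interval exponent 1/2 implies the smaller exponent \<open>H / 2\<close>;
  the surplus power of the distance is at most \<open>T powr (1/2 - H / 2)\<close>, since its
  exponent is positive.\<close>

lemma path_bound_of_sqrt:
  fixes f :: "real \<Rightarrow> 'a::real_normed_vector"
  assumes H: "0 < H" "H < 1" and s: "s \<in> {0..T}" and N: "0 \<le> N"
    and b: "\<And>r. r \<in> {0..s} \<Longrightarrow> norm (f r) \<le> N"
    and h: "\<And>r q. 1/2 < H \<Longrightarrow> r \<in> {0..s} \<Longrightarrow> q \<in> {0..s} \<Longrightarrow> norm (f r - f q) \<le> N * sqrt \<bar>r - q\<bar>"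
  shows "path_bound H f s (N * (1 + T powr (1/2 - H / 2)))"
proof -
  have 1: "N \<le> N * (1 + T powr (1/2 - H / 2))" using N by (simp add: mult_le_cancel_left1)
  have 2: "sqrt \<bar>r - q\<bar> \<le> (1 + T powr (1/2 - H / 2)) * \<bar>r - q\<bar> powr (H / 2)" if "r \<in> {0..s}" "q \<in> {0..s}" for r q
  proof -
    have "sqrt \<bar>r - q\<bar> = \<bar>r - q\<bar> powr (1/2 - H / 2) * \<bar>r - q\<bar> powr (H / 2)"
      by (simp add: powr_add [symmetric] powr_half_sqrt)
    also have "\<dots> \<le> T powr (1/2 - H / 2) * \<bar>r - q\<bar> powr (H / 2)"
      using H s that by (intro mult_right_mono powr_mono2) auto
    also have "\<dots> \<le> (1 + T powr (1/2 - H / 2)) * \<bar>r - q\<bar> powr (H / 2)"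
      by (intro mult_right_mono) auto
    finally show ?thesis .
  qed
  show ?thesis
    unfolding path_bound_def
  proof (intro conjI ballI impI)
    show "norm (f r) \<le> N * (1 + T powr (1/2 - H / 2))" if "r \<in> {0..s}" for r
      using b [OF that] 1 by linarith
    show "norm (f r - f q) \<le> N * (1 + T powr (1/2 - H / 2)) * \<bar>r - q\<bar> powr (H / 2)"
      if "1/2 < H" "r \<in> {0..s}" "q \<in> {0..s}" for r q
      using order_trans [OF h [OF that] mult_left_mono [OF 2 [OF that(2,3)] N]] by (simp add: mult.assoc)
  qed
qed

section \<open>Linearized drift and Taylor remainder along the deterministic path\<close>

locale drift_path = drift T K b for T K :: real and b :: "real \<Rightarrow> real ^ 'n::finite \<Rightarrow> real ^ 'n" +
  fixes H :: real and X :: "real \<Rightarrow> real ^ 'n"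
  assumes T: "0 < T" and H: "0 < H" "H < 1"
    and X: "\<And>t. t \<in> {0..T} \<Longrightarrow> (X has_vector_derivative b t (X t)) (at t within {0..T})"
begin

text \<open>The form in which \<open>K_sigma_estimates\<close> describes a perturbation of running
  norm proportional to \<open>E\<close>: the bounds concern \<open>[0, s]\<close> only, while
  continuity is kept on all of \<open>[0, T]\<close>.\<close>

definition path_class :: "real \<Rightarrow> (real \<Rightarrow> real ^ 'n) \<Rightarrow> real \<Rightarrow> bool" where
  "path_class s \<eta> E \<longleftrightarrow> continuous_on {0..T} \<eta> \<and> (\<forall>r\<in>{0..s}. norm (\<eta> r) \<le> E) \<and>
     (1/2 < H \<longrightarrow> (\<forall>r\<in>{0..s}. \<forall>q\<in>{0..s}. norm (\<eta> r - \<eta> q) \<le> E * sqrt \<bar>r - q\<bar>))"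

lemma X_cont: "continuous_on {0..T} X"
  by (rule continuous_on_vector_derivative [OF X])

lemma X_Lipschitz:
  assumes "r \<in> {0..T}" "q \<in> {0..T}"
  shows "norm (X r - X q) \<le> K * \<bar>r - q\<bar>"
proof -
  have "norm (X r - X q) \<le> K * norm (r - q)"
  proof (rule differentiable_bound [of "{0..T}" X "\<lambda>t h. h *\<^sub>R b t (X t)"])
    fix t assume t: "t \<in> {0..T}"
    show "(X has_derivative (\<lambda>h. h *\<^sub>R b t (X t))) (at t within {0..T})"
      using X [OF t] by (simp add: has_vector_derivative_def)
    show "onorm (\<lambda>h. h *\<^sub>R b t (X t)) \<le> K"
      by (rule onorm_le) (use b_bound [OF t, of "X t"] in \<open>auto simp: mult.commute [of K] intro!: mult_left_mono\<close>)
  qed (use assms in auto)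
  then show ?thesis by simp
qed

lemma abs_le_sqrt:
  assumes "r \<in> {0..T}" "q \<in> {0..T}"
  shows "\<bar>r - q\<bar> \<le> sqrt T * sqrt \<bar>r - q\<bar>"
proof -
  have "\<bar>r - q\<bar> = sqrt \<bar>r - q\<bar> * sqrt \<bar>r - q\<bar>" by simp
  also have "\<dots> \<le> sqrt T * sqrt \<bar>r - q\<bar>" using assms by (intro mult_right_mono) auto
  finally show ?thesis .
qed

lemma X_half_Hoelder:
  assumes "r \<in> {0..T}" "q \<in> {0..T}"
  shows "norm (X r - X q) \<le> K * sqrt T * sqrt \<bar>r - q\<bar>"
  using order_trans [OF X_Lipschitz [OF assms] mult_left_mono [OF abs_le_sqrt [OF assms] less_imp_le [OF K0]]]
  by (simp add: mult.assoc)

definition linear_drift :: "real \<Rightarrow> (real \<Rightarrow> real ^ 'n) \<Rightarrow> real ^ 'n" where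
  "linear_drift t \<eta> = jacobian (b t) (at (X t)) *v \<eta> t"

lemma composite_cont:
  assumes g: "continuous_on ({0..T} \<times> UNIV) (\<lambda>(t, x). g t x)" and y: "continuous_on {0..T} y"
  shows "continuous_on {0..T} (\<lambda>t. g t (y t :: real ^ 'n))"
  using continuous_on_compose2 [OF g continuous_on_Pair [OF continuous_on_id y]] by auto

lemma linear_drift_cont:
  assumes "continuous_on {0..T} \<eta>"
  shows "continuous_on {0..T} (\<lambda>t. linear_drift t \<eta>)"
proof -
  have "continuous_on {0..T} (\<lambda>t. \<Sum>i\<in>UNIV. \<eta> t $ i *\<^sub>R partial_deriv i (b t) (X t))"
    by (intro continuous_intros assms composite_cont [OF P_cont X_cont])
  then show ?thesis by (rule continuous_on_eq) (simp add: linear_drift_def jacobian_eq)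
qed

text \<open>A product rule: the increment of the perturbation meets the bound \<open>K\<close> of
  the partial derivatives, and its size meets their variation along \<open>X\<close>, which is
  Hoelder-1/2 directly in time and Lipschitz through the motion of \<open>X\<close>.\<close>

lemma linear_drift_half_Hoelder:
  assumes pc: "path_class s \<eta> E" and s: "s \<in> {0..T}" and h: "1/2 < H" and rq: "r \<in> {0..s}" "q \<in> {0..s}"
  shows "norm (linear_drift r \<eta> - linear_drift q \<eta>) \<le> real CARD('n) * (K + (K + K * (K * sqrt T))) * E * sqrt \<bar>r - q\<bar>"
proof -
  have rT: "r \<in> {0..T}" "q \<in> {0..T}" using rq s by auto
  have \<eta>: "norm (\<eta> r - \<eta> q) \<le> E * sqrt \<bar>r - q\<bar>" "norm (\<eta> q) \<le> E" using pc h rq by (auto simp: path_class_def)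
  let ?P = "\<lambda>i t. partial_deriv i (b t) (X t)"
  have P: "norm (?P i r - ?P i q) \<le> (K + K * (K * sqrt T)) * sqrt \<bar>r - q\<bar>" for i
  proof -
    have "norm (?P i r - ?P i q) \<le> norm (partial_deriv i (b r) (X r) - partial_deriv i (b q) (X r))
        + norm (partial_deriv i (b q) (X r) - partial_deriv i (b q) (X q))" by norm
    also have "\<dots> \<le> K * sqrt \<bar>r - q\<bar> + K * (K * sqrt T * sqrt \<bar>r - q\<bar>)"
      by (intro add_mono P_time order_trans [OF P_Lipschitz] mult_left_mono X_half_Hoelder)
        (use rT K0 in auto)
    finally show ?thesis by (simp add: algebra_simps)
  qed
  have "linear_drift r \<eta> - linear_drift q \<eta> = (\<Sum>i\<in>UNIV. (\<eta> r - \<eta> q) $ i *\<^sub>R ?P i r) + (\<Sum>i\<in>UNIV. \<eta> q $ i *\<^sub>R (?P i r - ?P i q))"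
    by (simp add: linear_drift_def jacobian_eq [OF rT(1)] jacobian_eq [OF rT(2)] scaleR_diff_left scaleR_diff_right sum_subtractf)
  also have "norm \<dots> \<le> real CARD('n) * K * norm (\<eta> r - \<eta> q)
      + real CARD('n) * ((K + K * (K * sqrt T)) * sqrt \<bar>r - q\<bar>) * norm (\<eta> q)"
    by (intro order_trans [OF norm_triangle_ineq] add_mono norm_sum_component_le P P_bound rT)
  also have "\<dots> \<le> real CARD('n) * K * (E * sqrt \<bar>r - q\<bar>) + real CARD('n) * ((K + K * (K * sqrt T)) * sqrt \<bar>r - q\<bar>) * E"
    using \<eta> K0 T by (intro add_mono mult_left_mono) auto
  finally show ?thesis by (simp add: algebra_simps)
qed

lemma linear_drift_bound:
  assumes "r \<in> {0..T}"
  shows "norm (linear_drift r \<eta>) \<le> real CARD('n) * K * norm (\<eta> r)"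
  unfolding linear_drift_def jacobian_eq [OF assms] by (rule norm_sum_component_le [OF P_bound [OF assms]])

lemma linear_drift_path_bound:
  obtains C where "0 \<le> C"
    "\<And>\<eta> s E. path_class s \<eta> E \<Longrightarrow> s \<in> {0..T} \<Longrightarrow> path_bound H (\<lambda>t. linear_drift t \<eta>) s (C * E)"
proof
  define C1 where "C1 = real CARD('n) * (K + (K + K * (K * sqrt T)))"
  let ?C = "C1 * (1 + T powr (1/2 - H / 2))"
  have C1: "0 \<le> C1" "real CARD('n) * K \<le> C1" using K0 T by (auto simp: C1_def intro!: mult_left_mono)
  show "0 \<le> ?C" using C1 by simp
  fix \<eta> s E assume pc: "path_class s \<eta> E" and s: "s \<in> {0..T}"
  have \<eta>: "norm (\<eta> r) \<le> E" if "r \<in> {0..s}" for r using pc that by (simp add: path_class_def)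
  have E: "0 \<le> E" using order_trans [OF norm_ge_zero \<eta> [of 0]] s by simp
  have "path_bound H (\<lambda>t. linear_drift t \<eta>) s (C1 * E * (1 + T powr (1/2 - H / 2)))"
  proof (rule path_bound_of_sqrt [OF H s])
    show "0 \<le> C1 * E" using C1 E by simp
    fix r assume r: "r \<in> {0..s}"
    have "norm (linear_drift r \<eta>) \<le> real CARD('n) * K * norm (\<eta> r)" by (rule linear_drift_bound) (use r s in auto)
    also have "\<dots> \<le> C1 * E" using \<eta> [OF r] C1 by (intro mult_mono) auto
    finally show "norm (linear_drift r \<eta>) \<le> C1 * E" .
  next
    fix r q assume "1/2 < H" "r \<in> {0..s}" "q \<in> {0..s}"
    from linear_drift_half_Hoelder [OF pc s this] show "norm (linear_drift r \<eta> - linear_drift q \<eta>) \<le> C1 * E * sqrt \<bar>r - q\<bar>"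
      by (simp add: C1_def)
  qed
  then show "path_bound H (\<lambda>t. linear_drift t \<eta>) s (?C * E)" by (simp add: ac_simps)
qed

definition drift_remainder :: "real \<Rightarrow> (real \<Rightarrow> real ^ 'n) \<Rightarrow> real ^ 'n" where
  "drift_remainder t \<eta> = b t (X t + \<eta> t) - b t (X t) - linear_drift t \<eta>"

lemma drift_remainder_cont:
  assumes "continuous_on {0..T} \<eta>"
  shows "continuous_on {0..T} (\<lambda>t. drift_remainder t \<eta>)"
  unfolding drift_remainder_def by (intro continuous_intros linear_drift_cont composite_cont [OF b_cont] assms X_cont)

text \<open>
  The remainder is quadratic in the size of the perturbation, but its Hoelder-\<open>1/2\<close> constant is only
  linear; interpolation gives a Hoelder-\<open>H/2\<close> constant of order \<open>2 - H > 1\<close>.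
\<close>

lemma drift_remainder_path_bound:
  obtains C where "0 \<le> C"
    "\<And>\<eta> E. path_class T \<eta> E \<Longrightarrow> E \<le> 1 \<Longrightarrow> path_bound H (\<lambda>t. drift_remainder t \<eta>) T (C * E powr (2 - H))"
proof -
  define n where "n = real CARD('n)"
  have n: "0 \<le> n" by (simp add: n_def)
  define C1 where "C1 = n * K"
  define C2 where "C2 = n * K + n * (K * (K * sqrt T)) + n * K + n * (K + (K + K * (K * sqrt T)))"
  define C where "C = C1 + (2 * C1) powr (1 - H) * C2 powr H"
  have C1: "0 \<le> C1" and C2: "0 \<le> C2" using n K0 T by (auto simp: C1_def C2_def)
  have C: "0 \<le> C" "C1 \<le> C" "(2 * C1) powr (1 - H) * C2 powr H \<le> C" using C1 by (auto simp: C_def)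
  show ?thesis
  proof (rule that [OF C(1)])
    fix \<eta> E assume pc: "path_class T \<eta> E" and E1: "E \<le> 1"
    have \<eta>: "norm (\<eta> r) \<le> E" if "r \<in> {0..T}" for r using pc that by (simp add: path_class_def)
    have E: "0 \<le> E" using order_trans [OF norm_ge_zero \<eta> [of 0]] T by simp
    have E2: "E\<^sup>2 \<le> E powr (2 - H)"
    proof (cases "E = 0")
      case False
      then have "E\<^sup>2 = E powr 2" using E by simp
      also have "\<dots> \<le> E powr (2 - H)" using E E1 False H by (intro powr_mono') auto
      finally show ?thesis .
    qed simp
    have quad: "norm (drift_remainder r \<eta>) \<le> C1 * E\<^sup>2" if r: "r \<in> {0..T}" for r
    proof -
      have "norm (drift_remainder r \<eta>) \<le> C1 * (norm (\<eta> r))\<^sup>2"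
        using remainder_bound [OF r, of "X r" "\<eta> r"] by (simp add: drift_remainder_def linear_drift_def C1_def n_def)
      also have "\<dots> \<le> C1 * E\<^sup>2" using \<eta> [OF r] C1 by (intro mult_left_mono power_mono) auto
      finally show ?thesis .
    qed
    show "path_bound H (\<lambda>t. drift_remainder t \<eta>) T (C * E powr (2 - H))"
      unfolding path_bound_def
    proof (intro conjI ballI impI)
      fix r assume r: "r \<in> {0..T}"
      have "norm (drift_remainder r \<eta>) \<le> C1 * E\<^sup>2" by (rule quad [OF r])
      also have "\<dots> \<le> C * E powr (2 - H)" using E2 C C1 by (intro mult_mono) auto
      finally show "norm (drift_remainder r \<eta>) \<le> C * E powr (2 - H)" .
    next
      fix r q assume h: "1/2 < H" and r: "r \<in> {0..T}" and q: "q \<in> {0..T}"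
      define d where "d = sqrt \<bar>r - q\<bar>"
      have d: "0 \<le> d" by (simp add: d_def)
      have \<eta>d: "norm (\<eta> r - \<eta> q) \<le> E * d" using pc h r q by (simp add: path_class_def d_def)
      have t1: "norm (b r (X r + \<eta> r) - b r (X r + \<eta> q)) \<le> n * K * (E * d)"
      proof -
        have "norm (b r (X r + \<eta> r) - b r (X r + \<eta> q)) \<le> n * K * norm (\<eta> r - \<eta> q)"
          using b_Lipschitz [OF r, of "X r + \<eta> r" "X r + \<eta> q"] by (simp add: n_def)
        also have "\<dots> \<le> n * K * (E * d)" using \<eta>d n K0 by (intro mult_left_mono) auto
        finally show ?thesis .
      qed
      have t2: "norm ((b r (X r + \<eta> q) - b r (X r)) - (b r (X q + \<eta> q) - b r (X q))) \<le> n * (K * E) * (K * sqrt T * d)"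
        unfolding n_def using X_half_Hoelder [OF r q] \<eta> [OF q] K0 E
        by (intro order_trans [OF increment_space [OF r]] mult_mono) (auto simp: d_def)
      have t3: "norm ((b r (X q + \<eta> q) - b r (X q)) - (b q (X q + \<eta> q) - b q (X q))) \<le> n * (K * d) * E"
        unfolding n_def d_def using \<eta> [OF q] K0
        by (intro order_trans [OF increment_time [OF r q]] mult_left_mono) auto
      have t4: "norm (linear_drift r \<eta> - linear_drift q \<eta>) \<le> n * (K + (K + K * (K * sqrt T))) * E * d"
        unfolding n_def d_def by (rule linear_drift_half_Hoelder [OF pc _ h r q]) (use T in auto)
      \<comment> \<open>One ingredient is changed at a time: the perturbation in \<open>t1\<close>,
        the base path in \<open>t2\<close>, the time argument in \<open>t3\<close>; the linear part
        is treated separately in \<open>t4\<close>.\<close>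
      have gen: "norm ((x1 - x4 - y) - (x7 - x8 - z)) \<le> norm (x1 - x2) + norm ((x2 - x4) - (x5 - x6))
          + norm ((x5 - x6) - (x7 - x8)) + norm (y - z)" for x1 x2 x4 x5 x6 x7 x8 y z :: "real ^ 'n"
        by norm
      have "norm (drift_remainder r \<eta> - drift_remainder q \<eta>) \<le> n * K * (E * d) + n * (K * E) * (K * sqrt T * d) + n * (K * d) * E
          + n * (K + (K + K * (K * sqrt T))) * E * d"
        unfolding drift_remainder_def by (rule order_trans [OF gen add_mono [OF add_mono [OF add_mono [OF t1 t2] t3] t4]])
      also have "\<dots> = C2 * (E * d)" by (simp add: C2_def algebra_simps)
      finally have lin: "norm (drift_remainder r \<eta> - drift_remainder q \<eta>) \<le> C2 * (E * d)" .
      have quad2: "norm (drift_remainder r \<eta> - drift_remainder q \<eta>) \<le> 2 * (C1 * E\<^sup>2)"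
        using norm_triangle_ineq4 [of "drift_remainder r \<eta>" "drift_remainder q \<eta>"] quad [OF r] quad [OF q] by linarith
      show "norm (drift_remainder r \<eta> - drift_remainder q \<eta>) \<le> C * E powr (2 - H) * \<bar>r - q\<bar> powr (H / 2)"
      proof (cases "norm (drift_remainder r \<eta> - drift_remainder q \<eta>) = 0 \<or> E = 0")
        case True
        then have "norm (drift_remainder r \<eta> - drift_remainder q \<eta>) = 0" using lin by auto
        then show ?thesis using C by simp
      next
        case False
        define x where "x = norm (drift_remainder r \<eta> - drift_remainder q \<eta>)"
        have x: "0 < x" and E0: "0 < E" using False E by (auto simp: x_def)
        \<comment> \<open>The quadratic bound is raised to \<open>1 - H\<close> and the linear one
          to \<open>H\<close>: the powers of \<open>E\<close> add up to
          \<open>2 * (1 - H) + H = 2 - H\<close>, and \<open>d powr H\<close> is the distance to the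
          power \<open>H / 2\<close>.\<close>
        have "x = x powr (1 - H) * x powr H" using x by (simp add: powr_add [symmetric])
        also have "\<dots> \<le> (2 * C1 * E powr 2) powr (1 - H) * (C2 * (E * d)) powr H"
          using quad2 lin x E0 H by (intro mult_mono powr_mono2) (auto simp: x_def)
        also have "\<dots> = ((2 * C1) powr (1 - H) * C2 powr H) * (E powr (2 * (1 - H)) * E powr H) * d powr H"
          using C1 C2 d E0 powr_powr [of E 2 "1 - H"] by (simp add: powr_mult)
        also have "E powr (2 * (1 - H)) * E powr H = E powr (2 - H)"
          by (simp add: powr_add [symmetric] algebra_simps)
        also have "d powr H = \<bar>r - q\<bar> powr (H / 2)"
          by (simp add: d_def powr_half_sqrt [symmetric] powr_powr)
        also have "((2 * C1) powr (1 - H) * C2 powr H) * E powr (2 - H) * \<bar>r - q\<bar> powr (H / 2)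
            \<le> C * E powr (2 - H) * \<bar>r - q\<bar> powr (H / 2)"
          using C by (intro mult_right_mono) auto
        finally show ?thesis by (simp add: x_def)
      qed
    qed
  qed
qed

end

section \<open>Second-order expansion of the divergence\<close>

lemma partial_deriv_sum_component:
  fixes g :: "'n::finite \<Rightarrow> real ^ 'n \<Rightarrow> real ^ 'n"
  assumes "\<And>k. g k differentiable (at x)"
  shows "(\<lambda>x. \<Sum>k\<in>UNIV. g k x $ k) differentiable (at x)"
    and "partial_deriv j (\<lambda>x. \<Sum>k\<in>UNIV. g k x $ k) x = (\<Sum>k\<in>UNIV. partial_deriv j (g k) x $ k)"
proof -
  have h: "((\<lambda>x. \<Sum>k\<in>UNIV. g k x $ k) has_derivative (\<lambda>y. \<Sum>k\<in>UNIV. frechet_derivative (g k) (at x) y $ k)) (at x)"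
    using assms unfolding frechet_derivative_works
    by (intro has_derivative_sum bounded_linear.has_derivative [OF bounded_linear_vec_nth]) auto
  then show "(\<lambda>x. \<Sum>k\<in>UNIV. g k x $ k) differentiable (at x)" by (auto simp: differentiable_def)
  show "partial_deriv j (\<lambda>x. \<Sum>k\<in>UNIV. g k x $ k) x = (\<Sum>k\<in>UNIV. partial_deriv j (g k) x $ k)"
    using partial_deriv_eqI [OF h] by (simp add: partial_deriv_def)
qed

lemma has_real_derivative_along_line:
  fixes q :: "real ^ 'n::finite \<Rightarrow> real"
  assumes "q differentiable (at (x + s *\<^sub>R y))"
  shows "((\<lambda>s. q (x + s *\<^sub>R y)) has_real_derivative (\<Sum>i\<in>UNIV. y $ i * partial_deriv i q (x + s *\<^sub>R y))) (at s)"
proof -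
  have "((\<lambda>s. x + s *\<^sub>R y) has_derivative (\<lambda>h. h *\<^sub>R y)) (at s)" by (auto intro!: derivative_eq_intros)
  from has_derivative_compose [OF this has_derivative_partial_derivs [OF assms]]
  show ?thesis
    unfolding has_field_derivative_def
    by (rule has_derivative_eq_rhs) (auto simp: fun_eq_iff sum_distrib_left sum_distrib_right ac_simps)
qed

text \<open>The grouping follows the order of differentiation along a line, where
  \<open>partial_deriv j\<close> is taken first and \<open>partial_deriv i\<close> second, in
  accordance with the indices of \<open>hessian\<close>.\<close>

lemma quadratic_form_eq: "y \<bullet> (A *v y) = (\<Sum>j\<in>UNIV. y $ j * (\<Sum>i\<in>UNIV. y $ i * A $ i $ j))"
  for A :: "real ^ 'n::finite ^ 'n"
proof -
  have "y \<bullet> (A *v y) = (\<Sum>i\<in>UNIV. \<Sum>j\<in>UNIV. y $ i * (A $ i $ j * y $ j))"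
    by (simp add: inner_vec_def matrix_vector_mult_def sum_distrib_left)
  also have "\<dots> = (\<Sum>j\<in>UNIV. \<Sum>i\<in>UNIV. y $ i * (A $ i $ j * y $ j))" by (rule sum.swap)
  also have "\<dots> = (\<Sum>j\<in>UNIV. y $ j * (\<Sum>i\<in>UNIV. y $ i * A $ i $ j))"
    by (simp add: sum_distrib_left ac_simps)
  finally show ?thesis .
qed

lemma quadratic_form_bound:
  fixes A :: "real ^ 'n::finite ^ 'n"
  assumes "\<And>i j. \<bar>A $ i $ j\<bar> \<le> k"
  shows "\<bar>y \<bullet> (A *v y)\<bar> \<le> (real CARD('n))\<^sup>2 * k * (norm y)\<^sup>2"
proof -
  have k: "0 \<le> k" using order_trans [OF abs_ge_zero assms] .
  have "norm (\<Sum>i\<in>UNIV. y $ i *\<^sub>R A $ i $ j) \<le> real CARD('n) * k * norm y" for j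
    by (rule norm_sum_component_le) (use assms in auto)
  then have "norm (\<Sum>j\<in>UNIV. y $ j *\<^sub>R (\<Sum>i\<in>UNIV. y $ i *\<^sub>R A $ i $ j)) \<le> real CARD('n) * (real CARD('n) * k * norm y) * norm y"
    by (rule norm_sum_component_le)
  then show ?thesis unfolding quadratic_form_eq by (simp add: power2_eq_square ac_simps)
qed

text \<open>The mean value theorem is applied twice to
  \<open>s \<mapsto> q (x + s *\<^sub>R y)\<close> minus its expected parabola. The first derivative
  at 0 vanishes because \<open>x\<close> is critical, and the second one is the quadratic form of
  the oscillation of the Hessian.\<close>

lemma second_order_Taylor_critical:
  fixes q :: "real ^ 'n::finite \<Rightarrow> real"
  assumes q: "\<And>z. q differentiable (at z)" and q': "\<And>j z. partial_deriv j q differentiable (at z)"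
    and crit: "grad q x = 0"
    and k: "\<And>z i j. norm z \<le> norm y \<Longrightarrow> \<bar>hessian q (x + z) $ i $ j - hessian q x $ i $ j\<bar> \<le> k"
  shows "\<bar>q (x + y) - q x - (y \<bullet> (hessian q x *v y)) / 2\<bar> \<le> (real CARD('n))\<^sup>2 * k * (norm y)\<^sup>2"
proof -
  define c where "c = y \<bullet> (hessian q x *v y)"
  define p where "p s = q (x + s *\<^sub>R y) - s\<^sup>2 / 2 * c" for s
  define p1 where "p1 s = (\<Sum>j\<in>UNIV. y $ j * partial_deriv j q (x + s *\<^sub>R y)) - s * c" for s
  define p2 where "p2 s = y \<bullet> ((hessian q (x + s *\<^sub>R y) - hessian q x) *v y)" for s
  have d1: "(p has_real_derivative p1 s) (at s)" for s
    unfolding p_def p1_def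
    by (auto intro!: derivative_eq_intros has_real_derivative_along_line q)
  have d2: "(p1 has_real_derivative p2 s) (at s)" for s
  proof -
    have "(p1 has_real_derivative (\<Sum>j\<in>UNIV. y $ j * (\<Sum>i\<in>UNIV. y $ i * partial_deriv i (partial_deriv j q) (x + s *\<^sub>R y))) - 1 * c) (at s)"
      unfolding p1_def
      by (intro DERIV_diff DERIV_sum DERIV_cmult has_real_derivative_along_line q' DERIV_cmult_right DERIV_ident)
    also have "(\<Sum>j\<in>UNIV. y $ j * (\<Sum>i\<in>UNIV. y $ i * partial_deriv i (partial_deriv j q) (x + s *\<^sub>R y))) - 1 * c = p2 s"
      unfolding p2_def c_def matrix_vector_mult_diff_rdistrib inner_diff_right quadratic_form_eq
      by (simp add: hessian_def)
    finally show ?thesis .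
  qed
  obtain s1 where s1: "0 < s1" "s1 < 1" "p 1 - p 0 = (1 - 0) * p1 s1"
    using MVT2 [of 0 1 p p1] d1 by auto
  obtain s2 where s2: "0 < s2" "s2 < s1" "p1 s1 - p1 0 = (s1 - 0) * p2 s2"
    using MVT2 [of 0 s1 p1 p2] d2 s1 by auto
  have "partial_deriv j q x = 0" for j
    using crit by (simp add: grad_def vec_eq_iff)
  then have "p1 0 = 0" by (simp add: p1_def)
  have "q (x + y) - q x - c / 2 = p 1 - p 0" by (simp add: p_def)
  also have "\<dots> = s1 * p2 s2" using s1 s2 \<open>p1 0 = 0\<close> by simp
  finally have "\<bar>q (x + y) - q x - c / 2\<bar> = s1 * \<bar>p2 s2\<bar>" using s1 by (simp add: abs_mult)
  also have "\<dots> \<le> 1 * \<bar>p2 s2\<bar>" using s1 by (intro mult_right_mono) auto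
  also have "\<bar>p2 s2\<bar> \<le> (real CARD('n))\<^sup>2 * k * (norm y)\<^sup>2"
    unfolding p2_def
  proof (rule quadratic_form_bound)
    have "norm (s2 *\<^sub>R y) \<le> norm y" using s1 s2 by (simp add: mult_left_le_one_le)
    from k [OF this] show "\<bar>(hessian q (x + s2 *\<^sub>R y) - hessian q x) $ i $ j\<bar> \<le> k" for i j by simp
  qed
  finally show ?thesis by (simp add: c_def)
qed

locale smooth_drift_path = drift_path T K b H X
  for T K H :: real and b :: "real \<Rightarrow> real ^ 'n::finite \<Rightarrow> real ^ 'n" and X +
  assumes Cb: "Cb_1_3 T b"
begin

lemma iterated_differentiable:
  "t \<in> {0..T} \<Longrightarrow> length is < 3 \<Longrightarrow> iterated_partial is (b t) differentiable (at x)"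
  using Cb unfolding Cb_1_3_def by blast

lemma iterated_continuous:
  "length is \<le> 3 \<Longrightarrow> continuous_on ({0..T} \<times> UNIV) (\<lambda>(t, x). iterated_partial is (b t) x)"
  using Cb unfolding Cb_1_3_def bounded_continuous_on_def by blast

lemma divg_differentiable: "t \<in> {0..T} \<Longrightarrow> divg (b t) differentiable (at x)"
  and partial_deriv_divg: "t \<in> {0..T} \<Longrightarrow>
    partial_deriv j (divg (b t)) = (\<lambda>x. \<Sum>k\<in>UNIV. partial_deriv j (partial_deriv k (b t)) x $ k)"
  using partial_deriv_sum_component [of "\<lambda>k. partial_deriv k (b t)"] iterated_differentiable [of t "[_]"]
  unfolding divg_def [abs_def] by (auto simp: fun_eq_iff)

lemma partial_deriv_divg_differentiable: "t \<in> {0..T} \<Longrightarrow> partial_deriv j (divg (b t)) differentiable (at x)"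
  and hessian_divg: "t \<in> {0..T} \<Longrightarrow> hessian (divg (b t)) x $ i $ j =
    (\<Sum>k\<in>UNIV. partial_deriv i (partial_deriv j (partial_deriv k (b t))) x $ k)"
  using partial_deriv_sum_component [of "\<lambda>k. partial_deriv j (partial_deriv k (b t))"] iterated_differentiable [of t "[_, _]"]
  by (auto simp: partial_deriv_divg hessian_def)

lemma divg_cont: "continuous_on ({0..T} \<times> UNIV) (\<lambda>(t, x). divg (b t) x)"
proof -
  have "continuous_on ({0..T} \<times> UNIV) (\<lambda>z. \<Sum>k\<in>UNIV. (case z of (t, x) \<Rightarrow> iterated_partial [k] (b t) x) $ k)"
    by (intro continuous_on_sum continuous_on_component iterated_continuous) simp
  then show ?thesis by (rule continuous_on_eq) (auto simp: divg_def)
qed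

lemma hessian_cont: "continuous_on ({0..T} \<times> UNIV) (\<lambda>(t, x). hessian (divg (b t)) x)"
proof -
  have "continuous_on ({0..T} \<times> UNIV) (\<lambda>z. \<chi> i j. \<Sum>k\<in>UNIV. (case z of (t, x) \<Rightarrow> iterated_partial [i, j, k] (b t) x) $ k)"
    by (intro continuous_on_vec_lambda continuous_on_sum continuous_on_component iterated_continuous) simp
  then show ?thesis by (rule continuous_on_eq) (auto simp: hessian_divg vec_eq_iff)
qed

lemma hessian_bounded:
  obtains B where "0 \<le> B" "\<And>t y. t \<in> {0..T} \<Longrightarrow> \<bar>y \<bullet> (hessian (divg (b t)) (X t) *v y)\<bar> \<le> B * (norm y)\<^sup>2"
proof -
  have "bounded ((\<lambda>t. hessian (divg (b t)) (X t)) ` {0..T})"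
    by (intro compact_imp_bounded compact_continuous_image composite_cont [OF hessian_cont X_cont]) auto
  then obtain B where "\<forall>z\<in>(\<lambda>t. hessian (divg (b t)) (X t)) ` {0..T}. norm z \<le> B"
    unfolding bounded_iff by blast
  then have B: "norm (hessian (divg (b t)) (X t)) \<le> B" if "t \<in> {0..T}" for t using that by auto
  have "\<bar>hessian (divg (b t)) (X t) $ i $ j\<bar> \<le> B" if "t \<in> {0..T}" for t i j
    using component_le_norm_cart [of "hessian (divg (b t)) (X t) $ i" j]
      Finite_Cartesian_Product.norm_nth_le [of "hessian (divg (b t)) (X t)" i] B [OF that] by linarith
  from quadratic_form_bound [OF this] that [of "(real CARD('n))\<^sup>2 * B"] show ?thesis
    using order_trans [OF norm_ge_zero B [of 0]] T by auto
qed

text \<open>The Hessian of the divergence involves third derivatives of \<open>b\<close>, which are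
  only continuous, so the remainder is small of second order without a rate. Its uniformity in
  \<open>t\<close> comes from uniform continuity on a compact neighbourhood of the path.\<close>

lemma divergence_expansion:
  assumes crit: "\<And>t. t \<in> {0..T} \<Longrightarrow> grad (divg (b t)) (X t) = 0" and k: "0 < k"
  obtains \<delta> where "0 < \<delta>" "\<And>t y. t \<in> {0..T} \<Longrightarrow> norm y \<le> \<delta> \<Longrightarrow>
    \<bar>divg (b t) (X t + y) - divg (b t) (X t) - (y \<bullet> (hessian (divg (b t)) (X t) *v y)) / 2\<bar> \<le> k * (norm y)\<^sup>2"
proof -
  define k' where "k' = k / (real CARD('n))\<^sup>2"
  have k': "0 < k'" using k by (simp add: k'_def)
  have "bounded (X ` {0..T})" by (intro compact_imp_bounded compact_continuous_image X_cont) auto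
  then obtain B where "\<forall>z\<in>X ` {0..T}. norm z \<le> B" unfolding bounded_iff by blast
  then have B: "norm (X t) \<le> B" if "t \<in> {0..T}" for t using that by auto
  let ?S = "{0..T} \<times> cball (0 :: real ^ 'n) (B + 1)"
  have "uniformly_continuous_on ?S (\<lambda>(t, x). hessian (divg (b t)) x)"
    by (intro compact_uniformly_continuous continuous_on_subset [OF hessian_cont] compact_Times) auto
  then obtain d where d: "0 < d" "\<And>z z'. z \<in> ?S \<Longrightarrow> z' \<in> ?S \<Longrightarrow> dist z' z < d \<Longrightarrow>
      dist ((\<lambda>(t, x). hessian (divg (b t)) x) z') ((\<lambda>(t, x). hessian (divg (b t)) x) z) < k'"
    using k' unfolding uniformly_continuous_on_def by blast
  show ?thesis
  \<comment> \<open>The bound 1 keeps the displaced point inside the ball of radius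
    \<open>B + 1\<close>; the bound \<open>d / 2\<close> is the one from uniform continuity.\<close>
  proof (rule that [of "min 1 (d / 2)"])
    show "0 < min 1 (d / 2)" using d by simp
    fix t and y :: "real ^ 'n" assume t: "t \<in> {0..T}" and y: "norm y \<le> min 1 (d / 2)"
    have "\<bar>divg (b t) (X t + y) - divg (b t) (X t) - (y \<bullet> (hessian (divg (b t)) (X t) *v y)) / 2\<bar>
        \<le> (real CARD('n))\<^sup>2 * k' * (norm y)\<^sup>2"
    proof (rule second_order_Taylor_critical [OF divg_differentiable [OF t] partial_deriv_divg_differentiable [OF t] crit [OF t]])
      fix z :: "real ^ 'n" and i j assume z: "norm z \<le> norm y"
      have "(t, X t) \<in> ?S" "(t, X t + z) \<in> ?S"
        using t B [OF t] z y norm_triangle_ineq [of "X t" z] by auto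
      moreover have "dist (t, X t + z) (t, X t) < d"
        using z y d(1) by (simp add: dist_Pair_Pair dist_norm)
      ultimately have "dist (hessian (divg (b t)) (X t + z)) (hessian (divg (b t)) (X t)) < k'"
        using d(2) [of "(t, X t)" "(t, X t + z)"] by simp
      then have "norm (hessian (divg (b t)) (X t + z) - hessian (divg (b t)) (X t)) < k'" by (simp add: dist_norm)
      then show "\<bar>hessian (divg (b t)) (X t + z) $ i $ j - hessian (divg (b t)) (X t) $ i $ j\<bar> \<le> k'"
        using component_le_norm_cart [of "(hessian (divg (b t)) (X t + z) - hessian (divg (b t)) (X t)) $ i" j]
          Finite_Cartesian_Product.norm_nth_le [of "hessian (divg (b t)) (X t + z) - hessian (divg (b t)) (X t)" i] by simp
    qed
    then show "\<bar>divg (b t) (X t + y) - divg (b t) (X t) - (y \<bullet> (hessian (divg (b t)) (X t) *v y)) / 2\<bar> \<le> k * (norm y)\<^sup>2"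
      by (simp add: k'_def)
  qed
qed

end

subsection \<open>Expansion of the functional along the deterministic path\<close>

lemma d_H_nonneg:
  assumes "0 < H" "H < 1"
  shows "0 \<le> d_H H"
  unfolding d_H_def using assms
  by (auto intro!: divide_nonneg_nonneg mult_nonneg_nonneg less_imp_le [OF Gamma_real_pos])

locale most_probable_path =
  cameron_martin H T m M \<sigma> \<sigma>' + smooth_drift_path T K H b X
  for H T m M K :: real and \<sigma> \<sigma>' X :: "real \<Rightarrow> real ^ 'n::finite" and b :: "real \<Rightarrow> real ^ 'n \<Rightarrow> real ^ 'n"
begin

lemma integral_lebesgue_eq:
  fixes f :: "real \<Rightarrow> 'a::euclidean_space"
  assumes "continuous_on {0..T} f" "t \<le> T"
  shows "(LINT s:{0..t}|lebesgue. f s) = integral {0..t} f" "set_integrable lebesgue {0..t} f"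
proof -
  have "f absolutely_integrable_on {0..t}"
    by (rule absolutely_integrable_continuous_real) (rule continuous_on_subset [OF assms(1)], use assms in auto)
  then show "(LINT s:{0..t}|lebesgue. f s) = integral {0..t} f" "set_integrable lebesgue {0..t} f"
    by (auto simp: set_lebesgue_integral_eq_integral)
qed

lemma quadratic_form_cont:
  assumes "continuous_on {0..T} y"
  shows "continuous_on {0..T} (\<lambda>t. y t \<bullet> (hessian (divg (b t)) (X t) *v y t))"
  unfolding quadratic_form_eq
  by (intro continuous_intros assms composite_cont [OF hessian_cont X_cont])

lemma K_sigma_path_class:
  obtains C where "0 < C"
    "\<And>u \<eta> s. u \<in> L2 T \<Longrightarrow> \<forall>t\<in>{0..T}. \<eta> t = K_sigma H \<sigma> u t \<Longrightarrow> s \<in> {0..T} \<Longrightarrow>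
      path_class s \<eta> (C * sqrt (L2_sqnorm s u))"
proof -
  obtain C0 where C0: "0 \<le> C0"
    "\<And>u t. u \<in> L2 T \<Longrightarrow> t \<in> {0..T} \<Longrightarrow> norm (K_sigma H \<sigma> u t) \<le> C0 * sqrt (L2_sqnorm t u)"
    "\<And>u s t. 1/2 < H \<Longrightarrow> u \<in> L2 T \<Longrightarrow> 0 \<le> s \<Longrightarrow> s \<le> t \<Longrightarrow> t \<le> T \<Longrightarrow>
      norm (K_sigma H \<sigma> u t - K_sigma H \<sigma> u s) \<le> C0 * sqrt (t - s) * sqrt (L2_sqnorm t u)"
    by (rule K_sigma_estimates, rule that)
  \<comment> \<open>The added 1 makes the constant strictly positive, as it will be divided
    by.\<close>
  define C where "C = C0 + 1"
  have C: "0 < C" "C0 \<le> C" using C0(1) by (auto simp: C_def)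
  show ?thesis
  proof (rule that [OF C(1)])
    fix u \<eta> s assume u: "u \<in> L2 T" and "\<forall>t\<in>{0..T}. \<eta> t = K_sigma H \<sigma> u t" and s: "s \<in> {0..T}"
    then have \<eta>: "\<eta> t = K_sigma H \<sigma> u t" if "t \<in> {0..T}" for t using that by blast
    have E: "sqrt (L2_sqnorm r u) \<le> sqrt (L2_sqnorm s u)" if "r \<in> {0..s}" for r
      using L2_sqnorm_mono [OF u, of r s] that s by simp
    have inc: "norm (\<eta> r - \<eta> q) \<le> C * sqrt (L2_sqnorm s u) * sqrt \<bar>r - q\<bar>"
      if h: "1/2 < H" and rq: "r \<in> {0..s}" "q \<in> {0..s}" "q \<le> r" for r q
    proof -
      have "norm (\<eta> r - \<eta> q) \<le> C0 * sqrt (r - q) * sqrt (L2_sqnorm r u)"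
        using C0(3) [OF h u, of q r] \<eta> [of r] \<eta> [of q] rq s by simp
      also have "\<dots> \<le> C * sqrt (r - q) * sqrt (L2_sqnorm s u)"
        using E [OF rq(1)] C C0(1) rq by (intro mult_mono) auto
      finally show ?thesis using rq by (simp add: ac_simps)
    qed
    show "path_class s \<eta> (C * sqrt (L2_sqnorm s u))"
      unfolding path_class_def
    proof (intro conjI ballI impI)
      show "continuous_on {0..T} \<eta>"
        by (rule continuous_on_eq [OF continuous_on_K_sigma [OF u]]) (use \<eta> in auto)
      show "norm (\<eta> r) \<le> C * sqrt (L2_sqnorm s u)" if r: "r \<in> {0..s}" for r
      proof -
        have "norm (\<eta> r) \<le> C0 * sqrt (L2_sqnorm r u)" using C0(2) [OF u, of r] \<eta> [of r] r s by simp
        also have "\<dots> \<le> C * sqrt (L2_sqnorm s u)" using E [OF r] C C0(1) by (intro mult_mono) auto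
        finally show ?thesis .
      qed
      show "norm (\<eta> r - \<eta> q) \<le> C * sqrt (L2_sqnorm s u) * sqrt \<bar>r - q\<bar>"
        if "1/2 < H" "r \<in> {0..s}" "q \<in> {0..s}" for r q
        using inc [OF that(1), of r q] inc [OF that(1), of q r] that
        by (cases "q \<le> r") (auto simp: norm_minus_commute abs_minus_commute)
    qed
  qed
qed

text \<open>Three causal estimates are chained: the running norm of \<open>u\<close> controls the
  path on \<open>[0, s]\<close>, the path controls its linearized drift there, and the drift
  controls the preimage at \<open>s\<close>.\<close>

lemma linear_part:
  obtains C where "0 \<le> C"
    "\<And>u \<eta>. u \<in> L2 T \<Longrightarrow> \<forall>t\<in>{0..T}. \<eta> t = K_sigma H \<sigma> u t \<Longrightarrow>
      \<exists>v\<in>L2 T. v 0 = 0 \<and> (\<forall>t\<in>{0..T}. K_sigma H \<sigma> v t = integral {0..t} (\<lambda>s. linear_drift s \<eta>)) \<and>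
        (\<forall>s\<in>{0<..T}. norm (v s) \<le> C * sqrt (L2_sqnorm s u) * s powr - (H - 1/2))"
proof -
  obtain C1 where C1: "0 < C1" and pc: "\<And>u \<eta> s. u \<in> L2 T \<Longrightarrow> \<forall>t\<in>{0..T}. \<eta> t = K_sigma H \<sigma> u t \<Longrightarrow> s \<in> {0..T} \<Longrightarrow>
      path_class s \<eta> (C1 * sqrt (L2_sqnorm s u))"
    by (rule K_sigma_path_class, rule that)
  obtain C2 where C2: "0 \<le> C2" and pb: "\<And>\<eta> s E. path_class s \<eta> E \<Longrightarrow> s \<in> {0..T} \<Longrightarrow> path_bound H (\<lambda>t. linear_drift t \<eta>) s (C2 * E)"
    by (rule linear_drift_path_bound, rule that)
  obtain C3 where C3: "0 \<le> C3" and pre: "\<And>f N0. continuous_on {0..T} f \<Longrightarrow> path_bound H f T N0 \<Longrightarrow>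
      \<exists>v\<in>L2 T. v 0 = 0 \<and> (\<forall>t\<in>{0..T}. K_sigma H \<sigma> v t = integral {0..t} f) \<and>
        (\<forall>s\<in>{0<..T}. \<forall>N. path_bound H f s N \<longrightarrow> norm (v s) \<le> C3 * N * s powr - (H - 1/2))"
    by (rule K_sigma_preimage, rule that)
  show ?thesis
  proof (rule that [of "C3 * (C2 * C1)"])
    show "0 \<le> C3 * (C2 * C1)" using C1 C2 C3 by simp
    fix u \<eta> assume u: "u \<in> L2 T" and \<eta>: "\<forall>t\<in>{0..T}. \<eta> t = K_sigma H \<sigma> u t"
    have b: "path_bound H (\<lambda>t. linear_drift t \<eta>) s (C2 * (C1 * sqrt (L2_sqnorm s u)))" if "s \<in> {0..T}" for s
      by (rule pb [OF pc [OF u \<eta> that] that])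
    have TT: "T \<in> {0..T}" using T by simp
    have c: "continuous_on {0..T} (\<lambda>t. linear_drift t \<eta>)"
      using pc [OF u \<eta> TT] by (intro linear_drift_cont) (simp add: path_class_def)
    obtain v where v: "v \<in> L2 T" "v 0 = 0" "\<forall>t\<in>{0..T}. K_sigma H \<sigma> v t = integral {0..t} (\<lambda>t. linear_drift t \<eta>)"
      "\<forall>s\<in>{0<..T}. \<forall>N. path_bound H (\<lambda>t. linear_drift t \<eta>) s N \<longrightarrow> norm (v s) \<le> C3 * N * s powr - (H - 1/2)"
      using pre [OF c b [OF TT]] by blast
    have "norm (v s) \<le> C3 * (C2 * C1) * sqrt (L2_sqnorm s u) * s powr - (H - 1/2)" if s: "s \<in> {0<..T}" for s
    proof -
      have "s \<in> {0..T}" using s by simp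
      from v(4) [rule_format, OF s b [OF this]] show ?thesis by (simp add: mult.assoc)
    qed
    then show "\<exists>v\<in>L2 T. v 0 = 0 \<and> (\<forall>t\<in>{0..T}. K_sigma H \<sigma> v t = integral {0..t} (\<lambda>s. linear_drift s \<eta>)) \<and>
        (\<forall>s\<in>{0<..T}. norm (v s) \<le> C3 * (C2 * C1) * sqrt (L2_sqnorm s u) * s powr - (H - 1/2))"
      using v by blast
  qed
qed

text \<open>The preimage of the Taylor remainder has norm of order \<open>2 - H\<close> in the norm
  of \<open>u\<close>. As \<open>2 - H > 1\<close>, it is negligible against the linear part for
  small perturbations.\<close>

lemma remainder_part:
  obtains C where "0 \<le> C"
    "\<And>u \<eta>. u \<in> L2 T \<Longrightarrow> \<forall>t\<in>{0..T}. \<eta> t = K_sigma H \<sigma> u t \<Longrightarrow> C * sqrt (L2_sqnorm T u) \<le> 1 \<Longrightarrow>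
      \<exists>r\<in>L2 T. (\<forall>t\<in>{0..T}. K_sigma H \<sigma> r t = integral {0..t} (\<lambda>s. drift_remainder s \<eta>)) \<and>
        L2_sqnorm T r \<le> C * sqrt (L2_sqnorm T u) powr (2 * (2 - H))"
proof -
  obtain C1 where C1: "0 < C1" and pc: "\<And>u \<eta> s. u \<in> L2 T \<Longrightarrow> \<forall>t\<in>{0..T}. \<eta> t = K_sigma H \<sigma> u t \<Longrightarrow> s \<in> {0..T} \<Longrightarrow>
      path_class s \<eta> (C1 * sqrt (L2_sqnorm s u))"
    by (rule K_sigma_path_class, rule that)
  obtain C2 where C2: "0 \<le> C2" and pb: "\<And>\<eta> E. path_class T \<eta> E \<Longrightarrow> E \<le> 1 \<Longrightarrow> path_bound H (\<lambda>t. drift_remainder t \<eta>) T (C2 * E powr (2 - H))"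
    by (rule drift_remainder_path_bound, rule that)
  obtain C3 where C3: "0 \<le> C3" and pre: "\<And>f N0. continuous_on {0..T} f \<Longrightarrow> path_bound H f T N0 \<Longrightarrow>
      \<exists>v\<in>L2 T. v 0 = 0 \<and> (\<forall>t\<in>{0..T}. K_sigma H \<sigma> v t = integral {0..t} f) \<and>
        (\<forall>s\<in>{0<..T}. \<forall>N. path_bound H f s N \<longrightarrow> norm (v s) \<le> C3 * N * s powr - (H - 1/2))"
    by (rule K_sigma_preimage, rule that)
  define a where "a = H - 1/2"
  have a: "a < 1/2" using H by (simp add: a_def)
  define C4 where "C4 = (C3 * (C2 * C1 powr (2 - H)))\<^sup>2 * (T powr (1 - 2 * a) / (1 - 2 * a))"
  have C4: "0 \<le> C4" using a by (simp add: C4_def)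
  show ?thesis
  \<comment> \<open>One constant serves two purposes: \<open>C1\<close> turns the smallness
    condition into \<open>E \<le> 1\<close> for the remainder estimate, and \<open>C4\<close> is the
    constant of the resulting bound.\<close>
  proof (rule that [of "C1 + C4"])
    show "0 \<le> C1 + C4" using C1 C4 by simp
    fix u \<eta> assume u: "u \<in> L2 T" and \<eta>: "\<forall>t\<in>{0..T}. \<eta> t = K_sigma H \<sigma> u t"
      and small: "(C1 + C4) * sqrt (L2_sqnorm T u) \<le> 1"
    define \<rho> where "\<rho> = sqrt (L2_sqnorm T u)"
    have \<rho>: "0 \<le> \<rho>" by (simp add: \<rho>_def)
    have TT: "T \<in> {0..T}" using T by simp
    have "C1 * \<rho> \<le> (C1 + C4) * \<rho>" using C4 \<rho> by (intro mult_right_mono) auto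
    then have E1: "C1 * \<rho> \<le> 1" using small by (simp add: \<rho>_def)
    have p: "path_class T \<eta> (C1 * \<rho>)" unfolding \<rho>_def by (rule pc [OF u \<eta> TT])
    have b: "path_bound H (\<lambda>t. drift_remainder t \<eta>) T (C2 * (C1 * \<rho>) powr (2 - H))" by (rule pb [OF p E1])
    have c: "continuous_on {0..T} (\<lambda>t. drift_remainder t \<eta>)" using p by (intro drift_remainder_cont) (simp add: path_class_def)
    obtain r where r: "r \<in> L2 T" "r 0 = 0" "\<forall>t\<in>{0..T}. K_sigma H \<sigma> r t = integral {0..t} (\<lambda>t. drift_remainder t \<eta>)"
      "\<forall>s\<in>{0<..T}. \<forall>N. path_bound H (\<lambda>t. drift_remainder t \<eta>) s N \<longrightarrow> norm (r s) \<le> C3 * N * s powr - (H - 1/2)"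
      using pre [OF c b] by blast
    let ?N = "C3 * (C2 * (C1 * \<rho>) powr (2 - H))"
    have "L2_sqnorm T r \<le> ?N\<^sup>2 * (T powr (1 - 2 * a) / (1 - 2 * a))"
    proof (rule L2_sqnorm_power_bound [OF a r(1,2)])
      fix s assume s: "s \<in> {0<..T}"
      have "path_bound H (\<lambda>t. drift_remainder t \<eta>) s (C2 * (C1 * \<rho>) powr (2 - H))"
        by (rule path_bound_subinterval [OF b]) (use s in simp)
      from r(4) [rule_format, OF s this] show "norm (r s) \<le> ?N * s powr - a" by (simp add: a_def)
    qed
    also have "?N\<^sup>2 = (C3 * (C2 * C1 powr (2 - H)))\<^sup>2 * (\<rho> powr (2 - H))\<^sup>2"
      using C1 \<rho> by (simp add: powr_mult power_mult_distrib)
    also have "(\<rho> powr (2 - H))\<^sup>2 = \<rho> powr (2 * (2 - H))"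
      by (simp add: power2_eq_square powr_add [symmetric])
    also have "(C3 * (C2 * C1 powr (2 - H)))\<^sup>2 * \<rho> powr (2 * (2 - H)) * (T powr (1 - 2 * a) / (1 - 2 * a)) = C4 * \<rho> powr (2 * (2 - H))"
      by (simp add: C4_def)
    also have "\<dots> \<le> (C1 + C4) * \<rho> powr (2 * (2 - H))" using C1 by (intro mult_right_mono) auto
    finally have "L2_sqnorm T r \<le> (C1 + C4) * sqrt (L2_sqnorm T u) powr (2 * (2 - H))" by (simp add: \<rho>_def)
    then show "\<exists>r\<in>L2 T. (\<forall>t\<in>{0..T}. K_sigma H \<sigma> r t = integral {0..t} (\<lambda>s. drift_remainder s \<eta>)) \<and>
        L2_sqnorm T r \<le> (C1 + C4) * sqrt (L2_sqnorm T u) powr (2 * (2 - H))"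
      using r by blast
  qed
qed

lemma CM_spaceE:
  assumes "\<eta> \<in> CM_space H T \<sigma>"
  obtains u where "u \<in> L2 T" "\<forall>t\<in>{0..T}. \<eta> t = K_sigma H \<sigma> u t" "(CM_norm H T \<sigma> \<eta>)\<^sup>2 = L2_sqnorm T u"
proof -
  obtain u where u: "u \<in> L2 T" "\<forall>t\<in>{0..T}. \<eta> t = K_sigma H \<sigma> u t"
    using assms by (auto simp: CM_space_def)
  have "(CM_norm H T \<sigma> \<eta>)\<^sup>2 = L2_sqnorm T u"
    using CM_norm_eq [of u \<eta>, OF u(1) bspec [OF u(2)]] by simp
  with u show ?thesis by (rule that)
qed

lemma linearized_sqnorm:
  assumes u: "u \<in> L2 T" and \<eta>: "\<forall>t\<in>{0..T}. \<eta> t = K_sigma H \<sigma> u t"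
    and v: "v \<in> L2 T" and K: "\<And>t. t \<in> {0..T} \<Longrightarrow> K_sigma H \<sigma> v t = integral {0..t} (\<lambda>s. linear_drift s \<eta>)"
  shows "L2_sqnorm T (K_sigma_inv H T \<sigma> (\<lambda>t. \<eta> t - (LINT u:{0..t}|lebesgue. jacobian (b u) (at (X u)) *v \<eta> u)))
    = L2_sqnorm T (\<lambda>s. u s - v s)"
proof (rule L2_sqnorm_K_sigma_inv [OF L2_diff [OF u v]])
  fix t assume t: "t \<in> {0..T}"
  have "continuous_on {0..T} \<eta>" by (rule continuous_on_eq [OF continuous_on_K_sigma [OF u]]) (use \<eta> in auto)
  from integral_lebesgue_eq(1) [OF linear_drift_cont [OF this], of t]
  have "(LINT u:{0..t}|lebesgue. jacobian (b u) (at (X u)) *v \<eta> u) = K_sigma H \<sigma> v t"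
    using K [OF t] t by (simp add: linear_drift_def)
  then show "\<eta> t - (LINT u:{0..t}|lebesgue. jacobian (b u) (at (X u)) *v \<eta> u) = K_sigma H \<sigma> (\<lambda>s. u s - v s) t"
    using bspec [OF \<eta> t] K_sigma_diff [OF u v t] by simp
qed

text \<open>The linearized path has preimage \<open>u - v\<close>, with \<open>v\<close> at time
  \<open>s\<close> controlled by \<open>u\<close> on \<open>[0, s]\<close>. Gronwall's inequality
  thus recovers \<open>u\<close> from \<open>u - v\<close>, and the reciprocal of its constant is
  the coercivity constant.\<close>

lemma exists_linearization_lower_bound: "\<exists>C1>0. linearization_lower_bound H T \<sigma> b X C1"
proof -
  obtain C where C: "0 \<le> C" and lin: "\<And>u \<eta>. u \<in> L2 T \<Longrightarrow> \<forall>t\<in>{0..T}. \<eta> t = K_sigma H \<sigma> u t \<Longrightarrow>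
      \<exists>v\<in>L2 T. v 0 = 0 \<and> (\<forall>t\<in>{0..T}. K_sigma H \<sigma> v t = integral {0..t} (\<lambda>s. linear_drift s \<eta>)) \<and>
        (\<forall>s\<in>{0<..T}. norm (v s) \<le> C * sqrt (L2_sqnorm s u) * s powr - (H - 1/2))"
    by (rule linear_part, rule that)
  have a: "H - 1/2 < 1/2" using H by simp
  obtain G where G: "0 < G" "\<And>u v :: real \<Rightarrow> real ^ 'n. u \<in> L2 T \<Longrightarrow> v \<in> L2 T \<Longrightarrow> v 0 = 0 \<Longrightarrow>
      \<forall>s\<in>{0<..T}. norm (v s) \<le> C * sqrt (L2_sqnorm s u) * s powr - (H - 1/2) \<Longrightarrow>
      L2_sqnorm T u \<le> G * L2_sqnorm T (\<lambda>s. u s - v s)"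
    by (rule singular_Gronwall [OF a C], rule that)
  have "linearization_lower_bound H T \<sigma> b X (1 / G)"
    unfolding linearization_lower_bound_def
  proof
    fix \<eta> assume "\<eta> \<in> CM_space H T \<sigma>"
    then obtain u where u: "u \<in> L2 T" and \<eta>: "\<forall>t\<in>{0..T}. \<eta> t = K_sigma H \<sigma> u t"
      and n: "(CM_norm H T \<sigma> \<eta>)\<^sup>2 = L2_sqnorm T u" by (rule CM_spaceE)
    obtain v where v: "v \<in> L2 T" "v 0 = 0" "\<forall>t\<in>{0..T}. K_sigma H \<sigma> v t = integral {0..t} (\<lambda>s. linear_drift s \<eta>)"
      "\<forall>s\<in>{0<..T}. norm (v s) \<le> C * sqrt (L2_sqnorm s u) * s powr - (H - 1/2)"
      using lin [OF u \<eta>] by blast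
    have "L2_sqnorm T u \<le> G * L2_sqnorm T (\<lambda>s. u s - v s)"
      by (rule G(2) [OF u v(1,2,4)])
    then show "1 / G * (CM_norm H T \<sigma> \<eta>)\<^sup>2
        \<le> L2_sqnorm T (K_sigma_inv H T \<sigma> (\<lambda>t. \<eta> t - (LINT u:{0..t}|lebesgue. jacobian (b u) (at (X u)) *v \<eta> u)))"
      using linearized_sqnorm [OF u \<eta> v(1)] v(3) G(1) n by (simp add: divide_le_eq mult.commute)
  qed
  then show ?thesis using G(1) by (intro exI [of _ "1 / G"]) simp
qed

lemma exists_divergence_hessian_bound: "\<exists>lV\<ge>0. divergence_hessian_bound H T \<sigma> b X lV"
proof -
  obtain B where B: "0 \<le> B" "\<And>t y. t \<in> {0..T} \<Longrightarrow> \<bar>y \<bullet> (hessian (divg (b t)) (X t) *v y)\<bar> \<le> B * (norm y)\<^sup>2"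
    by (rule hessian_bounded, rule that)
  obtain C where C: "0 < C" and pc: "\<And>u \<eta> s. u \<in> L2 T \<Longrightarrow> \<forall>t\<in>{0..T}. \<eta> t = K_sigma H \<sigma> u t \<Longrightarrow> s \<in> {0..T} \<Longrightarrow>
      path_class s \<eta> (C * sqrt (L2_sqnorm s u))"
    by (rule K_sigma_path_class, rule that)
  \<comment> \<open>The constant is the bound of the Hessian along \<open>X\<close>, times the
    square of the constant of the sup-norm estimate, times the length of the interval.\<close>
  have "divergence_hessian_bound H T \<sigma> b X (B * C\<^sup>2 * T)"
    unfolding divergence_hessian_bound_def
  proof
    fix \<eta> assume "\<eta> \<in> CM_space H T \<sigma>"
    then obtain u where u: "u \<in> L2 T" and \<eta>: "\<forall>t\<in>{0..T}. \<eta> t = K_sigma H \<sigma> u t"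
      and n: "(CM_norm H T \<sigma> \<eta>)\<^sup>2 = L2_sqnorm T u" by (rule CM_spaceE)
    have TT: "T \<in> {0..T}" using T by simp
    have p: "path_class T \<eta> (C * sqrt (L2_sqnorm T u))" by (rule pc [OF u \<eta> TT])
    let ?q = "\<lambda>s. \<eta> s \<bullet> (hessian (divg (b s)) (X s) *v \<eta> s)"
    have qc: "continuous_on {0..T} ?q"
      by (rule quadratic_form_cont) (use p in \<open>simp add: path_class_def\<close>)
    have "norm (integral {0..T} ?q) \<le> B * (C\<^sup>2 * L2_sqnorm T u) * (T - 0)"
    proof (rule integral_bound [OF _ qc])
      fix t assume t: "t \<in> {0..T}"
      have "norm (?q t) \<le> B * (norm (\<eta> t))\<^sup>2" using B(2) [OF t] by simp
      also have "\<dots> \<le> B * (C * sqrt (L2_sqnorm T u))\<^sup>2"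
        using p t B by (intro mult_left_mono power_mono) (auto simp: path_class_def)
      finally show "norm (?q t) \<le> B * (C\<^sup>2 * L2_sqnorm T u)" by (simp add: power_mult_distrib)
    qed (use T in simp)
    then show "- (LINT s:{0..T}|lebesgue. ?q s) \<le> B * C\<^sup>2 * T * (CM_norm H T \<sigma> \<eta>)\<^sup>2"
      using integral_lebesgue_eq(1) [OF qc order_refl] n by (simp add: ac_simps)
  qed
  then show ?thesis using B C T by (intro exI [of _ "B * C\<^sup>2 * T"]) simp
qed

section \<open>The functional expressed through preimages\<close>

lemma zero_L2: "(\<lambda>s. 0 :: real ^ 'n) \<in> L2 T"
  by (rule regular_L2) (simp add: regular_def sq_integrable_def)

lemma K_sigma_zero:
  assumes "t \<in> {0..T}"
  shows "K_sigma H \<sigma> (\<lambda>s. 0) t = 0"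
  using K_sigma_diff [OF zero_L2 zero_L2 assms] by simp

lemma b_X_cont: "continuous_on {0..T} (\<lambda>t. b t (X t))"
  by (rule composite_cont [OF b_cont X_cont])

lemma X_integral_eq:
  assumes "t \<in> {0..T}"
  shows "X t = X 0 + integral {0..t} (\<lambda>s. b s (X s))"
proof -
  have "((\<lambda>s. b s (X s)) has_integral (X t - X 0)) {0..t}"
  proof (rule fundamental_theorem_of_calculus)
    fix s assume "s \<in> {0..t}"
    then show "(X has_vector_derivative b s (X s)) (at s within {0..t})"
      using X [of s] assms by (auto intro: has_vector_derivative_within_subset)
  qed (use assms in simp)
  then show ?thesis by (simp add: integral_unique)
qed

text \<open>\<open>X\<close> minus its initial value is the primitive of \<open>b t (X t)\<close>,
  which is Hoelder-1/2 in time since \<open>X\<close> is Lipschitz; such primitives have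
  preimages.\<close>

lemma X_free: "X \<in> free_paths H T \<sigma> (X 0)"
proof -
  obtain C where pre: "\<And>f N0. continuous_on {0..T} f \<Longrightarrow> path_bound H f T N0 \<Longrightarrow>
      \<exists>v\<in>L2 T. v 0 = 0 \<and> (\<forall>t\<in>{0..T}. K_sigma H \<sigma> v t = integral {0..t} f) \<and>
        (\<forall>s\<in>{0<..T}. \<forall>N. path_bound H f s N \<longrightarrow> norm (v s) \<le> C * N * s powr - (H - 1/2))"
    by (rule K_sigma_preimage, rule that)
  define n where "n = real CARD('n)"
  \<comment> \<open>\<open>K\<close> bounds the drift itself; the other summands are the Hoelder-1/2
    contributions of its time dependence and of the motion of \<open>X\<close>.\<close>
  define N where "N = K + (K * sqrt T + n * K * (K * sqrt T))"
  have N: "K \<le> N" "0 \<le> N" using K0 T by (auto simp: N_def n_def intro!: add_nonneg_nonneg mult_nonneg_nonneg)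
  have TT: "T \<in> {0..T}" using T by simp
  have "path_bound H (\<lambda>t. b t (X t)) T (N * (1 + T powr (1/2 - H / 2)))"
  proof (rule path_bound_of_sqrt [OF H TT N(2)])
    show "norm (b r (X r)) \<le> N" if "r \<in> {0..T}" for r
      using b_bound [OF that, of "X r"] N by linarith
    show "norm (b r (X r) - b q (X q)) \<le> N * sqrt \<bar>r - q\<bar>" if r: "r \<in> {0..T}" and q: "q \<in> {0..T}" for r q
    proof -
      have "norm (b r (X r) - b q (X q)) \<le> norm (b r (X r) - b q (X r)) + norm (b q (X r) - b q (X q))" by norm
      also have "\<dots> \<le> K * (sqrt T * sqrt \<bar>r - q\<bar>) + n * K * (K * sqrt T * sqrt \<bar>r - q\<bar>)"
        unfolding n_def using K0
        by (intro add_mono order_trans [OF b_time [OF q r] mult_left_mono [OF abs_le_sqrt [OF r q]]]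
            order_trans [OF b_Lipschitz [OF q] mult_left_mono [OF X_half_Hoelder [OF r q]]]) auto
      also have "\<dots> = (K * sqrt T + n * K * (K * sqrt T)) * sqrt \<bar>r - q\<bar>" by (simp add: algebra_simps)
      also have "\<dots> \<le> N * sqrt \<bar>r - q\<bar>" using K0 by (intro mult_right_mono) (auto simp: N_def)
      finally show ?thesis .
    qed
  qed
  from pre [OF b_X_cont this] obtain v where v: "v \<in> L2 T"
    "\<forall>t\<in>{0..T}. K_sigma H \<sigma> v t = integral {0..t} (\<lambda>s. b s (X s))" by blast
  have "X t - X 0 = K_sigma H \<sigma> v t" if "t \<in> {0..T}" for t
    using v(2) that X_integral_eq [OF that] by simp
  then show ?thesis using v(1) by (auto simp: free_paths_def CM_space_def)
qed

lemma free_paths_difference: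
  assumes "\<phi> \<in> free_paths H T \<sigma> (X 0)"
  obtains u where "u \<in> L2 T" "\<forall>t\<in>{0..T}. \<phi> t - X t = K_sigma H \<sigma> u t"
proof -
  obtain u v where uv: "u \<in> L2 T" "v \<in> L2 T" "\<And>t. t \<in> {0..T} \<Longrightarrow> \<phi> t - X 0 = K_sigma H \<sigma> u t"
    "\<And>t. t \<in> {0..T} \<Longrightarrow> X t - X 0 = K_sigma H \<sigma> v t"
    using assms X_free by (auto simp: free_paths_def CM_space_def)
  show ?thesis
  proof (rule that [of "\<lambda>s. u s - v s"])
    show "(\<lambda>s. u s - v s) \<in> L2 T" by (rule L2_diff [OF uv(1,2)])
    show "\<forall>t\<in>{0..T}. \<phi> t - X t = K_sigma H \<sigma> (\<lambda>s. u s - v s) t"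
    proof
      fix t assume t: "t \<in> {0..T}"
      have "\<phi> t - X t = (\<phi> t - X 0) - (X t - X 0)" by simp
      then show "\<phi> t - X t = K_sigma H \<sigma> (\<lambda>s. u s - v s) t"
        by (simp only: K_sigma_diff [OF uv(1,2) t] uv(3) [OF t] uv(4) [OF t])
    qed
  qed
qed

text \<open>Subtracting the integral equation of \<open>X\<close> leaves only the perturbation and
  the increment of the drift under the inverse operator. With zero perturbation the first term
  vanishes, which evaluates the functional at \<open>X\<close>.\<close>

lemma OM_functional_eq:
  assumes w: "w \<in> L2 T" and \<eta>: "continuous_on {0..T} \<eta>" and \<phi>: "\<And>t. t \<in> {0..T} \<Longrightarrow> \<phi> t = X t + \<eta> t"
    and K: "\<And>t. t \<in> {0..T} \<Longrightarrow> K_sigma H \<sigma> w t = \<eta> t - integral {0..t} (\<lambda>s. b s (X s + \<eta> s) - b s (X s))"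
  shows "OM_functional H T \<sigma> b (X 0) \<epsilon> \<phi>
    = 1 / (2 * \<epsilon>) * L2_sqnorm T w + d_H H / 2 * integral {0..T} (\<lambda>t. divg (b t) (X t + \<eta> t))"
proof -
  have c: "continuous_on {0..T} (\<lambda>t. X t + \<eta> t)" by (intro continuous_intros X_cont \<eta>)
  have bc: "continuous_on {0..T} (\<lambda>s. b s (X s + \<eta> s))" by (rule composite_cont [OF b_cont c])
  have dc: "continuous_on {0..T} (\<lambda>s. divg (b s) (X s + \<eta> s))" by (rule composite_cont [OF divg_cont c])
  have "L2_sqnorm T (K_sigma_inv H T \<sigma> (\<lambda>t. \<phi> t - X 0 - (LINT s:{0..t}|lebesgue. b s (\<phi> s)))) = L2_sqnorm T w"
  proof (rule L2_sqnorm_K_sigma_inv [OF w])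
    fix t assume t: "t \<in> {0..T}"
    have "(LINT s:{0..t}|lebesgue. b s (\<phi> s)) = (LINT s:{0..t}|lebesgue. b s (X s + \<eta> s))"
      by (rule set_lebesgue_integral_cong) (use t \<phi> in auto)
    also have "\<dots> = integral {0..t} (\<lambda>s. b s (X s + \<eta> s))"
      by (rule integral_lebesgue_eq(1) [OF bc]) (use t in simp)
    also have "\<dots> = integral {0..t} (\<lambda>s. b s (X s + \<eta> s) - b s (X s)) + integral {0..t} (\<lambda>s. b s (X s))"
    proof -
      have "continuous_on {0..t} (\<lambda>s. b s (X s + \<eta> s))" "continuous_on {0..t} (\<lambda>s. b s (X s))"
        using continuous_on_subset [OF bc] continuous_on_subset [OF b_X_cont] t by auto
      then show ?thesis
        by (subst Henstock_Kurzweil_Integration.integral_diff) (auto intro: integrable_continuous_interval)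
    qed
    finally show "\<phi> t - X 0 - (LINT s:{0..t}|lebesgue. b s (\<phi> s)) = K_sigma H \<sigma> w t"
      using K [OF t] \<phi> [OF t] X_integral_eq [OF t] by simp
  qed
  moreover have "(LINT t:{0..T}|lebesgue. divg (b t) (\<phi> t)) = integral {0..T} (\<lambda>t. divg (b t) (X t + \<eta> t))"
  proof -
    have "(LINT t:{0..T}|lebesgue. divg (b t) (\<phi> t)) = (LINT t:{0..T}|lebesgue. divg (b t) (X t + \<eta> t))"
      by (rule set_lebesgue_integral_cong) (use \<phi> in auto)
    then show ?thesis using integral_lebesgue_eq(1) [OF dc order_refl] by simp
  qed
  ultimately show ?thesis by (simp add: OM_functional_def)
qed

lemma OM_functional_X:
  "OM_functional H T \<sigma> b (X 0) \<epsilon> X = d_H H / 2 * integral {0..T} (\<lambda>t. divg (b t) (X t))"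
  using OM_functional_eq [of "\<lambda>s. 0" "\<lambda>t. 0" X \<epsilon>] zero_L2
  by (simp add: K_sigma_zero L2_sqnorm_def set_lebesgue_integral_def)

lemma divergence_integral_lower_bound:
  assumes crit: "\<And>t. t \<in> {0..T} \<Longrightarrow> grad (divg (b t)) (X t) = 0" and k: "0 < k"
    and dhb: "divergence_hessian_bound H T \<sigma> b X lV"
  obtains \<delta> where "0 < \<delta>"
    "\<And>u \<eta>. u \<in> L2 T \<Longrightarrow> \<forall>t\<in>{0..T}. \<eta> t = K_sigma H \<sigma> u t \<Longrightarrow> sqrt (L2_sqnorm T u) \<le> \<delta> \<Longrightarrow>
      - (lV / 2 + k) * L2_sqnorm T u
        \<le> integral {0..T} (\<lambda>t. divg (b t) (X t + \<eta> t)) - integral {0..T} (\<lambda>t. divg (b t) (X t))"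
proof -
  obtain C where C: "0 < C" and pc: "\<And>u \<eta> s. u \<in> L2 T \<Longrightarrow> \<forall>t\<in>{0..T}. \<eta> t = K_sigma H \<sigma> u t \<Longrightarrow> s \<in> {0..T} \<Longrightarrow>
      path_class s \<eta> (C * sqrt (L2_sqnorm s u))"
    by (rule K_sigma_path_class, rule that)
  \<comment> \<open>Pointwise the perturbation is at most \<open>C * \<rho>\<close>, so the error of
    the expansion integrates to \<open>k' * (C * \<rho>)\<^sup>2 * T\<close>, which is now
    \<open>k * \<rho>\<^sup>2\<close>.\<close>
  define k' where "k' = k / (T * C\<^sup>2)"
  have k': "0 < k'" using k T C by (simp add: k'_def)
  obtain \<delta> where \<delta>: "0 < \<delta>" "\<And>t y. t \<in> {0..T} \<Longrightarrow> norm y \<le> \<delta> \<Longrightarrow>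
    \<bar>divg (b t) (X t + y) - divg (b t) (X t) - (y \<bullet> (hessian (divg (b t)) (X t) *v y)) / 2\<bar> \<le> k' * (norm y)\<^sup>2"
    by (rule divergence_expansion [OF crit k'], assumption, rule that)
  show ?thesis
  proof (rule that [of "\<delta> / C"])
    show "0 < \<delta> / C" using \<delta> C by simp
    fix u \<eta> assume u: "u \<in> L2 T" and \<eta>: "\<forall>t\<in>{0..T}. \<eta> t = K_sigma H \<sigma> u t" and small: "sqrt (L2_sqnorm T u) \<le> \<delta> / C"
    define \<rho> where "\<rho> = sqrt (L2_sqnorm T u)"
    have \<rho>2: "\<rho>\<^sup>2 = L2_sqnorm T u" by (simp add: \<rho>_def)
    have TT: "T \<in> {0..T}" using T by simp
    have p: "path_class T \<eta> (C * \<rho>)" unfolding \<rho>_def by (rule pc [OF u \<eta> TT])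
    have \<eta>c: "continuous_on {0..T} \<eta>" and \<eta>b: "\<And>t. t \<in> {0..T} \<Longrightarrow> norm (\<eta> t) \<le> C * \<rho>"
      using p by (auto simp: path_class_def)
    have C\<delta>: "C * \<rho> \<le> \<delta>" using small C by (simp add: \<rho>_def field_simps)
    let ?q = "\<lambda>t. \<eta> t \<bullet> (hessian (divg (b t)) (X t) *v \<eta> t)"
    have qc: "continuous_on {0..T} ?q" by (rule quadratic_form_cont [OF \<eta>c])
    have d1: "continuous_on {0..T} (\<lambda>t. divg (b t) (X t + \<eta> t))" and d0: "continuous_on {0..T} (\<lambda>t. divg (b t) (X t))"
      by (intro composite_cont [OF divg_cont] continuous_intros X_cont \<eta>c)+
    have low: "?q t / 2 - k' * (C * \<rho>)\<^sup>2 \<le> divg (b t) (X t + \<eta> t) - divg (b t) (X t)" if t: "t \<in> {0..T}" for t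
    proof -
      have "norm (\<eta> t) \<le> \<delta>" using \<eta>b [OF t] C\<delta> by linarith
      from \<delta>(2) [OF t this] have "?q t / 2 - k' * (norm (\<eta> t))\<^sup>2 \<le> divg (b t) (X t + \<eta> t) - divg (b t) (X t)" by linarith
      moreover have "k' * (norm (\<eta> t))\<^sup>2 \<le> k' * (C * \<rho>)\<^sup>2" using \<eta>b [OF t] k' by (intro mult_left_mono power_mono) auto
      ultimately show ?thesis by linarith
    qed
    have "integral {0..T} (\<lambda>t. ?q t / 2 - k' * (C * \<rho>)\<^sup>2) \<le> integral {0..T} (\<lambda>t. divg (b t) (X t + \<eta> t) - divg (b t) (X t))"
      by (intro integral_le integrable_continuous_interval continuous_intros qc d1 d0 low) auto
    also have "\<dots> = integral {0..T} (\<lambda>t. divg (b t) (X t + \<eta> t)) - integral {0..T} (\<lambda>t. divg (b t) (X t))"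
      by (rule Henstock_Kurzweil_Integration.integral_diff) (intro integrable_continuous_interval d1 d0)+
    also have "integral {0..T} (\<lambda>t. ?q t / 2 - k' * (C * \<rho>)\<^sup>2) = integral {0..T} ?q / 2 - k' * (C * \<rho>)\<^sup>2 * T"
      using T by (subst Henstock_Kurzweil_Integration.integral_diff)
        (auto intro!: integrable_continuous_interval continuous_intros qc)
    also have "k' * (C * \<rho>)\<^sup>2 * T = k * \<rho>\<^sup>2" using C T by (simp add: k'_def power_mult_distrib)
    finally have A: "integral {0..T} ?q / 2 - k * \<rho>\<^sup>2
        \<le> integral {0..T} (\<lambda>t. divg (b t) (X t + \<eta> t)) - integral {0..T} (\<lambda>t. divg (b t) (X t))" .
    have "\<eta> \<in> CM_space H T \<sigma>" using u \<eta> by (auto simp: CM_space_def)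
    with dhb have "- (LINT s:{0..T}|lebesgue. ?q s) \<le> lV * (CM_norm H T \<sigma> \<eta>)\<^sup>2"
      unfolding divergence_hessian_bound_def by blast
    moreover have "(CM_norm H T \<sigma> \<eta>)\<^sup>2 = \<rho>\<^sup>2"
      using CM_norm_eq [of u \<eta>, OF u bspec [OF \<eta>]] by (simp add: \<rho>2)
    ultimately have "- integral {0..T} ?q \<le> lV * \<rho>\<^sup>2"
      using integral_lebesgue_eq(1) [OF qc order_refl] by simp
    then show "- (lV / 2 + k) * L2_sqnorm T u
        \<le> integral {0..T} (\<lambda>t. divg (b t) (X t + \<eta> t)) - integral {0..T} (\<lambda>t. divg (b t) (X t))"
      using A unfolding \<rho>2 [symmetric] by (simp add: algebra_simps)
  qed
qed

text \<open>
  With \<open>u\<close>, \<open>v\<close>, \<open>r\<close> the preimages of the perturbation, of its linearized drift and of the Taylor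
  remainder, the quadratic part of the functional is a multiple of \<open>L2_sqnorm T (u - v - r)\<close>.
\<close>

lemma quadratic_growth:
  assumes C1: "0 < C1" and llb: "linearization_lower_bound H T \<sigma> b X C1"
    and dhb: "divergence_hessian_bound H T \<sigma> b X lV"
    and crit: "\<And>t. t \<in> {0..T} \<Longrightarrow> grad (divg (b t)) (X t) = 0"
    and \<epsilon>: "0 < \<epsilon>" and gap: "0 < C1 / \<epsilon> - d_H H / 2 * lV"
  obtains c \<delta> where "0 < c" "0 < \<delta>"
    "\<And>\<phi>. \<phi> \<in> free_paths H T \<sigma> (X 0) \<Longrightarrow> CM_norm H T \<sigma> (\<lambda>t. \<phi> t - X t) \<le> \<delta> \<Longrightarrow>
      OM_functional H T \<sigma> b (X 0) \<epsilon> X + c * (CM_norm H T \<sigma> (\<lambda>t. \<phi> t - X t))\<^sup>2 \<le> OM_functional H T \<sigma> b (X 0) \<epsilon> \<phi>"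
proof -
  define \<gamma> where "\<gamma> = C1 / \<epsilon> - d_H H / 2 * lV"
  have \<gamma>: "0 < \<gamma>" using gap by (simp add: \<gamma>_def)
  have d: "0 \<le> d_H H" by (rule d_H_nonneg [OF H])
  obtain Cl where lin: "\<And>u \<eta>. u \<in> L2 T \<Longrightarrow> \<forall>t\<in>{0..T}. \<eta> t = K_sigma H \<sigma> u t \<Longrightarrow>
      \<exists>v\<in>L2 T. v 0 = 0 \<and> (\<forall>t\<in>{0..T}. K_sigma H \<sigma> v t = integral {0..t} (\<lambda>s. linear_drift s \<eta>)) \<and>
        (\<forall>s\<in>{0<..T}. norm (v s) \<le> Cl * sqrt (L2_sqnorm s u) * s powr - (H - 1/2))"
    by (rule linear_part, rule that)
  obtain Cr where Cr: "0 \<le> Cr" and rem: "\<And>u \<eta>. u \<in> L2 T \<Longrightarrow> \<forall>t\<in>{0..T}. \<eta> t = K_sigma H \<sigma> u t \<Longrightarrow>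
      Cr * sqrt (L2_sqnorm T u) \<le> 1 \<Longrightarrow>
      \<exists>r\<in>L2 T. (\<forall>t\<in>{0..T}. K_sigma H \<sigma> r t = integral {0..t} (\<lambda>s. drift_remainder s \<eta>)) \<and>
        L2_sqnorm T r \<le> Cr * sqrt (L2_sqnorm T u) powr (2 * (2 - H))"
    by (rule remainder_part, rule that)
  \<comment> \<open>The expansion error of the divergence is allowed one sixteenth of
    \<open>\<gamma>\<close>; adding 1 to \<open>d_H H\<close>, known only to be nonnegative, keeps
    the division safe.\<close>
  define k where "k = \<gamma> / (8 * (d_H H + 1))"
  have k: "0 < k" "d_H H / 2 * k \<le> \<gamma> / 16" using \<gamma> d by (auto simp: k_def field_simps)
  obtain \<delta>1 where \<delta>1: "0 < \<delta>1" and dlow: "\<And>u \<eta>. u \<in> L2 T \<Longrightarrow> \<forall>t\<in>{0..T}. \<eta> t = K_sigma H \<sigma> u t \<Longrightarrow>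
      sqrt (L2_sqnorm T u) \<le> \<delta>1 \<Longrightarrow> - (lV / 2 + k) * L2_sqnorm T u
        \<le> integral {0..T} (\<lambda>t. divg (b t) (X t + \<eta> t)) - integral {0..T} (\<lambda>t. divg (b t) (X t))"
    by (rule divergence_integral_lower_bound [OF crit k(1) dhb], assumption, rule that)
  \<comment> \<open>With this weight
    \<open>C1 * (1 - l) / \<epsilon> = C1 / \<epsilon> - \<gamma> / 4\<close>: separating off the
    remainder costs a quarter of the gap.\<close>
  define l where "l = \<epsilon> * \<gamma> / (4 * C1)"
  have l: "0 < l" using \<epsilon> \<gamma> C1 by (simp add: l_def)
  define B where "B = (1 + 1 / l) * Cr / (2 * \<epsilon>)"
  have B: "0 \<le> B" using l Cr \<epsilon> by (simp add: B_def)
  \<comment> \<open>Below this radius \<open>B * \<rho> powr (2 * (1 - H))\<close> is at most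
    \<open>\<gamma> / 16\<close>. The exponent is the surplus of \<open>2 * (2 - H)\<close> over 2
    and is positive because \<open>H < 1\<close>.\<close>
  define \<delta>2 where "\<delta>2 = (\<gamma> / (16 * (B + 1))) powr (1 / (2 * (1 - H)))"
  have \<delta>2: "0 < \<delta>2" using \<gamma> B by (simp add: \<delta>2_def)
  define \<delta> where "\<delta> = min \<delta>1 (min (1 / (Cr + 1)) \<delta>2)"
  have \<delta>: "0 < \<delta>" "\<delta> \<le> \<delta>1" "\<delta> \<le> 1 / (Cr + 1)" "\<delta> \<le> \<delta>2" using \<delta>1 \<delta>2 Cr by (auto simp: \<delta>_def)
  show ?thesis
  \<comment> \<open>The quadratic terms leave
    \<open>(\<gamma> - \<gamma> / 4) / 2 = 3 / 8 * \<gamma>\<close>; the Taylor remainder and the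
    divergence error take one sixteenth each, so \<open>\<gamma> / 4\<close> remains.\<close>
  proof (rule that [of "\<gamma> / 4" \<delta>])
    fix \<phi> assume \<phi>: "\<phi> \<in> free_paths H T \<sigma> (X 0)" and small: "CM_norm H T \<sigma> (\<lambda>t. \<phi> t - X t) \<le> \<delta>"
    define \<eta> where "\<eta> t = \<phi> t - X t" for t
    obtain u where u: "u \<in> L2 T" and "\<forall>t\<in>{0..T}. \<phi> t - X t = K_sigma H \<sigma> u t" by (rule free_paths_difference [OF \<phi>])
    then have \<eta>: "\<forall>t\<in>{0..T}. \<eta> t = K_sigma H \<sigma> u t" by (simp add: \<eta>_def)
    define \<rho> where "\<rho> = sqrt (L2_sqnorm T u)"
    have \<rho>: "CM_norm H T \<sigma> (\<lambda>t. \<phi> t - X t) = \<rho>" "\<rho>\<^sup>2 = L2_sqnorm T u" "0 \<le> \<rho>"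
      using CM_norm_eq [of u \<eta>, OF u bspec [OF \<eta>]] by (simp_all add: \<rho>_def \<eta>_def [abs_def])
    have \<rho>\<delta>: "\<rho> \<le> \<delta>" using small \<rho> by simp
    have "Cr * \<rho> \<le> (Cr + 1) * (1 / (Cr + 1))" using \<rho>\<delta> \<delta>(3) \<rho> Cr by (intro mult_mono) auto
    then have Cr1: "Cr * sqrt (L2_sqnorm T u) \<le> 1" using Cr by (simp add: \<rho>_def)
    obtain v where v: "v \<in> L2 T" "\<forall>t\<in>{0..T}. K_sigma H \<sigma> v t = integral {0..t} (\<lambda>s. linear_drift s \<eta>)"
      using lin [OF u \<eta>] by blast
    obtain r where r: "r \<in> L2 T" "\<forall>t\<in>{0..T}. K_sigma H \<sigma> r t = integral {0..t} (\<lambda>s. drift_remainder s \<eta>)"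
      "L2_sqnorm T r \<le> Cr * \<rho> powr (2 * (2 - H))"
      using rem [OF u \<eta> Cr1] by (auto simp: \<rho>_def)
    have \<eta>c: "continuous_on {0..T} \<eta>" by (rule continuous_on_eq [OF continuous_on_K_sigma [OF u]]) (use \<eta> in auto)
    note uv = L2_diff [OF u v(1)]
    define w where "w s = u s - v s - r s" for s
    have w: "w \<in> L2 T" using L2_diff [OF uv r(1)] by (simp add: w_def [abs_def])
    have Kw: "K_sigma H \<sigma> w t = \<eta> t - integral {0..t} (\<lambda>s. b s (X s + \<eta> s) - b s (X s))" if t: "t \<in> {0..T}" for t
    proof -
      have "continuous_on {0..t} (\<lambda>s. linear_drift s \<eta>)" "continuous_on {0..t} (\<lambda>s. drift_remainder s \<eta>)"
        using continuous_on_subset [OF linear_drift_cont [OF \<eta>c]] continuous_on_subset [OF drift_remainder_cont [OF \<eta>c]] t by auto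
      then have "integral {0..t} (\<lambda>s. linear_drift s \<eta>) + integral {0..t} (\<lambda>s. drift_remainder s \<eta>) = integral {0..t} (\<lambda>s. linear_drift s \<eta> + drift_remainder s \<eta>)"
        by (intro Henstock_Kurzweil_Integration.integral_add [symmetric] integrable_continuous_interval)
      also have "\<dots> = integral {0..t} (\<lambda>s. b s (X s + \<eta> s) - b s (X s))" by (simp add: drift_remainder_def)
      finally have "integral {0..t} (\<lambda>s. linear_drift s \<eta>) + integral {0..t} (\<lambda>s. drift_remainder s \<eta>) = integral {0..t} (\<lambda>s. b s (X s + \<eta> s) - b s (X s))" .
      then show ?thesis
        using K_sigma_diff [OF uv r(1) t] K_sigma_diff [OF u v(1) t] bspec [OF \<eta> t] bspec [OF v(2) t] bspec [OF r(2) t]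
        by (simp add: w_def [abs_def] diff_diff_eq)
    qed
    let ?A = "L2_sqnorm T (\<lambda>s. u s - v s)" and ?S = "L2_sqnorm T w"
    let ?I = "integral {0..T} (\<lambda>t. divg (b t) (X t + \<eta> t)) - integral {0..T} (\<lambda>t. divg (b t) (X t))"
    have J: "OM_functional H T \<sigma> b (X 0) \<epsilon> \<phi> - OM_functional H T \<sigma> b (X 0) \<epsilon> X = 1 / (2 * \<epsilon>) * ?S + d_H H / 2 * ?I"
      using OM_functional_eq [OF w \<eta>c _ Kw, of \<phi> \<epsilon>] OM_functional_X [of \<epsilon>]
      by (simp add: \<eta>_def right_diff_distrib)
    have A: "C1 * \<rho>\<^sup>2 \<le> ?A"
    proof -
      have "\<eta> \<in> CM_space H T \<sigma>" using u \<eta> by (auto simp: CM_space_def)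
      with llb have "C1 * (CM_norm H T \<sigma> \<eta>)\<^sup>2
        \<le> L2_sqnorm T (K_sigma_inv H T \<sigma> (\<lambda>t. \<eta> t - (LINT u:{0..t}|lebesgue. jacobian (b u) (at (X u)) *v \<eta> u)))"
        unfolding linearization_lower_bound_def by blast
      also have "\<dots> = ?A" by (rule linearized_sqnorm [OF u \<eta> v(1)]) (use v(2) in blast)
      finally show ?thesis using \<rho>(1) by (simp add: \<eta>_def [abs_def])
    qed
    have AS: "?A \<le> (1 + l) * ?S + (1 + 1 / l) * L2_sqnorm T r"
      using L2_sqnorm_diff_bound [OF uv r(1) order_refl l] by (simp add: w_def [abs_def])
    have rp: "\<rho> powr (2 * (2 - H)) = \<rho>\<^sup>2 * \<rho> powr (2 * (1 - H))"
    proof (cases "\<rho> = 0")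
      case False
      then have "\<rho>\<^sup>2 = \<rho> powr 2" using \<rho>(3) by simp
      then show ?thesis by (simp only: powr_add [symmetric]) (simp add: algebra_simps)
    qed simp
    have B\<rho>: "B * \<rho> powr (2 * (1 - H)) \<le> \<gamma> / 16"
    proof -
      have "\<rho> powr (2 * (1 - H)) \<le> \<delta>2 powr (2 * (1 - H))" using \<rho>\<delta> \<delta>(4) \<rho>(3) H by (intro powr_mono2) auto
      also have "\<dots> = \<gamma> / (16 * (B + 1))" using \<gamma> B H by (simp add: \<delta>2_def powr_powr)
      finally have "B * \<rho> powr (2 * (1 - H)) \<le> (B + 1) * (\<gamma> / (16 * (B + 1)))" using B by (intro mult_mono) auto
      also have "\<dots> = \<gamma> / 16" using B by (simp add: field_simps)
      finally show ?thesis .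
    qed
    have S: "1 / (2 * \<epsilon>) * ?S \<ge> (C1 / \<epsilon> - \<gamma> / 4) / 2 * \<rho>\<^sup>2 - \<gamma> / 16 * \<rho>\<^sup>2"
    proof -
      define Q where "Q = (1 + 1 / l) * L2_sqnorm T r"
      have Q0: "0 \<le> Q" using l by (simp add: Q_def)
      have "(C1 * \<rho>\<^sup>2 - Q) / (1 + l) \<le> ?S"
        using A AS l by (simp add: Q_def pos_divide_le_eq mult.commute)
      \<comment> \<open>The elementary bound \<open>1 - l \<le> 1 / (1 + l)\<close> makes the loss
        linear in \<open>l\<close>.\<close>
      moreover have "C1 * (1 - l) * \<rho>\<^sup>2 \<le> C1 * \<rho>\<^sup>2 / (1 + l)"
      proof -
        have "C1 * (1 - l) * \<rho>\<^sup>2 * (1 + l) = C1 * \<rho>\<^sup>2 - C1 * \<rho>\<^sup>2 * l\<^sup>2" by (simp add: power2_eq_square algebra_simps)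
        also have "\<dots> \<le> C1 * \<rho>\<^sup>2" using C1 by simp
        finally show ?thesis using l by (simp add: pos_le_divide_eq)
      qed
      moreover have "Q / (1 + l) \<le> Q" using Q0 l by (simp add: divide_le_eq mult_le_cancel_left1)
      ultimately have "C1 * (1 - l) * \<rho>\<^sup>2 - Q \<le> ?S" by (simp add: diff_divide_distrib)
      then have "1 / (2 * \<epsilon>) * (C1 * (1 - l) * \<rho>\<^sup>2 - Q) \<le> 1 / (2 * \<epsilon>) * ?S" using \<epsilon> by (intro mult_left_mono) auto
      moreover have "1 / (2 * \<epsilon>) * (C1 * (1 - l) * \<rho>\<^sup>2 - Q) = (C1 / \<epsilon> - \<gamma> / 4) / 2 * \<rho>\<^sup>2 - Q / (2 * \<epsilon>)"
        using \<epsilon> C1 by (simp add: l_def field_simps)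
      moreover have "Q / (2 * \<epsilon>) \<le> \<gamma> / 16 * \<rho>\<^sup>2"
      proof -
        have "Q / (2 * \<epsilon>) \<le> (1 + 1 / l) * (Cr * \<rho> powr (2 * (2 - H))) / (2 * \<epsilon>)"
          unfolding Q_def using r(3) l \<epsilon> by (intro divide_right_mono mult_left_mono) auto
        also have "\<dots> = B * \<rho> powr (2 * (1 - H)) * \<rho>\<^sup>2" unfolding rp B_def by simp
        also have "\<dots> \<le> \<gamma> / 16 * \<rho>\<^sup>2" by (rule mult_right_mono [OF B\<rho>]) simp
        finally show ?thesis .
      qed
      ultimately show ?thesis by linarith
    qed
    have "\<rho> \<le> \<delta>1" using \<rho>\<delta> \<delta>(2) by linarith
    then have I: "- (lV / 2 + k) * \<rho>\<^sup>2 \<le> ?I" using dlow [OF u \<eta>] by (simp add: \<rho>_def)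
    have "- (d_H H / 2 * lV / 2 * \<rho>\<^sup>2) - d_H H / 2 * k * \<rho>\<^sup>2 = d_H H / 2 * (- (lV / 2 + k) * \<rho>\<^sup>2)"
      by (simp add: algebra_simps)
    also have "\<dots> \<le> d_H H / 2 * ?I" using d by (intro mult_left_mono I) auto
    finally have f1: "- (d_H H / 2 * lV / 2 * \<rho>\<^sup>2) - d_H H / 2 * k * \<rho>\<^sup>2 \<le> d_H H / 2 * ?I" .
    have f2: "d_H H / 2 * k * \<rho>\<^sup>2 \<le> (\<gamma> * \<rho>\<^sup>2) / 16"
      using mult_right_mono [OF k(2), of "\<rho>\<^sup>2"] by simp
    have "(C1 / \<epsilon> - \<gamma> / 4) / 2 * \<rho>\<^sup>2 - d_H H / 2 * lV / 2 * \<rho>\<^sup>2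
        = ((C1 / \<epsilon> - d_H H / 2 * lV) - \<gamma> / 4) / 2 * \<rho>\<^sup>2"
      by (simp only: left_diff_distrib diff_divide_distrib)
    also have "\<dots> = 3 / 8 * (\<gamma> * \<rho>\<^sup>2)"
      unfolding \<gamma>_def [symmetric] by (simp add: field_simps)
    finally have f3: "(C1 / \<epsilon> - \<gamma> / 4) / 2 * \<rho>\<^sup>2 - d_H H / 2 * lV / 2 * \<rho>\<^sup>2 = 3 / 8 * (\<gamma> * \<rho>\<^sup>2)" .
    have f4: "(C1 / \<epsilon> - \<gamma> / 4) / 2 * \<rho>\<^sup>2 - (\<gamma> * \<rho>\<^sup>2) / 16 \<le> 1 / (2 * \<epsilon>) * ?S"
      using S by simp
    \<comment> \<open>The products are abstracted into variables so that the four estimates combine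
      by linear arithmetic.\<close>
    have arith: "g / 4 \<le> s + i" if "- x - z \<le> i" "z \<le> g / 16" "y - x = 3 / 8 * g" "y - g / 16 \<le> s" for g s i x y z :: real
      using that by linarith
    have "\<gamma> / 4 * \<rho>\<^sup>2 \<le> 1 / (2 * \<epsilon>) * ?S + d_H H / 2 * ?I"
      using arith [OF f1 f2 f3 f4] by simp
    then show "OM_functional H T \<sigma> b (X 0) \<epsilon> X + \<gamma> / 4 * (CM_norm H T \<sigma> (\<lambda>t. \<phi> t - X t))\<^sup>2 \<le> OM_functional H T \<sigma> b (X 0) \<epsilon> \<phi>"
      using J \<rho>(1) by simp
  qed (use \<gamma> \<delta> in auto)
qed

end

theorem theorem4p8:
  fixes H T :: real
    and b :: "real \<Rightarrow> real ^ 'n::finite \<Rightarrow> real ^ 'n"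
    and \<sigma> :: "real \<Rightarrow> real ^ 'n"
    and X :: "real \<Rightarrow> real ^ 'n"
    and x0 xT :: "real ^ 'n"
  assumes "1/4 < H" and "H < 1" and "T > 0"
    and "Cb_1_3 T b" and "admissible_diffusion T \<sigma>"
    and "\<And>t. t \<in> {0..T} \<Longrightarrow> (X has_vector_derivative b t (X t)) (at t within {0..T})"
    and "X 0 = x0" and "xT = X T"
  shows
    "(\<exists>C1>0. linearization_lower_bound H T \<sigma> b X C1) \<and>
     (\<exists>lV\<ge>0. divergence_hessian_bound H T \<sigma> b X lV) \<and>
     (\<forall>C1 lV \<epsilon>.
        C1 > 0 \<longrightarrow> lV \<ge> 0 \<longrightarrow>
        linearization_lower_bound H T \<sigma> b X C1 \<longrightarrow>
        divergence_hessian_bound H T \<sigma> b X lV \<longrightarrow>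
        (\<forall>t\<in>{0..T}. grad (divg (b t)) (X t) = 0) \<longrightarrow>
        \<epsilon> > 0 \<longrightarrow>
        C1 / \<epsilon> - d_H H / 2 * lV > 0 \<longrightarrow>
          strict_local_minimizer H T \<sigma> (fixed_paths H T \<sigma> x0 xT) (OM_functional H T \<sigma> b x0 \<epsilon>) X \<and>
          strict_local_minimizer H T \<sigma> (free_paths H T \<sigma> x0) (OM_functional H T \<sigma> b x0 \<epsilon>) X \<and>
          locally_most_probable_transition_path H T \<sigma> b x0 xT \<epsilon> X \<and>
          locally_most_probable_evolution_path H T \<sigma> b x0 \<epsilon> X)"
proof -
  have H: "0 < H" "H < 1" using assms by auto
  obtain m M \<sigma>' where cm: "cameron_martin H T m M \<sigma> \<sigma>'"
    by (rule admissible_diffusion_cameron_martin [OF assms(5) H assms(3)])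
  obtain K where dr: "drift T K b" by (rule Cb_1_3_drift [OF assms(4)])
  interpret cameron_martin H T m M \<sigma> \<sigma>' by (rule cm)
  interpret drift T K b by (rule dr)
  interpret most_probable_path H T m M K \<sigma> \<sigma>' X b
    by unfold_locales (use assms H in auto)
  show ?thesis
  proof (intro conjI exists_linearization_lower_bound exists_divergence_hessian_bound allI impI)
    fix C1 lV \<epsilon>
    assume *: "C1 > 0" "linearization_lower_bound H T \<sigma> b X C1" "divergence_hessian_bound H T \<sigma> b X lV"
      "\<forall>t\<in>{0..T}. grad (divg (b t)) (X t) = 0" "\<epsilon> > 0" "C1 / \<epsilon> - d_H H / 2 * lV > 0"
    obtain c \<delta> where c: "0 < c" "0 < \<delta>" and "\<And>\<phi>. \<phi> \<in> free_paths H T \<sigma> (X 0) \<Longrightarrow> CM_norm H T \<sigma> (\<lambda>t. \<phi> t - X t) \<le> \<delta> \<Longrightarrow>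
      OM_functional H T \<sigma> b (X 0) \<epsilon> X + c * (CM_norm H T \<sigma> (\<lambda>t. \<phi> t - X t))\<^sup>2 \<le> OM_functional H T \<sigma> b (X 0) \<epsilon> \<phi>"
      by (rule quadratic_growth [OF *(1,2,3) bspec [OF *(4)] *(5,6)], assumption, rule that)
    note grow = this(3) [unfolded assms(7)]
    have X1: "X \<in> free_paths H T \<sigma> x0" using X_free assms(7) by simp
    then have X2: "X \<in> fixed_paths H T \<sigma> x0 xT" using assms(8) by (simp add: fixed_paths_def)
    \<comment> \<open>Quadratic growth holds on the free path space; the fixed-endpoint space is a
      subset containing \<open>X\<close>, so the same radius serves all four conclusions.\<close>
    have sub: "fixed_paths H T \<sigma> x0 xT \<subseteq> free_paths H T \<sigma> x0" by (auto simp: fixed_paths_def)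
    have strict: "OM_functional H T \<sigma> b x0 \<epsilon> X < OM_functional H T \<sigma> b x0 \<epsilon> \<phi>"
      if "\<phi> \<in> free_paths H T \<sigma> x0" "0 < CM_norm H T \<sigma> (\<lambda>t. \<phi> t - X t)" "CM_norm H T \<sigma> (\<lambda>t. \<phi> t - X t) \<le> \<delta>" for \<phi>
    proof -
      have "0 < c * (CM_norm H T \<sigma> (\<lambda>t. \<phi> t - X t))\<^sup>2" using c that by simp
      then show ?thesis using grow [OF that(1,3)] by linarith
    qed
    have weak: "OM_functional H T \<sigma> b x0 \<epsilon> X \<le> OM_functional H T \<sigma> b x0 \<epsilon> \<phi>"
      if "\<phi> \<in> free_paths H T \<sigma> x0" "CM_norm H T \<sigma> (\<lambda>t. \<phi> t - X t) \<le> \<delta>" for \<phi>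
    proof -
      have "0 \<le> c * (CM_norm H T \<sigma> (\<lambda>t. \<phi> t - X t))\<^sup>2" using c by simp
      then show ?thesis using grow [OF that] by linarith
    qed
    show "strict_local_minimizer H T \<sigma> (fixed_paths H T \<sigma> x0 xT) (OM_functional H T \<sigma> b x0 \<epsilon>) X"
      unfolding strict_local_minimizer_def using X2 c(2) strict sub by blast
    show "strict_local_minimizer H T \<sigma> (free_paths H T \<sigma> x0) (OM_functional H T \<sigma> b x0 \<epsilon>) X"
      unfolding strict_local_minimizer_def using X1 c(2) strict by blast
    show "locally_most_probable_transition_path H T \<sigma> b x0 xT \<epsilon> X"
      unfolding locally_most_probable_transition_path_def local_minimizer_def using X2 c(2) weak sub by blast
    show "locally_most_probable_evolution_path H T \<sigma> b x0 \<epsilon> X"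
      unfolding locally_most_probable_evolution_path_def local_minimizer_def using X1 c(2) weak by blast
  qed
qed

end
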